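(* Let $V$ be a non-negative, stationary and ergodic potential on $\mathbb{R}^d$, $d\ge 1$, which verifies $\mathbb{E}[\sup_{x\in B(0)}V(x,\cdot)]<\infty$. For $d=1,2$, assume moreover that there exist positive constants $\rho,\varepsilon$ and a measurable function $u:\Omega\to\mathbb{R}^d$ such that $\mathbb{P}$-a.s. $$\mathrm{Leb}\big(\{x\in\mathbb{R}^d: V(x,\omega)>\varepsilon\}\cap B(u(\omega),\rho)\big)>\varepsilon\qquad\text{and}\qquad \mathbb{E}(|u(\cdot)|^d)<\infty .$$ Then there is a non-random semi-norm $\alpha(\cdot)$ on $\mathbb{R}^d$ such that $\mathbb{P}$-a.s. and in $L^1_{\mathbb{P}}$, for all $x\in\mathbb{R}^d$, $$\lim_{r\to\infty}\frac1r a(0,rx,\omega)=\lim_{r\to\infty}\frac1r\mathbb{E}[a(0,rx,\omega)]=\inf_{r>0}\frac1r\mathbb{E}[a(0,rx,\omega)]=\alpha(x).$$ $\alpha$ is called the quenched Lyapunov exponent. Moreover, $a(0,\cdot,\omega)$ can be replaced by $-\log g(0,\cdot,\omega)$ in this display.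
   Context: Potential. $(\Omega,\mathcal{F},\mathbb{P})$ is a probability space with expectation $\mathbb{E}$, and $(\tau_x;x\in\mathbb{R}^d)$ is a family of measurable maps on $\Omega$ with $\tau_x\circ\tau_y=\tau_{x+y}$ for all $x,y$, with $(x,\omega)\mapsto\tau_x\omega$ measurable on $\mathbb{R}^d\times\Omega$, with $\mathbb{P}$ invariant under every $\tau_x$, and ergodic: if $A\in\mathcal{F}$ satisfies $\tau_x(A)=A$ for all $x\in\mathbb{R}^d$ then $\mathbb{P}(A)\in\{0,1\}$. A non-negative, stationary and ergodic potential is a function $V(x,\omega):=V_0(\tau_x\omega)$, where $V_0$ is a real-valued non-negative random variable on $\Omega$ which is not identically zero. Notation. $B(y,R)=\{x\in\mathbb{R}^d:|x-y|<R\}$, $B(y)=B(y,1)$, and $\overline B(y)$ is the closure of $B(y)$; $\mathrm{Leb}$ is Lebesgue measure on $\mathbb{R}^d$; $E[X,A]:=E[X\mathbf 1_A]$. $(Z_s;s\ge 0)$ is standard Brownian motion on $\mathbb{R}^d$, $P_x$ is the Wiener measure on paths started at $x$, with expectation $E_x$; $H(y):=\inf\{t\ge0:Z_t\in\overline B(y)\}$. For $x,y\in\mathbb{R}^d$ and $\omega\in\Omega$: $e(x,y,\omega):=E_x[\exp(-\int_0^{H(y)}V(Z_s,\omega)ds),\,H(y)<\infty]$ and $a(x,y,\omega):=-\log e(x,y,\omega)$. Green function. The Green measure relative to the potential $V$ is $G(x,A,\omega):=E_x[\int_0^\infty\mathbf 1_A(Z_t)\exp(-\int_0^tV(Z_s,\omega)ds)dt]$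 for $x\in\mathbb{R}^d$, $\omega\in\Omega$ and Borel $A\subset\mathbb{R}^d$. The Green function $g(x,y,\omega)$ is the density function (in $y$, with respect to Lebesgue measure) of the Green measure $G(x,\cdot,\omega)$.
   Formalization: The infimum uses the cost from the worst start in the closed unit ball at 0 (for a itself it is always 0); for -log g no infimum is claimed and x=0 is excluded if d>=2, as g(0,0)=infinity; tau_0=id is assumed; a.s. convergence is for each fixed x; g is the continuous version of the density. *)

theory Defs
  imports "HOL-Probability.Probability"
begin

section \<open>Stationary ergodic potentials\<close>

text \<open>
  The identity law \<open>flow_zero\<close> is the usual requirement on a group action. It does not follow
  from the composition law, and without it an ergodicity condition on the images
  \<open>tau x ` A\<close> would be too weak (for instance if the range of \<open>tau 0\<close> contains no
  nonempty measurable set).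
\<close>

locale ergodic_flow = prob_space M for M :: "'w measure" +
  fixes tau :: "'a::euclidean_space \<Rightarrow> 'w \<Rightarrow> 'w"
  assumes flow_measurable: "\<And>x. tau x \<in> measurable M M"
    and flow_zero: "\<And>\<omega>. \<omega> \<in> space M \<Longrightarrow> tau 0 \<omega> = \<omega>"
    and flow_add: "\<And>x y \<omega>. \<omega> \<in> space M \<Longrightarrow> tau x (tau y \<omega>) = tau (x + y) \<omega>"
    and flow_joint_measurable: "(\<lambda>(x, \<omega>). tau x \<omega>) \<in> measurable (borel \<Otimes>\<^sub>M M) M"
    and flow_invariant: "\<And>x. distr M M (tau x) = M"
    and flow_ergodic: "\<And>A. A \<in> sets M \<Longrightarrow> (\<forall>x. tau x ` A = A) \<Longrightarrow> prob A \<in> {0, 1}"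

locale ergodic_potential = ergodic_flow M tau
  for M :: "'w measure" and tau :: "'a::euclidean_space \<Rightarrow> 'w \<Rightarrow> 'w" +
  fixes V0 :: "'w \<Rightarrow> real"
  assumes V0_measurable: "V0 \<in> borel_measurable M"
    and V0_nonneg: "\<And>\<omega>. \<omega> \<in> space M \<Longrightarrow> 0 \<le> V0 \<omega>"
    and V0_nonzero: "\<exists>\<omega>\<in>space M. V0 \<omega> \<noteq> 0"


section \<open>Wiener measure\<close>

text \<open>Continuous paths on \<open>[0, \<infinity>)\<close>, with the \<open>\<sigma>\<close>-algebra generated by the coordinates.\<close>

definition path_space :: "(real \<Rightarrow> 'a::euclidean_space) measure" where
  "path_space = restrict_space (Pi\<^sub>M {0..} (\<lambda>_. borel)) {w. continuous_on {0..} w}"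

text \<open>
  The conditions fix all finite-dimensional distributions, so at most one measure satisfies
  them for each starting point; the canonical process is \<open>Z s w = w s\<close>.
\<close>

definition wiener_measure :: "'a::euclidean_space \<Rightarrow> (real \<Rightarrow> 'a) measure \<Rightarrow> bool" where
  "wiener_measure x P \<longleftrightarrow>
     prob_space P \<and> sets P = sets path_space \<and> (AE w in P. w 0 = x) \<and>
     (\<forall>s t. 0 \<le> s \<and> s < t \<longrightarrow>
        distributed P lborel (\<lambda>w. w t - w s)
          (\<lambda>z. ennreal (\<Prod>b\<in>Basis. normal_density 0 (sqrt (t - s)) (z \<bullet> b)))) \<and>
     (\<forall>t :: nat \<Rightarrow> real. 0 \<le> t 0 \<and> strict_mono t \<longrightarrow>
        prob_space.indep_vars P (\<lambda>_. borel) (\<lambda>i w. w (t (Suc i)) - w (t i)) UNIV)"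


section \<open>Crossing costs and the Green measure\<close>

text \<open>
  The exponent \<open>\<integral>\<^sub>0\<^sup>T V(Z\<^sub>s) ds\<close> is taken in \<open>[0, \<infinity>]\<close> with \<open>exp(-\<infinity>) = 0\<close>, and logarithms are
  extended by \<open>-log 0 = \<infinity>\<close> and \<open>-log \<infinity> = -\<infinity>\<close>, so that no default values of the integral or
  of \<open>ln\<close> enter.
\<close>

definition exp_neg :: "ennreal \<Rightarrow> real" where
  "exp_neg t = (if t = \<infinity> then 0 else exp (- enn2real t))"

definition neg_log :: "ennreal \<Rightarrow> ereal" where
  "neg_log t = (if t = 0 then \<infinity> else if t = \<infinity> then - \<infinity> else ereal (- ln (enn2real t)))"

definition survival :: "('a::euclidean_space \<Rightarrow> real) \<Rightarrow> real \<Rightarrow> (real \<Rightarrow> 'a) \<Rightarrow> real" where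
  "survival f T w = exp_neg (\<integral>\<^sup>+s\<in>{0..T}. ennreal (f (w s)) \<partial>lborel)"

definition hitting_time :: "'a::euclidean_space \<Rightarrow> (real \<Rightarrow> 'a) \<Rightarrow> ennreal" where
  "hitting_time y w = (INF t\<in>{t. 0 \<le> t \<and> w t \<in> cball y 1}. ennreal t)"

text \<open>
  In what follows \<open>P x\<close> is the law of Brownian motion started at \<open>x\<close>. The functions
  \<open>crossing_weight\<close>, \<open>crossing_cost\<close> and \<open>green_measure\<close> are \<open>e\<close>, \<open>a\<close> and \<open>G\<close>.
\<close>

definition crossing_weight ::
  "('a::euclidean_space \<Rightarrow> (real \<Rightarrow> 'a) measure) \<Rightarrow> ('a \<Rightarrow> 'w \<Rightarrow> real) \<Rightarrow> 'a \<Rightarrow> 'a \<Rightarrow> 'w \<Rightarrow> real"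
where
  "crossing_weight P V x y \<omega> =
     (\<integral>w. (if hitting_time y w < \<infinity>
           then survival (\<lambda>z. V z \<omega>) (enn2real (hitting_time y w)) w else 0) \<partial>P x)"

definition crossing_cost ::
  "('a::euclidean_space \<Rightarrow> (real \<Rightarrow> 'a) measure) \<Rightarrow> ('a \<Rightarrow> 'w \<Rightarrow> real) \<Rightarrow> 'a \<Rightarrow> 'a \<Rightarrow> 'w \<Rightarrow> ereal"
where
  "crossing_cost P V x y \<omega> = neg_log (ennreal (crossing_weight P V x y \<omega>))"

text \<open>
  Since \<open>crossing_cost P V 0 y \<omega> = 0\<close> whenever \<open>norm y \<le> 1\<close>, the quantity
  \<open>inf\<^sub>r (1/r) E[a(0, r x)]\<close> over all \<open>r > 0\<close> is always \<open>0\<close>, whereas the limit as \<open>r \<rightarrow> \<infinity>\<close> is not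
  (for \<open>V = 1\<close> it is \<open>\<surd>2 norm x\<close>). The subadditive quantity, for which the limit of the means
  is an infimum, is the cost from the worst point of the closed unit ball around the start.
\<close>

definition ball_crossing_cost ::
  "('a::euclidean_space \<Rightarrow> (real \<Rightarrow> 'a) measure) \<Rightarrow> ('a \<Rightarrow> 'w \<Rightarrow> real) \<Rightarrow> 'a \<Rightarrow> 'a \<Rightarrow> 'w \<Rightarrow> ereal"
where
  "ball_crossing_cost P V x y \<omega> = (SUP z\<in>cball x 1. crossing_cost P V z y \<omega>)"

definition green_measure ::
  "('a::euclidean_space \<Rightarrow> (real \<Rightarrow> 'a) measure) \<Rightarrow> ('a \<Rightarrow> 'w \<Rightarrow> real) \<Rightarrow> 'a \<Rightarrow> 'a set \<Rightarrow> 'w \<Rightarrow> ennreal"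
where
  "green_measure P V x A \<omega> =
     (\<integral>\<^sup>+w. (\<integral>\<^sup>+t\<in>{0..}. indicator A (w t) * ennreal (survival (\<lambda>z. V z \<omega>) t w) \<partial>lborel) \<partial>P x)"

text \<open>
  A density is only determined up to null sets, while the Green function is evaluated along
  rays. As usual it is the continuous version of the density, with values in \<open>[0, \<infinity>]\<close>
  (in dimension at least two, \<open>g x x \<omega> = \<infinity>\<close>). For locally bounded \<open>V \<ge> 0\<close> this version is
  unique, and it exists as soon as killed Brownian motion is transient.
\<close>

definition green_function ::
  "'w measure \<Rightarrow> ('a::euclidean_space \<Rightarrow> (real \<Rightarrow> 'a) measure) \<Rightarrow> ('a \<Rightarrow> 'w \<Rightarrow> real) \<Rightarrow>
   ('a \<Rightarrow> 'a \<Rightarrow> 'w \<Rightarrow> ennreal) \<Rightarrow> bool"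
where
  "green_function M P V g \<longleftrightarrow>
     (\<forall>x y. g x y \<in> borel_measurable M) \<and>
     (AE \<omega> in M. \<forall>x. continuous_on UNIV (\<lambda>y. g x y \<omega>) \<and>
        (\<forall>A\<in>sets borel. green_measure P V x A \<omega> = (\<integral>\<^sup>+y\<in>A. g x y \<omega> \<partial>lborel)))"


section \<open>Seminorms and modes of convergence\<close>

definition seminorm :: "('a::real_vector \<Rightarrow> real) \<Rightarrow> bool" where
  "seminorm p \<longleftrightarrow>
     (\<forall>x. 0 \<le> p x) \<and> (\<forall>c x. p (c *\<^sub>R x) = \<bar>c\<bar> * p x) \<and> (\<forall>x y. p (x + y) \<le> p x + p y)"

definition ereal_expectation :: "'w measure \<Rightarrow> ('w \<Rightarrow> ereal) \<Rightarrow> ereal" where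
  "ereal_expectation M X =
     enn2ereal (\<integral>\<^sup>+\<omega>. e2ennreal (X \<omega>) \<partial>M) - enn2ereal (\<integral>\<^sup>+\<omega>. e2ennreal (- X \<omega>) \<partial>M)"

definition converges_AE :: "'w measure \<Rightarrow> (real \<Rightarrow> 'w \<Rightarrow> ereal) \<Rightarrow> real \<Rightarrow> bool" where
  "converges_AE M X l \<longleftrightarrow> (AE \<omega> in M. ((\<lambda>r. X r \<omega>) \<longlongrightarrow> ereal l) at_top)"

definition converges_L1 :: "'w measure \<Rightarrow> (real \<Rightarrow> 'w \<Rightarrow> ereal) \<Rightarrow> real \<Rightarrow> bool" where
  "converges_L1 M X l \<longleftrightarrow>
     (\<forall>r>0. X r \<in> borel_measurable M) \<and>
     ((\<lambda>r. \<integral>\<^sup>+\<omega>. e2ennreal \<bar>X r \<omega> - ereal l\<bar> \<partial>M) \<longlongrightarrow> 0) at_top"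

end

theory Submission
 imports Defs
begin

text \<open>
 By the strong Markov property, \<open>d(x, y) = sup {a(z, y) | z \<in> cball x 1}\<close> satisfies
 \<open>d(0, x + y) \<le> d(0, x) + d(x, x + y)\<close>, so along each ray the subadditive ergodic theorem applies. All other
 quantities differ from it by an error of the form \<open>\<zeta>(\<omega>) + \<zeta>(\<tau>\<^sub>y\<omega>)\<close> with \<open>\<zeta>\<close> integrable, which is negligible on the scale
 of \<open>y\<close>. These comparisons (a Harnack inequality in the starting point, approximate symmetry
 \<open>a(x, y) \<approx> a(y, x)\<close>, and \<open>- log g \<approx> a\<close>) come from two inputs. First, near a point the Green measure of a
 small set is comparable with its volume, the constants being controlled by a Gaussian average of the potential
 and by the Green measure of balls. Second, the Green measure is symmetric, since Brownian motion is invariant under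
 time reversal. In dimensions one and two, the Green measure of balls is finite because the path visits the
 obstacle near \<open>u(\<omega>)\<close> often enough to be killed there. As the direction of the ray may fail to be ergodic by itself, the limit is
 shown to be constant by comparing the costs from \<open>0\<close> and from \<open>z\<close> for every \<open>z\<close>.
\<close>

section \<open>Paths\<close>

text \<open>The potential is unbounded and a path may go anywhere in unit time, so control near one
  point is not enough: the potential and the Green measure of unit balls are bounded on the whole
  space by weights that grow like a Gaussian around a centre. Such a weight must grow slower than
  the heat kernel decays, and each change of centre doubles its rate at most; hence the rates 1/64,
  1/16 and 1/8. All comparison constants have the form \<open>exp (C * (1 + K + ln L))\<close>,
  where \<open>K\<close> bounds the potential and \<open>L\<close> the Green measure. Costs are
  logarithms, so they change by amounts affine in \<open>K\<close> and \<open>ln L\<close>. This is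
  why first moments suffice: \<open>K\<close> comes from averaging the local supremum of V against a
  Gaussian, and \<open>ln L\<close> grows at most linearly in the distance to the obstacle. Both go
  into one integrable function, which along the integer points of a ray is almost surely o(n). The
  worst starting point in a ball appears because a path that reaches a ball is handed over at an
  uncontrolled point of it.\<close>

lemma space_path_space: "space path_space = extensional {0..} \<inter> {w. continuous_on {0..} w}"
 by (auto simp: path_space_def space_restrict_space space_PiM PiE_def)

lemma measurable_path_coord [measurable]:
 "0 \<le> s \<Longrightarrow> (\<lambda>w. w s) \<in> borel_measurable path_space"
 unfolding path_space_def by (intro measurable_restrict_space1 measurable_component_singleton) auto

lemma measurable_path_spaceI:
 assumes "\<And>s. 0 \<le> s \<Longrightarrow> (\<lambda>x. f x s) \<in> borel_measurable N"
  and "\<And>x. x \<in> space N \<Longrightarrow> f x \<in> extensional {0..}"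
  and "\<And>x. x \<in> space N \<Longrightarrow> continuous_on {0..} (f x)"
 shows "f \<in> measurable N path_space"
 unfolding path_space_def
 by (rule measurable_restrict_space2, use assms(3) in blast, rule measurable_PiM_single')
   (use assms in \<open>auto simp: space_PiM PiE_def\<close>)

abbreviation cylinder :: "real set \<Rightarrow> (real \<Rightarrow> 'a::euclidean_space set) \<Rightarrow> (real \<Rightarrow> 'a) set" where
 "cylinder J A \<equiv> {w \<in> space path_space. \<forall>j\<in>J. w j \<in> A j}"

lemma Collect_finite_borel:
 assumes "finite J" "\<And>j. j \<in> J \<Longrightarrow> f j \<in> borel_measurable N" "\<And>j. j \<in> J \<Longrightarrow> A j \<in> sets borel"
 shows "{x\<in>space N. \<forall>j\<in>J. f j x \<in> A j} \<in> sets N"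
proof (rule sets.sets_Collect_finite_All)
 fix j assume "j \<in> J"
 then have "f j -` A j \<inter> space N \<in> sets N" using assms by (intro measurable_sets) auto
 also have "f j -` A j \<inter> space N = {x\<in>space N. f j x \<in> A j}" by auto
 finally show "{x\<in>space N. f j x \<in> A j} \<in> sets N" .
qed fact

lemma cylinder_sets:
 assumes "finite J" "J \<subseteq> {0..}" "\<And>j. j \<in> J \<Longrightarrow> A j \<in> sets borel"
 shows "cylinder J A \<in> sets path_space"
 using assms by (intro Collect_finite_borel) auto

text \<open>Open sets \<open>A j\<close> suffice because the cylinders over open boxes already generate.\<close>

lemma path_measure_eqI:
 fixes P Q :: "(real \<Rightarrow> 'a::euclidean_space) measure"
 assumes P: "finite_measure P" "sets P = sets path_space" and Q: "sets Q = sets path_space"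
  and eq: "\<And>J A. finite J \<Longrightarrow> J \<subseteq> {0..} \<Longrightarrow> (\<And>j. j \<in> J \<Longrightarrow> open (A j)) \<Longrightarrow>
   emeasure P (cylinder J A) =
   emeasure Q (cylinder J A)"
 shows "P = Q"
proof -
 let ?\<Omega> = "space path_space :: (real \<Rightarrow> 'a) set"
 define C where "C J A = {w\<in>?\<Omega>. \<forall>j\<in>J. w j \<in> A j}" for J :: "real set" and A :: "real \<Rightarrow> 'a set"
 define E where "E = {C J A |J A. finite J \<and> J \<subseteq> {0..} \<and> (\<forall>j\<in>J. open (A j))}"
 have E_sub: "E \<subseteq> Pow ?\<Omega>" by (auto simp: E_def C_def)
 have Cm: "C J A \<in> sets path_space" if "finite J" "J \<subseteq> {0..}" "\<forall>j\<in>J. open (A j)" for J A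
  unfolding C_def using that by (intro cylinder_sets) auto
 \<comment> \<open>If the identity is measurable from the sigma-algebra generated by the open
   cylinders, every event of path space belongs to that sigma-algebra. Coordinatewise this is just
   the preimage of an open set.\<close>
 have "(\<lambda>w. w) \<in> measurable (sigma ?\<Omega> E) path_space"
 proof (rule measurable_path_spaceI)
  fix s :: real assume s: "0 \<le> s"
  show "(\<lambda>w. w s) \<in> borel_measurable (sigma ?\<Omega> E)"
  proof (rule borel_measurableI)
   fix S :: "'a set" assume "open S"
   then have "C {s} (\<lambda>_. S) \<in> E" using s unfolding E_def by blast
   moreover have "C {s} (\<lambda>_. S) = (\<lambda>w. w s) -` S \<inter> space (sigma ?\<Omega> E)"
    by (auto simp: C_def space_measure_of_conv)
   ultimately show "(\<lambda>w. w s) -` S \<inter> space (sigma ?\<Omega> E) \<in> sets (sigma ?\<Omega> E)"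
    using E_sub by (simp add: sigma_sets.Basic)
  qed
 qed (auto simp: space_measure_of_conv space_path_space)
 then have sub: "sets path_space \<subseteq> sigma_sets ?\<Omega> E"
 proof -
  assume m: "(\<lambda>w. w) \<in> measurable (sigma ?\<Omega> E) path_space"
  show ?thesis
  proof
   fix X :: "(real \<Rightarrow> 'a) set" assume X: "X \<in> sets path_space"
   from measurable_sets[OF m X] sets.sets_into_space[OF X] E_sub show "X \<in> sigma_sets ?\<Omega> E"
    by (simp add: space_measure_of_conv Int_absorb2)
  qed
 qed
 have sE: "sets path_space = sigma_sets ?\<Omega> E"
 proof (rule antisym[OF sub sets.sigma_sets_subset])
  show "E \<subseteq> sets path_space" using Cm by (auto simp: E_def)
 qed
 show ?thesis
 proof (rule measure_eqI_generator_eq[where E = E and \<Omega> = ?\<Omega> and A = "\<lambda>_. C {} (\<lambda>_. UNIV)"])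
  show "Int_stable E"
  proof (rule Int_stableI)
   fix a b assume "a \<in> E" "b \<in> E"
   then obtain J A J' A' where *: "a = C J A" "b = C J' A'" "finite J" "finite J'" "J \<subseteq> {0..}" "J' \<subseteq> {0..}"
    "\<forall>j\<in>J. open (A j)" "\<forall>j\<in>J'. open (A' j)"
    unfolding E_def by blast
   define A'' where "A'' j = (if j \<in> J then A j else UNIV) \<inter> (if j \<in> J' then A' j else UNIV)" for j
   have "a \<inter> b = C (J \<union> J') A''"
    unfolding * C_def A''_def by (auto split: if_splits)
   moreover have "\<forall>j\<in>J\<union>J'. open (A'' j)" unfolding A''_def using * by auto
   ultimately show "a \<inter> b \<in> E" unfolding E_def using *
    by (auto intro!: exI[of _ "J \<union> J'"] exI[of _ A''])
  qed
  show "range (\<lambda>_. C {} (\<lambda>_. UNIV)) \<subseteq> E" unfolding E_def by blast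
  interpret finite_measure P by fact
  show "emeasure P (C {} (\<lambda>_. UNIV)) \<noteq> \<infinity>" by simp
  show "emeasure P X = emeasure Q X" if "X \<in> E" for X
   using that eq unfolding E_def C_def by blast
 qed (use E_sub P Q sE in \<open>auto simp: C_def\<close>)
qed

section \<open>Translated, shifted and stopped paths\<close>

definition add_path :: "'a::euclidean_space \<Rightarrow> (real \<Rightarrow> 'a) \<Rightarrow> real \<Rightarrow> 'a" where
 "add_path x w = (\<lambda>s\<in>{0..}. x + w s)"

definition shift_path :: "real \<Rightarrow> (real \<Rightarrow> 'a::euclidean_space) \<Rightarrow> real \<Rightarrow> 'a" where
 "shift_path t w = (\<lambda>s\<in>{0..}. w (t + s))"

definition inc_path :: "real \<Rightarrow> (real \<Rightarrow> 'a::euclidean_space) \<Rightarrow> real \<Rightarrow> 'a" where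
 "inc_path t w = (\<lambda>s\<in>{0..}. w (t + s) - w t)"

text \<open>The stopped path carries the past up to time \<open>t\<close>, and
  \<open>inc_path\<close> the future relative to the position at \<open>t\<close>; their
  independence is the Markov property. All these operations restrict to \<open>{0..}\<close> because
  elements of \<open>path_space\<close> are extensional.\<close>

definition stop_path :: "real \<Rightarrow> (real \<Rightarrow> 'a::euclidean_space) \<Rightarrow> real \<Rightarrow> 'a" where
 "stop_path t w = (\<lambda>s\<in>{0..}. w (min s t))"

lemma add_path_apply [simp]: "0 \<le> s \<Longrightarrow> add_path x w s = x + w s"
 by (simp add: add_path_def)

lemma shift_path_apply [simp]: "0 \<le> s \<Longrightarrow> shift_path t w s = w (t + s)"
 by (simp add: shift_path_def)

lemma inc_path_apply [simp]: "0 \<le> s \<Longrightarrow> inc_path t w s = w (t + s) - w t"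
 by (simp add: inc_path_def)

lemma stop_path_apply [simp]: "0 \<le> s \<Longrightarrow> stop_path t w s = w (min s t)"
 by (simp add: stop_path_def)

lemma path_continuous_on: "w \<in> space path_space \<Longrightarrow> continuous_on {0..} w"
 by (auto simp: space_path_space)

lemma path_continuous_on_compose:
 assumes "w \<in> space path_space" "continuous_on S h" "\<And>x. x \<in> S \<Longrightarrow> 0 \<le> h x"
 shows "continuous_on S (\<lambda>x. w (h x))"
 using continuous_on_compose2[OF path_continuous_on[OF assms(1)] assms(2)] assms(3) by auto

lemma measurable_add_path [measurable]: "add_path x \<in> measurable path_space path_space"
proof (rule measurable_path_spaceI)
 show "continuous_on {0..} (add_path x w)" if "w \<in> space path_space" for w
 proof -
  have "continuous_on {0..} (\<lambda>s. x + w s)"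
   using path_continuous_on[OF that] by (intro continuous_intros)
  then show ?thesis by (rule continuous_on_eq) auto
 qed
qed (auto simp: add_path_def)

lemma measurable_shift_path [measurable]:
 assumes "0 \<le> t" shows "shift_path t \<in> measurable path_space path_space"
proof (rule measurable_path_spaceI)
 show "continuous_on {0..} (shift_path t w)" if "w \<in> space path_space" for w
 proof -
  have "continuous_on {0..} (\<lambda>s. w (t + s))"
   using assms by (intro path_continuous_on_compose[OF that] continuous_intros) auto
  then show ?thesis by (rule continuous_on_eq) auto
 qed
qed (use assms in \<open>auto simp: shift_path_def\<close>)

lemma measurable_inc_path [measurable]:
 assumes "0 \<le> t" shows "inc_path t \<in> measurable path_space path_space"
proof (rule measurable_path_spaceI)
 show "continuous_on {0..} (inc_path t w)" if "w \<in> space path_space" for w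
 proof -
  have "continuous_on {0..} (\<lambda>s. w (t + s) - w t)"
   using assms by (intro continuous_intros path_continuous_on_compose[OF that]) auto
  then show ?thesis by (rule continuous_on_eq) auto
 qed
qed (use assms in \<open>auto simp: inc_path_def\<close>)

lemma measurable_stop_path [measurable]:
 assumes "0 \<le> t" shows "stop_path t \<in> measurable path_space path_space"
proof (rule measurable_path_spaceI)
 show "continuous_on {0..} (stop_path t w)" if "w \<in> space path_space" for w
 proof -
  have "continuous_on {0..} (\<lambda>s. w (min s t))"
   using assms by (intro path_continuous_on_compose[OF that] continuous_intros) auto
  then show ?thesis by (rule continuous_on_eq) auto
 qed
qed (use assms in \<open>auto simp: stop_path_def\<close>)

section \<open>Uniqueness of Wiener measure and the Markov property\<close>

text \<open>The heat kernel: the density of a Brownian increment over time \<open>t\<close>.\<close>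

definition gauss :: "real \<Rightarrow> 'a::euclidean_space \<Rightarrow> real" where
 "gauss t z = (\<Prod>b\<in>Basis. normal_density 0 (sqrt t) (z \<bullet> b))"

lemma wiener_prob_space: "wiener_measure x P \<Longrightarrow> prob_space P"
 and wiener_sets: "wiener_measure x P \<Longrightarrow> sets P = sets path_space"
 and wiener_start: "wiener_measure x P \<Longrightarrow> AE w in P. w 0 = x"
 and wiener_inc: "wiener_measure x P \<Longrightarrow> 0 \<le> s \<Longrightarrow> s < t \<Longrightarrow>
  distributed P lborel (\<lambda>w. w t - w s) (\<lambda>z. ennreal (gauss (t - s) z))"
 by (auto simp: wiener_measure_def gauss_def)

lemma wiener_indep: "wiener_measure x P \<Longrightarrow> 0 \<le> t 0 \<Longrightarrow> strict_mono t \<Longrightarrow>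
  prob_space.indep_vars P (\<lambda>_. borel) (\<lambda>i w. w (t (Suc i)) - w (t i)) UNIV" for t :: "nat \<Rightarrow> real"
 by (auto simp: wiener_measure_def)

lemma wiener_space: "wiener_measure x P \<Longrightarrow> space P = space path_space"
 using wiener_sets sets_eq_imp_space_eq by blast

text \<open>\<open>wiener_measure\<close> states independence along infinite increasing sequences of
  times. A finite set of times is therefore listed in order and continued past its maximum. Since 0
  belongs to it, the sequence starts at time 0, where the position is known.\<close>

lemma ex_strict_mono_enum:
 fixes S :: "real set"
 assumes "finite S" "S \<subseteq> {0..}" "0 \<in> S"
 obtains t :: "nat \<Rightarrow> real" where "strict_mono t" "t 0 = 0" "t ` {..<card S} = S"
proof -
 define l where "l = sorted_list_of_set S"
 have l: "sorted_wrt (<) l" "set l = S" "length l = card S"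
  unfolding l_def using assms by auto
 define n where "n = card S"
 have n: "0 < n" using assms by (auto simp: n_def card_gt_0_iff)
 define t where "t i = (if i < n then l ! i else Max S + real (i + 1))" for i
 have le: "l ! i \<le> Max S" if "i < n" for i
  using that l assms by (intro Max_ge) (auto simp: n_def)
 have "t i < t (Suc i)" for i
  using le[of i] l(1,3) n unfolding t_def by (auto simp: sorted_wrt_iff_nth_less n_def)
 then have sm: "strict_mono t" by (simp add: strict_mono_Suc_iff)
 have im: "t ` {..<n} = S"
  using l(2,3) by (auto simp: t_def n_def set_conv_nth)
 obtain i where i: "i < n" "t i = 0" using im assms(3) by (auto simp: image_iff)
 have "t 0 \<in> S" using im n by auto
 then have "0 \<le> t 0" using assms by auto
 moreover have "t 0 \<le> t i" using sm by (simp add: strict_mono_less_eq)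
 ultimately have "t 0 = 0" using i by simp
 then show ?thesis using that[OF sm] im by (simp add: n_def)
qed

lemma wiener_sequence_law:
 assumes W: "wiener_measure x P" and t: "strict_mono t" "0 \<le> t 0"
 shows "distr P (PiM UNIV (\<lambda>_::nat. borel)) (\<lambda>w i. w (t (Suc i)) - w (t i)) =
  PiM UNIV (\<lambda>i. density lborel (\<lambda>z. ennreal (gauss (t (Suc i) - t i) z)))"
proof -
 interpret prob_space P by (rule wiener_prob_space[OF W])
 have [measurable_cong]: "sets P = sets path_space" by (rule wiener_sets[OF W])
 have t0: "0 \<le> t i" for i
  using t by (metis le0 order_trans strict_mono_less_eq)
 have d: "distributed P lborel (\<lambda>w. w (t (Suc i)) - w (t i)) (\<lambda>z. ennreal (gauss (t (Suc i) - t i) z))" for i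
  using t0 t by (intro wiener_inc[OF W]) (auto simp: strict_mono_less)
 have m: "(\<lambda>w. w (t (Suc i)) - w (t i)) \<in> borel_measurable P" for i
  using t0 by measurable
 have "distr P (PiM UNIV (\<lambda>_. borel)) (\<lambda>w. \<lambda>i\<in>UNIV. w (t (Suc i)) - w (t i)) =
  PiM UNIV (\<lambda>i. distr P borel (\<lambda>w. w (t (Suc i)) - w (t i)))"
  using wiener_indep[OF W t(2,1)] m by (subst (asm) indep_vars_iff_distr_eq_PiM') auto
 moreover have "distr P borel (\<lambda>w. w (t (Suc i)) - w (t i)) =
   density lborel (\<lambda>z. ennreal (gauss (t (Suc i) - t i) z))" for i
 proof -
  have "distr P borel (\<lambda>w. w (t (Suc i)) - w (t i)) = distr P lborel (\<lambda>w. w (t (Suc i)) - w (t i))"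
   by (rule distr_cong) auto
  then show ?thesis using d[of i] by (simp add: distributed_def)
 qed
 ultimately show ?thesis by (simp add: restrict_def)
qed

lemma path_telescope:
 fixes w :: "real \<Rightarrow> 'a::euclidean_space"
 shows "w (t n) = w (t 0) + (\<Sum>k<n. w (t (Suc k)) - w (t k))"
 by (induction n) auto

text \<open>Up to the null event \<open>w 0 \<noteq> x\<close>, positions at finitely many times are
  partial sums of increments, whose joint law is prescribed. Uniqueness replaces later computations
  of laws: the law of a transformed path is identified by checking the conditions of
  \<open>wiener_measure\<close>.\<close>

lemma wiener_unique:
 assumes P: "wiener_measure x P" and Q: "wiener_measure x Q"
 shows "P = Q"
proof (rule path_measure_eqI)
 interpret P: prob_space P by (rule wiener_prob_space[OF P])
 show "finite_measure P" by (rule P.finite_measure_axioms)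
 show "sets P = sets path_space" by (rule wiener_sets[OF P])
 show "sets Q = sets path_space" by (rule wiener_sets[OF Q])
 fix J :: "real set" and A :: "real \<Rightarrow> 'a set"
 assume J: "finite J" "J \<subseteq> {0..}" and A: "\<And>j. j \<in> J \<Longrightarrow> open (A j)"
 obtain t where t: "strict_mono t" "t 0 = 0" "t ` {..<card (insert 0 J)} = insert 0 J"
  using ex_strict_mono_enum[of "insert 0 J"] J by auto
 have "\<forall>j\<in>J. \<exists>n. t n = j" using t(3) by (metis imageE insertCI)
 then obtain n where n: "\<And>j. j \<in> J \<Longrightarrow> t (n j) = j" by metis
 define B :: "(nat \<Rightarrow> 'a) set" where "B = {v. \<forall>j\<in>J. x + (\<Sum>k<n j. v k) \<in> A j}"
 have [measurable]: "B \<in> sets (PiM UNIV (\<lambda>_. borel))"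
 proof -
  have "{v \<in> space (PiM UNIV (\<lambda>_. borel)). \<forall>j\<in>J. x + (\<Sum>k<n j. v k) \<in> A j} \<in> sets (PiM UNIV (\<lambda>_::nat. borel::'a measure))"
   using J A by (intro Collect_finite_borel) auto
  then show ?thesis by (simp add: B_def space_PiM)
 qed
 have t0: "0 \<le> t i" for i using t by (metis le0 strict_mono_less_eq)
 have *: "emeasure R (cylinder J A) =
   emeasure (PiM UNIV (\<lambda>i. density lborel (\<lambda>z. ennreal (gauss (t (Suc i) - t i) z)))) B"
  if R: "wiener_measure x R" for R
 proof -
  note [measurable_cong] = wiener_sets[OF R]
  have m: "(\<lambda>w i. w (t (Suc i)) - w (t i)) \<in> measurable R (PiM UNIV (\<lambda>_::nat. borel))"
   using t0 by (intro measurable_PiM_single') auto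
  have "emeasure R (cylinder J A) =
    emeasure R ((\<lambda>w i. w (t (Suc i)) - w (t i)) -` B \<inter> space R)"
  proof (rule emeasure_eq_AE)
   show "AE w in R. (w \<in> cylinder J A) =
    (w \<in> (\<lambda>w i. w (t (Suc i)) - w (t i)) -` B \<inter> space R)"
    using wiener_start[OF R] AE_space
   proof eventually_elim
    case (elim w)
    have "w j = x + (\<Sum>k<n j. w (t (Suc k)) - w (t k))" if "j \<in> J" for j
     using path_telescope[of w t "n j"] n[OF that] elim t(2) by simp
    then show ?case using elim by (auto simp: B_def wiener_space[OF R])
   qed
   have "cylinder J A \<in> sets path_space"
    using J A by (intro cylinder_sets) auto
   then show "cylinder J A \<in> sets R"
    using wiener_sets[OF R] by simp
  qed (use m in measurable)
  also have "\<dots> = emeasure (distr R (PiM UNIV (\<lambda>_. borel)) (\<lambda>w i. w (t (Suc i)) - w (t i))) B"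
   using m by (simp add: emeasure_distr)
  finally show ?thesis
   using wiener_sequence_law[OF R t(1)] t(2) by simp
 qed
 show "emeasure P (cylinder J A) =
  emeasure Q (cylinder J A)"
  using *[OF P] *[OF Q] by simp
qed

text \<open>The conditions on Wiener measure concern only the start and the increments, so a map
  that preserves increments up to a time lag \<open>c\<close> produces Wiener measure again. Lag 0
  covers translations, lag \<open>t\<close> the restart at time \<open>t\<close>.\<close>

lemma wiener_map:
 assumes W: "wiener_measure x P" and \<phi> [measurable]: "\<phi> \<in> measurable path_space path_space" and c: "0 \<le> c"
  and inc: "\<And>w s. w \<in> space path_space \<Longrightarrow> 0 \<le> s \<Longrightarrow> \<phi> w s - \<phi> w 0 = w (c + s) - w c"
  and start: "AE w in P. \<phi> w 0 = y"
 shows "wiener_measure y (distr P path_space \<phi>)"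
proof -
 interpret P: prob_space P by (rule wiener_prob_space[OF W])
 note [measurable_cong] = wiener_sets[OF W]
 have m [measurable]: "\<phi> \<in> measurable P path_space" by measurable
 interpret D: prob_space "distr P path_space \<phi>" by (rule P.prob_space_distr[OF m])
 have inc2: "\<phi> w t - \<phi> w s = w (c + t) - w (c + s)" if "w \<in> space P" "0 \<le> s" "0 \<le> t" for w s t
 proof -
  have "\<phi> w t - \<phi> w s = (\<phi> w t - \<phi> w 0) - (\<phi> w s - \<phi> w 0)" by simp
  also have "\<dots> = w (c + t) - w (c + s)" using that by (simp only: inc wiener_space[OF W]) simp
  finally show ?thesis .
 qed
 show ?thesis
  unfolding wiener_measure_def
 proof (intro conjI allI impI)
  show "prob_space (distr P path_space \<phi>)" by (rule D.prob_space_axioms)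
  have "{w \<in> space path_space. w 0 = y} \<in> sets path_space"
   using Collect_finite_borel[of "{0::real}" "\<lambda>_ w. w 0" path_space "\<lambda>_. {y}"] by simp
  then show "AE w in distr P path_space \<phi>. w 0 = y"
   using start by (subst AE_distr_iff[OF m]) auto
 next
  fix s t :: real assume st: "0 \<le> s \<and> s < t"
  have [measurable]: "(\<lambda>w. w t - w s) \<in> borel_measurable path_space" using st by simp
  have d: "distributed P lborel (\<lambda>w. w (c + t) - w (c + s)) (\<lambda>z. ennreal (gauss (t - s) z))"
   using wiener_inc[OF W, of "c + s" "c + t"] st c by simp
  have "distr (distr P path_space \<phi>) lborel (\<lambda>w. w t - w s) = distr P lborel (\<lambda>w. w (c + t) - w (c + s))"
   using st c inc2 by (subst distr_distr) (auto intro!: distr_cong)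
  with d show "distributed (distr P path_space \<phi>) lborel (\<lambda>w. w t - w s)
    (\<lambda>z. ennreal (\<Prod>b\<in>Basis. normal_density 0 (sqrt (t - s)) (z \<bullet> b)))"
   unfolding distributed_def gauss_def by auto
 next
  fix t :: "nat \<Rightarrow> real" assume t: "0 \<le> t 0 \<and> strict_mono t"
  have t0: "0 \<le> t i" for i using t by (metis le0 order_trans strict_mono_less_eq)
  have rv: "(\<lambda>w. w (t (Suc i)) - w (t i)) \<in> borel_measurable path_space" for i using t0 by simp
  have rvc: "(\<lambda>w. w (c + t (Suc i)) - w (c + t i)) \<in> borel_measurable P" for i
  proof -
   have "0 \<le> c + t i" for i using t0 c by simp
   then show ?thesis by measurable
  qed
  have "P.indep_vars (\<lambda>_. borel) (\<lambda>i w. w (c + t (Suc i)) - w (c + t i)) UNIV"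
   using wiener_indep[OF W, of "\<lambda>i. c + t i"] t c by (auto simp: strict_mono_def)
  then have *: "distr P (PiM UNIV (\<lambda>_. borel)) (\<lambda>w. \<lambda>i\<in>UNIV. w (c + t (Suc i)) - w (c + t i)) =
    PiM UNIV (\<lambda>i. distr P borel (\<lambda>w. w (c + t (Suc i)) - w (c + t i)))"
   using rvc by (subst (asm) P.indep_vars_iff_distr_eq_PiM') auto
  have 1: "distr (distr P path_space \<phi>) (PiM UNIV (\<lambda>_. borel)) (\<lambda>w. \<lambda>i\<in>UNIV. w (t (Suc i)) - w (t i)) =
    distr P (PiM UNIV (\<lambda>_. borel)) (\<lambda>w. \<lambda>i\<in>UNIV. w (c + t (Suc i)) - w (c + t i))"
   using t0 inc2 rv
   by (subst distr_distr) (auto intro!: distr_cong measurable_PiM_single' simp: restrict_def fun_eq_iff)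
  have 2: "distr (distr P path_space \<phi>) borel (\<lambda>w. w (t (Suc i)) - w (t i)) =
    distr P borel (\<lambda>w. w (c + t (Suc i)) - w (c + t i))" for i
   using t0 inc2 rv by (subst distr_distr) (auto intro!: distr_cong)
  show "D.indep_vars (\<lambda>_. borel) (\<lambda>i w. w (t (Suc i)) - w (t i)) UNIV"
   using rv by (subst D.indep_vars_iff_distr_eq_PiM') (auto simp: * 1 2)
 qed simp
qed

lemma wiener_add_path:
 assumes "wiener_measure x P"
 shows "wiener_measure (y + x) (distr P path_space (add_path y))"
 using wiener_start[OF assms] by (intro wiener_map[OF assms, where c = 0]) auto

lemma wiener_inc_path:
 assumes "wiener_measure x P" "0 \<le> t"
 shows "wiener_measure 0 (distr P path_space (inc_path t))"
 using assms by (intro wiener_map[OF assms(1), where c = t]) auto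

text \<open>Independence is phrased through a law: under the restriction \<open>N\<close> of a
  measure to an event, \<open>Y\<close> has law \<open>Q\<close> up to the total mass. In this form
  it extends from open cylinders to all events by \<open>path_measure_eqI\<close>.\<close>

lemma path_indep_eqI:
 fixes Y :: "'b \<Rightarrow> real \<Rightarrow> 'a::euclidean_space"
 assumes N: "finite_measure N" and Y [measurable]: "Y \<in> measurable N path_space"
  and Q: "finite_measure Q" "sets Q = sets path_space"
  and eq: "\<And>K B. finite K \<Longrightarrow> K \<subseteq> {0..} \<Longrightarrow> (\<And>k. k \<in> K \<Longrightarrow> open (B k)) \<Longrightarrow>
   emeasure N {w\<in>space N. \<forall>k\<in>K. Y w k \<in> B k} =
   emeasure N (space N) * emeasure Q (cylinder K B)"
 shows "distr N path_space Y = scale_measure (emeasure N (space N)) Q"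
proof (rule path_measure_eqI)
 interpret N: finite_measure N by fact
 show "finite_measure (distr N path_space Y)" by (rule N.finite_measure_distr[OF Y])
 show "sets (scale_measure (emeasure N (space N)) Q) = sets path_space" using Q by simp
 fix K and B :: "real \<Rightarrow> 'a set" assume KB: "finite K" "K \<subseteq> {0..}" "\<And>k. k \<in> K \<Longrightarrow> open (B k)"
 have "emeasure (distr N path_space Y) (cylinder K B) =
   emeasure N (Y -` cylinder K B \<inter> space N)"
  using KB by (intro emeasure_distr Y cylinder_sets) auto
 also have "Y -` cylinder K B \<inter> space N = {w\<in>space N. \<forall>k\<in>K. Y w k \<in> B k}"
  using measurable_space[OF Y] by auto
 finally show "emeasure (distr N path_space Y) (cylinder K B) =
   emeasure (scale_measure (emeasure N (space N)) Q) (cylinder K B)"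
  using eq[OF KB] by simp
qed simp

text \<open>All times involved are listed in one increasing sequence that passes through
  \<open>t\<close> at index \<open>m\<close>. Positions up to \<open>t\<close> are sums of
  increments with index below \<open>m\<close>, increments after \<open>t\<close> are sums with
  index at least \<open>m\<close>, and disjoint blocks of independent variables are
  independent.\<close>

lemma wiener_indep_cylinders:
 fixes P :: "(real \<Rightarrow> 'a::euclidean_space) measure"
 assumes W: "wiener_measure x P" and t: "0 \<le> t"
  and J: "finite J" "J \<subseteq> {0..}" "\<And>j. j \<in> J \<Longrightarrow> open (A j)"
  and K: "finite K" "K \<subseteq> {0..}" "\<And>k. k \<in> K \<Longrightarrow> open (B k)"
 shows "emeasure P {w\<in>space P. (\<forall>j\<in>J. w (min j t) \<in> A j) \<and> (\<forall>k\<in>K. w (t + k) - w t \<in> B k)} =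
  emeasure P {w\<in>space P. \<forall>j\<in>J. w (min j t) \<in> A j} *
  emeasure P {w\<in>space P. \<forall>k\<in>K. w (t + k) - w t \<in> B k}"
proof -
 interpret P: prob_space P by (rule wiener_prob_space[OF W])
 note [measurable_cong] = wiener_sets[OF W]
 define S where "S = insert 0 (insert t ((\<lambda>j. min j t) ` J \<union> (\<lambda>k. t + k) ` K))"
 have "finite S" "S \<subseteq> {0..}" "0 \<in> S" using J K t by (auto simp: S_def)
 then obtain \<tau> where \<tau>: "strict_mono \<tau>" "\<tau> 0 = 0" "\<tau> ` {..<card S} = S"
  using ex_strict_mono_enum by blast
 have \<tau>0: "0 \<le> \<tau> i" for i using \<tau> by (metis le0 strict_mono_less_eq)
 have ex: "\<exists>i. \<tau> i = s" if "s \<in> S" for s using \<tau>(3) that by (metis imageE)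
 obtain m where m: "\<tau> m = t" using ex[of t] by (auto simp: S_def)
 have "\<forall>j\<in>J. \<exists>i. \<tau> i = min j t" using ex by (auto simp: S_def)
 then obtain p where p: "\<And>j. j \<in> J \<Longrightarrow> \<tau> (p j) = min j t" by metis
 have "\<forall>k\<in>K. \<exists>i. \<tau> i = t + k" using ex by (auto simp: S_def)
 then obtain q where q: "\<And>k. k \<in> K \<Longrightarrow> \<tau> (q k) = t + k" by metis
 have pm: "p j \<le> m" if "j \<in> J" for j
  using p[OF that] m strict_mono_less_eq[OF \<tau>(1), of "p j" m] by simp
 have qm: "m \<le> q k" if "k \<in> K" for k
  using q[OF that] m K(2) that strict_mono_less_eq[OF \<tau>(1), of m "q k"] by auto
 define X where "X i w = w (\<tau> (Suc i)) - w (\<tau> i)" for i :: nat and w :: "real \<Rightarrow> 'a"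
 have Xm: "X i \<in> borel_measurable P" for i unfolding X_def using \<tau>0 by measurable
 have ind: "P.indep_vars (\<lambda>_. borel) X UNIV"
  using wiener_indep[OF W _ \<tau>(1)] \<tau>(2) unfolding X_def by simp
 have iv: "P.indep_var (PiM {..<m} (\<lambda>_. borel)) (\<lambda>w. \<lambda>i\<in>{..<m}. X i w)
   (PiM {m..} (\<lambda>_. borel)) (\<lambda>w. \<lambda>i\<in>{m..}. X i w)"
  by (rule P.indep_var_restrict[OF ind]) auto
 define XA :: "(nat \<Rightarrow> 'a) set"
  where "XA = {v \<in> space (PiM {..<m} (\<lambda>_. borel)). \<forall>j\<in>J. x + (\<Sum>i<p j. v i) \<in> A j}"
 define XB :: "(nat \<Rightarrow> 'a) set"
  where "XB = {v \<in> space (PiM {m..} (\<lambda>_. borel)). \<forall>k\<in>K. (\<Sum>i\<in>{m..<q k}. v i) \<in> B k}"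
 have XA: "XA \<in> sets (PiM {..<m} (\<lambda>_. borel))" unfolding XA_def
  using J pm by (intro Collect_finite_borel borel_measurable_add borel_measurable_sum borel_measurable_const
   measurable_component_singleton) fastforce+
 have XB: "XB \<in> sets (PiM {m..} (\<lambda>_. borel))" unfolding XB_def
  using K by (intro Collect_finite_borel borel_measurable_sum measurable_component_singleton) auto
 have fA: "(\<lambda>w. \<lambda>i\<in>{..<m}. X i w) \<in> measurable P (PiM {..<m} (\<lambda>_. borel))"
  and fB: "(\<lambda>w. \<lambda>i\<in>{m..}. X i w) \<in> measurable P (PiM {m..} (\<lambda>_. borel))"
  using Xm by (auto intro!: measurable_restrict)
 have tA: "w (min j t) = w 0 + (\<Sum>i<p j. X i w)" if "j \<in> J" for w j
  using path_telescope[of w \<tau> "p j"] p[OF that] \<tau>(2) by (simp add: X_def)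
 have tB: "w (t + k) - w t = (\<Sum>i\<in>{m..<q k}. X i w)" if "k \<in> K" for w k
  using sum_Suc_diff'[OF qm[OF that], of "\<lambda>i. w (\<tau> i)"] q[OF that] m by (simp add: X_def)
 have sA: "(\<Sum>i<p j. (\<lambda>i\<in>{..<m}. X i w) i) = (\<Sum>i<p j. X i w)" if "j \<in> J" for j w
  using pm[OF that] by (intro sum.cong) auto
 have sB: "(\<Sum>i\<in>{m..<q k}. (\<lambda>i\<in>{m..}. X i w) i) = (\<Sum>i\<in>{m..<q k}. X i w)" for k w
  by (intro sum.cong) auto
 define EA where "EA = (\<lambda>w. \<lambda>i\<in>{..<m}. X i w) -` XA \<inter> space P"
 define EB where "EB = (\<lambda>w. \<lambda>i\<in>{m..}. X i w) -` XB \<inter> space P"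
 have EAs: "EA \<in> sets P" and EBs: "EB \<in> sets P"
  unfolding EA_def EB_def using fA fB XA XB by (auto intro: measurable_sets)
 have EB_eq: "EB = {w\<in>space P. \<forall>k\<in>K. w (t + k) - w t \<in> B k}"
  using tB sB measurable_space[OF fB] by (auto simp: EB_def XB_def)
 have EA_iff: "w \<in> EA \<longleftrightarrow> (\<forall>j\<in>J. w (min j t) \<in> A j)" if "w \<in> space P" "w 0 = x" for w
  using tA sA measurable_space[OF fA] that by (auto simp: EA_def XA_def)
 have sC: "{w\<in>space P. \<forall>j\<in>J. w (min j t) \<in> A j} \<in> sets P"
  using J t by (intro Collect_finite_borel) auto
 have eA: "emeasure P {w\<in>space P. \<forall>j\<in>J. w (min j t) \<in> A j} = emeasure P EA"
  using EAs sC wiener_start[OF W] EA_iff by (intro emeasure_eq_AE) auto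
 have "emeasure P {w\<in>space P. (\<forall>j\<in>J. w (min j t) \<in> A j) \<and> (\<forall>k\<in>K. w (t + k) - w t \<in> B k)} =
   emeasure P (EA \<inter> EB)"
 proof -
  have "{w\<in>space P. (\<forall>j\<in>J. w (min j t) \<in> A j) \<and> (\<forall>k\<in>K. w (t + k) - w t \<in> B k)} =
   {w\<in>space P. \<forall>j\<in>J. w (min j t) \<in> A j} \<inter> EB" unfolding EB_eq by auto
  then show ?thesis
   using EAs EBs sC wiener_start[OF W] EA_iff by (intro emeasure_eq_AE) auto
 qed
 also have "EA \<inter> EB = (\<lambda>w. ((\<lambda>i\<in>{..<m}. X i w), (\<lambda>i\<in>{m..}. X i w))) -` (XA \<times> XB) \<inter> space P"
  by (auto simp: EA_def EB_def)
 also have "emeasure P \<dots> = emeasure P EA * emeasure P EB"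
  using P.indep_varD[OF iv XA XB]
  by (simp add: P.emeasure_eq_measure EA_def EB_def ennreal_mult'' )
 finally show ?thesis unfolding eA EB_eq .
qed

text \<open>Prepares the evaluation \<open>w (T w)\<close> at a random time. A continuous path is
  the limit of its values at times rounded up to the grid of mesh \<open>1 / Suc n\<close>, and at a
  fixed grid point this is a coordinate map. The \<open>max 0\<close> keeps times in the domain of
  the paths.\<close>

lemma measurable_path_eval_pair:
 "(\<lambda>(s, w). w (max 0 s)) \<in> borel_measurable (borel \<Otimes>\<^sub>M (path_space :: (real \<Rightarrow> 'a::euclidean_space) measure))"
proof (rule borel_measurable_LIMSEQ_metric)
 fix n :: nat
 define u where "u i = (\<lambda>(s::real, w::real \<Rightarrow> 'a). w (real i / real (Suc n)))" for i :: nat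
 define g where "g = (\<lambda>(s::real, w::real \<Rightarrow> 'a). nat \<lceil>max 0 s * real (Suc n)\<rceil>)"
 have [measurable]: "(\<lambda>w. w (real i / real (Suc n))) \<in> borel_measurable (path_space :: (real \<Rightarrow> 'a) measure)" for i
  by simp
 have "(\<lambda>x. u (g x) x) \<in> borel_measurable (borel \<Otimes>\<^sub>M path_space)"
  unfolding u_def g_def
  by (rule measurable_compose_countable) measurable
 then show "(\<lambda>(s, w). w (real (nat \<lceil>max 0 s * real (Suc n)\<rceil>) / real (Suc n)))
   \<in> borel_measurable (borel \<Otimes>\<^sub>M (path_space :: (real \<Rightarrow> 'a) measure))"
  by (simp add: u_def g_def case_prod_beta)
next
 fix x :: "real \<times> (real \<Rightarrow> 'a)" assume "x \<in> space (borel \<Otimes>\<^sub>M path_space)"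
 then obtain s w where x: "x = (s, w)" and w: "w \<in> space path_space"
  by (auto simp: space_pair_measure)
 define r where "r = max 0 s"
 define q where "q n = real (nat \<lceil>r * real (Suc n)\<rceil>) / real (Suc n)" for n
 have r: "0 \<le> r" by (simp add: r_def)
 have lo: "r \<le> q n" and hi: "q n \<le> r + inverse (real (Suc n))" for n
 proof -
  have "0 \<le> \<lceil>r * real (Suc n)\<rceil>" using r by (simp add: le_ceiling_iff less_le_trans[of "-1" 0])
  then have eq: "q n = real_of_int \<lceil>r * real (Suc n)\<rceil> / real (Suc n)"
   unfolding q_def by simp
  have "r * real (Suc n) \<le> real_of_int \<lceil>r * real (Suc n)\<rceil>" by (rule le_of_int_ceiling)
  then show "r \<le> q n" unfolding eq by (simp add: pos_le_divide_eq)
  have "real_of_int \<lceil>r * real (Suc n)\<rceil> \<le> r * real (Suc n) + 1" by linarith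
  then have "q n \<le> (r * real (Suc n) + 1) / real (Suc n)" unfolding eq by (intro divide_right_mono) auto
  also have "\<dots> = r + inverse (real (Suc n))" by (simp add: field_simps)
  finally show "q n \<le> r + inverse (real (Suc n))" .
 qed
 have "q \<longlonglongrightarrow> r"
 proof (rule tendsto_sandwich[OF _ _ tendsto_const])
  show "\<forall>\<^sub>F n in sequentially. r \<le> q n" using lo by simp
  show "\<forall>\<^sub>F n in sequentially. q n \<le> r + inverse (real (Suc n))" using hi by simp
  show "(\<lambda>n. r + inverse (real (Suc n))) \<longlonglongrightarrow> r"
   using tendsto_add[OF tendsto_const LIMSEQ_inverse_real_of_nat, of r] by simp
 qed
 moreover have "q n \<in> {0..}" for n by (simp add: q_def)
 ultimately have "(\<lambda>n. w (q n)) \<longlonglongrightarrow> w r"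
  using path_continuous_on[OF w] r by (intro continuous_on_tendsto_compose[of "{0..}" w]) auto
 then show "(\<lambda>n. case x of (s, w) \<Rightarrow> w (real (nat \<lceil>max 0 s * real (Suc n)\<rceil>) / real (Suc n)))
   \<longlonglongrightarrow> (case x of (s, w) \<Rightarrow> w (max 0 s))"
  by (simp add: x q_def r_def)
qed

lemma measurable_path_eval:
 assumes f: "f \<in> borel_measurable N" and g: "g \<in> measurable N path_space"
  and nn: "\<And>x. x \<in> space N \<Longrightarrow> 0 \<le> f x"
 shows "(\<lambda>x. g x (f x)) \<in> borel_measurable N"
proof -
 have "(\<lambda>x. (case (f x, g x) of (s, w) \<Rightarrow> w (max 0 s))) \<in> borel_measurable N"
  by (rule measurable_compose[OF _ measurable_path_eval_pair]) (use f g in measurable)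
 also have "?this \<longleftrightarrow> (\<lambda>x. g x (f x)) \<in> borel_measurable N"
  using nn by (intro measurable_cong) (auto simp: max_absorb2)
 finally show ?thesis .
qed

lemma measurable_add_path_pair [measurable (raw)]:
 assumes [measurable]: "f \<in> borel_measurable N" and g: "g \<in> measurable N path_space"
 shows "(\<lambda>x. add_path (f x) (g x)) \<in> measurable N path_space"
proof (rule measurable_path_spaceI)
 fix s :: real assume s: "0 \<le> s"
 have [measurable]: "(\<lambda>x. g x s) \<in> borel_measurable N"
  using g s by (rule measurable_compose[OF _ measurable_path_coord])
 show "(\<lambda>x. add_path (f x) (g x) s) \<in> borel_measurable N" using s by simp
next
 fix x assume "x \<in> space N"
 then have "g x \<in> space path_space" by (rule measurable_space[OF g])
 then show "add_path (f x) (g x) \<in> extensional {0..}" "continuous_on {0..} (add_path (f x) (g x))"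
  using measurable_space[OF measurable_add_path, of "g x" "f x"] by (auto simp: space_path_space)
qed

lemma measurable_inc_path_random:
 assumes T: "T \<in> borel_measurable N" "\<And>x. x \<in> space N \<Longrightarrow> 0 \<le> T x" and g: "g \<in> measurable N path_space"
 shows "(\<lambda>x. inc_path (T x) (g x)) \<in> measurable N path_space"
proof (rule measurable_path_spaceI)
 fix s :: real assume s: "0 \<le> s"
 have [measurable]: "(\<lambda>x. g x (T x + s)) \<in> borel_measurable N"
  by (rule measurable_path_eval[of "\<lambda>x. T x + s" N g]) (use s T g in auto)
 have [measurable]: "(\<lambda>x. g x (T x)) \<in> borel_measurable N"
  by (rule measurable_path_eval[of T N g]) (use T g in auto)
 show "(\<lambda>x. inc_path (T x) (g x) s) \<in> borel_measurable N" using s by simp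
next
 fix x assume x: "x \<in> space N"
 then have "g x \<in> space path_space" by (rule measurable_space[OF g])
 then show "inc_path (T x) (g x) \<in> extensional {0..}" "continuous_on {0..} (inc_path (T x) (g x))"
  using measurable_space[OF measurable_inc_path, of "T x" "g x"] T(2)[OF x] by (auto simp: space_path_space)
qed

text \<open>The strong Markov property is proved by approximating the stopping time, which calls for
  test functions continuous in the positions. This lemma leads from them back to the open sets of
  \<open>path_measure_eqI\<close>.\<close>

lemma indicator_open_limit:
 fixes S :: "'a::metric_space set"
 assumes "open S"
 obtains h :: "nat \<Rightarrow> 'a \<Rightarrow> real"
 where "\<And>n. continuous_on UNIV (h n)" "\<And>n x. 0 \<le> h n x" "\<And>n x. h n x \<le> 1"
  "\<And>x. (\<lambda>n. h n x) \<longlonglongrightarrow> indicator S x"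
\<comment> \<open>\<open>infdist\<close> to the empty set is 0, so the construction by the distance
  to the complement would give 0 for \<open>S = UNIV\<close>.\<close>
proof (cases "S = UNIV")
 case True
 then show ?thesis using that[of "\<lambda>_ _. 1"] by simp
next
 case False
 define h where "h n x = min 1 (real n * infdist x (- S))" for n x
 have lim: "(\<lambda>n. h n x) \<longlonglongrightarrow> indicator S x" for x
 proof (cases "x \<in> S")
  case True
  then have "0 < infdist x (- S)"
   using False assms by (metis Compl_iff Compl_UNIV_eq closed_Compl double_compl in_closed_iff_infdist_zero infdist_pos_not_in_closed)
  then obtain m where m: "1 \<le> real m * infdist x (- S)"
   by (metis less_imp_le mult.commute reals_Archimedean3)
  have "\<forall>\<^sub>F n in sequentially. h n x = 1"
  proof (rule eventually_sequentiallyI)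
   fix n assume "m \<le> n"
   then have "1 \<le> real n * infdist x (- S)"
    using m by (meson dual_order.trans infdist_nonneg mult_right_mono of_nat_mono)
   then show "h n x = 1" by (simp add: h_def)
  qed
  then show ?thesis using True by (simp add: tendsto_eventually)
 next
  case False
  then show ?thesis by (simp add: h_def)
 qed
 show ?thesis
 proof (rule that[of h])
  show "continuous_on UNIV (h n)" for n
   unfolding h_def by (intro continuous_intros)
  show "(\<lambda>n. h n x) \<longlonglongrightarrow> indicator S x" for x by (rule lim)
 qed (auto simp: h_def infdist_nonneg)
qed

section \<open>Brownian motion from every starting point and its simple Markov property\<close>

locale brownian =
 fixes P :: "'a::euclidean_space \<Rightarrow> (real \<Rightarrow> 'a) measure"
 assumes wiener: "\<And>x. wiener_measure x (P x)"
begin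

abbreviation start_expectation :: "'a \<Rightarrow> ((real \<Rightarrow> 'a) \<Rightarrow> ennreal) \<Rightarrow> ennreal" ("\<E>") where
 "\<E> x F \<equiv> \<integral>\<^sup>+w. F w \<partial>P x"

lemma prob_P: "prob_space (P x)" by (rule wiener_prob_space[OF wiener])

lemma sets_P [measurable_cong, simp]: "sets (P x) = sets path_space" by (rule wiener_sets[OF wiener])

lemma space_P [simp]: "space (P x) = space path_space" by (rule wiener_space[OF wiener])

lemma measurable_P [simp]: "measurable (P x) N = measurable path_space N"
 by (rule measurable_cong_sets) auto

lemma emeasure_P_space [simp]: "emeasure (P x) (space path_space) = 1"
 using prob_space.emeasure_space_1[OF prob_P, of x] by simp

text \<open>Puts all starting points on the one probability space of paths from 0, so that
  measurability in the starting point becomes a Fubini statement.\<close>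

lemma P_eq_distr: "P x = distr (P 0) path_space (add_path x)"
 using wiener_unique[OF wiener wiener_add_path[OF wiener, of x 0]] by simp

lemma distr_inc_path: "0 \<le> t \<Longrightarrow> distr (P x) path_space (inc_path t) = P 0"
 using wiener_unique[OF wiener_inc_path[OF wiener] wiener] by metis

lemma nn_integral_P:
 "F \<in> borel_measurable path_space \<Longrightarrow> (\<E> x (\<lambda>w. F w)) = \<E> 0 (\<lambda>w. F (add_path x w))"
 by (subst P_eq_distr) (simp add: nn_integral_distr)

lemma measurable_nn_integral_P:
 assumes [measurable]: "F \<in> borel_measurable path_space"
 shows "(\<lambda>x. \<integral>\<^sup>+w. F w \<partial>P x) \<in> borel_measurable borel"
proof -
 interpret prob_space "P 0" by (rule prob_P)
 show ?thesis by (subst nn_integral_P) measurable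
qed

text \<open>Independence is known for cylinders on both sides. It is extended first in the future
  event \<open>C\<close> for a fixed cylinder of the past, then in the past event \<open>D\<close>
  for a fixed \<open>C\<close>, each time by \<open>path_indep_eqI\<close> on a restricted
  measure.\<close>

lemma stop_inc_indep:
 assumes t: "0 \<le> t" and D: "D \<in> sets path_space" and C: "C \<in> sets path_space"
 shows "emeasure (P x) {w\<in>space path_space. stop_path t w \<in> D \<and> inc_path t w \<in> C} =
  emeasure (P x) {w\<in>space path_space. stop_path t w \<in> D} * emeasure (P 0) C"
proof -
 interpret prob_space "P x" by (rule prob_P)
 interpret P0: prob_space "P 0" by (rule prob_P)
 note [measurable] = measurable_stop_path[OF t] measurable_inc_path[OF t] D C
 have inc: "emeasure (P x) {w\<in>space path_space. inc_path t w \<in> C} = emeasure (P 0) C" if [measurable]: "C \<in> sets path_space" for C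
  by (subst distr_inc_path[OF t, of x, symmetric], subst emeasure_distr) (auto intro!: arg_cong[where f = "emeasure _"])
 have eq1: "emeasure (P x) {w\<in>space path_space. (\<forall>j\<in>J. stop_path t w j \<in> A j) \<and> inc_path t w \<in> C} =
   emeasure (P x) {w\<in>space path_space. \<forall>j\<in>J. stop_path t w j \<in> A j} * emeasure (P 0) C"
  if J: "finite J" "J \<subseteq> {0..}" "\<And>j. j \<in> J \<Longrightarrow> open (A j)" for J A
 proof -
  define E where "E = {w\<in>space path_space. \<forall>j\<in>J. stop_path t w j \<in> A j}"
  have E_eq: "E = {w\<in>space (P x). \<forall>j\<in>J. w (min j t) \<in> A j}"
   unfolding E_def space_P using J(2) by (intro Collect_cong conj_cong ball_cong) auto
  have [measurable, simp]: "E \<in> sets path_space"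
   unfolding E_eq space_P using J t by (intro Collect_finite_borel) auto
  let ?N = "restrict_space (P x) E"
  have sN: "space ?N = E" by (simp add: space_restrict_space2)
  have "distr ?N path_space (inc_path t) = scale_measure (emeasure ?N (space ?N)) (P 0)"
  proof (rule path_indep_eqI)
   show "finite_measure ?N" by (rule finite_measure_restrict_space) simp_all
   show "inc_path t \<in> measurable ?N path_space" by (intro measurable_restrict_space1) simp
   show "finite_measure (P 0)" by unfold_locales
   fix K and B :: "real \<Rightarrow> 'a set" assume K: "finite K" "K \<subseteq> {0..}" "\<And>k. k \<in> K \<Longrightarrow> open (B k)"
   have K0: "\<And>k. k \<in> K \<Longrightarrow> 0 \<le> k" using K by auto
   have cyl: "cylinder K B \<in> sets path_space"
    using K by (intro cylinder_sets) auto
   have seteq: "{w\<in>space ?N. \<forall>k\<in>K. inc_path t w k \<in> B k} =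
    {w\<in>space (P x). (\<forall>j\<in>J. w (min j t) \<in> A j) \<and> (\<forall>k\<in>K. w (t + k) - w t \<in> B k)}"
    unfolding sN using K0 by (auto simp: E_eq)
   have "emeasure ?N {w\<in>space ?N. \<forall>k\<in>K. inc_path t w k \<in> B k} =
    emeasure (P x) {w\<in>space (P x). (\<forall>j\<in>J. w (min j t) \<in> A j) \<and> (\<forall>k\<in>K. w (t + k) - w t \<in> B k)}"
    unfolding seteq
   proof (rule emeasure_restrict_space)
    show "E \<inter> space (P x) \<in> sets (P x)" by (intro sets.Int) simp_all
   qed (auto simp: E_eq)
   also have "\<dots> = emeasure (P x) E * emeasure (P x) {w\<in>space (P x). \<forall>k\<in>K. w (t + k) - w t \<in> B k}"
    unfolding E_eq by (rule wiener_indep_cylinders[OF wiener t J K])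
   also have "{w\<in>space (P x). \<forall>k\<in>K. w (t + k) - w t \<in> B k} =
     {w\<in>space path_space. inc_path t w \<in> cylinder K B}"
    using K0 measurable_space[OF measurable_inc_path[OF t]] by auto
   also have "emeasure (P x) \<dots> = emeasure (P 0) (cylinder K B)"
    by (rule inc[OF cyl])
   also have "emeasure (P x) E = emeasure ?N (space ?N)"
    unfolding sN by (subst emeasure_restrict_space) auto
   finally show "emeasure ?N {w\<in>space ?N. \<forall>k\<in>K. inc_path t w k \<in> B k} =
    emeasure ?N (space ?N) * emeasure (P 0) (cylinder K B)" .
  qed simp
  then have "emeasure (distr ?N path_space (inc_path t)) C = emeasure (P x) E * emeasure (P 0) C"
   by (simp add: sN emeasure_restrict_space)
  also have "emeasure (distr ?N path_space (inc_path t)) C = emeasure ?N (inc_path t -` C \<inter> space ?N)"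
   by (intro emeasure_distr measurable_restrict_space1) auto
  also have "\<dots> = emeasure (P x) (inc_path t -` C \<inter> E)"
   unfolding sN by (subst emeasure_restrict_space) auto
  also have "inc_path t -` C \<inter> E = {w\<in>space path_space. (\<forall>j\<in>J. stop_path t w j \<in> A j) \<and> inc_path t w \<in> C}"
   by (auto simp: E_def)
  finally show ?thesis by (simp add: E_def)
 qed
 define E where "E = {w\<in>space path_space. inc_path t w \<in> C}"
 have [measurable, simp]: "E \<in> sets path_space" unfolding E_def by measurable
 let ?N = "restrict_space (P x) E" and ?Q = "distr (P x) path_space (stop_path t)"
 have sN: "space ?N = E" by (simp add: space_restrict_space2)
 have "distr ?N path_space (stop_path t) = scale_measure (emeasure ?N (space ?N)) ?Q"
 proof (rule path_indep_eqI)
  show "finite_measure ?N" by (rule finite_measure_restrict_space) simp_all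
  show "stop_path t \<in> measurable ?N path_space" by (intro measurable_restrict_space1) simp
  show "finite_measure ?Q" by (rule finite_measure_distr) simp
  fix K and B :: "real \<Rightarrow> 'a set" assume K: "finite K" "K \<subseteq> {0..}" "\<And>k. k \<in> K \<Longrightarrow> open (B k)"
  have cyl: "cylinder K B \<in> sets path_space"
   using K by (intro cylinder_sets) auto
  have seteq: "{w\<in>space ?N. \<forall>k\<in>K. stop_path t w k \<in> B k} =
    {w\<in>space path_space. (\<forall>j\<in>K. stop_path t w j \<in> B j) \<and> inc_path t w \<in> C}"
   by (auto simp: sN E_def)
  have "emeasure ?N {w\<in>space ?N. \<forall>k\<in>K. stop_path t w k \<in> B k} =
    emeasure (P x) {w\<in>space path_space. (\<forall>j\<in>K. stop_path t w j \<in> B j) \<and> inc_path t w \<in> C}"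
   unfolding seteq
  proof (rule emeasure_restrict_space)
   show "E \<inter> space (P x) \<in> sets (P x)" by (intro sets.Int) simp_all
  qed (auto simp: E_def)
  also have "\<dots> = emeasure (P x) {w\<in>space path_space. \<forall>j\<in>K. stop_path t w j \<in> B j} * emeasure (P 0) C"
   by (rule eq1[OF K])
  also have "emeasure (P 0) C = emeasure ?N (space ?N)"
   unfolding sN by (subst emeasure_restrict_space) (auto simp: E_def inc)
  also have "emeasure (P x) {w\<in>space path_space. \<forall>j\<in>K. stop_path t w j \<in> B j} =
    emeasure ?Q (cylinder K B)"
   using cyl measurable_space[OF measurable_stop_path[OF t]]
   by (subst emeasure_distr) (auto intro!: arg_cong[where f = "emeasure _"])
  finally show "emeasure ?N {w\<in>space ?N. \<forall>k\<in>K. stop_path t w k \<in> B k} =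
    emeasure ?N (space ?N) * emeasure ?Q (cylinder K B)"
   by (simp add: mult.commute)
 qed simp
 then have "emeasure (distr ?N path_space (stop_path t)) D = emeasure (P 0) C * emeasure ?Q D"
  by (simp add: sN emeasure_restrict_space) (simp add: E_def inc)
 also have "emeasure (distr ?N path_space (stop_path t)) D = emeasure ?N (stop_path t -` D \<inter> space ?N)"
  by (intro emeasure_distr measurable_restrict_space1) auto
 also have "\<dots> = emeasure (P x) (stop_path t -` D \<inter> E)"
  unfolding sN by (subst emeasure_restrict_space) auto
 also have "stop_path t -` D \<inter> E = {w\<in>space path_space. stop_path t w \<in> D \<and> inc_path t w \<in> C}"
  by (auto simp: E_def)
 also have "emeasure ?Q D = emeasure (P x) {w\<in>space path_space. stop_path t w \<in> D}"
  by (subst emeasure_distr) (auto intro!: arg_cong[where f = "emeasure _"])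
 finally show ?thesis by (simp add: mult.commute)
qed

end

declare measurable_path_coord [measurable del]

section \<open>Stopping times and the strong Markov property\<close>

text \<open>
 \<open>T\<close> is a stopping time that is finite on the event \<open>E\<close>, which is itself determined by the path up
 to time \<open>T\<close>. Measurability with respect to the past is expressed by invariance under stopping the
 path (Galmarino's test).
\<close>

definition stopping :: "(real \<Rightarrow> 'a::euclidean_space) set \<Rightarrow> ((real \<Rightarrow> 'a) \<Rightarrow> real) \<Rightarrow> bool" where
 "stopping E T \<longleftrightarrow> E \<in> sets path_space \<and> T \<in> borel_measurable path_space \<and> (\<forall>w\<in>E. 0 \<le> T w) \<and>
   (\<forall>w\<in>space path_space. \<forall>t\<ge>0.
    (w \<in> E \<and> T w \<le> t \<longleftrightarrow> stop_path t w \<in> E \<and> T (stop_path t w) \<le> t) \<and>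
    (w \<in> E \<and> T w \<le> t \<longrightarrow> T (stop_path t w) = T w))"

lemma stoppingD:
 assumes "stopping E T"
 shows "E \<in> sets path_space" "T \<in> borel_measurable path_space" "\<And>w. w \<in> E \<Longrightarrow> 0 \<le> T w"
  "\<And>w. w \<in> E \<Longrightarrow> w \<in> space path_space"
  "\<And>w t. w \<in> E \<Longrightarrow> T w \<le> t \<Longrightarrow> stop_path t w \<in> E"
  "\<And>w t. w \<in> E \<Longrightarrow> T w \<le> t \<Longrightarrow> T (stop_path t w) = T w"
  "\<And>w t. w \<in> space path_space \<Longrightarrow> 0 \<le> t \<Longrightarrow> stop_path t w \<in> E \<Longrightarrow> T (stop_path t w) \<le> t \<Longrightarrow> w \<in> E"
  "\<And>w t. w \<in> space path_space \<Longrightarrow> 0 \<le> t \<Longrightarrow> stop_path t w \<in> E \<Longrightarrow> T (stop_path t w) \<le> t \<Longrightarrow> T w \<le> t"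
proof -
 show 1: "E \<in> sets path_space" "T \<in> borel_measurable path_space" "\<And>w. w \<in> E \<Longrightarrow> 0 \<le> T w"
  using assms by (auto simp: stopping_def)
 show 2: "w \<in> E \<Longrightarrow> w \<in> space path_space" for w
  using sets.sets_into_space[OF 1(1)] by auto
 have *: "(w \<in> E \<and> T w \<le> t \<longleftrightarrow> stop_path t w \<in> E \<and> T (stop_path t w) \<le> t) \<and>
    (w \<in> E \<and> T w \<le> t \<longrightarrow> T (stop_path t w) = T w)" if "w \<in> space path_space" "0 \<le> t" for w t
  using assms that unfolding stopping_def by blast
 have **: "0 \<le> t" if "w \<in> E" "T w \<le> t" for w t using 1(3)[OF that(1)] that(2) by simp
 show "stop_path t w \<in> E" "T (stop_path t w) = T w" if "w \<in> E" "T w \<le> t" for w t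
  using *[OF 2[OF that(1)] **[OF that]] that by auto
 show "w \<in> E" "T w \<le> t" if "w \<in> space path_space" "0 \<le> t" "stop_path t w \<in> E" "T (stop_path t w) \<le> t" for w t
  using *[OF that(1,2)] that(3,4) by auto
qed

text \<open>Lets information available at time \<open>T\<close> be absorbed into the event:
  \<open>strong_markov\<close> uses it for events that constrain the position at \<open>T\<close>
  and the value of a weight of the past.\<close>

lemma stopping_subset:
 assumes T: "stopping E T" and F: "F \<in> sets path_space" "F \<subseteq> E"
  and inv: "\<And>w t. w \<in> E \<Longrightarrow> T w \<le> t \<Longrightarrow> w \<in> F \<longleftrightarrow> stop_path t w \<in> F"
 shows "stopping F T"
 unfolding stopping_def
proof (intro conjI ballI allI impI)
 note D = stoppingD[OF T]
 fix w :: "real \<Rightarrow> 'a" and t assume w: "w \<in> space path_space" and t: "0 \<le> (t::real)"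
 show "w \<in> F \<and> T w \<le> t \<longleftrightarrow> stop_path t w \<in> F \<and> T (stop_path t w) \<le> t"
  using D(6,7,8)[of w t] F(2) inv[of w t] w t by (metis subsetD)
 show "T (stop_path t w) = T w" if "w \<in> F \<and> T w \<le> t"
  using that D(6) F(2) by auto
qed (use F T in \<open>auto simp: stopping_def\<close>)

context brownian
begin

lemma stop_inc_nn_integral:
 assumes t: "0 \<le> t" and D [measurable]: "D \<in> sets path_space" and F [measurable]: "F \<in> borel_measurable path_space"
 shows "\<E> x (\<lambda>w. indicator D (stop_path t w) * F (inc_path t w)) =
  emeasure (P x) {w\<in>space path_space. stop_path t w \<in> D} * \<E> 0 (\<lambda>w. F w)"
proof -
 note [measurable] = measurable_stop_path[OF t] measurable_inc_path[OF t]
 let ?c = "emeasure (P x) {w\<in>space path_space. stop_path t w \<in> D}"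
 let ?N = "density (P x) (\<lambda>w. indicator D (stop_path t w))"
 have eq: "distr ?N path_space (inc_path t) = scale_measure ?c (P 0)"
 proof (rule measure_eqI)
  fix C assume "C \<in> sets (distr ?N path_space (inc_path t))"
  then have C [measurable]: "C \<in> sets path_space" by simp
  have "emeasure (distr ?N path_space (inc_path t)) C = emeasure ?N (inc_path t -` C \<inter> space path_space)"
   by (subst emeasure_distr) auto
  also have "\<dots> = \<E> x (\<lambda>w. indicator D (stop_path t w) * indicator (inc_path t -` C \<inter> space path_space) w)"
   by (subst emeasure_density) auto
  also have "\<dots> = \<E> x (\<lambda>w. indicator {w\<in>space path_space. stop_path t w \<in> D \<and> inc_path t w \<in> C} w)"
   by (intro nn_integral_cong) (auto simp: indicator_def)
  also have "\<dots> = ?c * emeasure (P 0) C"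
   by (subst nn_integral_indicator) (auto simp: stop_inc_indep[OF t D C])
  finally show "emeasure (distr ?N path_space (inc_path t)) C = emeasure (scale_measure ?c (P 0)) C"
   by simp
 qed simp
 have "\<E> x (\<lambda>w. indicator D (stop_path t w) * F (inc_path t w)) = (\<integral>\<^sup>+w. F w \<partial>distr ?N path_space (inc_path t))"
  by (simp add: nn_integral_distr nn_integral_density)
 then show ?thesis unfolding eq by (simp add: nn_integral_scale_measure)
qed

text \<open>Discretisation from above: with \<open>T\<close> rounded up to a grid, the simple Markov
  property applies on each piece where the rounded time is constant. As the mesh shrinks, the
  increments converge by continuity of the path, which is why the test functions \<open>h k\<close>
  are continuous.\<close>

lemma stopping_inc_nn_integral_continuous:
 assumes T: "stopping E T" and K: "finite K" "K \<subseteq> {0..}"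
  and h: "\<And>k. continuous_on UNIV (h k)" "\<And>k z. 0 \<le> h k z" "\<And>k z. h k z \<le> (1::real)"
 shows "\<E> x (\<lambda>w. indicator E w * ennreal (\<Prod>k\<in>K. h k (inc_path (T w) w k))) =
  emeasure (P x) E * \<E> 0 (\<lambda>w. ennreal (\<Prod>k\<in>K. h k (w k)))"
proof -
 interpret prob_space "P x" by (rule prob_P)
 note D = stoppingD[OF T]
 have K0: "0 \<le> k" if "k \<in> K" for k using K that by auto
 have [measurable]: "h k \<in> borel_measurable borel" for k
  using h(1) by (rule borel_measurable_continuous_onI)
 have [measurable]: "E \<in> sets path_space" "T \<in> borel_measurable path_space" by (fact D)+
 define F where "F w = ennreal (\<Prod>k\<in>K. h k (w k))" for w
 have [measurable]: "F \<in> borel_measurable path_space"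
  unfolding F_def by (intro measurable_compose[OF _ measurable_ennreal] borel_measurable_prod
   measurable_compose[OF measurable_path_coord]) (use K0 in auto)
 have F1: "F w \<le> 1" for w
  unfolding F_def using h by (auto intro!: prod_le_1)
 \<comment> \<open>Off \<open>E\<close> the sign of \<open>T\<close> is unknown; the positive part
   makes all times legitimate there and changes nothing on \<open>E\<close>.\<close>
 define T' where "T' w = max 0 (T w)" for w
 \<comment> \<open>Adding 1 to the floor always leads to a grid time after \<open>T\<close>, so the
   piece of \<open>E\<close> on which it takes a given value is decided by that time.\<close>
 define S where "S n w = real (nat \<lfloor>T' w * real (Suc n)\<rfloor> + 1) / real (Suc n)" for n w
 have [measurable]: "T' \<in> borel_measurable path_space"
  unfolding T'_def by measurable
 have [measurable]: "S n \<in> borel_measurable path_space" for n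
  unfolding S_def by measurable
 have S0: "0 \<le> S n w" for n w by (simp add: S_def)
 have T'0: "0 \<le> T' w" for w by (simp add: T'_def)
 have TT': "T w = T' w" if "w \<in> E" for w using D(3)[OF that] by (simp add: T'_def)
 have [measurable]: "(\<lambda>w. inc_path (S n w) w) \<in> measurable path_space path_space"
   "(\<lambda>w. inc_path (T' w) w) \<in> measurable path_space path_space" for n
  by (rule measurable_inc_path_random; simp add: S0 T'0)+
 have S_lo: "T' w \<le> S n w" and S_hi: "S n w \<le> T' w + inverse (real (Suc n))" for w n
 proof -
  have f0: "0 \<le> \<lfloor>T' w * real (Suc n)\<rfloor>" using T'0[of w] by simp
  have eq: "S n w = (real_of_int \<lfloor>T' w * real (Suc n)\<rfloor> + 1) / real (Suc n)"
   unfolding S_def using f0 by simp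
  have "T' w * real (Suc n) \<le> real_of_int \<lfloor>T' w * real (Suc n)\<rfloor> + 1" by linarith
  then show "T' w \<le> S n w" unfolding eq by (simp add: pos_le_divide_eq)
  have "real_of_int \<lfloor>T' w * real (Suc n)\<rfloor> + 1 \<le> T' w * real (Suc n) + 1" by linarith
  then have "S n w \<le> (T' w * real (Suc n) + 1) / real (Suc n)"
   unfolding eq by (intro divide_right_mono) auto
  also have "\<dots> = T' w + inverse (real (Suc n))" by (simp add: field_simps)
  finally show "S n w \<le> T' w + inverse (real (Suc n))" .
 qed
 have disc: "\<E> x (\<lambda>w. indicator E w * F (inc_path (S n w) w)) =
   emeasure (P x) E * \<E> 0 (\<lambda>w. F w)" for n
 proof -
  define t where "t i = real (i + 1) / real (Suc n)" for i
  have t0: "0 \<le> t i" for i by (simp add: t_def)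
  define Ei where "Ei i = {w\<in>E. nat \<lfloor>T' w * real (Suc n)\<rfloor> = i}" for i
  have [measurable]: "Ei i \<in> sets path_space" for i
  proof -
   have "Ei i = E \<inter> {w\<in>space path_space. nat \<lfloor>T' w * real (Suc n)\<rfloor> = i}"
    using D(4) by (auto simp: Ei_def)
   also have "\<dots> \<in> sets path_space" by measurable
   finally show ?thesis .
  qed
  have S_eq: "S n w = t i" if "w \<in> Ei i" for w i
   using that by (simp add: Ei_def S_def t_def)
  have Ei_le: "T w \<le> t i" if "w \<in> Ei i" for w i
   using S_lo[of w n] S_eq[OF that] TT'[of w] that by (simp add: Ei_def)
  have stop_Ei: "stop_path (t i) w \<in> Ei i \<longleftrightarrow> w \<in> Ei i" if w: "w \<in> space path_space" for w i
  proof
   assume a: "w \<in> Ei i"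
   then have "w \<in> E" by (simp add: Ei_def)
   from D(5,6)[OF this Ei_le[OF a]] a show "stop_path (t i) w \<in> Ei i"
    by (simp add: Ei_def T'_def)
  next
   assume a: "stop_path (t i) w \<in> Ei i"
   then have "stop_path (t i) w \<in> E" by (simp add: Ei_def)
   from D(7,8)[OF w t0 this Ei_le[OF a]] have "w \<in> E" "T w \<le> t i" .
   from D(6)[OF this] a \<open>w \<in> E\<close> show "w \<in> Ei i" by (simp add: Ei_def T'_def)
  qed
  have Ei_eq: "{w\<in>space path_space. stop_path (t i) w \<in> Ei i} = Ei i" for i
   using stop_Ei D(4) by (auto simp: Ei_def)
  have one: "indicator E w * F (inc_path (S n w) w) =
   (\<Sum>i. indicator (Ei i) (stop_path (t i) w) * F (inc_path (t i) w))" if w: "w \<in> space path_space" for w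
  proof -
   define j where "j = nat \<lfloor>T' w * real (Suc n)\<rfloor>"
   have "(\<Sum>i. indicator (Ei i) (stop_path (t i) w) * F (inc_path (t i) w)) =
    (\<Sum>i\<in>{j}. indicator (Ei i) (stop_path (t i) w) * F (inc_path (t i) w))"
   proof (rule suminf_finite)
    fix i assume "i \<notin> {j}"
    then have "w \<notin> Ei i" by (auto simp: Ei_def j_def)
    then show "indicator (Ei i) (stop_path (t i) w) * F (inc_path (t i) w) = 0"
     using stop_Ei[OF w, of i] by simp
   qed simp
   also have "\<dots> = indicator E w * F (inc_path (S n w) w)"
    using stop_Ei[OF w, of j] S_eq[of w j] by (cases "w \<in> E") (auto simp: Ei_def j_def)
   finally show ?thesis by simp
  qed
  have "\<E> x (\<lambda>w. indicator E w * F (inc_path (S n w) w)) =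
    \<E> x (\<lambda>w. (\<Sum>i. indicator (Ei i) (stop_path (t i) w) * F (inc_path (t i) w)))"
   using one by (intro nn_integral_cong) simp
  also have "\<dots> = (\<Sum>i. \<integral>\<^sup>+w. indicator (Ei i) (stop_path (t i) w) * F (inc_path (t i) w) \<partial>P x)"
  proof (rule nn_integral_suminf)
   fix i
   note [measurable] = measurable_stop_path[OF t0[of i]] measurable_inc_path[OF t0[of i]]
   show "(\<lambda>w. indicator (Ei i) (stop_path (t i) w) * F (inc_path (t i) w)) \<in> borel_measurable (P x)"
    by measurable
  qed
  also have "\<dots> = (\<Sum>i. emeasure (P x) (Ei i) * \<E> 0 (\<lambda>w. F w))"
   using stop_inc_nn_integral[OF t0, of "Ei _" F x] by (simp add: Ei_eq)
  also have "\<dots> = (\<Sum>i. emeasure (P x) (Ei i)) * \<E> 0 (\<lambda>w. F w)"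
   by (rule ennreal_suminf_multc)
  also have "(\<Sum>i. emeasure (P x) (Ei i)) = emeasure (P x) (\<Union>i. Ei i)"
   by (rule suminf_emeasure) (auto simp: disjoint_family_on_def Ei_def)
  also have "(\<Union>i. Ei i) = E" by (auto simp: Ei_def)
  finally show ?thesis .
 qed
 have "(\<lambda>n. \<integral>\<^sup>+w. indicator E w * F (inc_path (S n w) w) \<partial>P x) \<longlonglongrightarrow>
   \<E> x (\<lambda>w. indicator E w * F (inc_path (T' w) w))"
 proof (rule nn_integral_dominated_convergence[where w = "\<lambda>_. 1"])
  show "AE w in P x. (\<lambda>n. indicator E w * F (inc_path (S n w) w)) \<longlonglongrightarrow> indicator E w * F (inc_path (T' w) w)"
  proof (rule AE_I2)
   fix w assume "w \<in> space (P x)"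
   then have w: "w \<in> space path_space" by simp
   have Sl: "(\<lambda>n. S n w) \<longlonglongrightarrow> T' w"
   proof (rule tendsto_sandwich[OF _ _ tendsto_const])
    show "(\<lambda>n. T' w + inverse (real (Suc n))) \<longlonglongrightarrow> T' w"
     using tendsto_add[OF tendsto_const LIMSEQ_inverse_real_of_nat, of "T' w"] by simp
   qed (use S_lo S_hi in auto)
   have wl: "(\<lambda>n. w (S n w + k)) \<longlonglongrightarrow> w (T' w + k)" if "0 \<le> k" for k
    using path_continuous_on[OF w] Sl S0 T'0[of w] that
    by (intro continuous_on_tendsto_compose[of "{0..}" w]) (auto intro!: tendsto_intros)
   have "(\<lambda>n. inc_path (S n w) w k) \<longlonglongrightarrow> inc_path (T' w) w k" if "k \<in> K" for k
    using tendsto_diff[OF wl[OF K0[OF that]] wl[of 0]] K0[OF that] by simp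
   then have "(\<lambda>n. F (inc_path (S n w) w)) \<longlonglongrightarrow> F (inc_path (T' w) w)"
    unfolding F_def
    by (intro tendsto_ennrealI tendsto_prod continuous_on_tendsto_compose[OF h(1)]) auto
   then show "(\<lambda>n. indicator E w * F (inc_path (S n w) w)) \<longlonglongrightarrow> indicator E w * F (inc_path (T' w) w)"
    by (cases "w \<in> E") auto
  qed
 qed (use F1 in \<open>auto simp: indicator_def\<close>)
 then have "\<E> x (\<lambda>w. indicator E w * F (inc_path (T' w) w)) = emeasure (P x) E * \<E> 0 (\<lambda>w. F w)"
  unfolding disc by (rule LIMSEQ_unique[OF _ tendsto_const])
 moreover have "\<E> x (\<lambda>w. indicator E w * F (inc_path (T' w) w)) = \<E> x (\<lambda>w. indicator E w * F (inc_path (T w) w))"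
  by (intro nn_integral_cong) (auto simp: indicator_def TT')
 ultimately show ?thesis by (simp add: F_def)
qed

text \<open>On \<open>E\<close> the increments after \<open>T\<close> form a Brownian motion from 0,
  with the same law whatever \<open>E\<close> is. Applied to smaller events decided by time
  \<open>T\<close>, this is independence of the past.\<close>

lemma stopping_inc_distr:
 assumes T: "stopping E T"
 shows "distr (restrict_space (P x) E) path_space (\<lambda>w. inc_path (T w) w) =
  scale_measure (emeasure (P x) E) (P 0)"
proof -
 interpret prob_space "P x" by (rule prob_P)
 interpret P0: prob_space "P 0" by (rule prob_P)
 note D = stoppingD[OF T]
 have [measurable, simp]: "E \<in> sets path_space" "T \<in> borel_measurable path_space" by (fact D)+
 let ?N = "restrict_space (P x) E"
 have sN: "space ?N = E" by (simp add: space_restrict_space2)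
 have eN: "emeasure ?N E = emeasure (P x) E"
  by (subst emeasure_restrict_space) auto
 have m: "(\<lambda>w. inc_path (T w) w) \<in> measurable ?N path_space"
 proof (rule measurable_inc_path_random)
  show "T \<in> borel_measurable ?N" by (intro measurable_restrict_space1) simp
  show "(\<lambda>x. x) \<in> measurable ?N path_space" by (intro measurable_restrict_space1) simp
 qed (use D(3) sN in auto)
 have "distr ?N path_space (\<lambda>w. inc_path (T w) w) = scale_measure (emeasure ?N (space ?N)) (P 0)"
 proof (rule path_indep_eqI)
  show "finite_measure ?N" by (rule finite_measure_restrict_space) simp_all
  show "finite_measure (P 0)" by unfold_locales
  fix K and B :: "real \<Rightarrow> 'a set" assume K: "finite K" "K \<subseteq> {0..}" "\<And>k. k \<in> K \<Longrightarrow> open (B k)"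
  have op: "open (if k \<in> K then B k else UNIV)" for k using K(3) by simp
  have "\<exists>h :: real \<Rightarrow> nat \<Rightarrow> 'a \<Rightarrow> real. \<forall>k. (\<forall>n. continuous_on UNIV (h k n)) \<and> (\<forall>n x. 0 \<le> h k n x) \<and> (\<forall>n x. h k n x \<le> 1) \<and>
    (\<forall>x. (\<lambda>n. h k n x) \<longlonglongrightarrow> indicator (if k \<in> K then B k else UNIV) x)"
   by (intro choice allI, rule indicator_open_limit[OF op]) blast
  then obtain h :: "real \<Rightarrow> nat \<Rightarrow> 'a \<Rightarrow> real" where h: "\<And>k n. continuous_on UNIV (h k n)"
    "\<And>k n x. 0 \<le> h k n x" "\<And>k n x. h k n x \<le> 1"
    "\<And>k x. (\<lambda>n. h k n x) \<longlonglongrightarrow> indicator (if k \<in> K then B k else UNIV) x" by metis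
  have [measurable]: "h k n \<in> borel_measurable borel" for k n
   using h(1) by (rule borel_measurable_continuous_onI)
  have K0: "0 \<le> k" if "k \<in> K" for k using K that by auto
  have lim: "(\<lambda>n. ennreal (\<Prod>k\<in>K. h k n (w k))) \<longlonglongrightarrow> ennreal (indicator {w. \<forall>k\<in>K. w k \<in> B k} w)" for w
  proof (rule tendsto_ennrealI)
   have "(\<lambda>n. \<Prod>k\<in>K. h k n (w k)) \<longlonglongrightarrow> (\<Prod>k\<in>K. indicator (if k \<in> K then B k else UNIV) (w k))"
    by (intro tendsto_prod h(4))
   also have "(\<Prod>k\<in>K. indicator (if k \<in> K then B k else UNIV) (w k)) = (indicator {w. \<forall>k\<in>K. w k \<in> B k} w :: real)"
    using K(1) by (auto simp: indicator_def prod_zero_iff intro!: prod.neutral)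
   finally show "(\<lambda>n. \<Prod>k\<in>K. h k n (w k)) \<longlonglongrightarrow> indicator {w. \<forall>k\<in>K. w k \<in> B k} w" .
  qed
  have le1: "ennreal (\<Prod>k\<in>K. h k n (w k)) \<le> 1" for n w
   using h(2,3) by (auto intro!: prod_le_1)
  have mF: "(\<lambda>w. ennreal (\<Prod>k\<in>K. h k n (w k))) \<in> borel_measurable path_space" for n
   by (intro measurable_compose[OF _ measurable_ennreal] borel_measurable_prod
    measurable_compose[OF measurable_path_coord]) (use K0 in auto)
  have mI: "(\<lambda>w. ennreal (indicator {w. \<forall>k\<in>K. w k \<in> B k} w)) \<in> borel_measurable path_space"
   by (rule borel_measurable_LIMSEQ_order[OF lim]) (rule mF)
  have l1: "(\<lambda>n. \<integral>\<^sup>+w. ennreal (\<Prod>k\<in>K. h k n (inc_path (T w) w k)) \<partial>?N) \<longlonglongrightarrow>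
    (\<integral>\<^sup>+w. ennreal (indicator {w. \<forall>k\<in>K. w k \<in> B k} (inc_path (T w) w)) \<partial>?N)"
   by (rule nn_integral_dominated_convergence[where w = "\<lambda>_. 1"])
     (use lim le1 measurable_compose[OF m mF] measurable_compose[OF m mI] eN in \<open>auto simp: sN less_top[symmetric]\<close>)
  have l2: "(\<lambda>n. emeasure (P x) E * \<E> 0 (\<lambda>w. ennreal (\<Prod>k\<in>K. h k n (w k)))) \<longlonglongrightarrow>
    emeasure (P x) E * \<E> 0 (\<lambda>w. ennreal (indicator {w. \<forall>k\<in>K. w k \<in> B k} w))"
  proof (rule ennreal_tendsto_cmult)
   show "emeasure (P x) E < \<top>" by (simp add: top.not_eq_extremum[symmetric])
   show "(\<lambda>n. \<integral>\<^sup>+w. ennreal (\<Prod>k\<in>K. h k n (w k)) \<partial>P 0) \<longlonglongrightarrow>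
    \<E> 0 (\<lambda>w. ennreal (indicator {w. \<forall>k\<in>K. w k \<in> B k} w))"
    by (rule nn_integral_dominated_convergence[where w = "\<lambda>_. 1"]) (use lim le1 mF mI in auto)
  qed
  have eq: "(\<integral>\<^sup>+w. ennreal (\<Prod>k\<in>K. h k n (inc_path (T w) w k)) \<partial>?N) =
    emeasure (P x) E * \<E> 0 (\<lambda>w. ennreal (\<Prod>k\<in>K. h k n (w k)))" for n
  proof -
   have "(\<integral>\<^sup>+w. ennreal (\<Prod>k\<in>K. h k n (inc_path (T w) w k)) \<partial>?N) =
     \<E> x (\<lambda>w. indicator E w * ennreal (\<Prod>k\<in>K. h k n (inc_path (T w) w k)))"
    by (subst nn_integral_restrict_space) (auto simp: mult.commute)
   then show ?thesis
    using stopping_inc_nn_integral_continuous[OF T K(1,2), of "\<lambda>k. h k n" x] h by simp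
  qed
  have A: "(\<integral>\<^sup>+w. ennreal (indicator {w. \<forall>k\<in>K. w k \<in> B k} (inc_path (T w) w)) \<partial>?N) =
    emeasure (P x) E * \<E> 0 (\<lambda>w. ennreal (indicator {w. \<forall>k\<in>K. w k \<in> B k} w))"
   using LIMSEQ_unique[OF l1[unfolded eq] l2] .
  have cyl: "cylinder K B \<in> sets path_space"
   using K by (intro cylinder_sets) auto
  have "(\<integral>\<^sup>+w. ennreal (indicator {w. \<forall>k\<in>K. w k \<in> B k} (inc_path (T w) w)) \<partial>?N) =
   (\<integral>\<^sup>+w. indicator {w\<in>space ?N. \<forall>k\<in>K. inc_path (T w) w k \<in> B k} w \<partial>?N)"
   by (intro nn_integral_cong) (auto simp: indicator_def)
  also have "\<dots> = emeasure ?N {w\<in>space ?N. \<forall>k\<in>K. inc_path (T w) w k \<in> B k}"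
  proof (rule nn_integral_indicator)
   have "(\<lambda>w. inc_path (T w) w) -` cylinder K B \<inter> space ?N \<in> sets ?N"
    using m cyl by (rule measurable_sets)
   also have "(\<lambda>w. inc_path (T w) w) -` cylinder K B \<inter> space ?N =
    {w\<in>space ?N. \<forall>k\<in>K. inc_path (T w) w k \<in> B k}" using measurable_space[OF m] by auto
   finally show "{w\<in>space ?N. \<forall>k\<in>K. inc_path (T w) w k \<in> B k} \<in> sets ?N" .
  qed
  finally have L: "(\<integral>\<^sup>+w. ennreal (indicator {w. \<forall>k\<in>K. w k \<in> B k} (inc_path (T w) w)) \<partial>?N) =
   emeasure ?N {w\<in>space ?N. \<forall>k\<in>K. inc_path (T w) w k \<in> B k}" .
  have "\<E> 0 (\<lambda>w. ennreal (indicator {w. \<forall>k\<in>K. w k \<in> B k} w)) =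
    \<E> 0 (\<lambda>w. indicator (cylinder K B) w)"
   by (intro nn_integral_cong) (auto simp: indicator_def)
  also have "\<dots> = emeasure (P 0) (cylinder K B)"
   using cyl by (intro nn_integral_indicator) auto
  finally show "emeasure ?N {w\<in>space ?N. \<forall>k\<in>K. inc_path (T w) w k \<in> B k} =
   emeasure ?N (space ?N) * emeasure (P 0) (cylinder K B)"
   using A L by (simp add: sN eN)
 qed (use m in auto)
 then show ?thesis by (simp add: sN eN)
qed

text \<open>By \<open>inv\<close> the weight \<open>\<phi>\<close> depends only on the path up to
  \<open>T\<close>; in the applications it is the survival weight up to \<open>T\<close>.\<close>

theorem strong_markov:
 assumes T: "stopping E T"
  and \<phi> [measurable]: "\<phi> \<in> borel_measurable path_space"
  and inv: "\<And>w t. w \<in> E \<Longrightarrow> T w \<le> t \<Longrightarrow> \<phi> (stop_path t w) = \<phi> w"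
  and F [measurable]: "F \<in> borel_measurable path_space"
 shows "\<E> x (\<lambda>w. indicator E w * (\<phi> w * F (shift_path (T w) w))) =
  \<E> x (\<lambda>w. indicator E w * (\<phi> w * \<E> (w (T w)) (\<lambda>w'. F w')))"
proof -
 interpret prob_space "P x" by (rule prob_P)
 interpret P0: prob_space "P 0" by (rule prob_P)
 note D = stoppingD[OF T]
 have [measurable, simp]: "E \<in> sets path_space" "T \<in> borel_measurable path_space" by (fact D)+
 let ?R = "restrict_space (P x) E"
 have sR: "space ?R = E" by (simp add: space_restrict_space2)
 have mT: "T \<in> borel_measurable ?R" and m\<phi>: "\<phi> \<in> borel_measurable ?R"
  and mid: "(\<lambda>x. x) \<in> measurable ?R path_space"
  by (intro measurable_restrict_space1; simp)+
 have minc: "(\<lambda>w. inc_path (T w) w) \<in> measurable ?R path_space"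
  by (rule measurable_inc_path_random[OF mT _ mid]) (use D(3) sR in auto)
 have mev: "(\<lambda>w. w (T w)) \<in> borel_measurable ?R"
  by (rule measurable_path_eval[OF mT mid]) (use D(3) sR in auto)
 note [measurable] = m\<phi> minc mev
 let ?\<Phi> = "\<lambda>w. (w (T w), \<phi> w)"
 let ?B = "borel :: ('a \<times> ennreal) measure"
 have m\<Phi> [measurable]: "?\<Phi> \<in> measurable ?R (borel \<Otimes>\<^sub>M borel)" by measurable
 interpret R: finite_measure ?R by (rule finite_measure_restrict_space) simp_all
 interpret RP: finite_measure "distr ?R (borel \<Otimes>\<^sub>M borel) ?\<Phi>" by (rule R.finite_measure_distr[OF m\<Phi>])
 \<comment> \<open>Under the restriction to \<open>E\<close>, the position at \<open>T\<close>
   together with the weight is independent of the increments after \<open>T\<close>. On a rectangle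
   the first factor cuts out a smaller stopping event \<open>E'\<close>, to which
   \<open>stopping_inc_distr\<close> applies.\<close>
 have pair: "distr ?R (borel \<Otimes>\<^sub>M borel) ?\<Phi> \<Otimes>\<^sub>M P 0 =
   distr ?R ((borel \<Otimes>\<^sub>M borel) \<Otimes>\<^sub>M path_space) (\<lambda>w. (?\<Phi> w, inc_path (T w) w))"
 proof (rule pair_measure_eqI)
  show "sigma_finite_measure (distr ?R (borel \<Otimes>\<^sub>M borel) ?\<Phi>)" "sigma_finite_measure (P 0)" by unfold_locales
  show "sets (distr ?R (borel \<Otimes>\<^sub>M borel) ?\<Phi> \<Otimes>\<^sub>M P 0) =
    sets (distr ?R ((borel \<Otimes>\<^sub>M borel) \<Otimes>\<^sub>M path_space) (\<lambda>w. (?\<Phi> w, inc_path (T w) w)))"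
   by (simp cong: sets_pair_measure_cong)
  fix A C assume "A \<in> sets (distr ?R (borel \<Otimes>\<^sub>M borel) ?\<Phi>)" "C \<in> sets (P 0)"
  then have A [measurable]: "A \<in> sets (borel \<Otimes>\<^sub>M borel)" and C [measurable]: "C \<in> sets path_space" by auto
  define E' where "E' = ?\<Phi> -` A \<inter> space ?R"
  have "E' \<in> sets ?R" unfolding E'_def by measurable
  then have E' [measurable]: "E' \<in> sets path_space" and E'sub: "E' \<subseteq> E"
   by (auto simp: sets_restrict_space E'_def sR)
  have st: "stopping E' T"
  proof (rule stopping_subset[OF T E' E'sub])
   fix w t assume w: "w \<in> E" "T w \<le> t"
   have "stop_path t w (T w) = w (T w)"
    using D(3)[OF w(1)] w(2) by (simp add: min_absorb1)
   then show "w \<in> E' \<longleftrightarrow> stop_path t w \<in> E'"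
    using w D(5,6)[OF w] inv[OF w] by (simp add: E'_def sR)
  qed
  have "emeasure (distr ?R ((borel \<Otimes>\<^sub>M borel) \<Otimes>\<^sub>M path_space) (\<lambda>w. (?\<Phi> w, inc_path (T w) w))) (A \<times> C) =
   emeasure ?R ((\<lambda>w. (?\<Phi> w, inc_path (T w) w)) -` (A \<times> C) \<inter> space ?R)"
   by (rule emeasure_distr) measurable
  also have "(\<lambda>w. (?\<Phi> w, inc_path (T w) w)) -` (A \<times> C) \<inter> space ?R = E' \<inter> ((\<lambda>w. inc_path (T w) w) -` C)"
   by (auto simp: E'_def)
  also have "emeasure ?R \<dots> = emeasure (P x) (E' \<inter> ((\<lambda>w. inc_path (T w) w) -` C))"
   using E'sub by (intro emeasure_restrict_space) auto
  also have "\<dots> = emeasure (restrict_space (P x) E') (E' \<inter> ((\<lambda>w. inc_path (T w) w) -` C))"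
   by (intro emeasure_restrict_space[symmetric]) (auto intro!: sets.Int)
  also have "\<dots> = emeasure (distr (restrict_space (P x) E') path_space (\<lambda>w. inc_path (T w) w)) C"
  proof -
   have "(\<lambda>w. inc_path (T w) w) \<in> measurable (restrict_space (P x) E') path_space"
    using E'sub D(3)
    by (intro measurable_inc_path_random measurable_restrict_space1) (auto simp: space_restrict_space)
   then show ?thesis
    by (subst emeasure_distr) (auto simp: space_restrict_space2 Int_commute)
  qed
  also have "\<dots> = emeasure (P x) E' * emeasure (P 0) C"
   unfolding stopping_inc_distr[OF st] by simp
  also have "emeasure (P x) E' = emeasure ?R E'"
   using E'sub by (intro emeasure_restrict_space[symmetric]) auto
  also have "\<dots> = emeasure (distr ?R (borel \<Otimes>\<^sub>M borel) ?\<Phi>) A"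
   unfolding E'_def by (rule emeasure_distr[symmetric]) measurable
  finally show "emeasure (distr ?R (borel \<Otimes>\<^sub>M borel) ?\<Phi>) A * emeasure (P 0) C =
   emeasure (distr ?R ((borel \<Otimes>\<^sub>M borel) \<Otimes>\<^sub>M path_space) (\<lambda>w. (?\<Phi> w, inc_path (T w) w))) (A \<times> C)" by simp
 qed
 define h where "h z = snd (fst z) * F (add_path (fst (fst z)) (snd z))" for z
 have h [measurable]: "h \<in> borel_measurable ((borel \<Otimes>\<^sub>M borel) \<Otimes>\<^sub>M path_space)"
  unfolding h_def by measurable
 have "\<E> x (\<lambda>w. indicator E w * (\<phi> w * F (shift_path (T w) w))) =
   (\<integral>\<^sup>+w. \<phi> w * F (shift_path (T w) w) \<partial>?R)"
  by (subst nn_integral_restrict_space) (auto simp: mult.commute)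
 also have "\<dots> = (\<integral>\<^sup>+w. h (?\<Phi> w, inc_path (T w) w) \<partial>?R)"
 proof (intro nn_integral_cong)
  fix w assume "w \<in> space ?R"
  have "add_path (w (T w)) (inc_path (T w) w) = shift_path (T w) w"
   by (auto simp: add_path_def inc_path_def shift_path_def restrict_def)
  then show "\<phi> w * F (shift_path (T w) w) = h (?\<Phi> w, inc_path (T w) w)"
   by (simp add: h_def)
 qed
 also have "\<dots> = (\<integral>\<^sup>+z. h z \<partial>distr ?R ((borel \<Otimes>\<^sub>M borel) \<Otimes>\<^sub>M path_space) (\<lambda>w. (?\<Phi> w, inc_path (T w) w)))"
  by (rule nn_integral_distr[symmetric]) measurable
 also have "\<dots> = (\<integral>\<^sup>+z. h z \<partial>(distr ?R (borel \<Otimes>\<^sub>M borel) ?\<Phi> \<Otimes>\<^sub>M P 0))"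
  unfolding pair ..
 also have "\<dots> = (\<integral>\<^sup>+a. \<integral>\<^sup>+w'. h (a, w') \<partial>P 0 \<partial>distr ?R (borel \<Otimes>\<^sub>M borel) ?\<Phi>)"
  by (rule P0.nn_integral_fst[symmetric]) measurable
 also have "\<dots> = (\<integral>\<^sup>+w. \<integral>\<^sup>+w'. h (?\<Phi> w, w') \<partial>P 0 \<partial>?R)"
  by (rule nn_integral_distr) measurable
 also have "\<dots> = (\<integral>\<^sup>+w. \<phi> w * \<E> (w (T w)) (\<lambda>w'. F w') \<partial>?R)"
  by (intro nn_integral_cong) (simp add: h_def nn_integral_P[of F "_ (T _)"] nn_integral_cmult)
 also have "\<dots> = \<E> x (\<lambda>w. indicator E w * (\<phi> w * \<E> (w (T w)) (\<lambda>w'. F w')))"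
  by (subst nn_integral_restrict_space) (auto simp: mult.commute)
 finally show ?thesis .
qed

end

section \<open>Survival weights and hitting times\<close>

lemma exp_neg_nonneg [simp]: "0 \<le> exp_neg t"
 by (simp add: exp_neg_def)

lemma exp_neg_le_1 [simp]: "exp_neg t \<le> 1"
 by (simp add: exp_neg_def)

lemma exp_neg_0 [simp]: "exp_neg 0 = 1"
 by (simp add: exp_neg_def)

lemma exp_neg_antimono: "s \<le> t \<Longrightarrow> exp_neg t \<le> exp_neg s"
 by (auto simp: exp_neg_def top_unique less_top intro!: enn2real_mono)

lemma exp_neg_add: "exp_neg (s + t) = exp_neg s * exp_neg t"
 by (auto simp: exp_neg_def less_top[symmetric] enn2real_plus exp_add[symmetric])

lemma exp_neg_ennreal: "0 \<le> r \<Longrightarrow> exp_neg (ennreal r) = exp (- r)"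
 by (simp add: exp_neg_def)

lemma measurable_exp_neg [measurable]: "exp_neg \<in> borel_measurable borel"
 unfolding exp_neg_def[abs_def] by measurable

lemma exp_neg_ge: "0 \<le> r \<Longrightarrow> 1 - r \<le> exp_neg (ennreal r)"
 using exp_ge_add_one_self[of "- r"] by (simp add: exp_neg_ennreal)

text \<open>The tangent to \<open>exp (- t)\<close> at \<open>m\<close>, arranged without subtraction.\<close>

lemma exp_neg_tangent:
 assumes "0 \<le> m"
 shows "ennreal (exp (- m) * (1 + m)) \<le> ennreal (exp_neg t) + ennreal (exp (- m)) * t"
proof (cases "t = \<infinity>")
 case True
 then show ?thesis by (simp add: ennreal_mult_top)
next
 case False
 then obtain r where r: "t = ennreal r" "0 \<le> r" by (cases t) auto
 have "1 + (m - r) \<le> exp (m - r)" by (rule exp_ge_add_one_self)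
 then have "exp (- m) * (1 + (m - r)) \<le> exp (- m) * exp (m - r)" by (intro mult_left_mono) auto
 also have "\<dots> = exp (- r)" by (simp add: exp_add[symmetric])
 finally have "exp (- m) * (1 + m) \<le> exp (- r) + exp (- m) * r" by (simp add: algebra_simps)
 then show ?thesis using r assms
  by (simp add: exp_neg_ennreal ennreal_mult[symmetric] ennreal_plus[symmetric] del: ennreal_plus)
qed

lemma survival_bounds [simp]: "0 \<le> survival f t w" "survival f t w \<le> 1"
 by (simp_all add: survival_def)

lemma survival_antimono: "s \<le> t \<Longrightarrow> survival f t w \<le> survival f s w"
 unfolding survival_def
 by (intro exp_neg_antimono nn_integral_mono) (auto simp: indicator_def)

lemma survival_cong:
 assumes "\<And>s. 0 \<le> s \<Longrightarrow> s \<le> t \<Longrightarrow> f (w s) = g (w' s)"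
 shows "survival f t w = survival g t w'"
 unfolding survival_def using assms
 by (intro arg_cong[where f = exp_neg] nn_integral_cong) (auto simp: indicator_def)

lemma survival_0 [simp]: "survival f 0 w = 1"
proof -
 have "(\<integral>\<^sup>+s\<in>{0..0}. ennreal (f (w s)) \<partial>lborel) = 0"
  by (rule nn_integral_null_set) auto
 then show ?thesis by (simp only: survival_def exp_neg_0)
qed

lemma nn_integral_lborel_shift:
 fixes F :: "'a::euclidean_space \<Rightarrow> ennreal"
 assumes [measurable]: "F \<in> borel_measurable borel"
 shows "(\<integral>\<^sup>+s. F (c + s) \<partial>lborel) = (\<integral>\<^sup>+s. F s \<partial>lborel)"
proof -
 have "(\<integral>\<^sup>+s. F s \<partial>lborel) = (\<integral>\<^sup>+s. F s \<partial>distr lborel borel ((+) c))"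
  by (simp add: lborel_distr_plus)
 also have "\<dots> = (\<integral>\<^sup>+s. F (c + s) \<partial>lborel)"
  by (subst nn_integral_distr) auto
 finally show ?thesis by simp
qed

lemma measurable_path_max [measurable]:
 assumes "w \<in> space path_space" shows "(\<lambda>s. w (max 0 s)) \<in> borel_measurable borel"
 by (intro borel_measurable_continuous_onI path_continuous_on_compose[OF assms] continuous_intros) auto

lemma survival_add:
 assumes [measurable]: "f \<in> borel_measurable borel" and w: "w \<in> space path_space" and t: "0 \<le> T" "0 \<le> t"
 shows "survival f (T + t) w = survival f T w * survival f t (shift_path T w)"
proof -
 have [measurable]: "(\<lambda>s. w (max 0 s)) \<in> borel_measurable borel" using w by measurable
 let ?F = "\<lambda>s. ennreal (f (w (max 0 s)))"
 have "(\<integral>\<^sup>+s\<in>{0..T + t}. ennreal (f (w s)) \<partial>lborel) =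
   (\<integral>\<^sup>+s. ?F s * indicator {0..T} s + ?F s * indicator {T<..T + t} s \<partial>lborel)"
  using t by (intro nn_integral_cong) (auto simp: indicator_def max_def)
 also have "\<dots> = (\<integral>\<^sup>+s. ?F s * indicator {0..T} s \<partial>lborel) + (\<integral>\<^sup>+s. ?F s * indicator {T<..T + t} s \<partial>lborel)"
  by (rule nn_integral_add) measurable
 also have "(\<integral>\<^sup>+s. ?F s * indicator {0..T} s \<partial>lborel) = (\<integral>\<^sup>+s\<in>{0..T}. ennreal (f (w s)) \<partial>lborel)"
  by (intro nn_integral_cong) (auto simp: indicator_def max_def)
 also have "(\<integral>\<^sup>+s. ?F s * indicator {T<..T + t} s \<partial>lborel) = (\<integral>\<^sup>+s. ?F (T + s) * indicator {T<..T + t} (T + s) \<partial>lborel)"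
  by (rule nn_integral_lborel_shift[symmetric]) measurable
 also have "\<dots> = (\<integral>\<^sup>+s\<in>{0..t}. ennreal (f (shift_path T w s)) \<partial>lborel)"
 proof (rule nn_integral_cong_AE)
  show "AE s in lborel. ?F (T + s) * indicator {T<..T + t} (T + s) = ennreal (f (shift_path T w s)) * indicator {0..t} s"
   using AE_lborel_singleton[of 0]
   by eventually_elim (use t in \<open>auto simp: indicator_def max_def\<close>)
 qed
 finally show ?thesis by (simp add: survival_def exp_neg_add)
qed

text \<open>The potential may depend on the parameter because it varies with the environment in
  \<open>measurable_cross_environment\<close>.\<close>

lemma measurable_survival:
 assumes F: "(\<lambda>(x, z). F x z) \<in> borel_measurable (N \<Otimes>\<^sub>M borel)"
  and T [measurable]: "T \<in> borel_measurable N" and g: "g \<in> measurable N path_space"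
 shows "(\<lambda>x. survival (F x) (T x) (g x)) \<in> borel_measurable N"
proof -
 have ev: "(\<lambda>(x, s). g x (max 0 s)) \<in> borel_measurable (N \<Otimes>\<^sub>M borel)"
  unfolding case_prod_beta
  by (rule measurable_path_eval) (use measurable_compose[OF measurable_fst g] in auto)
 have "(\<lambda>p. (case (fst p, g (fst p) (max 0 (snd p))) of (x, z) \<Rightarrow> F x z)) \<in> borel_measurable (N \<Otimes>\<^sub>M borel)"
  by (rule measurable_compose[OF _ F]) (use ev in \<open>simp add: case_prod_beta\<close>)
 then have [measurable]: "(\<lambda>p. F (fst p) (g (fst p) (max 0 (snd p)))) \<in> borel_measurable (N \<Otimes>\<^sub>M borel)"
  by simp
 have "(\<lambda>x. exp_neg (\<integral>\<^sup>+s. ennreal (F x (g x (max 0 s))) * indicator {s. 0 \<le> s \<and> s \<le> T x} s \<partial>lborel)) \<in> borel_measurable N"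
 proof -
  have [measurable]: "(\<lambda>p. F (fst p) (g (fst p) (max 0 (snd p)))) \<in> borel_measurable (N \<Otimes>\<^sub>M lborel)"
   by (simp cong: measurable_cong_sets)
  show ?thesis unfolding indicator_def by measurable
 qed
 also have "(\<lambda>x. exp_neg (\<integral>\<^sup>+s. ennreal (F x (g x (max 0 s))) * indicator {s. 0 \<le> s \<and> s \<le> T x} s \<partial>lborel)) =
   (\<lambda>x. survival (F x) (T x) (g x))"
  unfolding survival_def
  by (intro ext arg_cong[where f = exp_neg] nn_integral_cong) (auto simp: indicator_def max_def)
 finally show ?thesis .
qed

lemma measurable_survival_path:
 assumes f: "f \<in> borel_measurable borel" and "T \<in> borel_measurable N" "g \<in> measurable N path_space"
 shows "(\<lambda>x. survival f (T x) (g x)) \<in> borel_measurable N"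
 using assms measurable_compose[OF measurable_snd f] by (intro measurable_survival) (auto simp: case_prod_beta)

section \<open>Hitting times of closed unit balls\<close>

definition hit_event :: "'a::euclidean_space \<Rightarrow> (real \<Rightarrow> 'a) set" where
 "hit_event y = {w\<in>space path_space. hitting_time y w < \<infinity>}"

text \<open>\<open>enn2real\<close> turns the hitting time of a path that never hits into 0, so
  \<open>hit\<close> is meaningful only on \<open>hit_event\<close>.\<close>

definition hit :: "'a::euclidean_space \<Rightarrow> (real \<Rightarrow> 'a) \<Rightarrow> real" where
 "hit y w = enn2real (hitting_time y w)"

lemma hitting_time_le: "0 \<le> t \<Longrightarrow> w t \<in> cball y 1 \<Longrightarrow> hitting_time y w \<le> ennreal t"
 unfolding hitting_time_def by (rule INF_lower) auto

lemma hit_nonneg [simp]: "0 \<le> hit y w"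
 by (simp add: hit_def)

lemma hitting_time_hit: "hitting_time y w < \<infinity> \<Longrightarrow> hitting_time y w = ennreal (hit y w)"
 by (simp add: hit_def)

text \<open>The ball is closed and the path is continuous, so the infimum is a minimum.\<close>

lemma hit_attained:
 assumes "w \<in> hit_event y"
 shows "w (hit y w) \<in> cball y 1"
proof -
 have w: "w \<in> space path_space" and fin: "hitting_time y w < \<infinity>" using assms by (auto simp: hit_event_def)
 have "\<exists>s. 0 \<le> s \<and> s < hit y w + inverse (real (Suc n)) \<and> w s \<in> cball y 1" for n
 proof -
  have "hitting_time y w < ennreal (hit y w + inverse (real (Suc n)))"
   by (subst hitting_time_hit[OF fin]) (auto intro!: ennreal_lessI add_nonneg_pos)
  then obtain s where "0 \<le> s" "w s \<in> cball y 1" "ennreal s < ennreal (hit y w + inverse (real (Suc n)))"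
   unfolding hitting_time_def by (auto simp: INF_less_iff)
  then have "s < hit y w + inverse (real (Suc n))" by (simp add: ennreal_less_iff del: ennreal_plus)
  then show ?thesis using \<open>0 \<le> s\<close> \<open>w s \<in> cball y 1\<close> by blast
 qed
 then obtain s where s: "\<And>n. 0 \<le> s n" "\<And>n. s n < hit y w + inverse (real (Suc n))" "\<And>n. w (s n) \<in> cball y 1" by metis
 have "hit y w \<le> s n" for n
  using hitting_time_le[of "s n" w y] s(1,3)[of n]
  by (simp add: hitting_time_hit[OF fin])
 note lo = this
 have "s \<longlonglongrightarrow> hit y w"
 proof (rule tendsto_sandwich[OF _ _ tendsto_const])
  show "\<forall>\<^sub>F n in sequentially. hit y w \<le> s n" using lo by simp
  show "(\<lambda>n. hit y w + inverse (real (Suc n))) \<longlonglongrightarrow> hit y w"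
   using tendsto_add[OF tendsto_const LIMSEQ_inverse_real_of_nat, of "hit y w"] by simp
 qed (use s(2) in \<open>auto intro!: always_eventually less_imp_le\<close>)
 then have "(\<lambda>n. w (s n)) \<longlonglongrightarrow> w (hit y w)"
  using path_continuous_on[OF w] s(1) by (intro continuous_on_tendsto_compose[of "{0..}" w]) auto
 then show ?thesis
  using s(3) closed_sequentially[OF closed_cball] by metis
qed

lemma hit_le: "0 \<le> t \<Longrightarrow> w t \<in> cball y 1 \<Longrightarrow> hit y w \<le> t"
 unfolding hit_def by (rule enn2real_leI) (auto intro: hitting_time_le)

lemma hit_eventI: "w \<in> space path_space \<Longrightarrow> 0 \<le> t \<Longrightarrow> w t \<in> cball y 1 \<Longrightarrow> w \<in> hit_event y"
 using hitting_time_le[of t w y] by (auto simp: hit_event_def le_less_trans)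

lemma hit_before: "0 \<le> s \<Longrightarrow> s < hit y w \<Longrightarrow> w s \<notin> cball y 1"
 using hit_le[of s w y] by auto

lemma hit_event_space: "w \<in> hit_event y \<Longrightarrow> w \<in> space path_space"
 by (simp add: hit_event_def)

lemma hit_unique:
 assumes "0 \<le> t" "w t \<in> cball y 1" "\<And>s. 0 \<le> s \<Longrightarrow> s < t \<Longrightarrow> w s \<notin> cball y 1" "w \<in> space path_space"
 shows "hit y w = t"
 using hit_le[of t w y] hit_attained[of w y] hit_eventI[of w t y] assms(3)[of "hit y w"] assms(1,2,4)
 by (metis antisym_conv2 hit_nonneg)

lemma hit_start: "w \<in> space path_space \<Longrightarrow> w 0 \<in> cball y 1 \<Longrightarrow> hit y w = 0 \<and> w \<in> hit_event y"
 using hit_unique[of 0 w y] hit_eventI[of w 0 y] by auto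

lemma hit_gt_iff:
 assumes w: "w \<in> space path_space" and t: "0 \<le> t"
 shows "w \<in> hit_event y \<and> hit y w \<le> t \<longleftrightarrow> (\<exists>s\<in>{0..t}. w s \<in> cball y 1)"
 using hit_attained[of w y] hit_le[of _ w y] hit_eventI[OF w] by (metis atLeastAtMost_iff hit_nonneg order_trans)

text \<open>Reduces the event to countably many coordinates. A visit to the closed ball up to time
  \<open>t\<close> is detected by slightly larger balls at rational fractions of \<open>t\<close>;
  conversely these force the minimal distance over the compact interval to be at most 1.\<close>

lemma hit_le_iff_rational:
 assumes w: "w \<in> space path_space" and t: "0 \<le> t"
 shows "w \<in> hit_event y \<and> hit y w \<le> t \<longleftrightarrow>
  (\<forall>n::nat. \<exists>q\<in>{q\<in>\<rat>. 0 \<le> q \<and> q \<le> 1}. dist y (w (q * t)) < 1 + inverse (real (Suc n)))"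
proof
 assume "w \<in> hit_event y \<and> hit y w \<le> t"
 then obtain s where s: "0 \<le> s" "s \<le> t" "dist y (w s) \<le> 1"
  using hit_gt_iff[OF w t, of y] by auto
 show "\<forall>n::nat. \<exists>q\<in>{q\<in>\<rat>. 0 \<le> q \<and> q \<le> 1}. dist y (w (q * t)) < 1 + inverse (real (Suc n))"
 proof
  fix n :: nat
  define \<epsilon> where "\<epsilon> = inverse (real (Suc n))"
  have e: "0 < \<epsilon>" by (simp add: \<epsilon>_def)
  have "continuous_on {0..} w" by (rule path_continuous_on[OF w])
  then obtain \<delta> where \<delta>: "0 < \<delta>" "\<And>r. 0 \<le> r \<Longrightarrow> dist r s < \<delta> \<Longrightarrow> dist (w r) (w s) < \<epsilon>"
   using s e unfolding continuous_on_iff by (metis atLeast_iff)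
  obtain q where q: "q \<in> \<rat>" "0 \<le> q" "q \<le> 1" "dist (q * t) s < \<delta>"
  proof (cases "t = 0")
   case True
   then show ?thesis using that[of 0] s \<delta> by simp
  next
   case False
   then have t: "0 < t" using t by simp
   define a where "a = max 0 (s / t - \<delta> / t)"
   have ab: "a < s / t \<or> s = 0" using s t \<delta> by (auto simp: a_def field_simps)
   show ?thesis
   proof (cases "s = 0")
    case True then show ?thesis using that[of 0] \<delta> by simp
   next
    case False
    then have "a < s / t" using ab by simp
    then obtain q where q: "q \<in> \<rat>" "a < q" "q < s / t" using Rats_dense_in_real by blast
    have "s / t \<le> 1" using s t by simp
    moreover have "q * t < s" using q t by (simp add: field_simps)
    moreover have "s - \<delta> < q * t"
    proof -
     have "s / t - \<delta> / t < q" using q by (simp add: a_def)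
     then show ?thesis using t by (simp add: field_simps)
    qed
    ultimately show ?thesis using that[of q] q by (auto simp: a_def dist_real_def)
   qed
  qed
  have "dist y (w (q * t)) \<le> dist y (w s) + dist (w (q * t)) (w s)"
   by (metis dist_commute dist_triangle)
  also have "\<dots> < 1 + \<epsilon>" using s \<delta>(2)[of "q * t"] q t by (simp add: add_le_less_mono)
  finally show "\<exists>q\<in>{q\<in>\<rat>. 0 \<le> q \<and> q \<le> 1}. dist y (w (q * t)) < 1 + inverse (real (Suc n))"
   using q by (auto simp: \<epsilon>_def)
 qed
next
 assume *: "\<forall>n::nat. \<exists>q\<in>{q\<in>\<rat>. 0 \<le> q \<and> q \<le> 1}. dist y (w (q * t)) < 1 + inverse (real (Suc n))"
 have cont: "continuous_on {0..t} (\<lambda>s. dist y (w s))"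
  by (intro continuous_on_dist continuous_on_const continuous_on_subset[OF path_continuous_on[OF w]]) auto
 obtain s where s: "s \<in> {0..t}" "\<And>r. r \<in> {0..t} \<Longrightarrow> dist y (w s) \<le> dist y (w r)"
  using continuous_attains_inf[OF _ _ cont] t by auto
 have "dist y (w s) \<le> 1 + inverse (real (Suc n))" for n
 proof -
  obtain q where q: "0 \<le> q" "q \<le> 1" "dist y (w (q * t)) < 1 + inverse (real (Suc n))" using * by blast
  have "q * t \<in> {0..t}" using q t by (simp add: mult_left_le_one_le)
  then show ?thesis using s(2) q by fastforce
 qed
 then have "dist y (w s) \<le> 1"
  using LIMSEQ_le_const[OF tendsto_add[OF tendsto_const LIMSEQ_inverse_real_of_nat, of 1]] by auto
 then show "w \<in> hit_event y \<and> hit y w \<le> t"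
  using hit_gt_iff[OF w t, of y] s by auto
qed

lemma hit_le_measurable:
 "0 \<le> t \<Longrightarrow> {w\<in>space path_space. w \<in> hit_event y \<and> hit y w \<le> t} \<in> sets path_space"
proof -
 assume t: "0 \<le> t"
 have "{w\<in>space path_space. w \<in> hit_event y \<and> hit y w \<le> t} =
  {w\<in>space path_space. \<forall>n::nat. \<exists>q\<in>{q\<in>\<rat>. 0 \<le> q \<and> q \<le> 1}. dist y (w (q * t)) < 1 + inverse (real (Suc n))}"
  by (rule Collect_cong, rule conj_cong[OF refl], rule hit_le_iff_rational[OF _ t])
 also have "\<dots> \<in> sets path_space"
 proof (intro sets.sets_Collect_countable_All sets.sets_Collect_countable_Ex')
  show "countable {q\<in>\<rat>. 0 \<le> q \<and> q \<le> (1::real)}"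
   by (rule countable_subset[OF _ countable_rat]) auto
  fix n :: nat and q :: real assume "q \<in> {q\<in>\<rat>. 0 \<le> q \<and> q \<le> 1}"
  then have [measurable]: "(\<lambda>w. w (q * t)) \<in> borel_measurable path_space"
   using t by (intro measurable_path_coord) auto
  show "{w\<in>space path_space. dist y (w (q * t)) < 1 + inverse (real (Suc n))} \<in> sets path_space"
   by measurable
 qed
 finally show ?thesis .
qed

lemma hit_event_sets [measurable, simp]: "hit_event y \<in> sets path_space"
proof -
 have "hit_event y = (\<Union>n::nat. {w\<in>space path_space. w \<in> hit_event y \<and> hit y w \<le> real n})"
  using real_arch_simple by (auto simp: hit_event_space)
 also have "\<dots> \<in> sets path_space"
  by (intro sets.countable_UN) (auto intro!: hit_le_measurable)
 finally show ?thesis .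
qed

lemma hit_measurable [measurable, simp]: "hit y \<in> borel_measurable path_space"
proof (rule borel_measurableI_le)
 fix t :: real
 have not_hit: "hit y w = 0" if "w \<in> space path_space" "w \<notin> hit_event y" for w
  using that by (auto simp: hit_def hit_event_def top.not_eq_extremum[symmetric])
 show "{w\<in>space path_space. hit y w \<le> t} \<in> sets path_space"
 proof (cases "0 \<le> t")
  case True
  \<comment> \<open>The default value 0 puts every path that never hits into the sublevel
    set.\<close>
  have "{w\<in>space path_space. hit y w \<le> t} =
   {w\<in>space path_space. w \<in> hit_event y \<and> hit y w \<le> t} \<union> (space path_space - hit_event y)"
   using not_hit True by auto
  also have "\<dots> \<in> sets path_space" using hit_le_measurable[OF True] by (intro sets.Un sets.Diff) auto
  finally show ?thesis .
 next
  case False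
  then have "{w\<in>space path_space. hit y w \<le> t} = {}"
   using less_le_trans[OF _ hit_nonneg, of t y] by (auto simp: not_le)
  then show ?thesis by (simp only: sets.empty_sets)
 qed
qed

lemma stop_path_space: "w \<in> space path_space \<Longrightarrow> 0 \<le> t \<Longrightarrow> stop_path t w \<in> space path_space"
 using measurable_space[OF measurable_stop_path] by blast

lemma shift_path_space: "w \<in> space path_space \<Longrightarrow> 0 \<le> t \<Longrightarrow> shift_path t w \<in> space path_space"
 using measurable_space[OF measurable_shift_path] by blast

lemma stopping_hit: "stopping (hit_event y) (hit y)"
 unfolding stopping_def
proof (intro conjI ballI allI impI)
 fix w :: "real \<Rightarrow> 'a" and t :: real assume w: "w \<in> space path_space" and t: "0 \<le> t"
 have "(\<exists>s\<in>{0..t}. stop_path t w s \<in> cball y 1) \<longleftrightarrow> (\<exists>s\<in>{0..t}. w s \<in> cball y 1)"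
  by (intro bex_cong) (auto simp: min_absorb1)
 then show "w \<in> hit_event y \<and> hit y w \<le> t \<longleftrightarrow> stop_path t w \<in> hit_event y \<and> hit y (stop_path t w) \<le> t"
  using hit_gt_iff[OF w t] hit_gt_iff[OF stop_path_space[OF w t] t] by simp
 assume "w \<in> hit_event y \<and> hit y w \<le> t"
 then show "hit y (stop_path t w) = hit y w"
  using hit_attained[of w y] hit_before[of _ y w] stop_path_space[OF w t]
  by (intro hit_unique) (auto simp: min_absorb1)
qed auto

lemma stopping_const: "0 \<le> t \<Longrightarrow> stopping (space path_space) (\<lambda>_. t)"
 by (auto simp: stopping_def stop_path_space)

lemma survival_stop: "T \<le> t \<Longrightarrow> survival f T (stop_path t w) = survival f T w"
 by (intro survival_cong) (auto simp: min_absorb1)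

section \<open>The heat kernel\<close>

lemma gauss_eq:
 fixes z :: "'a::euclidean_space"
 assumes "0 < t"
 shows "gauss t z = (1 / sqrt (2 * pi * t)) ^ DIM('a) * exp (- (norm z)\<^sup>2 / (2 * t))"
proof -
 have "gauss t z = (\<Prod>b\<in>Basis. (1 / sqrt (2 * pi * t)) * exp (- (z \<bullet> b)\<^sup>2 / (2 * t)))"
  unfolding gauss_def normal_density_def using assms by (intro prod.cong) auto
 also have "\<dots> = (1 / sqrt (2 * pi * t)) ^ DIM('a) * exp (\<Sum>b\<in>Basis. - (z \<bullet> b)\<^sup>2 / (2 * t))"
  by (simp add: prod.distrib exp_sum prod_dividef power_divide)
 also have "(\<Sum>b\<in>Basis. - (z \<bullet> b)\<^sup>2 / (2 * t)) = - (norm z)\<^sup>2 / (2 * t)"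
 proof -
  have "(\<Sum>b\<in>Basis. (z \<bullet> b)\<^sup>2) = (norm z)\<^sup>2"
   using power2_norm_eq_inner[of z] euclidean_inner[of z z] by (simp only: power2_eq_square)
  then show ?thesis by (simp add: sum_divide_distrib[symmetric] sum_negf)
 qed
 finally show ?thesis .
qed

abbreviation surv :: "('a::euclidean_space \<Rightarrow> real) \<Rightarrow> real \<Rightarrow> (real \<Rightarrow> 'a) \<Rightarrow> ennreal" where
 "surv f t w \<equiv> ennreal (survival f t w)"

abbreviation heat :: "real \<Rightarrow> 'a::euclidean_space \<Rightarrow> 'a set \<Rightarrow> ennreal" where
 "heat t z A \<equiv> \<integral>\<^sup>+v. indicator A v * ennreal (gauss t (v - z)) \<partial>lborel"

lemma gauss_nonneg [simp]: "0 \<le> gauss t z"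
 by (simp add: gauss_def prod_nonneg)

lemma gauss_minus: "gauss t (- z) = gauss t z"
 by (simp add: gauss_def normal_density_def)

lemma gauss_commute: "gauss t (x - y) = gauss t (y - x)"
 using gauss_minus[of t "x - y"] by simp

lemma measurable_gauss [measurable (raw)]:
 assumes [measurable]: "f \<in> borel_measurable N" "g \<in> borel_measurable N"
 shows "(\<lambda>x. gauss (f x) (g x)) \<in> borel_measurable N"
 unfolding gauss_def normal_density_def by measurable

lemma nn_integral_gauss:
 fixes x :: "'a::euclidean_space"
 assumes "0 < t" shows "(\<integral>\<^sup>+z. ennreal (gauss t (z - x)) \<partial>lborel) = 1"
proof -
 have "(\<integral>\<^sup>+z. ennreal (gauss t (z - x)) \<partial>lborel) = (\<integral>\<^sup>+(z::'a). ennreal (gauss t z) \<partial>lborel)"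
  using nn_integral_lborel_shift[of "\<lambda>z. ennreal (gauss t z)" "- x"] by (simp add: add.commute[of "- x"])
 also have "\<dots> = (\<integral>\<^sup>+(z::'a). (\<Prod>b\<in>Basis. ennreal (normal_density 0 (sqrt t) (z \<bullet> b))) \<partial>lborel)"
  by (simp add: gauss_def prod_ennreal)
 also have "\<dots> = (\<Prod>b\<in>(Basis::'a set). \<integral>\<^sup>+z. ennreal (normal_density 0 (sqrt t) z) \<partial>lborel)"
  by (rule nn_integral_lborel_prod) auto
 also have "(\<integral>\<^sup>+z. ennreal (normal_density 0 (sqrt t) z) \<partial>lborel) = 1"
  using assms integrable_normal_density[of "sqrt t" 0] integral_normal_density[of "sqrt t" 0]
  by (subst nn_integral_eq_integral) auto
 finally show ?thesis by simp
qed

text \<open>An exponential of a small multiple of the squared norm only widens the Gaussian, at the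
  price of a constant factor. This is how potentials of Gaussian growth are integrated against the
  heat kernel.\<close>

lemma exp_gauss:
 fixes z :: "'a::euclidean_space"
 assumes t: "0 < t" and \<eta>: "2 * \<eta> * t < 1"
 shows "exp (\<eta> * (norm z)\<^sup>2) * gauss t z = (1 / sqrt (1 - 2 * \<eta> * t)) ^ DIM('a) * gauss (t / (1 - 2 * \<eta> * t)) z"
proof -
 define c where "c = 1 - 2 * \<eta> * t"
 have c: "0 < c" using \<eta> by (simp add: c_def)
 have tc: "0 < t / c" using t c by simp
 have e: "- (norm z)\<^sup>2 / (2 * (t / c)) = \<eta> * (norm z)\<^sup>2 + - (norm z)\<^sup>2 / (2 * t)"
  using t c by (simp add: c_def field_simps)
 have "exp (- (norm z)\<^sup>2 / (2 * (t / c))) = exp (\<eta> * (norm z)\<^sup>2) * exp (- (norm z)\<^sup>2 / (2 * t))"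
  unfolding e by (rule exp_add)
 moreover have "(1 / sqrt c) * (1 / sqrt (2 * pi * (t / c))) = 1 / sqrt (2 * pi * t)"
  using t c by (simp add: real_sqrt_mult[symmetric] divide_simps)
 ultimately show ?thesis
  unfolding gauss_eq[OF t] c_def[symmetric] gauss_eq[OF tc] mult.assoc[symmetric] power_mult_distrib[symmetric]
  by simp
qed

section \<open>Occupation times of the killed path\<close>

definition occupation :: "('a::euclidean_space \<Rightarrow> real) \<Rightarrow> ('a \<Rightarrow> ennreal) \<Rightarrow> real \<Rightarrow> (real \<Rightarrow> 'a) \<Rightarrow> ennreal" where
 "occupation f F T w = (\<integral>\<^sup>+t\<in>{0..T}. surv f t w * F (w t) \<partial>lborel)"

definition total_occupation :: "('a::euclidean_space \<Rightarrow> real) \<Rightarrow> ('a \<Rightarrow> ennreal) \<Rightarrow> (real \<Rightarrow> 'a) \<Rightarrow> ennreal" where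
 "total_occupation f F w = (\<integral>\<^sup>+t\<in>{0..}. surv f t w * F (w t) \<partial>lborel)"

lemma measurable_survival_eval:
 assumes f: "f \<in> borel_measurable borel" and F: "F \<in> borel_measurable borel"
 shows "(\<lambda>(w, t). surv f t w * F (w (max 0 t))) \<in> borel_measurable (path_space \<Otimes>\<^sub>M borel)"
proof -
 have "(\<lambda>p. survival f (snd p) (fst p)) \<in> borel_measurable (path_space \<Otimes>\<^sub>M borel)"
  by (rule measurable_survival_path[OF f]) auto
 moreover have "(\<lambda>p. fst p (max 0 (snd p))) \<in> borel_measurable (path_space \<Otimes>\<^sub>M (borel :: real measure))"
  by (rule measurable_path_eval) auto
 from measurable_compose[OF this F]
 have "(\<lambda>p. F (fst p (max 0 (snd p)))) \<in> borel_measurable (path_space \<Otimes>\<^sub>M borel)" .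
 ultimately show ?thesis by (simp add: case_prod_beta)
qed

lemma measurable_survival_eval_lborel:
 assumes f: "f \<in> borel_measurable borel" and F: "F \<in> borel_measurable borel"
 shows "(\<lambda>p. surv f (snd p) (fst p) * F (fst p (max 0 (snd p)))) \<in> borel_measurable (path_space \<Otimes>\<^sub>M lborel)"
 using measurable_survival_eval[OF assms] by (simp add: case_prod_beta cong: measurable_cong_sets)

lemma occupation_max:
 "occupation f F T w = (\<integral>\<^sup>+t. (surv f t w * F (w (max 0 t))) * indicator {0..T} t \<partial>lborel)"
 "total_occupation f F w = (\<integral>\<^sup>+t. (surv f t w * F (w (max 0 t))) * indicator {0..} t \<partial>lborel)"
 unfolding occupation_def total_occupation_def by (intro nn_integral_cong; auto simp: indicator_def max_def)+

lemma measurable_occupation: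
 assumes "f \<in> borel_measurable borel" "F \<in> borel_measurable borel"
 shows "occupation f F T \<in> borel_measurable path_space" "total_occupation f F \<in> borel_measurable path_space"
proof -
 note [measurable] = measurable_survival_eval_lborel[OF assms]
 show "occupation f F T \<in> borel_measurable path_space"
  unfolding occupation_max[abs_def] by measurable
 show "total_occupation f F \<in> borel_measurable path_space"
  unfolding occupation_max[abs_def] by measurable
qed

lemma
 assumes f: "f \<in> borel_measurable borel" and F: "F \<in> borel_measurable borel"
  and w: "w \<in> space path_space" and T: "0 \<le> T"
 shows total_occupation_split: "total_occupation f F w = occupation f F T w + surv f T w * total_occupation f F (shift_path T w)"
  and occupation_split: "occupation f F S w \<le> occupation f F T w + surv f T w * occupation f F S (shift_path T w)"
proof -
 let ?h = "\<lambda>w t. surv f t w * F (w (max 0 t))"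
 have m: "?h w \<in> borel_measurable borel" if "w \<in> space path_space" for w
  using measurable_compose[OF _ measurable_survival_eval[OF f F], of "\<lambda>t. (w, t)" borel] that by simp
 note [measurable] = m[OF w] m[OF shift_path_space[OF w T]]
 \<comment> \<open>Both statements split the time axis at \<open>T\<close>. The set \<open>J\<close>
   of times counted after \<open>T\<close> is \<open>{0..}\<close> for the first and
   \<open>{0..S}\<close> for the second, which is an inequality because a run of length
   \<open>S\<close> after \<open>T\<close> covers at least the horizon \<open>S\<close>.\<close>
 have tail: "(\<integral>\<^sup>+t. ?h w t * indicator {t. 0 \<le> t \<and> (t \<le> T \<or> t - T \<in> J)} t \<partial>lborel) =
   occupation f F T w + surv f T w * (\<integral>\<^sup>+t. ?h (shift_path T w) t * indicator J t \<partial>lborel)"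
  if J [measurable]: "J \<in> sets borel" and J0: "J \<subseteq> {0..}" for J
 proof -
  have "(\<integral>\<^sup>+t. ?h w t * indicator {t. 0 \<le> t \<and> (t \<le> T \<or> t - T \<in> J)} t \<partial>lborel) =
    (\<integral>\<^sup>+t. ?h w t * indicator {0..T} t + ?h w t * indicator J (t - T) \<partial>lborel)"
   by (rule nn_integral_cong_AE, use AE_lborel_singleton[of T] in eventually_elim) (use J0 T in \<open>force simp: indicator_def\<close>)
  also have "\<dots> = occupation f F T w + (\<integral>\<^sup>+t. ?h w t * indicator J (t - T) \<partial>lborel)"
   unfolding occupation_max by (rule nn_integral_add) measurable
  also have "(\<integral>\<^sup>+t. ?h w t * indicator J (t - T) \<partial>lborel) = (\<integral>\<^sup>+t. ?h w (T + t) * indicator J (T + t - T) \<partial>lborel)"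
   by (rule nn_integral_lborel_shift[symmetric]) measurable
  also have "\<dots> = (\<integral>\<^sup>+t. surv f T w * (?h (shift_path T w) t * indicator J t) \<partial>lborel)"
  proof (rule nn_integral_cong)
   fix t
   show "?h w (T + t) * indicator J (T + t - T) = surv f T w * (?h (shift_path T w) t * indicator J t)"
   proof (cases "t \<in> J")
    case True
    then have "0 \<le> t" using J0 by auto
    then show ?thesis using True T survival_add[OF f w T, of t] by (simp add: ennreal_mult mult.assoc max_absorb2)
   qed simp
  qed
  also have "\<dots> = surv f T w * (\<integral>\<^sup>+t. ?h (shift_path T w) t * indicator J t \<partial>lborel)"
   by (rule nn_integral_cmult) measurable
  finally show ?thesis .
 qed
 have "{t. 0 \<le> t \<and> (t \<le> T \<or> t - T \<in> {0..})} = {0..}" by auto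
 with tail[of "{0..}"] show "total_occupation f F w = occupation f F T w + surv f T w * total_occupation f F (shift_path T w)"
  by (simp add: occupation_max)
 have "occupation f F S w \<le> (\<integral>\<^sup>+t. ?h w t * indicator {t. 0 \<le> t \<and> (t \<le> T \<or> t - T \<in> {0..S})} t \<partial>lborel)"
  unfolding occupation_max using T by (intro nn_integral_mono) (auto simp: indicator_def)
 then show "occupation f F S w \<le> occupation f F T w + surv f T w * occupation f F S (shift_path T w)"
  using tail[of "{0..S}"] by (simp add: occupation_max)
qed

section \<open>Crossing weights and the Green operator\<close>

context brownian
begin

text \<open>\<open>cross\<close> and \<open>green\<close> are \<open>crossing_weight\<close> and
  \<open>green_measure\<close> for a fixed potential. They take values in \<open>ennreal\<close>,
  which avoids integrability conditions, and \<open>green\<close> acts on functions, since its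
  symmetry is a statement about pairs of functions.\<close>

definition cross :: "('a \<Rightarrow> real) \<Rightarrow> 'a \<Rightarrow> 'a \<Rightarrow> ennreal" where
 "cross f x y = \<E> x (\<lambda>w. indicator (hit_event y) w * surv f (hit y w) w)"

definition green :: "('a \<Rightarrow> real) \<Rightarrow> 'a \<Rightarrow> ('a \<Rightarrow> ennreal) \<Rightarrow> ennreal" where
 "green f x F = \<E> x (\<lambda>w. total_occupation f F w)"

lemma AE_start: "AE w in P x. w 0 = x"
 by (rule wiener_start[OF wiener])

lemma nn_integral_P_mono:
 assumes "\<And>w. w \<in> space path_space \<Longrightarrow> w 0 = x \<Longrightarrow> F w \<le> H w"
 shows "\<E> x (\<lambda>w. F w) \<le> \<E> x (\<lambda>w. H w)"
 using AE_start[of x] by (intro nn_integral_mono_AE) (use assms in \<open>auto\<close>)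

lemma nn_integral_P_cong:
 assumes "\<And>w. w \<in> space path_space \<Longrightarrow> w 0 = x \<Longrightarrow> F w = H w"
 shows "\<E> x (\<lambda>w. F w) = \<E> x (\<lambda>w. H w)"
 using AE_start[of x] by (intro nn_integral_cong_AE) (use assms in \<open>auto\<close>)

lemma nn_integral_P_eval:
 assumes F [measurable]: "F \<in> borel_measurable borel" and t: "0 < t"
 shows "\<E> x (\<lambda>w. F (w t)) = (\<integral>\<^sup>+v. F v * ennreal (gauss t (v - x)) \<partial>lborel)"
proof -
 have d: "distributed (P x) lborel (\<lambda>w. w t - w 0) (\<lambda>z. ennreal (gauss (t - 0) z))"
  by (rule wiener_inc[OF wiener]) (use t in auto)
 have "\<E> x (\<lambda>w. F (w t)) = \<E> x (\<lambda>w. F (x + (w t - w 0)))"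
  by (intro nn_integral_P_cong) simp
 also have "\<dots> = (\<integral>\<^sup>+z. ennreal (gauss t z) * F (x + z) \<partial>lborel)"
  using distributed_nn_integral[OF d, of "\<lambda>z. F (x + z)"] by simp
 also have "\<dots> = (\<integral>\<^sup>+z. ennreal (gauss t ((x + z) - x)) * F (x + z) \<partial>lborel)" by simp
 also have "\<dots> = (\<integral>\<^sup>+v. ennreal (gauss t (v - x)) * F v \<partial>lborel)"
  by (rule nn_integral_lborel_shift[of "\<lambda>v. ennreal (gauss t (v - x)) * F v"]) measurable
 finally show ?thesis by (simp add: mult.commute)
qed

lemma measurable_cross_functional:
 assumes f: "f \<in> borel_measurable borel"
 shows "(\<lambda>w. indicator (hit_event y) w * surv f (hit y w) w) \<in> borel_measurable path_space"
proof -
 have [measurable]: "(\<lambda>w. survival f (hit y w) w) \<in> borel_measurable path_space"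
  by (rule measurable_survival_path[OF f]) auto
 show ?thesis by measurable
qed

lemma measurable_cross: "f \<in> borel_measurable borel \<Longrightarrow> (\<lambda>x. cross f x y) \<in> borel_measurable borel"
 unfolding cross_def by (rule measurable_nn_integral_P[OF measurable_cross_functional])

lemma measurable_green:
 "f \<in> borel_measurable borel \<Longrightarrow> F \<in> borel_measurable borel \<Longrightarrow> (\<lambda>x. green f x F) \<in> borel_measurable borel"
 unfolding green_def by (rule measurable_nn_integral_P[OF measurable_occupation(2)])

lemma cross_le_1: "cross f x y \<le> 1"
proof -
 have "cross f x y \<le> \<E> x (\<lambda>w. 1)"
  unfolding cross_def by (intro nn_integral_mono) (auto simp: indicator_def)
 then show ?thesis by simp
qed

lemma cross_eq_1: "x \<in> cball y 1 \<Longrightarrow> cross f x y = 1"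
proof -
 assume x: "x \<in> cball y 1"
 have "cross f x y = \<E> x (\<lambda>w. 1)"
  unfolding cross_def using hit_start[of _ y] x by (intro nn_integral_P_cong) (auto simp: indicator_def)
 then show ?thesis by simp
qed

lemma green_cmult:
 assumes "f \<in> borel_measurable borel" and F: "F \<in> borel_measurable borel"
 shows "green f x (\<lambda>v. c * F v) = c * green f x F"
proof -
 note m = measurable_survival_eval[OF assms]
 have "total_occupation f (\<lambda>v. c * F v) w = c * total_occupation f F w" if w: "w \<in> space path_space" for w
 proof -
  define k where "k = (\<lambda>t. surv f t w * F (w (max 0 t)))"
  have [measurable]: "k \<in> borel_measurable lborel"
   using measurable_compose[OF _ m, of "\<lambda>t. (w, t)" borel] w by (simp add: k_def)
  have "(\<integral>\<^sup>+t. c * (k t * indicator {0..} t) \<partial>lborel) = c * (\<integral>\<^sup>+t. k t * indicator {0..} t \<partial>lborel)"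
   by (rule nn_integral_cmult) measurable
  then show ?thesis unfolding occupation_max by (simp add: k_def ac_simps)
 qed
 then have "green f x (\<lambda>v. c * F v) = \<E> x (\<lambda>w. c * total_occupation f F w)"
  unfolding green_def by (intro nn_integral_cong) auto
 also have "\<dots> = c * green f x F"
  unfolding green_def by (rule nn_integral_cmult) (use measurable_occupation[OF assms] in simp)
 finally show ?thesis .
qed

lemma survival_stop_hit:
 "w \<in> hit_event y \<Longrightarrow> hit y w \<le> t \<Longrightarrow> survival f (hit y (stop_path t w)) (stop_path t w) = survival f (hit y w) w"
 using stoppingD(6)[OF stopping_hit, of w y t] by (simp add: survival_stop)

lemma strong_markov_hit:
 assumes f: "f \<in> borel_measurable borel" and F: "F \<in> borel_measurable path_space"
 shows "\<E> x (\<lambda>w. indicator (hit_event y) w * (surv f (hit y w) w * F (shift_path (hit y w) w))) =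
  \<E> x (\<lambda>w. indicator (hit_event y) w * (surv f (hit y w) w * \<E> (w (hit y w)) (\<lambda>w'. F w')))"
proof (rule strong_markov[OF stopping_hit _ _ F])
 have "(\<lambda>w. survival f (hit y w) w) \<in> borel_measurable path_space"
  by (rule measurable_survival_path[OF f]) auto
 then show "(\<lambda>w. surv f (hit y w) w) \<in> borel_measurable path_space" by measurable
qed (simp add: survival_stop_hit)

lemma markov:
 assumes f: "f \<in> borel_measurable borel" and F: "F \<in> borel_measurable path_space" and t: "0 \<le> t"
  and \<phi>: "\<phi> \<in> borel_measurable path_space" "\<And>w s. w \<in> space path_space \<Longrightarrow> t \<le> s \<Longrightarrow> \<phi> (stop_path s w) = \<phi> w"
 shows "\<E> x (\<lambda>w. \<phi> w * F (shift_path t w)) = \<E> x (\<lambda>w. \<phi> w * \<E> (w t) (\<lambda>w'. F w'))"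
proof -
 have "\<E> x (\<lambda>w. \<phi> w * F (shift_path t w)) =
   \<E> x (\<lambda>w. indicator (space path_space) w * (\<phi> w * F (shift_path t w)))"
  by (intro nn_integral_cong) auto
 also have "\<dots> = \<E> x (\<lambda>w. indicator (space path_space) w * (\<phi> w * \<E> (w t) (\<lambda>w'. F w')))"
  by (rule strong_markov[OF stopping_const[OF t] \<phi>(1) _ F]) (use \<phi>(2) in auto)
 also have "\<dots> = \<E> x (\<lambda>w. \<phi> w * \<E> (w t) (\<lambda>w'. F w'))"
  by (intro nn_integral_cong) auto
 finally show ?thesis .
qed

text \<open>One way to reach the ball around \<open>z\<close> is to visit the ball around
  \<open>y\<close> first and to continue from the point of arrival. If the path meets the ball
  around \<open>z\<close> earlier than that, it stops earlier, which only raises the survival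
  weight.\<close>

lemma cross_subadditive:
 assumes f: "f \<in> borel_measurable borel" and c: "\<And>v. v \<in> cball y 1 \<Longrightarrow> c \<le> cross f v z"
 shows "cross f x y * c \<le> cross f x z"
proof -
 let ?F = "\<lambda>w. indicator (hit_event z) w * surv f (hit z w) w"
 note m = measurable_cross_functional[OF f]
 have "cross f x y * c = \<E> x (\<lambda>w. indicator (hit_event y) w * surv f (hit y w) w * c)"
  unfolding cross_def by (rule nn_integral_multc[symmetric]) (use m in simp)
 also have "\<dots> \<le> \<E> x (\<lambda>w. indicator (hit_event y) w * (surv f (hit y w) w * \<E> (w (hit y w)) (\<lambda>w'. ?F w')))"
  unfolding cross_def[symmetric] using hit_attained c
  by (intro nn_integral_mono) (auto simp: indicator_def intro!: mult_left_mono)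
 also have "\<dots> = \<E> x (\<lambda>w. indicator (hit_event y) w * (surv f (hit y w) w * ?F (shift_path (hit y w) w)))"
  by (rule strong_markov_hit[OF f m, symmetric])
 also have "\<dots> \<le> cross f x z"
  unfolding cross_def
 proof (rule nn_integral_mono)
  fix w assume "w \<in> space (P x)"
  then have w: "w \<in> space path_space" by simp
  show "indicator (hit_event y) w * (surv f (hit y w) w * ?F (shift_path (hit y w) w)) \<le> ?F w"
  proof (cases "w \<in> hit_event y \<and> shift_path (hit y w) w \<in> hit_event z")
   case True
   define T where "T = hit y w"
   define S where "S = hit z (shift_path T w)"
   have "shift_path T w S \<in> cball z 1" unfolding S_def using True by (intro hit_attained) (simp add: T_def)
   then have at: "w (T + S) \<in> cball z 1" by (simp add: S_def)
   have "0 \<le> T + S" by (simp add: T_def S_def)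
   then have "w \<in> hit_event z" "hit z w \<le> T + S" using hit_eventI[OF w _ at] hit_le[of "T + S" w z] at by auto
   moreover have "survival f T w * survival f S (shift_path T w) = survival f (T + S) w"
    using survival_add[OF f w, of T S] by (simp add: T_def S_def)
   ultimately show ?thesis
    using True survival_antimono[of "hit z w" "T + S" f w]
    by (simp add: T_def S_def ennreal_mult[symmetric])
  qed (auto simp: indicator_def)
 qed
 finally show ?thesis .
qed

lemma occupation_hit:
 assumes F0: "\<And>v. v \<notin> cball y 1 \<Longrightarrow> F v = 0"
 shows "occupation f F (hit y w) w = 0"
 unfolding occupation_def
proof (rule nn_integral_zero')
 show "AE t in lborel. surv f t w * F (w t) * indicator {0..hit y w} t = 0"
  using AE_lborel_singleton[of "hit y w"]
  by eventually_elim (use F0 hit_before[of _ y w] in \<open>force simp: indicator_def\<close>)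
qed

text \<open>First entrance decomposition: nothing is collected before the ball carrying
  \<open>F\<close> is reached, and what follows is the Green integral from the entrance
  point.\<close>

lemma green_hit:
 assumes f: "f \<in> borel_measurable borel" and F: "F \<in> borel_measurable borel"
  and F0: "\<And>v. v \<notin> cball y 1 \<Longrightarrow> F v = 0"
 shows "green f x F =
  \<E> x (\<lambda>w. indicator (hit_event y) w * (surv f (hit y w) w * green f (w (hit y w)) F))"
proof -
 have "total_occupation f F w =
   indicator (hit_event y) w * (surv f (hit y w) w * total_occupation f F (shift_path (hit y w) w))"
  if w: "w \<in> space path_space" for w
 proof (cases "w \<in> hit_event y")
  case True
  then show ?thesis using total_occupation_split[OF f F w, of "hit y w"] occupation_hit[of y F, OF F0] by simp
 next
  case False
  have "F (w t) = 0" if "0 \<le> t" for t using F0 hit_eventI[OF w that] False by blast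
  then have "total_occupation f F w = (\<integral>\<^sup>+t. 0 \<partial>(lborel :: real measure))"
   unfolding total_occupation_def by (intro nn_integral_cong) (auto simp: indicator_def)
  then show ?thesis using False by simp
 qed
 then have "green f x F = \<E> x (\<lambda>w. indicator (hit_event y) w *
   (surv f (hit y w) w * total_occupation f F (shift_path (hit y w) w)))"
  unfolding green_def by (intro nn_integral_cong) simp
 also have "\<dots> = \<E> x (\<lambda>w. indicator (hit_event y) w * (surv f (hit y w) w * green f (w (hit y w)) F))"
  unfolding green_def by (rule strong_markov_hit[OF f measurable_occupation(2)[OF f F]])
 finally show ?thesis .
qed

text \<open>A path from outside enters on the sphere. This keeps the entrance point at a distance
  from sets well inside the ball, which matters in dimension at least two, where the Green function
  is singular on the diagonal.\<close>

lemma hit_sphere: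
 assumes w: "w \<in> hit_event y" and out: "w 0 \<notin> ball y 1"
 shows "dist y (w (hit y w)) = 1"
proof (rule antisym)
 show "dist y (w (hit y w)) \<le> 1" using hit_attained[OF w] by simp
 show "1 \<le> dist y (w (hit y w))"
 proof (cases "hit y w = 0")
  case True then show ?thesis using out by simp
 next
  case False
  then have pos: "0 < hit y w" by (simp add: less_le)
  define s where "s n = hit y w * (1 - inverse (real (Suc n)))" for n
  have s: "0 \<le> s n" "s n < hit y w" for n using pos by (auto simp: s_def field_simps)
  have "s \<longlonglongrightarrow> hit y w * (1 - 0)" unfolding s_def
   by (intro tendsto_mult tendsto_diff tendsto_const LIMSEQ_inverse_real_of_nat)
  then have "(\<lambda>n. w (s n)) \<longlonglongrightarrow> w (hit y w)"
   using path_continuous_on[OF hit_event_space[OF w]] s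
   by (intro continuous_on_tendsto_compose[of "{0..}" w]) auto
  then have "(\<lambda>n. dist y (w (s n))) \<longlonglongrightarrow> dist y (w (hit y w))"
   by (intro tendsto_dist tendsto_const)
  moreover have "1 \<le> dist y (w (s n))" for n using hit_before[OF s(1,2), of n] by simp
  ultimately show ?thesis using LIMSEQ_le_const by blast
 qed
qed

text \<open>\<open>S\<close> contains the possible entrance points: the sphere for a start outside
  the open ball, the closed ball otherwise. Bounds on \<open>S\<close> are transported to the start
  at the price of the crossing weight.\<close>

lemma
 assumes f: "f \<in> borel_measurable borel" and F: "F \<in> borel_measurable borel"
  and F0: "\<And>v. v \<notin> cball y 1 \<Longrightarrow> F v = 0"
  and S: "\<And>v. v \<in> cball y 1 \<Longrightarrow> (x \<notin> ball y 1 \<Longrightarrow> dist y v = 1) \<Longrightarrow> v \<in> S"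
 shows green_le_cross: "(\<And>v. v \<in> S \<Longrightarrow> green f v F \<le> C) \<Longrightarrow> green f x F \<le> cross f x y * C"
  and green_ge_cross: "(\<And>v. v \<in> S \<Longrightarrow> C \<le> green f v F) \<Longrightarrow> cross f x y * C \<le> green f x F"
proof -
 have eq: "cross f x y * C = \<E> x (\<lambda>w. indicator (hit_event y) w * surv f (hit y w) w * C)"
  unfolding cross_def by (rule nn_integral_multc[symmetric]) (use measurable_cross_functional[OF f] in simp)
 have g: "green f x F =
  \<E> x (\<lambda>w. indicator (hit_event y) w * (surv f (hit y w) w * green f (w (hit y w)) F))"
  by (rule green_hit[OF f F F0])
 have inS: "w (hit y w) \<in> S" if "w \<in> hit_event y" "w 0 = x" for w
  using S[of "w (hit y w)"] hit_attained[OF that(1)] hit_sphere[OF that(1)] that(2) by auto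
 show "green f x F \<le> cross f x y * C" if "\<And>v. v \<in> S \<Longrightarrow> green f v F \<le> C"
  unfolding eq g using inS that
  by (intro nn_integral_P_mono) (auto simp: indicator_def intro!: mult_left_mono)
 show "cross f x y * C \<le> green f x F" if "\<And>v. v \<in> S \<Longrightarrow> C \<le> green f v F"
  unfolding eq g using inS that
  by (intro nn_integral_P_mono) (auto simp: indicator_def intro!: mult_left_mono)
qed

lemma green_markov:
 assumes f: "f \<in> borel_measurable borel" and F: "F \<in> borel_measurable borel" and t: "0 \<le> t"
 shows "green f x F = \<E> x (\<lambda>w. occupation f F t w) + \<E> x (\<lambda>w. surv f t w * green f (w t) F)"
proof -
 note m = measurable_occupation[OF f F]
 have s: "(\<lambda>w. surv f t w) \<in> borel_measurable path_space"
  using measurable_survival_path[OF f, of "\<lambda>_. t" path_space "\<lambda>w. w"] by simp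
 have sh: "(\<lambda>w. total_occupation f F (shift_path t w)) \<in> borel_measurable path_space"
  by (rule measurable_compose[OF measurable_shift_path[OF t] m(2)])
 have "green f x F = \<E> x (\<lambda>w. occupation f F t w + surv f t w * total_occupation f F (shift_path t w))"
  unfolding green_def using total_occupation_split[OF f F _ t] by (intro nn_integral_cong) simp
 also have "\<dots> = \<E> x (\<lambda>w. occupation f F t w) + \<E> x (\<lambda>w. surv f t w * total_occupation f F (shift_path t w))"
  using m s sh by (intro nn_integral_add) auto
 also have "\<E> x (\<lambda>w. surv f t w * total_occupation f F (shift_path t w)) =
   \<E> x (\<lambda>w. surv f t w * green f (w t) F)"
  unfolding green_def by (rule markov[OF f m(2) t s]) (simp add: survival_stop)
 finally show ?thesis .
qed

end

section \<open>Time reversal and symmetry of the Green measure\<close>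

text \<open>The path run backwards from time \<open>t\<close>, seen from its position at
  \<open>t\<close>. It is frozen after \<open>t\<close>, so that it can be compared with
  \<open>stop_path t\<close> as a whole path.\<close>

definition rev_path :: "real \<Rightarrow> (real \<Rightarrow> 'a::euclidean_space) \<Rightarrow> real \<Rightarrow> 'a" where
 "rev_path t w = (\<lambda>s\<in>{0..}. w (t - min s t) - w t)"

lemma rev_path_apply [simp]: "0 \<le> s \<Longrightarrow> rev_path t w s = w (t - min s t) - w t"
 by (simp add: rev_path_def)

lemma measurable_rev_path:
 assumes "0 \<le> t" shows "rev_path t \<in> measurable path_space path_space"
proof (rule measurable_path_spaceI)
 show "continuous_on {0..} (rev_path t w)" if "w \<in> space path_space" for w :: "real \<Rightarrow> 'a"
 proof -
  have "continuous_on {0..} (\<lambda>s. w (t - min s t) - w t)"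
   using assms by (intro continuous_on_diff continuous_on_const path_continuous_on_compose[OF that] continuous_intros) auto
  then show ?thesis by (rule continuous_on_eq) auto
 qed
next
 fix s :: real assume s: "0 \<le> s"
 show "(\<lambda>w. rev_path t w s) \<in> borel_measurable path_space"
  using s assms by (simp, intro borel_measurable_diff measurable_path_coord) auto
qed (auto simp: rev_path_def)

lemma nn_integral_lborel_minus:
 fixes F :: "'a::euclidean_space \<Rightarrow> ennreal"
 assumes [measurable]: "F \<in> borel_measurable borel"
 shows "(\<integral>\<^sup>+s. F (- s) \<partial>lborel) = (\<integral>\<^sup>+s. F s \<partial>lborel)"
proof -
 have "(\<integral>\<^sup>+s. F s \<partial>lborel) = (\<integral>\<^sup>+s. F s \<partial>distr lborel borel uminus)"
  using lborel_affine[of "-1" "0::'a"] by (simp add: density_1 id_def[symmetric])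
 also have "\<dots> = (\<integral>\<^sup>+s. F (- s) \<partial>lborel)"
  by (subst nn_integral_distr) auto
 finally show ?thesis by simp
qed

context brownian
begin

lemma inc_rectangle:
 assumes t: "strict_mono t" "0 \<le> t (0::nat)" and m: "0 < m" and C: "\<And>i. i < m \<Longrightarrow> C i \<in> sets borel"
 shows "emeasure (P x) {w\<in>space path_space. \<forall>i<m. w (t (Suc i)) - w (t i) \<in> C i} =
  (\<Prod>i<m. \<integral>\<^sup>+z. ennreal (gauss (t (Suc i) - t i) z) * indicator (C i) z \<partial>lborel)"
proof -
 interpret prob_space "P x" by (rule prob_P)
 have t0: "0 \<le> t i" for i using t by (metis le0 order_trans strict_mono_less_eq)
 let ?X = "\<lambda>i w. w (t (Suc i)) - w (t i)"
 have "{w\<in>space path_space. \<forall>i<m. ?X i w \<in> C i} = (\<Inter>i\<in>{..<m}. ?X i -` C i \<inter> space (P x))"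
  using m by auto
 also have "emeasure (P x) \<dots> = (\<Prod>i<m. emeasure (P x) (?X i -` C i \<inter> space (P x)))"
  using indep_varsD[OF wiener_indep[OF wiener t(2,1)], of "{..<m}" C] m C
  by (auto simp: emeasure_eq_measure prod_ennreal)
 also have "\<dots> = (\<Prod>i<m. \<integral>\<^sup>+z. ennreal (gauss (t (Suc i) - t i) z) * indicator (C i) z \<partial>lborel)"
 proof (rule prod.cong[OF refl])
  fix i assume "i \<in> {..<m}"
  then show "emeasure (P x) (?X i -` C i \<inter> space (P x)) = (\<integral>\<^sup>+z. ennreal (gauss (t (Suc i) - t i) z) * indicator (C i) z \<partial>lborel)"
   using t t0 C by (intro distributed_emeasure[OF wiener_inc[OF wiener]]) (auto simp: strict_mono_less)
 qed
 finally show ?thesis .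
qed

text \<open>Increments of the reversed path over a grid are the negatives of increments of the path
  over the reversed grid. Joint laws of increments are products of Gaussians that depend only on
  time differences, and neither reordering nor a change of sign affects them.\<close>

lemma distr_rev_path:
 assumes t: "0 < t"
 shows "distr (P 0) path_space (rev_path t) = distr (P 0) path_space (stop_path t)"
proof (rule path_measure_eqI)
 interpret prob_space "P 0" by (rule prob_P)
 have mr: "rev_path t \<in> measurable (P 0) path_space" using measurable_rev_path[of t] t by simp
 have ms: "stop_path t \<in> measurable (P 0) path_space" using measurable_stop_path[of t] t by simp
 show "finite_measure (distr (P 0) path_space (rev_path t))" by (rule finite_measure_distr[OF mr])
 fix J and A :: "real \<Rightarrow> 'a set" assume J: "finite J" "J \<subseteq> {0..}" and A: "\<And>j. j \<in> J \<Longrightarrow> open (A j)"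
 define S where "S = insert 0 (insert t ((\<lambda>j. min j t) ` J))"
 have "finite S" "S \<subseteq> {0..}" "0 \<in> S" using J t by (auto simp: S_def)
 then obtain \<tau> where \<tau>: "strict_mono \<tau>" "\<tau> 0 = 0" "\<tau> ` {..<card S} = S"
  using ex_strict_mono_enum by blast
 have \<tau>0: "0 \<le> \<tau> i" for i using \<tau> by (metis le0 strict_mono_less_eq)
 have ex: "\<exists>i. \<tau> i = s" if "s \<in> S" for s using \<tau>(3) that by (metis imageE)
 obtain m where m: "\<tau> m = t" using ex[of t] by (auto simp: S_def)
 have m0: "0 < m" using m \<tau>(2) t by (cases m) auto
 have "\<forall>j\<in>J. \<exists>i. \<tau> i = min j t" using ex by (auto simp: S_def)
 then obtain p where p: "\<And>j. j \<in> J \<Longrightarrow> \<tau> (p j) = min j t" by metis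
 have pm: "p j \<le> m" if "j \<in> J" for j
  using p[OF that] m strict_mono_less_eq[OF \<tau>(1), of "p j" m] by simp
 have \<tau>m: "\<tau> i \<le> t" if "i \<le> m" for i using that m strict_mono_less_eq[OF \<tau>(1)] by metis
 define X where "X i w = w (\<tau> (Suc i)) - w (\<tau> i)" for i :: nat and w :: "real \<Rightarrow> 'a"
 define Z where "Z i w = w (t - \<tau> (Suc i)) - w (t - \<tau> i)" for i :: nat and w :: "real \<Rightarrow> 'a"
 \<comment> \<open>The reversed grid on \<open>[0, t]\<close>. After index \<open>m\<close> it
   continues by unit steps, since \<open>inc_rectangle\<close> refers to infinite increasing
   sequences.\<close>
 define \<sigma> where "\<sigma> i = (if i \<le> m then t - \<tau> (m - i) else t + real (i - m))" for i
 have \<sigma>_mono: "strict_mono \<sigma>"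
  unfolding strict_mono_Suc_iff
 proof
  fix i
  show "\<sigma> i < \<sigma> (Suc i)"
   using strict_monoD[OF \<tau>(1), of "m - Suc i" "m - i"] \<tau>(2) by (auto simp: \<sigma>_def not_le Suc_diff_le)
 qed
 have \<sigma>_0: "\<sigma> 0 = 0" using m by (simp add: \<sigma>_def)
 have Xm: "X i \<in> borel_measurable path_space" for i
  unfolding X_def using \<tau>0 by (intro borel_measurable_diff measurable_path_coord)
 have Zm: "Z i \<in> borel_measurable path_space" if "i < m" for i
  unfolding Z_def using \<tau>m[of i] \<tau>m[of "Suc i"] that by (intro borel_measurable_diff measurable_path_coord) auto
 let ?M = "PiM {..<m} (\<lambda>_. borel :: 'a measure)"
 let ?X = "\<lambda>w. \<lambda>i\<in>{..<m}. X i w" and ?Z = "\<lambda>w. \<lambda>i\<in>{..<m}. Z i w"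
 have fX: "?X \<in> measurable (P 0) ?M" and fZ: "?Z \<in> measurable (P 0) ?M"
  using Xm Zm by (auto intro!: measurable_restrict)
 have law: "distr (P 0) ?M ?X = distr (P 0) ?M ?Z"
 proof (rule measure_eqI_PiM_finite[where I = "{..<m}" and M = "\<lambda>_. borel" and A = "\<lambda>_. PiE {..<m} (\<lambda>_. UNIV)"])
  fix C :: "nat \<Rightarrow> 'a set" assume C: "\<And>i. i \<in> {..<m} \<Longrightarrow> C i \<in> sets borel"
  have CM: "PiE {..<m} C \<in> sets ?M" using C by (intro sets_PiM_I_finite) auto
  have restr: "(\<lambda>i\<in>{..<m}. v i) \<in> PiE {..<m} C \<longleftrightarrow> (\<forall>i<m. v i \<in> C i)" for v and C :: "nat \<Rightarrow> 'a set"
   by (auto simp: restrict_PiE_iff Pi_iff)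
  \<comment> \<open>Reversal moves each constraint to the mirrored index and changes its
    sign.\<close>
  define C' where "C' i = uminus -` C (m - Suc i)" for i
  have C'm: "C' i \<in> sets borel" if "i < m" for i
  proof -
   have "uminus -` C (m - Suc i) \<inter> space borel \<in> sets (borel :: 'a measure)"
    using C that by (intro measurable_sets[of uminus borel borel]) auto
   then show ?thesis by (simp add: C'_def)
  qed
  have "emeasure (distr (P 0) ?M ?X) (PiE {..<m} C) = emeasure (P 0) (?X -` PiE {..<m} C \<inter> space (P 0))"
   by (rule emeasure_distr[OF fX CM])
  also have "?X -` PiE {..<m} C \<inter> space (P 0) = {w\<in>space path_space. \<forall>i<m. w (\<tau> (Suc i)) - w (\<tau> i) \<in> C i}"
   unfolding space_P X_def[symmetric] using restr by (auto simp del: restrict_apply)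
  also have "emeasure (P 0) \<dots> = (\<Prod>i<m. \<integral>\<^sup>+z. ennreal (gauss (\<tau> (Suc i) - \<tau> i) z) * indicator (C i) z \<partial>lborel)"
   using \<tau> m0 C by (intro inc_rectangle) auto
  finally have L: "emeasure (distr (P 0) ?M ?X) (PiE {..<m} C) =
   (\<Prod>i<m. \<integral>\<^sup>+z. ennreal (gauss (\<tau> (Suc i) - \<tau> i) z) * indicator (C i) z \<partial>lborel)" .
  have "emeasure (distr (P 0) ?M ?Z) (PiE {..<m} C) = emeasure (P 0) (?Z -` PiE {..<m} C \<inter> space (P 0))"
   by (rule emeasure_distr[OF fZ CM])
  also have "?Z -` PiE {..<m} C \<inter> space (P 0) = {w\<in>space path_space. \<forall>i<m. Z i w \<in> C i}"
   unfolding space_P using restr by (auto simp del: restrict_apply)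
  also have "\<dots> = {w\<in>space path_space. \<forall>i<m. w (\<sigma> (Suc i)) - w (\<sigma> i) \<in> C' i}"
  proof (intro Collect_cong conj_cong refl)
   fix w :: "real \<Rightarrow> 'a"
   have "w (\<sigma> (Suc i)) - w (\<sigma> i) \<in> C' i \<longleftrightarrow> Z (m - Suc i) w \<in> C (m - Suc i)" if "i < m" for i
    using that by (simp add: \<sigma>_def C'_def Z_def Suc_diff_Suc)
   then have "(\<forall>i<m. w (\<sigma> (Suc i)) - w (\<sigma> i) \<in> C' i) \<longleftrightarrow> (\<forall>i<m. Z (m - Suc i) w \<in> C (m - Suc i))"
    by simp
   also have "\<dots> \<longleftrightarrow> (\<forall>i<m. Z i w \<in> C i)"
   proof safe
    fix i assume *: "\<forall>i<m. Z (m - Suc i) w \<in> C (m - Suc i)" "i < m"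
    then have "Z (m - Suc (m - Suc i)) w \<in> C (m - Suc (m - Suc i))" by (metis diff_less m0 zero_less_Suc)
    moreover have "m - Suc (m - Suc i) = i" using *(2) by simp
    ultimately show "Z i w \<in> C i" by simp
   qed simp
   finally show "(\<forall>i<m. Z i w \<in> C i) \<longleftrightarrow> (\<forall>i<m. w (\<sigma> (Suc i)) - w (\<sigma> i) \<in> C' i)" by simp
  qed
  also have "emeasure (P 0) \<dots> = (\<Prod>i<m. \<integral>\<^sup>+z. ennreal (gauss (\<sigma> (Suc i) - \<sigma> i) z) * indicator (C' i) z \<partial>lborel)"
   using \<sigma>_mono \<sigma>_0 m0 C'm by (intro inc_rectangle) auto
  also have "\<dots> = (\<Prod>i<m. (\<lambda>i. \<integral>\<^sup>+z. ennreal (gauss (\<tau> (Suc i) - \<tau> i) z) * indicator (C i) z \<partial>lborel) (m - Suc i))"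
  proof (rule prod.cong[OF refl])
   fix i assume "i \<in> {..<m}"
   then have i: "i < m" by simp
   have [measurable]: "C (m - Suc i) \<in> sets borel" using C i by simp
   have "\<sigma> (Suc i) - \<sigma> i = \<tau> (Suc (m - Suc i)) - \<tau> (m - Suc i)"
    using i by (simp add: \<sigma>_def Suc_diff_Suc)
   then have "(\<integral>\<^sup>+z. ennreal (gauss (\<sigma> (Suc i) - \<sigma> i) z) * indicator (C' i) z \<partial>lborel) =
    (\<integral>\<^sup>+z. ennreal (gauss (\<tau> (Suc (m - Suc i)) - \<tau> (m - Suc i)) (- z)) * indicator (C (m - Suc i)) (- z) \<partial>lborel)"
    by (simp add: gauss_minus C'_def indicator_def)
   also have "\<dots> = (\<integral>\<^sup>+z. ennreal (gauss (\<tau> (Suc (m - Suc i)) - \<tau> (m - Suc i)) z) * indicator (C (m - Suc i)) z \<partial>lborel)"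
    by (rule nn_integral_lborel_minus[of "\<lambda>z. ennreal (gauss (\<tau> (Suc (m - Suc i)) - \<tau> (m - Suc i)) z) * indicator (C (m - Suc i)) z"]) measurable
   finally show "(\<integral>\<^sup>+z. ennreal (gauss (\<sigma> (Suc i) - \<sigma> i) z) * indicator (C' i) z \<partial>lborel) =
    (\<lambda>i. \<integral>\<^sup>+z. ennreal (gauss (\<tau> (Suc i) - \<tau> i) z) * indicator (C i) z \<partial>lborel) (m - Suc i)" by simp
  qed
  also have "\<dots> = (\<Prod>i<m. \<integral>\<^sup>+z. ennreal (gauss (\<tau> (Suc i) - \<tau> i) z) * indicator (C i) z \<partial>lborel)"
   by (rule prod.nat_diff_reindex)
  finally show "emeasure (distr (P 0) ?M ?X) (PiE {..<m} C) = emeasure (distr (P 0) ?M ?Z) (PiE {..<m} C)"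
   unfolding L ..
 next
  show "range (\<lambda>_. PiE {..<m} (\<lambda>_. UNIV)) \<subseteq> prod_algebra {..<m} (\<lambda>_. borel :: 'a measure)"
   by (auto intro!: prod_algebraI_finite)
  show "emeasure (distr (P 0) ?M ?X) (PiE {..<m} (\<lambda>_. UNIV)) \<noteq> \<infinity>" for i :: nat
   using finite_measure.emeasure_finite[OF finite_measure_distr[OF fX]] by simp
 qed (auto simp: space_PiM)
 define B where "B = {v \<in> space ?M. \<forall>j\<in>J. (\<Sum>i<p j. v i) \<in> A j}"
 have B: "B \<in> sets ?M" unfolding B_def
  using J A pm by (intro Collect_finite_borel borel_measurable_sum measurable_component_singleton) fastforce+
 have cyl: "cylinder J A \<in> sets path_space"
  using J A by (intro cylinder_sets) auto
 have j0: "0 \<le> j" if "j \<in> J" for j using J that by auto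
 have "emeasure (distr (P 0) path_space (stop_path t)) (cylinder J A) =
   emeasure (P 0) (stop_path t -` cylinder J A \<inter> space (P 0))"
  by (rule emeasure_distr[OF ms cyl])
 also have "\<dots> = emeasure (P 0) (?X -` B \<inter> space (P 0))"
 proof (rule emeasure_eq_AE)
  show "AE w in P 0. (w \<in> stop_path t -` cylinder J A \<inter> space (P 0)) = (w \<in> ?X -` B \<inter> space (P 0))"
   using AE_start AE_space
  proof eventually_elim
   case (elim w)
   have "stop_path t w j = (\<Sum>i<p j. ?X w i)" if "j \<in> J" for j
   proof -
    have "w (min j t) = (\<Sum>i<p j. X i w)"
     using path_telescope[of w \<tau> "p j"] p[OF that] \<tau>(2) elim(1) by (simp add: X_def)
    also have "\<dots> = (\<Sum>i<p j. ?X w i)" using pm[OF that] by (intro sum.cong) auto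
    finally show ?thesis using j0[OF that] by simp
   qed
   then show ?case
    using elim measurable_space[OF ms elim(2)] measurable_space[OF fX elim(2)] by (simp add: B_def)
  qed
 qed (use measurable_sets[OF ms cyl] measurable_sets[OF fX B] in auto)
 also have "\<dots> = emeasure (distr (P 0) ?M ?Z) B"
  unfolding law[symmetric] by (rule emeasure_distr[OF fX B, symmetric])
 also have "\<dots> = emeasure (P 0) (?Z -` B \<inter> space (P 0))"
  by (rule emeasure_distr[OF fZ B])
 also have "\<dots> = emeasure (P 0) (rev_path t -` cylinder J A \<inter> space (P 0))"
 proof (rule arg_cong[where f = "emeasure (P 0)"], rule set_eqI)
  fix w
  have "rev_path t w j = (\<Sum>i<p j. ?Z w i)" if "j \<in> J" for j
  proof -
   have "w (t - min j t) = w t + (\<Sum>i<p j. Z i w)"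
    using path_telescope[of "\<lambda>s. w (t - s)" \<tau> "p j"] p[OF that] \<tau>(2) by (simp add: Z_def)
   also have "(\<Sum>i<p j. Z i w) = (\<Sum>i<p j. ?Z w i)" using pm[OF that] by (intro sum.cong) auto
   finally show ?thesis using j0[OF that] by simp
  qed
  then show "w \<in> ?Z -` B \<inter> space (P 0) \<longleftrightarrow> w \<in> rev_path t -` cylinder J A \<inter> space (P 0)"
   using measurable_space[OF mr, of w] measurable_space[OF fZ, of w] by (auto simp: B_def)
 qed
 also have "\<dots> = emeasure (distr (P 0) path_space (rev_path t)) (cylinder J A)"
  by (rule emeasure_distr[OF mr cyl, symmetric])
 finally show "emeasure (distr (P 0) path_space (rev_path t)) (cylinder J A) =
   emeasure (distr (P 0) path_space (stop_path t)) (cylinder J A)" by simp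
qed auto

section \<open>The Feynman-Kac semigroup and its symmetry\<close>

definition semigroup :: "('a \<Rightarrow> real) \<Rightarrow> real \<Rightarrow> 'a \<Rightarrow> ('a \<Rightarrow> ennreal) \<Rightarrow> ennreal" where
 "semigroup f t x F = \<E> x (\<lambda>w. surv f t w * F (w t))"

lemma measurable_add_functional:
 assumes f: "f \<in> borel_measurable borel" and F: "F \<in> borel_measurable borel"
 shows "(\<lambda>p. surv f (snd (fst p)) (add_path (fst (fst p)) (snd p)) * F (fst (fst p) + snd p (max 0 (snd (fst p)))))
  \<in> borel_measurable ((borel \<Otimes>\<^sub>M borel) \<Otimes>\<^sub>M path_space)"
proof -
 have "(\<lambda>p. (add_path (fst (fst p)) (snd p), snd (fst p))) \<in>
   measurable ((borel \<Otimes>\<^sub>M borel) \<Otimes>\<^sub>M path_space) (path_space \<Otimes>\<^sub>M borel)" by measurable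
 from measurable_compose[OF this measurable_survival_eval[OF f F]] show ?thesis
  by (simp add: case_prod_beta)
qed

lemma semigroup_eq:
 assumes f: "f \<in> borel_measurable borel" and F: "F \<in> borel_measurable borel" and t: "0 \<le> t"
 shows "semigroup f t x F = \<E> 0 (\<lambda>w. surv f t (add_path x w) * F (x + w (max 0 t)))"
proof -
 have "(\<lambda>w. surv f t w * F (w (max 0 t))) \<in> borel_measurable path_space"
  using measurable_compose[OF _ measurable_survival_eval[OF f F], of "\<lambda>w. (w, t)" path_space] by simp
 from nn_integral_P[OF this] show ?thesis using t by (simp add: semigroup_def max_absorb2)
qed

text \<open>The reversed path from \<open>y\<close> and the original path shifted to end at
  \<open>y\<close> pass through the same points in opposite order, so they collect the same
  potential.\<close>

lemma survival_rev_path: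
 assumes f: "f \<in> borel_measurable borel" and w: "w \<in> space path_space" and t: "0 \<le> t"
 shows "survival f t (add_path y (rev_path t w)) = survival f t (add_path (y - w t) w)"
proof -
 have [measurable]: "(\<lambda>s. f (y - w t + w (max 0 s))) \<in> borel_measurable borel"
  by (rule measurable_compose[OF _ f]) (use measurable_path_max[OF w] in measurable)
 have "(\<integral>\<^sup>+s\<in>{0..t}. ennreal (f (add_path (y - w t) w s)) \<partial>lborel) =
   (\<integral>\<^sup>+s. ennreal (f (y - w t + w (max 0 s))) * indicator {0..t} s \<partial>lborel)"
  by (intro nn_integral_cong) (auto simp: indicator_def max_absorb2)
 also have "\<dots> = ennreal \<bar>- 1\<bar> * (\<integral>\<^sup>+s. ennreal (f (y - w t + w (max 0 (t + (- 1) * s)))) * indicator {0..t} (t + (- 1) * s) \<partial>lborel)"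
  by (rule nn_integral_real_affine[of "\<lambda>s. ennreal (f (y - w t + w (max 0 s))) * indicator {0..t} s"]) simp_all
 also have "\<dots> = (\<integral>\<^sup>+s\<in>{0..t}. ennreal (f (add_path y (rev_path t w) s)) \<partial>lborel)"
  by (simp, intro nn_integral_cong) (auto simp: indicator_def max_def min_absorb1 algebra_simps)
 finally show ?thesis by (simp add: survival_def)
qed

text \<open>For a fixed path from 0, translating the start by \<open>- w t\<close> makes the end
  point the variable of integration, by invariance of Lebesgue measure. Time reversal then turns the
  path that ends there into one that starts there.\<close>

lemma semigroup_symmetric:
 assumes f: "f \<in> borel_measurable borel" and H [measurable]: "H \<in> borel_measurable borel"
  and F [measurable]: "F \<in> borel_measurable borel" and t: "0 < t"
 shows "(\<integral>\<^sup>+x. H x * semigroup f t x F \<partial>lborel) = (\<integral>\<^sup>+x. F x * semigroup f t x H \<partial>lborel)"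
proof -
 interpret prob_space "P 0" by (rule prob_P)
 interpret pair_sigma_finite "lborel :: 'a measure" "P 0" ..
 have t0: "0 \<le> t" using t by simp
 have mS: "(\<lambda>(x, w). survival f t (add_path x w)) \<in> borel_measurable (borel \<Otimes>\<^sub>M path_space)"
  unfolding case_prod_beta by (rule measurable_survival_path[OF f]) auto
 have [measurable]: "(\<lambda>w. w t) \<in> borel_measurable path_space" by (rule measurable_path_coord[OF t0])
 have m1 [measurable]: "(\<lambda>(x, w). H x * (surv f t (add_path x w) * F (x + w t))) \<in> borel_measurable (lborel \<Otimes>\<^sub>M P 0)"
  using mS by (simp add: case_prod_beta cong: measurable_cong_sets)
 have m2 [measurable]: "(\<lambda>(x, w). F x * (surv f t (add_path (x - w t) w) * H (x - w t))) \<in> borel_measurable (lborel \<Otimes>\<^sub>M P 0)"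
 proof -
  have "(\<lambda>p. (fst p - snd p t, snd p)) \<in> measurable (borel \<Otimes>\<^sub>M path_space) (borel \<Otimes>\<^sub>M (path_space :: (real \<Rightarrow> 'a) measure))" by measurable
  from measurable_compose[OF this mS] show ?thesis by (simp add: case_prod_beta cong: measurable_cong_sets)
 qed
 have mSH: "(\<lambda>w. surv f t (add_path x w) * H (x + w t)) \<in> borel_measurable path_space" for x
  using measurable_compose[OF _ mS, of "\<lambda>w. (x, w)" path_space] by simp
 have mSF: "(\<lambda>w. surv f t (add_path x w) * F (x + w t)) \<in> borel_measurable path_space" for x
  using measurable_compose[OF _ mS, of "\<lambda>w. (x, w)" path_space] by simp
 have "(\<integral>\<^sup>+x. H x * semigroup f t x F \<partial>lborel) =
   (\<integral>\<^sup>+x. \<integral>\<^sup>+w. H x * (surv f t (add_path x w) * F (x + w t)) \<partial>P 0 \<partial>lborel)"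
  using mSF t by (subst nn_integral_cmult) (auto simp: semigroup_eq[OF f F t0] max_absorb2)
 also have "\<dots> = \<E> 0 (\<lambda>w. \<integral>\<^sup>+x. H x * (surv f t (add_path x w) * F (x + w t)) \<partial>lborel)"
  by (rule Fubini'[symmetric]) (use m1 in simp)
 also have "\<dots> = \<E> 0 (\<lambda>w. \<integral>\<^sup>+x. F x * (surv f t (add_path (x - w t) w) * H (x - w t)) \<partial>lborel)"
 proof (rule nn_integral_cong)
  fix w assume "w \<in> space (P 0)"
  then have w: "w \<in> space path_space" by simp
  have "(\<lambda>x. H x * (surv f t (add_path x w) * F (x + w t))) \<in> borel_measurable borel"
   using measurable_compose[OF _ mS, of "\<lambda>x. (x, w)" borel] w by simp
  from nn_integral_lborel_shift[OF this, of "- w t", symmetric]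
  show "(\<integral>\<^sup>+x. H x * (surv f t (add_path x w) * F (x + w t)) \<partial>lborel) =
   (\<integral>\<^sup>+x. F x * (surv f t (add_path (x - w t) w) * H (x - w t)) \<partial>lborel)"
   by (simp add: add.commute[of "- w t"] ac_simps)
 qed
 also have "\<dots> = (\<integral>\<^sup>+x. \<integral>\<^sup>+w. F x * (surv f t (add_path (x - w t) w) * H (x - w t)) \<partial>P 0 \<partial>lborel)"
  by (rule Fubini') (use m2 in simp)
 also have "\<dots> = (\<integral>\<^sup>+x. F x * semigroup f t x H \<partial>lborel)"
 proof (rule nn_integral_cong)
  fix x :: 'a
  have mr: "rev_path t \<in> measurable path_space path_space" by (rule measurable_rev_path[OF t0])
  have "\<E> 0 (\<lambda>w. F x * (surv f t (add_path (x - w t) w) * H (x - w t))) =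
    \<E> 0 (\<lambda>w. F x * (surv f t (add_path x (rev_path t w)) * H (x + rev_path t w t)))"
   using t by (intro nn_integral_P_cong) (simp add: survival_rev_path[OF f])
  also have "\<dots> = F x * \<E> 0 (\<lambda>w. surv f t (add_path x (rev_path t w)) * H (x + rev_path t w t))"
   by (rule nn_integral_cmult) (use measurable_compose[OF mr mSH] in simp)
  also have "\<E> 0 (\<lambda>w. surv f t (add_path x (rev_path t w)) * H (x + rev_path t w t)) =
   (\<integral>\<^sup>+w. surv f t (add_path x w) * H (x + w t) \<partial>distr (P 0) path_space (rev_path t))"
   by (rule nn_integral_distr[symmetric]) (use mr mSH in simp_all)
  also have "\<dots> = \<E> 0 (\<lambda>w. surv f t (add_path x (stop_path t w)) * H (x + stop_path t w t))"
   unfolding distr_rev_path[OF t] by (rule nn_integral_distr) (use measurable_stop_path[OF t0] mSH in simp_all)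
  also have "\<dots> = \<E> 0 (\<lambda>w. surv f t (add_path x w) * H (x + w t))"
  proof (rule nn_integral_cong)
   fix w
   have "survival f t (add_path x (stop_path t w)) = survival f t (add_path x w)"
    by (rule survival_cong) (auto simp: min_absorb1)
   then show "surv f t (add_path x (stop_path t w)) * H (x + stop_path t w t) =
    surv f t (add_path x w) * H (x + w t)" using t by simp
  qed
  also have "\<dots> = semigroup f t x H" using t by (simp add: semigroup_eq[OF f H t0] max_absorb2)
  finally show "\<E> 0 (\<lambda>w. F x * (surv f t (add_path (x - w t) w) * H (x - w t))) = F x * semigroup f t x H" .
 qed
 finally show ?thesis .
qed

lemma measurable_semigroup:
 assumes f: "f \<in> borel_measurable borel" and F: "F \<in> borel_measurable borel"
 shows "(\<lambda>(x, t). semigroup f t x F * indicator {0..} t) \<in> borel_measurable (borel \<Otimes>\<^sub>M borel)"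
proof -
 interpret prob_space "P 0" by (rule prob_P)
 have [measurable]: "(\<lambda>p. surv f (snd (fst p)) (add_path (fst (fst p)) (snd p)) * F (fst (fst p) + snd p (max 0 (snd (fst p)))))
  \<in> borel_measurable ((borel \<Otimes>\<^sub>M borel) \<Otimes>\<^sub>M P 0)"
  using measurable_add_functional[OF f F] by (simp add: case_prod_beta cong: measurable_cong_sets)
 have "(\<lambda>p. \<E> 0 (\<lambda>w. surv f (snd p) (add_path (fst p) w) * F (fst p + w (max 0 (snd p)))) * indicator {0..} (snd p))
   \<in> borel_measurable (borel \<Otimes>\<^sub>M borel)" by measurable
 also have "(\<lambda>p. \<E> 0 (\<lambda>w. surv f (snd p) (add_path (fst p) w) * F (fst p + w (max 0 (snd p)))) * indicator {0..} (snd p)) =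
   (\<lambda>(x, t). semigroup f t x F * indicator {0..} t)"
  by (auto simp: fun_eq_iff semigroup_eq[OF f F] indicator_def)
 finally show ?thesis .
qed

lemma green_eq_semigroup:
 assumes f: "f \<in> borel_measurable borel" and F: "F \<in> borel_measurable borel"
 shows "green f x F = (\<integral>\<^sup>+t. semigroup f t x F * indicator {0..} t \<partial>lborel)"
proof -
 interpret prob_space "P x" by (rule prob_P)
 interpret pair_sigma_finite "P x" "lborel :: real measure" ..
 have [measurable]: "(\<lambda>p. surv f (snd p) (fst p) * F (fst p (max 0 (snd p)))) \<in> borel_measurable (P x \<Otimes>\<^sub>M lborel)"
  using measurable_survival_eval[OF f F] by (simp add: case_prod_beta cong: measurable_cong_sets)
 have "green f x F = \<E> x (\<lambda>w. \<integral>\<^sup>+t. surv f t w * F (w (max 0 t)) * indicator {0..} t \<partial>lborel)"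
  unfolding green_def occupation_max ..
 also have "\<dots> = (\<integral>\<^sup>+t. \<integral>\<^sup>+w. surv f t w * F (w (max 0 t)) * indicator {0..} t \<partial>P x \<partial>lborel)"
  by (rule Fubini'[symmetric]) (simp add: case_prod_beta)
 also have "\<dots> = (\<integral>\<^sup>+t. semigroup f t x F * indicator {0..} t \<partial>lborel)"
  by (intro nn_integral_cong) (auto simp: semigroup_def indicator_def max_absorb2)
 finally show ?thesis .
qed

text \<open>The symmetry of the semigroup is integrated over time; time 0, where it is not stated,
  is a null set.\<close>

lemma green_symmetric:
 assumes f: "f \<in> borel_measurable borel" and H: "H \<in> borel_measurable borel" and F: "F \<in> borel_measurable borel"
 shows "(\<integral>\<^sup>+x. H x * green f x F \<partial>lborel) = (\<integral>\<^sup>+x. F x * green f x H \<partial>lborel)"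
proof -
 have *: "(\<integral>\<^sup>+x. H x * green f x F \<partial>lborel) = (\<integral>\<^sup>+t. (\<integral>\<^sup>+x. H x * semigroup f t x F \<partial>lborel) * indicator {0..} t \<partial>lborel)"
  if [measurable]: "H \<in> borel_measurable borel" "F \<in> borel_measurable borel" for H F
 proof -
  note m = measurable_semigroup[OF f that(2)]
  have [measurable]: "(\<lambda>p. semigroup f (snd p) (fst p) F * indicator {0..} (snd p)) \<in> borel_measurable (lborel \<Otimes>\<^sub>M lborel)"
   using m by (simp add: case_prod_beta cong: measurable_cong_sets)
  have mt: "(\<lambda>t. semigroup f t x F * indicator {0..} t) \<in> borel_measurable lborel" for x
   using measurable_compose[OF _ m, of "\<lambda>t. (x, t)" borel] by simp
  have mx: "(\<lambda>x. semigroup f t x F * indicator {0..} t) \<in> borel_measurable lborel" for t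
   using measurable_compose[OF _ m, of "\<lambda>x. (x, t)" borel] by simp
  have "(\<integral>\<^sup>+x. H x * green f x F \<partial>lborel) = (\<integral>\<^sup>+x. \<integral>\<^sup>+t. H x * (semigroup f t x F * indicator {0..} t) \<partial>lborel \<partial>lborel)"
   using mt by (simp add: green_eq_semigroup[OF f that(2)] nn_integral_cmult)
  also have "\<dots> = (\<integral>\<^sup>+t. \<integral>\<^sup>+x. H x * (semigroup f t x F * indicator {0..} t) \<partial>lborel \<partial>lborel)"
   by (rule lborel_pair.Fubini'[symmetric]) (simp add: case_prod_beta)
  also have "\<dots> = (\<integral>\<^sup>+t. (\<integral>\<^sup>+x. H x * semigroup f t x F \<partial>lborel) * indicator {0..} t \<partial>lborel)"
   by (intro nn_integral_cong) (auto simp: indicator_def)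
  finally show ?thesis .
 qed
 show ?thesis
  unfolding *[OF H F] *[OF F H]
 proof (rule nn_integral_cong_AE)
  show "AE t in lborel. (\<integral>\<^sup>+x. H x * semigroup f t x F \<partial>lborel) * indicator {0..} t =
    (\<integral>\<^sup>+x. F x * semigroup f t x H \<partial>lborel) * indicator {0..} t"
   using AE_lborel_singleton[of 0]
   by eventually_elim (use semigroup_symmetric[OF f H F] in \<open>auto simp: indicator_def\<close>)
 qed
qed

end

section \<open>Two-sided bounds near a point\<close>

lemma ball_sets_borel [measurable, simp]:
 fixes y :: "'a::metric_space"
 shows "ball y r \<in> sets borel" "cball y r \<in> sets borel"
 by (auto intro: borel_open borel_closed)

lemma power2_dist_le:
 fixes u v w :: "'a::real_normed_vector"
 assumes "norm (w - u) \<le> R"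
 shows "(norm (v - u))\<^sup>2 \<le> 2 * (norm (v - w))\<^sup>2 + 2 * R\<^sup>2"
proof -
 have R: "0 \<le> R" using assms norm_ge_zero order_trans by blast
 have "norm (v - u) \<le> norm (v - w) + R"
  using norm_triangle_ineq[of "v - w" "w - u"] assms by simp
 then have "(norm (v - u))\<^sup>2 \<le> (norm (v - w) + R)\<^sup>2" by (intro power_mono) auto
 also have "\<dots> \<le> 2 * (norm (v - w))\<^sup>2 + 2 * R\<^sup>2"
  using zero_le_power2[of "norm (v - w) - R"] by (simp add: power2_eq_square algebra_simps)
 finally show ?thesis .
qed

lemma gauss_le_1:
 fixes z :: "'a::euclidean_space"
 assumes "1 / 2 \<le> t" shows "gauss t z \<le> 1"
proof -
 have "1 \<le> 2 * pi * t" using assms pi_ge_two mult_mono[of 2 pi "1/2" t] by simp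
 then have "1 \<le> sqrt (2 * pi * t)" by simp
 then have "(1 / sqrt (2 * pi * t)) ^ DIM('a) \<le> 1" by (intro power_le_one) auto
 moreover have "exp (- (norm z)\<^sup>2 / (2 * t)) \<le> 1" using assms by simp
 ultimately show ?thesis using assms by (subst gauss_eq) (auto intro!: mult_le_one)
qed

lemma gauss_ge:
 fixes z :: "'a::euclidean_space"
 assumes t: "a \<le> t" "t \<le> b" "0 < a" and z: "norm z \<le> R"
 shows "(1 / sqrt (2 * pi * b)) ^ DIM('a) * exp (- R\<^sup>2 / (2 * a)) \<le> gauss t z"
proof -
 have R: "0 \<le> R" using z norm_ge_zero order_trans by blast
 have "(norm z)\<^sup>2 / (2 * t) \<le> R\<^sup>2 / (2 * a)"
  using t z R by (intro frac_le power_mono mult_left_mono) auto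
 then have 1: "exp (- R\<^sup>2 / (2 * a)) \<le> exp (- (norm z)\<^sup>2 / (2 * t))" by simp
 have "(1 / sqrt (2 * pi * b)) ^ DIM('a) \<le> (1 / sqrt (2 * pi * t)) ^ DIM('a)"
  using t by (intro power_mono divide_left_mono) (auto intro!: mult_pos_pos)
 then show ?thesis unfolding gauss_eq[OF less_le_trans[OF t(3,1)]]
  using 1 t by (intro mult_mono) auto
qed

text \<open>Away from 0 the exponential factor beats the blow-up of the normalisation for small
  \<open>t\<close>. The distance 1/4 is that between the unit sphere and the ball of radius 3/4 in
  \<open>green_cross_bounds\<close>.\<close>

lemma gauss_away_bounded:
 "\<exists>C>0. \<forall>(t::real) z. 0 < t \<longrightarrow> t \<le> 1 \<longrightarrow> 1 / 4 \<le> norm (z::'a::euclidean_space) \<longrightarrow> gauss t z \<le> C"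
proof (intro exI conjI allI impI)
 let ?D = "DIM('a)"
 show "0 < (32 * real ?D) ^ ?D" by simp
 fix t :: real and z :: 'a assume t: "0 < t" "t \<le> 1" and z: "1 / 4 \<le> norm z"
 have "(1 / 4)\<^sup>2 \<le> (norm z)\<^sup>2" using z by (intro power_mono) auto
 then have n: "1 / (32 * t) \<le> (norm z)\<^sup>2 / (2 * t)" using t by (simp add: field_simps power2_eq_square)
 \<comment> \<open>The inequality \<open>(1 + x / n) ^ n \<le> exp x\<close>, with \<open>n\<close>
   the dimension and \<open>x = 1 / (32 * t)\<close>, yields a power of \<open>t\<close> that
   absorbs the normalisation.\<close>
 have "(1 / (32 * t) / real ?D) ^ ?D \<le> (1 + 1 / (32 * t) / real ?D) ^ ?D"
  using t by (intro power_mono) auto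
 also have "\<dots> \<le> exp (1 / (32 * t))"
 proof (rule exp_ge_one_plus_x_over_n_power_n)
  have "0 \<le> 1 / (32 * t)" using t by simp
  then show "- real ?D \<le> 1 / (32 * t)" by linarith
 qed simp
 also have "\<dots> \<le> exp ((norm z)\<^sup>2 / (2 * t))" using n by (simp only: exp_le_cancel_iff)
 finally have e: "(1 / (32 * t * real ?D)) ^ ?D \<le> exp ((norm z)\<^sup>2 / (2 * t))"
  by (simp only: divide_divide_eq_left)
 have "exp (- (norm z)\<^sup>2 / (2 * t)) = 1 / exp ((norm z)\<^sup>2 / (2 * t))"
  by (simp add: exp_minus field_simps)
 also have "\<dots> \<le> 1 / (1 / (32 * t * real ?D)) ^ ?D"
  using e t by (intro divide_left_mono mult_pos_pos zero_less_power) auto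
 also have "\<dots> = (32 * t * real ?D) ^ ?D" by (simp add: power_divide)
 finally have e2: "exp (- (norm z)\<^sup>2 / (2 * t)) \<le> (32 * t * real ?D) ^ ?D" .
 have "gauss t z \<le> (1 / sqrt (2 * pi * t)) ^ ?D * (32 * t * real ?D) ^ ?D"
  unfolding gauss_eq[OF t(1)] using e2 t by (intro mult_left_mono) auto
 also have "\<dots> = (t / sqrt (2 * pi * t)) ^ ?D * (32 * real ?D) ^ ?D"
 proof -
  have "1 / sqrt (2 * pi * t) * (32 * t * real ?D) = t / sqrt (2 * pi * t) * (32 * real ?D)" by simp
  then show ?thesis by (simp only: power_mult_distrib[symmetric])
 qed
 also have "\<dots> \<le> 1 ^ ?D * (32 * real ?D) ^ ?D"
 proof (intro mult_right_mono power_mono)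
  have "t * t \<le> 2 * pi * t" using t pi_ge_two by (intro mult_right_mono) auto
  then have "t \<le> sqrt (2 * pi * t)" using t by (intro real_le_rsqrt) (simp add: power2_eq_square)
  then show "t / sqrt (2 * pi * t) \<le> 1" using t by simp
 qed (use t in auto)
 finally show "gauss t z \<le> (32 * real ?D) ^ ?D" by simp
qed

lemma nn_integral_exp_norm:
 assumes "0 < a"
 shows "(\<integral>\<^sup>+u. ennreal (exp (- a * (norm (u - c :: 'a::euclidean_space))\<^sup>2)) \<partial>lborel) < \<infinity>"
proof -
 define t where "t = 1 / (2 * a)"
 have t: "0 < t" using assms by (simp add: t_def)
 define k where "k = (1 / sqrt (2 * pi * t)) ^ DIM('a)"
 have k: "0 < k" using t by (simp add: k_def)
 have "exp (- a * (norm (u - c))\<^sup>2) = gauss t (u - c) * (1 / k)" for u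
  using k assms by (simp add: gauss_eq[OF t] k_def[symmetric]) (simp add: t_def)
 then have "ennreal (exp (- a * (norm (u - c))\<^sup>2)) = ennreal (gauss t (u - c)) * ennreal (1 / k)" for u
  using k by (simp add: ennreal_mult[symmetric])
 then have "(\<integral>\<^sup>+u. ennreal (exp (- a * (norm (u - c))\<^sup>2)) \<partial>lborel) = (\<integral>\<^sup>+u. ennreal (gauss t (u - c)) * ennreal (1 / k) \<partial>lborel)"
  by simp
 also have "\<dots> = ennreal (1 / k)" using nn_integral_gauss[OF t, of c] by (simp add: nn_integral_multc)
 finally show ?thesis by simp
qed

lemma emeasure_ball_pos:
 fixes y :: "'a::euclidean_space"
 assumes "0 < r" shows "0 < emeasure lborel (ball y r)" "emeasure lborel (ball y r) < \<infinity>"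
 using assms by (simp_all add: emeasure_ball)

lemma emeasure_ball_translate:
 fixes y z :: "'a::euclidean_space"
 shows "emeasure lborel (ball y r) = emeasure lborel (ball z r)"
 by (cases "0 < r") (simp_all add: emeasure_ball not_less ball_empty)

text \<open>Jensen's inequality, with the tangent to \<open>exp (- t)\<close> taken at \<open>m\<close>.\<close>

lemma exp_neg_jensen:
 assumes [measurable]: "X \<in> borel_measurable N" "A \<in> borel_measurable N"
  and m: "0 \<le> m" and fin: "(\<integral>\<^sup>+w. X w \<partial>N) < \<infinity>"
  and le: "(\<integral>\<^sup>+w. X w * A w \<partial>N) \<le> ennreal m * (\<integral>\<^sup>+w. X w \<partial>N)"
 shows "ennreal (exp (- m)) * (\<integral>\<^sup>+w. X w \<partial>N) \<le> (\<integral>\<^sup>+w. X w * ennreal (exp_neg (A w)) \<partial>N)"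
proof -
 let ?I = "\<integral>\<^sup>+w. X w \<partial>N" and ?Y = "\<integral>\<^sup>+w. X w * ennreal (exp_neg (A w)) \<partial>N"
 have "ennreal (exp (- m) * (1 + m)) * ?I = (\<integral>\<^sup>+w. ennreal (exp (- m) * (1 + m)) * X w \<partial>N)"
  by (rule nn_integral_cmult[symmetric]) measurable
 also have "\<dots> \<le> (\<integral>\<^sup>+w. X w * ennreal (exp_neg (A w)) + ennreal (exp (- m)) * (X w * A w) \<partial>N)"
 proof (rule nn_integral_mono)
  fix w
  show "ennreal (exp (- m) * (1 + m)) * X w \<le> X w * ennreal (exp_neg (A w)) + ennreal (exp (- m)) * (X w * A w)"
   using mult_right_mono[OF exp_neg_tangent[OF m, of "A w"], of "X w"] by (simp add: algebra_simps)
 qed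
 also have "\<dots> = ?Y + ennreal (exp (- m)) * (\<integral>\<^sup>+w. X w * A w \<partial>N)"
  by (simp add: nn_integral_add nn_integral_cmult)
 also have "\<dots> \<le> ?Y + ennreal (exp (- m)) * (ennreal m * ?I)"
  by (intro add_left_mono mult_left_mono le) simp
 finally have *: "ennreal (exp (- m) * (1 + m)) * ?I \<le> ?Y + ennreal (exp (- m)) * (ennreal m * ?I)" .
 obtain i where i: "?I = ennreal i" "0 \<le> i" using fin by (cases ?I) auto
 show ?thesis
 proof (cases ?Y)
  case (real r)
  have "exp (- m) * (1 + m) * i \<le> r + exp (- m) * (m * i)"
   using * unfolding i(1) real(2) using i(2) real(1) m
   by (simp add: ennreal_mult[symmetric] ennreal_plus[symmetric] del: ennreal_plus)
  then have "exp (- m) * i \<le> r" by (simp add: algebra_simps)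
  then show ?thesis unfolding i(1) real(2) using i(2) real(1) by (simp add: ennreal_mult[symmetric])
 qed simp
qed

section \<open>Potentials of Gaussian growth and lower bounds\<close>

context brownian
begin

definition action :: "('a \<Rightarrow> real) \<Rightarrow> real \<Rightarrow> (real \<Rightarrow> 'a) \<Rightarrow> ennreal" where
 "action f T w = (\<integral>\<^sup>+s\<in>{0..T}. ennreal (f (w s)) \<partial>lborel)"

lemma survival_action: "survival f T w = exp_neg (action f T w)"
 by (simp add: survival_def action_def)

lemma measurable_eval_pair:
 assumes f: "f \<in> borel_measurable borel"
 shows "(\<lambda>(w, s). ennreal (f (w (max 0 s)))) \<in> borel_measurable (path_space \<Otimes>\<^sub>M lborel)"
proof -
 have "(\<lambda>p. fst p (max 0 (snd p))) \<in> borel_measurable (path_space \<Otimes>\<^sub>M (borel :: real measure))"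
  by (rule measurable_path_eval) auto
 from measurable_compose[OF this f]
 show ?thesis by (simp add: case_prod_beta cong: measurable_cong_sets)
qed

lemma action_max: "action f T w = (\<integral>\<^sup>+s. ennreal (f (w (max 0 s))) * indicator {0..T} s \<partial>lborel)"
 unfolding action_def by (intro nn_integral_cong) (auto simp: indicator_def max_absorb2)

lemma measurable_action: "f \<in> borel_measurable borel \<Longrightarrow> action f T \<in> borel_measurable path_space"
proof -
 assume "f \<in> borel_measurable borel"
 then have [measurable]: "(\<lambda>p. ennreal (f (fst p (max 0 (snd p))))) \<in> borel_measurable (path_space \<Otimes>\<^sub>M lborel)"
  using measurable_eval_pair[of f] by (simp add: case_prod_beta)
 show "action f T \<in> borel_measurable path_space"
  unfolding action_max[abs_def] by measurable
qed

text \<open>Fubini over time, with a weight \<open>X\<close> that will be the indicator of an event.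
  The two end times are null sets, so the bound is asked for strictly between them.\<close>

lemma nn_integral_action:
 assumes f: "f \<in> borel_measurable borel" and X: "X \<in> borel_measurable path_space"
  and b: "\<And>s. 0 < s \<Longrightarrow> s < T \<Longrightarrow> (\<E> x (\<lambda>w. X w * ennreal (f (w s)))) \<le> B" and T: "0 \<le> T"
 shows "\<E> x (\<lambda>w. X w * action f T w) \<le> ennreal T * B"
proof -
 interpret prob_space "P x" by (rule prob_P)
 interpret pair_sigma_finite "P x" "lborel :: real measure" ..
 note [measurable] = X
 have m [measurable]: "(\<lambda>p. ennreal (f (fst p (max 0 (snd p))))) \<in> borel_measurable (P x \<Otimes>\<^sub>M lborel)"
  using measurable_eval_pair[OF f] by (simp add: case_prod_beta cong: measurable_cong_sets)
 have m2: "(\<lambda>s. ennreal (f (w (max 0 s)))) \<in> borel_measurable lborel" if "w \<in> space path_space" for w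
  using measurable_compose[OF _ measurable_eval_pair[OF f], of "\<lambda>s. (w, s)" lborel] that by simp
 have "\<E> x (\<lambda>w. X w * action f T w) = \<E> x (\<lambda>w. \<integral>\<^sup>+s. X w * (ennreal (f (w (max 0 s))) * indicator {0..T} s) \<partial>lborel)"
  unfolding action_max by (intro nn_integral_cong nn_integral_cmult[symmetric]) (use m2 in auto)
 also have "\<dots> = (\<integral>\<^sup>+s. \<integral>\<^sup>+w. X w * (ennreal (f (w (max 0 s))) * indicator {0..T} s) \<partial>P x \<partial>lborel)"
  by (rule Fubini'[symmetric]) (simp add: case_prod_beta)
 also have "\<dots> \<le> (\<integral>\<^sup>+s. B * indicator {0..T} s \<partial>lborel)"
 proof (rule nn_integral_mono_AE)
  show "AE s in lborel. \<E> x (\<lambda>w. X w * (ennreal (f (w (max 0 s))) * indicator {0..T} s)) \<le> B * indicator {0..T} s"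
   using AE_lborel_singleton[of 0] AE_lborel_singleton[of T]
   by eventually_elim (use b in \<open>auto simp: indicator_def max_absorb2\<close>)
 qed
 also have "\<dots> = ennreal T * B" using T by (simp add: nn_integral_cmult mult.commute)
 finally show ?thesis .
qed

text \<open>The price of integrating a potential of Gaussian growth against the heat kernel from a
  point within \<open>R\<close> of the centre: \<open>exp (R\<^sup>2 / 8)\<close> for the change of
  centre, and \<open>sqrt 2\<close> per dimension for the widened Gaussian.\<close>

definition pot_const :: "real \<Rightarrow> real" where
 "pot_const R = exp (R\<^sup>2 / 8) * sqrt 2 ^ DIM('a)"

lemma pot_const_pos [simp]: "0 < pot_const R"
 by (simp add: pot_const_def)

text \<open>Moving the centre to the starting point turns the rate 1/16 into 1/8, which the heat
  kernel still absorbs up to time 2.\<close>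

definition pot_bound :: "('a \<Rightarrow> real) \<Rightarrow> 'a \<Rightarrow> real \<Rightarrow> bool" where
 "pot_bound f c K \<longleftrightarrow> f \<in> borel_measurable borel \<and> 0 \<le> K \<and> (\<forall>v. f v \<le> K * exp ((norm (v - c))\<^sup>2 / 16))"

lemma gauss_pot_bound:
 assumes f: "pot_bound f c K" and x: "norm (x - c) \<le> R" and s: "0 < s" "s \<le> 2"
 shows "(\<integral>\<^sup>+v. ennreal (f v) * ennreal (gauss s (v - x)) \<partial>lborel) \<le> ennreal (K * pot_const R)"
proof -
 have K: "0 \<le> K" using f by (simp add: pot_bound_def)
 define q where "q = 1 - 2 * (1 / 8) * s"
 have q: "1 / 2 \<le> q" "0 < q" using s by (auto simp: q_def)
 have sq: "0 < s / q" using s q by simp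
 have le: "f v * gauss s (v - x) \<le> K * pot_const R * gauss (s / q) (v - x)" for v
 proof -
  have "f v \<le> K * exp ((norm (v - c))\<^sup>2 / 16)" using f by (simp add: pot_bound_def)
  also have "\<dots> \<le> K * exp (1 / 8 * (norm (v - x))\<^sup>2 + R\<^sup>2 / 8)"
   using power2_dist_le[OF x, of v] K by (intro mult_left_mono) auto
  finally have "f v * gauss s (v - x) \<le> (K * exp (1 / 8 * (norm (v - x))\<^sup>2 + R\<^sup>2 / 8)) * gauss s (v - x)"
   by (intro mult_right_mono) auto
  also have "\<dots> = K * exp (R\<^sup>2 / 8) * (exp (1 / 8 * (norm (v - x))\<^sup>2) * gauss s (v - x))"
   by (simp add: exp_add)
  also have "exp (1 / 8 * (norm (v - x))\<^sup>2) * gauss s (v - x) = (1 / sqrt q) ^ DIM('a) * gauss (s / q) (v - x)"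
   unfolding q_def by (rule exp_gauss) (use s in auto)
  also have "K * exp (R\<^sup>2 / 8) * ((1 / sqrt q) ^ DIM('a) * gauss (s / q) (v - x)) \<le>
    K * exp (R\<^sup>2 / 8) * (sqrt 2 ^ DIM('a) * gauss (s / q) (v - x))"
  proof (intro mult_left_mono mult_right_mono power_mono)
   have "1 / sqrt q = sqrt (1 / q)" by (simp add: real_sqrt_divide)
   also have "\<dots> \<le> sqrt 2" using q by (simp add: field_simps)
   finally show "1 / sqrt q \<le> sqrt 2" .
  qed (use K q in auto)
  finally show ?thesis by (simp add: pot_const_def)
 qed
 have "(\<integral>\<^sup>+v. ennreal (f v) * ennreal (gauss s (v - x)) \<partial>lborel) \<le>
   (\<integral>\<^sup>+v. ennreal (K * pot_const R) * ennreal (gauss (s / q) (v - x)) \<partial>lborel)"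
 proof (rule nn_integral_mono)
  fix v
  show "ennreal (f v) * ennreal (gauss s (v - x)) \<le> ennreal (K * pot_const R) * ennreal (gauss (s / q) (v - x))"
  proof (cases "0 \<le> f v")
   case True
   then show ?thesis using le[of v] K by (simp add: ennreal_mult[symmetric] less_imp_le)
  qed (simp add: ennreal_neg)
 qed
 also have "\<dots> = ennreal (K * pot_const R)"
  using nn_integral_gauss[OF sq, of x] by (simp add: nn_integral_cmult)
 finally show ?thesis .
qed

lemma pot_boundD:
 assumes "pot_bound f c K" shows "f \<in> borel_measurable borel" "0 \<le> K"
 using assms by (auto simp: pot_bound_def)

lemma measurable_eval_P: "0 \<le> s \<Longrightarrow> F \<in> borel_measurable borel \<Longrightarrow> (\<lambda>w. F (w s)) \<in> borel_measurable path_space"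
 using measurable_compose[OF measurable_path_coord] by blast

lemma nn_integral_action_bound:
 assumes f: "pot_bound f c K" and x: "norm (x - c) \<le> R" and T: "0 \<le> T" "T \<le> 2"
 shows "\<E> x (\<lambda>w. action f T w) \<le> ennreal (T * (K * pot_const R))"
proof -
 have "\<E> x (\<lambda>w. 1 * action f T w) \<le> ennreal T * ennreal (K * pot_const R)"
 proof (rule nn_integral_action[OF pot_boundD(1)[OF f]])
  fix s assume s: "0 < s" "s < T"
  have "\<E> x (\<lambda>w. 1 * ennreal (f (w s))) = (\<integral>\<^sup>+v. ennreal (f v) * ennreal (gauss s (v - x)) \<partial>lborel)"
   using nn_integral_P_eval[OF _ s(1), of "\<lambda>v. ennreal (f v)" x] pot_boundD(1)[OF f] by simp
  also have "\<dots> \<le> ennreal (K * pot_const R)"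
   using s T by (intro gauss_pot_bound[OF f x]) auto
  finally show "\<E> x (\<lambda>w. 1 * ennreal (f (w s))) \<le> ennreal (K * pot_const R)" .
 qed (use T in auto)
 then show ?thesis using T pot_boundD(2)[OF f] by (simp add: ennreal_mult less_imp_le)
qed

text \<open>The path is in the open ball around \<open>y\<close> at time 1 with probability at least
  \<open>p\<close>. Given this event, the mean action is at most \<open>K * pot_const R / p\<close>,
  and Jensen's inequality turns this into a lower bound for the survival weight whose exponent is
  affine in \<open>K\<close>.\<close>

lemma cross_lower:
 "\<exists>C\<ge>0. \<forall>f c K z y. pot_bound f c K \<longrightarrow> norm (z - c) \<le> R \<longrightarrow> norm (y - c) \<le> R \<longrightarrow>
   ennreal (exp (- C * (1 + K))) \<le> cross f z y"
proof -
 define b where "b = measure lborel (ball (0::'a) 1)"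
 have b: "0 < b" "emeasure lborel (ball y 1) = ennreal b" for y :: 'a
  by (auto simp: b_def content_ball_pos emeasure_ball content_ball)
 \<comment> \<open>The Gaussian density at distance at most \<open>2 * R + 1\<close>, times the
   volume of the unit ball.\<close>
 define p where "p = (1 / sqrt (2 * pi * 1)) ^ DIM('a) * exp (- (2 * R + 1)\<^sup>2 / (2 * 1)) * b"
 have p: "0 < p" using b by (simp add: p_def)
 define C where "C = max (\<bar>ln p\<bar>) (pot_const R / p)"
 have C: "0 \<le> C" by (simp add: C_def)
 have "ennreal (exp (- C * (1 + K))) \<le> cross f z y"
  if f: "pot_bound f c K" and z: "norm (z - c) \<le> R" and y: "norm (y - c) \<le> R" for f c K z y
 proof -
  note [measurable] = pot_boundD(1)[OF f]
  have K: "0 \<le> K" by (rule pot_boundD(2)[OF f])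
  define X where "X w = (indicator (ball y 1) (w 1) :: ennreal)" for w :: "real \<Rightarrow> 'a"
  have mX: "X \<in> borel_measurable path_space" unfolding X_def by (rule measurable_eval_P[OF _ borel_measurable_indicator]) auto
  have "ennreal p = ennreal ((1 / sqrt (2 * pi * 1)) ^ DIM('a) * exp (- (2 * R + 1)\<^sup>2 / (2 * 1))) * emeasure lborel (ball y 1)"
   using b by (simp add: p_def ennreal_mult)
  also have "\<dots> = (\<integral>\<^sup>+v. ennreal ((1 / sqrt (2 * pi * 1)) ^ DIM('a) * exp (- (2 * R + 1)\<^sup>2 / (2 * 1))) * indicator (ball y 1) v \<partial>lborel)"
   by (simp add: nn_integral_cmult)
  also have "\<dots> \<le> (\<integral>\<^sup>+v. indicator (ball y 1) v * ennreal (gauss 1 (v - z)) \<partial>lborel)"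
  proof (rule nn_integral_mono)
   fix v
   show "ennreal ((1 / sqrt (2 * pi * 1)) ^ DIM('a) * exp (- (2 * R + 1)\<^sup>2 / (2 * 1))) * indicator (ball y 1) v
    \<le> indicator (ball y 1) v * ennreal (gauss 1 (v - z))"
   proof (cases "v \<in> ball y 1")
    case True
    then have v: "norm (v - y) \<le> 1" by (simp add: dist_norm norm_minus_commute)
    have "norm (v - z) \<le> norm (v - y) + norm (y - c) + norm (c - z)"
     using norm_triangle_ineq[of "v - y" "y - z"] norm_triangle_ineq[of "y - c" "c - z"] by simp
    then have "norm (v - z) \<le> 2 * R + 1" using v y z by (simp add: norm_minus_commute)
    from gauss_ge[OF _ _ _ this, of 1 1 1] True show ?thesis by (auto intro!: ennreal_leI)
   qed simp
  qed
  also have "\<dots> = \<E> z (\<lambda>w. X w)"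
   unfolding X_def by (rule nn_integral_P_eval[symmetric]) auto
  finally have pX: "ennreal p \<le> \<E> z (\<lambda>w. X w)" .
  have X1: "\<E> z (\<lambda>w. X w) \<le> 1"
  proof -
   have "\<E> z (\<lambda>w. X w) \<le> \<E> z (\<lambda>w. 1)"
    by (intro nn_integral_mono) (auto simp: X_def indicator_def)
   then show ?thesis by simp
  qed
  define m where "m = K * pot_const R / p"
  have m: "0 \<le> m" using K p by (simp add: m_def less_imp_le)
  have "\<E> z (\<lambda>w. X w * action f 1 w) \<le> \<E> z (\<lambda>w. action f 1 w)"
   by (intro nn_integral_mono) (auto simp: X_def indicator_def)
  also have "\<dots> \<le> ennreal (K * pot_const R)"
   using nn_integral_action_bound[OF f z, of 1] by simp
  also have "\<dots> = ennreal m * ennreal p" using p m by (simp add: m_def ennreal_mult[symmetric])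
  also have "\<dots> \<le> ennreal m * \<E> z (\<lambda>w. X w)" by (intro mult_left_mono pX) simp
  finally have "ennreal (exp (- m)) * \<E> z (\<lambda>w. X w) \<le> \<E> z (\<lambda>w. X w * ennreal (exp_neg (action f 1 w)))"
   using mX measurable_action[OF pot_boundD(1)[OF f]] m X1
   by (intro exp_neg_jensen) (auto simp: le_less_trans)
  also have "\<dots> \<le> cross f z y"
   unfolding cross_def survival_action[symmetric]
  proof (rule nn_integral_mono)
   fix w assume "w \<in> space (P z)"
   then have w: "w \<in> space path_space" by simp
   show "X w * surv f 1 w \<le> indicator (hit_event y) w * surv f (hit y w) w"
   proof (cases "w 1 \<in> ball y 1")
    case True
    then have "w 1 \<in> cball y 1" by simp
    then have "w \<in> hit_event y" "hit y w \<le> 1" using hit_eventI[OF w, of 1 y] hit_le[of 1 w y] by auto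
    then show ?thesis using True survival_antimono[of "hit y w" 1 f w] by (simp add: X_def ennreal_leI)
   qed (simp add: X_def)
  qed
  finally have *: "ennreal (exp (- m)) * \<E> z (\<lambda>w. X w) \<le> cross f z y" .
  have "- C * (1 + K) \<le> - m + ln p"
  proof -
   have "K * (pot_const R / p) \<le> K * C" using K by (intro mult_left_mono) (auto simp: C_def)
   moreover have "- C \<le> ln p" using C_def by linarith
   ultimately show ?thesis by (simp add: m_def algebra_simps)
  qed
  then have "exp (- C * (1 + K)) \<le> exp (- m + ln p)" by simp
  also have "\<dots> = exp (- m) * p" using p by (simp only: exp_add exp_ln)
  finally have "ennreal (exp (- C * (1 + K))) \<le> ennreal (exp (- m)) * ennreal p"
   by (simp add: ennreal_mult[symmetric] ennreal_leI p less_imp_le)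
  also have "\<dots> \<le> ennreal (exp (- m)) * \<E> z (\<lambda>w. X w)" by (intro mult_left_mono pX) simp
  finally show ?thesis using * by (rule order_trans)
 qed
 then show ?thesis using C by blast
qed

end

context brownian
begin

text \<open>The density of the position at time \<open>t\<close> is bounded when \<open>t \<ge> 1/2\<close>, so of the two time
 intervals \<open>[0, s]\<close> and \<open>[s, t]\<close> with \<open>t \<ge> 1\<close>, one can be integrated out.\<close>

lemma potential_endpoint_bound:
 assumes f: "pot_bound f c K" and z: "norm (z - c) \<le> 1" and A [measurable]: "A \<in> sets borel"
  and Ac: "A \<subseteq> cball c 1" and t: "1 \<le> t" "t \<le> 2" and s: "0 < s" "s < t"
 shows "\<E> z (\<lambda>w. indicator A (w t) * ennreal (f (w s))) \<le> emeasure lborel A * ennreal (K * pot_const 1)"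
proof -
 note [measurable] = pot_boundD(1)[OF f]
 have ts: "0 < t - s" using s by simp
 have f': "(\<lambda>v. ennreal (f v)) \<in> borel_measurable borel" by measurable
 have mA: "(indicator A :: 'a \<Rightarrow> ennreal) \<in> borel_measurable borel" by measurable
 let ?q = "\<lambda>v. \<integral>\<^sup>+a. indicator A a * ennreal (gauss (t - s) (a - v)) \<partial>lborel"
 have mq [measurable]: "?q \<in> borel_measurable borel" by measurable
 have "\<E> z (\<lambda>w. indicator A (w t) * ennreal (f (w s))) =
   \<E> z (\<lambda>w. ennreal (f (w s)) * indicator A (shift_path s w (t - s)))"
  using s by (intro nn_integral_cong) (simp add: mult.commute)
 also have "\<dots> = \<E> z (\<lambda>w. ennreal (f (w s)) * \<E> (w s) (\<lambda>w'. indicator A (w' (t - s))))"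
  using s ts by (intro markov[where f = f and F = "\<lambda>w. indicator A (w (t - s))"] measurable_eval_P[OF _ f'] measurable_eval_P[OF _ mA]
   pot_boundD(1)[OF f]) (auto simp: min_absorb1)
 also have "\<dots> = \<E> z (\<lambda>w. ennreal (f (w s)) * ?q (w s))"
  using nn_integral_P_eval[OF mA ts] by simp
 also have "\<dots> = (\<integral>\<^sup>+v. (ennreal (f v) * ?q v) * ennreal (gauss s (v - z)) \<partial>lborel)"
  by (rule nn_integral_P_eval[OF _ s(1)]) measurable
 finally have eq: "\<E> z (\<lambda>w. indicator A (w t) * ennreal (f (w s))) =
  (\<integral>\<^sup>+v. (ennreal (f v) * ?q v) * ennreal (gauss s (v - z)) \<partial>lborel)" .
 show ?thesis
 proof (cases "1 / 2 \<le> t - s")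
  case True
  have q: "?q v \<le> emeasure lborel A" for v
  proof -
   have "?q v \<le> (\<integral>\<^sup>+a. indicator A a \<partial>lborel)"
    using gauss_le_1[OF True] by (intro nn_integral_mono) (auto simp: indicator_def)
   then show ?thesis by simp
  qed
  have "(\<integral>\<^sup>+v. (ennreal (f v) * ?q v) * ennreal (gauss s (v - z)) \<partial>lborel) \<le>
    (\<integral>\<^sup>+v. emeasure lborel A * (ennreal (f v) * ennreal (gauss s (v - z))) \<partial>lborel)"
  proof (rule nn_integral_mono)
   fix v
   have "?q v * (ennreal (f v) * ennreal (gauss s (v - z))) \<le> emeasure lborel A * (ennreal (f v) * ennreal (gauss s (v - z)))"
    by (rule mult_right_mono[OF q]) simp
   then show "(ennreal (f v) * ?q v) * ennreal (gauss s (v - z)) \<le> emeasure lborel A * (ennreal (f v) * ennreal (gauss s (v - z)))"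
    by (simp only: mult_ac)
  qed
  also have "\<dots> = emeasure lborel A * (\<integral>\<^sup>+v. ennreal (f v) * ennreal (gauss s (v - z)) \<partial>lborel)"
   by (rule nn_integral_cmult) measurable
  also have "\<dots> \<le> emeasure lborel A * ennreal (K * pot_const 1)"
   using s t by (intro mult_left_mono gauss_pot_bound[OF f z]) auto
  finally show ?thesis unfolding eq .
 next
  case False
  then have s2: "1 / 2 \<le> s" using t by simp
  have "(\<integral>\<^sup>+v. (ennreal (f v) * ?q v) * ennreal (gauss s (v - z)) \<partial>lborel) \<le> (\<integral>\<^sup>+v. ennreal (f v) * ?q v \<partial>lborel)"
  proof (rule nn_integral_mono)
   fix v
   have "ennreal (gauss s (v - z)) \<le> 1" using gauss_le_1[OF s2] by simp
   from mult_left_mono[OF this, of "ennreal (f v) * ?q v"]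
   show "(ennreal (f v) * ?q v) * ennreal (gauss s (v - z)) \<le> ennreal (f v) * ?q v"
    by simp
  qed
  also have "\<dots> = (\<integral>\<^sup>+v. \<integral>\<^sup>+a. ennreal (f v) * (indicator A a * ennreal (gauss (t - s) (a - v))) \<partial>lborel \<partial>lborel)"
   by (rule nn_integral_cong, rule nn_integral_cmult[symmetric]) measurable
  also have "\<dots> = (\<integral>\<^sup>+a. \<integral>\<^sup>+v. ennreal (f v) * (indicator A a * ennreal (gauss (t - s) (a - v))) \<partial>lborel \<partial>lborel)"
   by (rule lborel_pair.Fubini') measurable
  also have "\<dots> \<le> (\<integral>\<^sup>+a. indicator A a * ennreal (K * pot_const 1) \<partial>lborel)"
  proof (rule nn_integral_mono)
   fix a
   show "(\<integral>\<^sup>+v. ennreal (f v) * (indicator A a * ennreal (gauss (t - s) (a - v))) \<partial>lborel) \<le> indicator A a * ennreal (K * pot_const 1)"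
   proof (cases "a \<in> A")
    case True
    then have "norm (a - c) \<le> 1" using Ac by (auto simp: dist_norm norm_minus_commute)
    from gauss_pot_bound[OF f this ts] s t True show ?thesis
     by (simp add: gauss_commute[of _ a])
   qed simp
  qed
  also have "\<dots> = emeasure lborel A * ennreal (K * pot_const 1)" by (simp add: nn_integral_multc)
  finally show ?thesis unfolding eq .
 qed
qed

text \<open>Only times in \<open>[1, 2]\<close> are used. Jensen's inequality is applied on the
  event that the path is in \<open>A\<close> at time \<open>t\<close>: its probability is at least,
  and the action on it at most, a constant times the volume of \<open>A\<close>. Hence the mean
  action given the event does not blow up for small \<open>A\<close>.\<close>

lemma green_lower:
 "\<exists>C\<ge>0. \<forall>f c K z A. pot_bound f c K \<longrightarrow> norm (z - c) \<le> 1 \<longrightarrow> A \<in> sets borel \<longrightarrow> A \<subseteq> cball c 1 \<longrightarrow>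
   ennreal (exp (- C * (1 + K))) * emeasure lborel A \<le> green f z (indicator A)"
proof -
 \<comment> \<open>\<open>gauss_ge\<close> for times between 1 and 2 and for two points of a ball of
   radius 1, whose distance is at most 2.\<close>
 define p where "p = (1 / sqrt (2 * pi * 2)) ^ DIM('a) * exp (- 2\<^sup>2 / (2 * 1))"
 have p: "0 < p" by (simp add: p_def)
 define C where "C = max \<bar>ln p\<bar> (2 * pot_const 1 / p)"
 have C: "0 \<le> C" by (simp add: C_def)
 have "ennreal (exp (- C * (1 + K))) * emeasure lborel A \<le> green f z (indicator A)"
  if f: "pot_bound f c K" and z: "norm (z - c) \<le> 1" and A: "A \<in> sets borel" and Ac: "A \<subseteq> cball c 1" for f c K z A
 proof -
  note [measurable] = pot_boundD(1)[OF f] A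
  have K: "0 \<le> K" by (rule pot_boundD(2)[OF f])
  have mA: "(indicator A :: 'a \<Rightarrow> ennreal) \<in> borel_measurable borel" by measurable
  have "emeasure lborel A \<le> emeasure lborel (cball c 1)" using Ac by (intro emeasure_mono) auto
  also have "\<dots> < \<infinity>" by (simp add: emeasure_cball)
  finally have Afin: "emeasure lborel A < \<infinity>" .
  define m where "m = 2 * (K * pot_const 1) / p"
  have m: "0 \<le> m" using K p by (simp add: m_def less_imp_le)
  have semi: "ennreal (exp (- m)) * (ennreal p * emeasure lborel A) \<le> semigroup f t z (indicator A)"
   if t: "1 \<le> t" "t \<le> 2" for t
  proof -
   define X where "X w = (indicator A (w t) :: ennreal)" for w :: "real \<Rightarrow> 'a"
   have mX: "X \<in> borel_measurable path_space" unfolding X_def using t by (intro measurable_eval_P[OF _ mA]) simp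
   have "ennreal p * emeasure lborel A = (\<integral>\<^sup>+v. ennreal p * indicator A v \<partial>lborel)"
    by (simp add: nn_integral_cmult)
   also have "\<dots> \<le> (\<integral>\<^sup>+v. indicator A v * ennreal (gauss t (v - z)) \<partial>lborel)"
   proof (rule nn_integral_mono)
    fix v
    show "ennreal p * indicator A v \<le> indicator A v * ennreal (gauss t (v - z))"
    proof (cases "v \<in> A")
     case True
     then have "norm (v - c) \<le> 1" using Ac by (auto simp: dist_norm norm_minus_commute)
     then have "norm (v - z) \<le> 2" using norm_triangle_ineq[of "v - c" "c - z"] z by (simp add: norm_minus_commute)
     from gauss_ge[OF t _ this] True show ?thesis by (auto simp: p_def intro!: ennreal_leI)
    qed simp
   qed
   also have "\<dots> = \<E> z (\<lambda>w. X w)"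
    unfolding X_def using t by (intro nn_integral_P_eval[symmetric] mA) auto
   finally have pX: "ennreal p * emeasure lborel A \<le> \<E> z (\<lambda>w. X w)" .
   have X1: "\<E> z (\<lambda>w. X w) \<le> 1"
   proof -
    have "\<E> z (\<lambda>w. X w) \<le> \<E> z (\<lambda>w. 1)"
     by (intro nn_integral_mono) (auto simp: X_def indicator_def)
    then show ?thesis by simp
   qed
   have "\<E> z (\<lambda>w. X w * action f t w) \<le> ennreal t * (emeasure lborel A * ennreal (K * pot_const 1))"
    using t unfolding X_def
    by (intro nn_integral_action[OF pot_boundD(1)[OF f] mX[unfolded X_def]] potential_endpoint_bound[OF f z A Ac]) auto
   also have "\<dots> \<le> ennreal 2 * (emeasure lborel A * ennreal (K * pot_const 1))"
    using t by (intro mult_right_mono ennreal_leI) auto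
   also have "\<dots> = (ennreal 2 * ennreal (K * pot_const 1)) * emeasure lborel A"
    by (simp only: mult_ac)
   also have "ennreal 2 * ennreal (K * pot_const 1) = ennreal m * ennreal p"
    using p m K by (subst (1 2) ennreal_mult[symmetric]) (auto simp: m_def less_imp_le)
   also have "ennreal m * ennreal p * emeasure lborel A \<le> ennreal m * \<E> z (\<lambda>w. X w)"
    unfolding mult.assoc by (intro mult_left_mono pX) simp
   finally have "ennreal (exp (- m)) * \<E> z (\<lambda>w. X w) \<le> \<E> z (\<lambda>w. X w * ennreal (exp_neg (action f t w)))"
    using mX measurable_action[OF pot_boundD(1)[OF f]] m X1
    by (intro exp_neg_jensen) (auto simp: le_less_trans)
   also have "\<dots> = semigroup f t z (indicator A)"
    by (simp add: semigroup_def X_def survival_action mult.commute)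
   finally show ?thesis using mult_left_mono[OF pX, of "ennreal (exp (- m))"] by (simp add: order_trans)
  qed
  have "ennreal (exp (- C * (1 + K))) * emeasure lborel A \<le> ennreal (exp (- m)) * (ennreal p * emeasure lborel A)"
  proof -
   have "- C * (1 + K) \<le> - m + ln p"
   proof -
    have "K * (2 * pot_const 1 / p) \<le> K * C" using K by (intro mult_left_mono) (auto simp: C_def)
    moreover have "- C \<le> ln p" using C_def by linarith
    ultimately show ?thesis by (simp add: m_def algebra_simps)
   qed
   then have "exp (- C * (1 + K)) \<le> exp (- m + ln p)" by simp
   also have "\<dots> = exp (- m) * p" using p by (simp only: exp_add exp_ln)
   finally have "ennreal (exp (- C * (1 + K))) \<le> ennreal (exp (- m)) * ennreal p"
    by (simp add: ennreal_mult[symmetric] ennreal_leI p less_imp_le)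
   from mult_right_mono[OF this, of "emeasure lborel A"] show ?thesis by (simp add: mult.assoc)
  qed
  also have "\<dots> = (\<integral>\<^sup>+t. (ennreal (exp (- m)) * (ennreal p * emeasure lborel A)) * indicator {1..2::real} t \<partial>lborel)"
   by (simp add: nn_integral_cmult)
  also have "\<dots> \<le> (\<integral>\<^sup>+t. semigroup f t z (indicator A) * indicator {0..} t \<partial>lborel)"
   using semi by (intro nn_integral_mono) (auto simp: indicator_def)
  also have "\<dots> = green f z (indicator A)"
   by (rule green_eq_semigroup[symmetric]) measurable
  finally show ?thesis .
 qed
 then show ?thesis using C by blast
qed

section \<open>Upper bounds for the Green measure of small sets\<close>

definition green_bound :: "('a \<Rightarrow> real) \<Rightarrow> 'a \<Rightarrow> real \<Rightarrow> bool" where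
 "green_bound f c L \<longleftrightarrow> f \<in> borel_measurable borel \<and> 1 \<le> L \<and>
   (\<forall>x v. green f x (indicator (ball v 1)) \<le> ennreal (L * exp ((norm (v - c))\<^sup>2 / 16)))"

text \<open>The density of the position has to be integrated down to time 0. In dimension one it is
  at most \<open>t powr (- 1 / 2)\<close>, which is integrable; otherwise \<open>A\<close> must keep
  a distance from \<open>z\<close>.\<close>

lemma short_time_occupation:
 "\<exists>C>0. \<forall>z A. A \<in> sets borel \<longrightarrow> DIM('a) = 1 \<or> (\<forall>a\<in>A. 1 / 4 \<le> dist z a) \<longrightarrow>
   (\<integral>\<^sup>+t. (\<integral>\<^sup>+v. indicator A v * ennreal (gauss t (v - z)) \<partial>lborel) * indicator {0<..1} t \<partial>lborel)
    \<le> ennreal C * emeasure lborel (A :: 'a set)"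
proof (cases "DIM('a) = 1")
 case True
 have g: "gauss t (v::'a) \<le> t powr (- 1 / 2)" if t: "0 < t" for t v
 proof -
  have "gauss t v \<le> 1 / sqrt (2 * pi * t) * 1"
   unfolding gauss_eq[OF t] True using t by (intro mult_mono) auto
  also have "\<dots> \<le> 1 / sqrt t"
  proof -
   have "1 * t \<le> 2 * pi * t" using t pi_ge_two by (intro mult_right_mono) auto
   then have "sqrt t \<le> sqrt (2 * pi * t)" by simp
   then show ?thesis using t by (simp only: mult_1_right) (intro frac_le, auto)
  qed
  also have "\<dots> = t powr (- 1 / 2)"
   using t by (simp add: powr_minus_divide powr_half_sqrt)
  finally show ?thesis by simp
 qed
 have hi: "((\<lambda>t. t powr (- 1 / 2)) has_integral 2) {0..1::real}"
  using has_integral_powr_from_0[of "- 1 / 2" 1] by simp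
 have I: "(\<integral>\<^sup>+t. ennreal (t powr (- 1 / 2)) * indicator {0..1::real} t \<partial>lborel) = ennreal 2"
  by (rule nn_integral_has_integral_lebesgue'[OF _ hi]) auto
 show ?thesis
 proof (intro exI[of _ 2] conjI allI impI)
  fix z :: 'a and A :: "'a set" assume [measurable]: "A \<in> sets borel"
  have "(\<integral>\<^sup>+t. (\<integral>\<^sup>+v. indicator A v * ennreal (gauss t (v - z)) \<partial>lborel) * indicator {0<..1} t \<partial>lborel)
   \<le> (\<integral>\<^sup>+t. emeasure lborel A * (ennreal (t powr (- 1 / 2)) * indicator {0..1} t) \<partial>lborel)"
  proof (rule nn_integral_mono)
   fix t :: real
   show "(\<integral>\<^sup>+v. indicator A v * ennreal (gauss t (v - z)) \<partial>lborel) * indicator {0<..1} t \<le>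
    emeasure lborel A * (ennreal (t powr (- 1 / 2)) * indicator {0..1} t)"
   proof (cases "t \<in> {0<..1}")
    case True
    then have t: "0 < t" by simp
    have "(\<integral>\<^sup>+v. indicator A v * ennreal (gauss t (v - z)) \<partial>lborel) \<le> (\<integral>\<^sup>+v. indicator A v * ennreal (t powr (- 1 / 2)) \<partial>lborel)"
     using g[OF t] by (intro nn_integral_mono mult_left_mono ennreal_leI) auto
    also have "\<dots> = emeasure lborel A * ennreal (t powr (- 1 / 2))" by (simp add: nn_integral_multc)
    finally show ?thesis using True by simp
   qed simp
  qed
  also have "\<dots> = emeasure lborel A * ennreal 2"
   unfolding I[symmetric] by (rule nn_integral_cmult) measurable
  finally show "(\<integral>\<^sup>+t. (\<integral>\<^sup>+v. indicator A v * ennreal (gauss t (v - z)) \<partial>lborel) * indicator {0<..1} t \<partial>lborel)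
    \<le> ennreal 2 * emeasure lborel A" by (simp add: mult.commute)
 qed simp
next
 case False
 obtain C where C: "0 < C" "\<And>t z. 0 < t \<Longrightarrow> t \<le> 1 \<Longrightarrow> 1 / 4 \<le> norm (z::'a) \<Longrightarrow> gauss t z \<le> C"
  using gauss_away_bounded by metis
 show ?thesis
 proof (intro exI[of _ C] conjI allI impI)
  fix z :: 'a and A :: "'a set" assume [measurable]: "A \<in> sets borel" and "DIM('a) = 1 \<or> (\<forall>a\<in>A. 1 / 4 \<le> dist z a)"
  then have d: "1 / 4 \<le> norm (a - z)" if "a \<in> A" for a using that False by (auto simp: dist_norm norm_minus_commute)
  have "(\<integral>\<^sup>+t. (\<integral>\<^sup>+v. indicator A v * ennreal (gauss t (v - z)) \<partial>lborel) * indicator {0<..1} t \<partial>lborel)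
   \<le> (\<integral>\<^sup>+t. (ennreal C * emeasure lborel A) * indicator {0<..1::real} t \<partial>lborel)"
  proof (rule nn_integral_mono)
   fix t :: real
   show "(\<integral>\<^sup>+v. indicator A v * ennreal (gauss t (v - z)) \<partial>lborel) * indicator {0<..1} t \<le>
    (ennreal C * emeasure lborel A) * indicator {0<..1} t"
   proof (cases "t \<in> {0<..1}")
    case True
    have "(\<integral>\<^sup>+v. indicator A v * ennreal (gauss t (v - z)) \<partial>lborel) \<le> (\<integral>\<^sup>+v. ennreal C * indicator A v \<partial>lborel)"
     using C(2) d True by (intro nn_integral_mono) (auto simp: indicator_def intro!: ennreal_leI)
    then show ?thesis using True by (simp add: nn_integral_cmult)
   qed simp
  qed
  also have "\<dots> = ennreal C * emeasure lborel A" by (simp add: nn_integral_cmult)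
  finally show "(\<integral>\<^sup>+t. (\<integral>\<^sup>+v. indicator A v * ennreal (gauss t (v - z)) \<partial>lborel) * indicator {0<..1} t \<partial>lborel)
    \<le> ennreal C * emeasure lborel A" .
 qed (rule C(1))
qed

text \<open>After time 1 the density of the position is dominated by a mixture of indicators of unit
  balls, with Gaussian weights of rate 1/4 in the centre \<open>u\<close>. Symmetry exchanges the
  Green measure of \<open>A\<close> integrated over \<open>ball u 1\<close> for the Green measure of
  \<open>ball u 1\<close> integrated over \<open>A\<close>. By hypothesis the latter is at most the
  volume of \<open>A\<close> times a weight of rate 1/16.\<close>

lemma green_upper:
 "\<exists>C>0. \<forall>f c L z A. green_bound f c L \<longrightarrow> norm (z - c) \<le> 1 \<longrightarrow> A \<in> sets borel \<longrightarrow>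
   DIM('a) = 1 \<or> (\<forall>a\<in>A. 1 / 4 \<le> dist z a) \<longrightarrow>
   green f z (indicator A) \<le> ennreal (C * L) * emeasure lborel A"
proof -
 obtain C1 where c1: "0 < C1 \<and> (\<forall>z A. A \<in> sets borel \<longrightarrow> DIM('a) = 1 \<or> (\<forall>a\<in>A. 1 / 4 \<le> dist z a) \<longrightarrow>
   (\<integral>\<^sup>+t. (\<integral>\<^sup>+v. indicator A v * ennreal (gauss t (v - z)) \<partial>lborel) * indicator {0<..1} t \<partial>lborel)
    \<le> ennreal C1 * emeasure lborel (A :: 'a set))"
  by (rule exE[OF short_time_occupation])
 note C1 = conjunct1[OF c1] and short = conjunct2[OF c1, rule_format]
 define b where "b = measure lborel (ball (0::'a) 1)"
 have b: "0 < b" "emeasure lborel (ball v 1) = ennreal b" for v :: 'a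
  by (auto simp: b_def content_ball_pos emeasure_ball content_ball)
 \<comment> \<open>3/16 is the rate 1/4 of the mixture less the rate 1/16 in
   \<open>green_bound\<close>.\<close>
 define I where "I = (\<integral>\<^sup>+u. ennreal (exp (- (3 / 16) * (norm (u - (0 :: 'a)))\<^sup>2)) \<partial>lborel)"
 have "I < \<infinity>" unfolding I_def by (rule nn_integral_exp_norm) simp
 then obtain i where i: "I = ennreal i" "0 \<le> i" by (cases I) auto
 have Ic: "(\<integral>\<^sup>+u. ennreal (exp (- (3 / 16) * (norm (u - c))\<^sup>2)) \<partial>lborel) = I" for c :: 'a
  using nn_integral_lborel_shift[of "\<lambda>u. ennreal (exp (- (3 / 16) * (norm u)\<^sup>2))" "- c"]
  by (simp add: I_def add.commute[of "- c"])
 define C where "C = C1 + exp 2 / b * i"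
 have C: "0 < C" using C1 b i by (simp add: C_def add_pos_nonneg)
 have "green f z (indicator A) \<le> ennreal (C * L) * emeasure lborel A"
  if f: "green_bound f c L" and z: "norm (z - c) \<le> 1" and A: "A \<in> sets borel"
   and d: "DIM('a) = 1 \<or> (\<forall>a\<in>A. 1 / 4 \<le> dist z a)" for f c L z A
 proof -
  have fm: "f \<in> borel_measurable borel" and L: "1 \<le> L"
   and gb: "\<And>x v. green f x (indicator (ball v 1)) \<le> ennreal (L * exp ((norm (v - c))\<^sup>2 / 16))"
   using f by (auto simp: green_bound_def)
  note [measurable] = fm A
  have mA: "(indicator A :: 'a \<Rightarrow> ennreal) \<in> borel_measurable borel" by measurable
  have mB: "(indicator (ball v 1) :: 'a \<Rightarrow> ennreal) \<in> borel_measurable borel" for v by measurable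
  have mG [measurable]: "(\<lambda>v. green f v (indicator A)) \<in> borel_measurable borel"
   by (rule measurable_green[OF fm mA])
  interpret pair_sigma_finite "P z" "lborel :: real measure"
   using prob_space_imp_sigma_finite[OF prob_P[of z]] sigma_finite_lborel by (rule pair_sigma_finite.intro)
  have mAp: "(\<lambda>p. indicator A (fst p (max 0 (snd p))) :: ennreal) \<in> borel_measurable (path_space \<Otimes>\<^sub>M (borel :: real measure))"
   by (rule measurable_compose[OF measurable_path_eval mA]) auto
  have "\<E> z (\<lambda>w. occupation f (indicator A) 1 w) \<le>
    \<E> z (\<lambda>w. \<integral>\<^sup>+t. indicator A (w (max 0 t)) * indicator {0..1} t \<partial>lborel)"
   unfolding occupation_max(1) by (intro nn_integral_mono) (auto simp: indicator_def)
  also have "\<dots> = (\<integral>\<^sup>+t. \<integral>\<^sup>+w. indicator A (w (max 0 t)) * indicator {0..1} t \<partial>P z \<partial>lborel)"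
  proof (rule Fubini'[symmetric])
   have [measurable]: "(\<lambda>p. indicator A (fst p (max 0 (snd p))) :: ennreal) \<in> borel_measurable (P z \<Otimes>\<^sub>M lborel)"
    using mAp by (simp cong: measurable_cong_sets)
   show "(\<lambda>(w, t). indicator A (w (max 0 t)) * indicator {0..1} t :: ennreal) \<in> borel_measurable (P z \<Otimes>\<^sub>M lborel)"
    unfolding case_prod_beta by measurable
  qed
  also have "\<dots> \<le> (\<integral>\<^sup>+t. (\<integral>\<^sup>+v. indicator A v * ennreal (gauss t (v - z)) \<partial>lborel) * indicator {0<..1} t \<partial>lborel)"
  proof (rule nn_integral_mono_AE)
   show "AE t in lborel. \<E> z (\<lambda>w. indicator A (w (max 0 t)) * indicator {0..1} t) \<le>
     (\<integral>\<^sup>+v. indicator A v * ennreal (gauss t (v - z)) \<partial>lborel) * indicator {0<..1} t"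
    using AE_lborel_singleton[of 0]
    by eventually_elim (use nn_integral_P_eval[OF mA, of _ z] in \<open>auto simp: indicator_def max_absorb2\<close>)
  qed
  also have "\<dots> \<le> ennreal C1 * emeasure lborel A" by (rule short[OF A d])
  also have "\<dots> \<le> ennreal (C1 * L) * emeasure lborel A"
   using C1 L by (intro mult_right_mono ennreal_leI) auto
  finally have 1: "\<E> z (\<lambda>w. occupation f (indicator A) 1 w) \<le> ennreal (C1 * L) * emeasure lborel A" .
  let ?e = "\<lambda>u. ennreal (exp (- (1 / 4) * (norm (u - c))\<^sup>2))" and ?k = "\<lambda>u v. indicator {p. dist (fst p) (snd p) < 1} (u, v) * green f v (indicator A)"
  \<comment> \<open>The division by \<open>b\<close> averages over the centres \<open>u\<close>
    within 1 of \<open>v\<close>. The constant \<open>exp 2\<close> comes from squaring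
    \<open>norm (u - c) \<le> norm (v - z) + 2\<close>.\<close>
  have g: "ennreal (gauss 1 (v - z)) \<le> ennreal (exp 2 / b) * (\<integral>\<^sup>+u. ?e u * indicator (ball u 1) v \<partial>lborel)" for v
  proof -
   have "ennreal (gauss 1 (v - z)) = ennreal (exp 2 / b) * (ennreal (exp (- 2) * gauss 1 (v - z)) * emeasure lborel (ball v 1))"
    using b by (simp add: ennreal_mult[symmetric] exp_minus)
   also have "ennreal (exp (- 2) * gauss 1 (v - z)) * emeasure lborel (ball v 1) =
    (\<integral>\<^sup>+u. ennreal (exp (- 2) * gauss 1 (v - z)) * indicator (ball v 1) u \<partial>lborel)"
    by (simp add: nn_integral_cmult)
   also have "\<dots> \<le> (\<integral>\<^sup>+u. ?e u * indicator (ball u 1) v \<partial>lborel)"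
   proof (rule nn_integral_mono)
    fix u
    show "ennreal (exp (- 2) * gauss 1 (v - z)) * indicator (ball v 1) u \<le> ?e u * indicator (ball u 1) v"
    proof (cases "u \<in> ball v 1")
     case True
     then have uv: "norm (u - v) \<le> 1" "v \<in> ball u 1" by (auto simp: dist_norm norm_minus_commute)
     have "norm (z - c + (u - v)) \<le> 2" using norm_triangle_ineq[of "z - c" "u - v"] z uv by simp
     then have "norm (u - c) \<le> norm (v - z) + 2"
      using norm_triangle_ineq[of "v - z" "z - c + (u - v)"] by simp
     then have "(norm (u - c))\<^sup>2 \<le> (norm (v - z) + 2)\<^sup>2" by (intro power_mono) auto
     also have "\<dots> \<le> 2 * (norm (v - z))\<^sup>2 + 8"
      using zero_le_power2[of "norm (v - z) - 2"] by (simp add: power2_eq_square algebra_simps)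
     finally have "- 2 + - (norm (v - z))\<^sup>2 / 2 \<le> - (1 / 4) * (norm (u - c))\<^sup>2" by simp
     then have e: "exp (- 2) * exp (- (norm (v - z))\<^sup>2 / 2) \<le> exp (- (1 / 4) * (norm (u - c))\<^sup>2)"
      by (simp only: exp_add[symmetric] exp_le_cancel_iff)
     have "gauss 1 (v - z) \<le> 1 * exp (- (norm (v - z))\<^sup>2 / 2)"
     proof -
      have "(1 / sqrt (2 * pi * 1)) ^ DIM('a) \<le> 1" using pi_ge_two by (intro power_le_one) auto
      then show ?thesis by (subst gauss_eq) (auto intro!: mult_right_mono)
     qed
     then have "exp (- 2) * gauss 1 (v - z) \<le> exp (- (1 / 4) * (norm (u - c))\<^sup>2)"
      using e by (intro order_trans[OF mult_left_mono e]) auto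
     then show ?thesis using True uv by (simp add: ennreal_leI)
    qed simp
   qed
   finally show ?thesis by (simp add: mult_left_mono)
  qed
  have "\<E> z (\<lambda>w. surv f 1 w * green f (w 1) (indicator A)) \<le> \<E> z (\<lambda>w. green f (w 1) (indicator A))"
  proof (rule nn_integral_mono)
   fix w
   have "surv f 1 w \<le> 1" by simp
   from mult_right_mono[OF this, of "green f (w 1) (indicator A)"]
   show "surv f 1 w * green f (w 1) (indicator A) \<le> green f (w 1) (indicator A)" by simp
  qed
  also have "\<dots> = (\<integral>\<^sup>+v. green f v (indicator A) * ennreal (gauss 1 (v - z)) \<partial>lborel)"
   by (rule nn_integral_P_eval[OF mG]) simp
  also have "\<dots> \<le> (\<integral>\<^sup>+v. green f v (indicator A) * (ennreal (exp 2 / b) *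
    (\<integral>\<^sup>+u. ?e u * indicator (ball u 1) v \<partial>lborel)) \<partial>lborel)"
   by (intro nn_integral_mono mult_left_mono g) simp
  also have "\<dots> = (\<integral>\<^sup>+v. \<integral>\<^sup>+u. ennreal (exp 2 / b) * (?e u * ?k u v) \<partial>lborel \<partial>lborel)"
  proof (rule nn_integral_cong)
   fix v
   have "green f v (indicator A) * (ennreal (exp 2 / b) * (\<integral>\<^sup>+u. ?e u * indicator (ball u 1) v \<partial>lborel)) =
    (green f v (indicator A) * ennreal (exp 2 / b)) * (\<integral>\<^sup>+u. ?e u * indicator (ball v 1) u \<partial>lborel)"
    by (simp add: mult.assoc indicator_def dist_commute)
   also have "\<dots> = (\<integral>\<^sup>+u. (green f v (indicator A) * ennreal (exp 2 / b)) * (?e u * indicator (ball v 1) u) \<partial>lborel)"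
    by (rule nn_integral_cmult[symmetric]) measurable
   also have "\<dots> = (\<integral>\<^sup>+u. ennreal (exp 2 / b) * (?e u * ?k u v) \<partial>lborel)"
    by (intro nn_integral_cong) (simp add: mult_ac indicator_def dist_commute)
   finally show "green f v (indicator A) * (ennreal (exp 2 / b) * (\<integral>\<^sup>+u. ?e u * indicator (ball u 1) v \<partial>lborel)) =
    (\<integral>\<^sup>+u. ennreal (exp 2 / b) * (?e u * ?k u v) \<partial>lborel)" .
  qed
  also have "\<dots> = (\<integral>\<^sup>+u. \<integral>\<^sup>+v. ennreal (exp 2 / b) * (?e u * ?k u v) \<partial>lborel \<partial>lborel)"
  proof (rule lborel_pair.Fubini')
   have [measurable]: "{p. dist (fst p) (snd p :: 'a) < 1} \<in> sets (borel \<Otimes>\<^sub>M borel)"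
    unfolding borel_prod by (intro borel_open open_Collect_less continuous_intros)
   show "(\<lambda>(u, v). ennreal (exp 2 / b) * (?e u * ?k u v)) \<in> borel_measurable (lborel \<Otimes>\<^sub>M lborel)"
    by (simp add: case_prod_beta cong: measurable_cong_sets sets_pair_measure_cong)
  qed
  also have "\<dots> = (\<integral>\<^sup>+u. ennreal (exp 2 / b) * (?e u * (\<integral>\<^sup>+v. indicator (ball u 1) v * green f v (indicator A) \<partial>lborel)) \<partial>lborel)"
  proof (rule nn_integral_cong)
   fix u
   have "(\<lambda>v. indicator (ball u 1) v * green f v (indicator A)) \<in> borel_measurable lborel" by measurable
   then have "(\<integral>\<^sup>+v. (ennreal (exp 2 / b) * ?e u) * (indicator (ball u 1) v * green f v (indicator A)) \<partial>lborel) =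
    (ennreal (exp 2 / b) * ?e u) * (\<integral>\<^sup>+v. indicator (ball u 1) v * green f v (indicator A) \<partial>lborel)"
    by (rule nn_integral_cmult)
   then show "(\<integral>\<^sup>+v. ennreal (exp 2 / b) * (?e u * ?k u v) \<partial>lborel) =
    ennreal (exp 2 / b) * (?e u * (\<integral>\<^sup>+v. indicator (ball u 1) v * green f v (indicator A) \<partial>lborel))"
    by (simp add: mult.assoc indicator_def)
  qed
  also have "\<dots> \<le> (\<integral>\<^sup>+u. (ennreal (exp 2 / b * L) * emeasure lborel A) * ennreal (exp (- (3 / 16) * (norm (u - c))\<^sup>2)) \<partial>lborel)"
  proof (rule nn_integral_mono)
   fix u
   have "(\<integral>\<^sup>+v. indicator (ball u 1) v * green f v (indicator A) \<partial>lborel) = (\<integral>\<^sup>+v. indicator A v * green f v (indicator (ball u 1)) \<partial>lborel)"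
    by (rule green_symmetric[OF fm mB mA])
   also have "\<dots> \<le> (\<integral>\<^sup>+v. indicator A v * ennreal (L * exp ((norm (u - c))\<^sup>2 / 16)) \<partial>lborel)"
    by (intro nn_integral_mono mult_left_mono gb) simp
   also have "\<dots> = emeasure lborel A * ennreal (L * exp ((norm (u - c))\<^sup>2 / 16))" by (simp add: nn_integral_multc)
   finally have "ennreal (exp 2 / b) * (?e u * (\<integral>\<^sup>+v. indicator (ball u 1) v * green f v (indicator A) \<partial>lborel)) \<le>
    ennreal (exp 2 / b) * (?e u * (emeasure lborel A * ennreal (L * exp ((norm (u - c))\<^sup>2 / 16))))"
    by (intro mult_left_mono) auto
   also have "\<dots> = emeasure lborel A * (ennreal (exp 2 / b) * (?e u * ennreal (L * exp ((norm (u - c))\<^sup>2 / 16))))"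
    by (simp only: mult_ac)
   also have "ennreal (exp 2 / b) * (?e u * ennreal (L * exp ((norm (u - c))\<^sup>2 / 16))) =
    ennreal (exp 2 / b * L) * ennreal (exp (- (3 / 16) * (norm (u - c))\<^sup>2))"
   proof -
    have "exp (- (1 / 4) * (norm (u - c))\<^sup>2) * exp ((norm (u - c))\<^sup>2 / 16) = exp (- (3 / 16) * (norm (u - c))\<^sup>2)"
     by (simp add: exp_add[symmetric])
    then have "exp 2 / b * (exp (- (1 / 4) * (norm (u - c))\<^sup>2) * (L * exp ((norm (u - c))\<^sup>2 / 16))) = exp 2 / b * L * exp (- (3 / 16) * (norm (u - c))\<^sup>2)"
     by (simp add: mult_ac)
    then show ?thesis using b L by (simp only: ennreal_mult[symmetric] ennreal_mult'[symmetric] mult_nonneg_nonneg exp_ge_zero divide_nonneg_pos)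
   qed
   finally show "ennreal (exp 2 / b) * (?e u * (\<integral>\<^sup>+v. indicator (ball u 1) v * green f v (indicator A) \<partial>lborel)) \<le>
    (ennreal (exp 2 / b * L) * emeasure lborel A) * ennreal (exp (- (3 / 16) * (norm (u - c))\<^sup>2))"
    by (simp only: mult_ac)
  qed
  also have "\<dots> = (ennreal (exp 2 / b * L) * emeasure lborel A) * ennreal i"
   unfolding i(1)[symmetric] Ic[of c, symmetric] by (rule nn_integral_cmult) measurable
  also have "\<dots> = ennreal (exp 2 / b * i * L) * emeasure lborel A"
  proof -
   have "ennreal (exp 2 / b * i * L) = ennreal (exp 2 / b * L) * ennreal i"
    using b L i by (subst ennreal_mult[symmetric]) (auto simp: mult_ac)
   then show ?thesis by (simp only: mult_ac)
  qed
  finally have 2: "\<E> z (\<lambda>w. surv f 1 w * green f (w 1) (indicator A)) \<le> ennreal (exp 2 / b * i * L) * emeasure lborel A" .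
  have "green f z (indicator A) \<le> ennreal (C1 * L) * emeasure lborel A + ennreal (exp 2 / b * i * L) * emeasure lborel A"
   using green_markov[OF fm mA, of 1 z] add_mono[OF 1 2] by simp
  also have "\<dots> = ennreal (C * L) * emeasure lborel A"
  proof -
   have "ennreal (C * L) = ennreal (C1 * L) + ennreal (exp 2 / b * i * L)"
    using C1 b i L by (subst ennreal_plus[symmetric]) (auto simp: C_def algebra_simps)
   then show ?thesis by (simp only: distrib_right)
  qed
  finally show ?thesis .
 qed
 then show ?thesis using C by blast
qed

end

section \<open>Continuity in the starting point\<close>

lemma gauss_translate_dominated:
 fixes u v z :: "'a::euclidean_space"
 assumes t: "0 < t" and z: "norm (z - u) \<le> 1"
 shows "gauss t (v - z) \<le> (1 / sqrt (2 * pi * t)) ^ DIM('a) * exp (1 / (2 * t)) * exp (- (1 / (4 * t)) * (norm (v - u))\<^sup>2)"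
proof -
 have "(norm (v - u))\<^sup>2 \<le> 2 * (norm (v - z))\<^sup>2 + 2 * 1\<^sup>2"
  by (rule power2_dist_le) (rule z)
 then have "(norm (v - u))\<^sup>2 / (4 * t) \<le> (2 * (norm (v - z))\<^sup>2 + 2 * 1\<^sup>2) / (4 * t)"
  using t by (intro divide_right_mono) auto
 then have "- (norm (v - z))\<^sup>2 / (2 * t) \<le> 1 / (2 * t) + - (1 / (4 * t)) * (norm (v - u))\<^sup>2"
  by (simp add: add_divide_distrib)
 then have "exp (- (norm (v - z))\<^sup>2 / (2 * t)) \<le> exp (1 / (2 * t)) * exp (- (1 / (4 * t)) * (norm (v - u))\<^sup>2)"
  by (simp only: exp_add[symmetric] exp_le_cancel_iff)
 then show ?thesis
  unfolding gauss_eq[OF t] mult.assoc using t by (intro mult_left_mono) auto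
qed

context brownian
begin

text \<open>Smoothing: after any positive time, bounded measurable functions become continuous in
  the starting point. The densities from starting points near the limit have a common integrable
  majorant.\<close>

lemma heat_continuous:
 assumes F [measurable]: "F \<in> borel_measurable borel" and F1: "\<And>v. F v \<le> (1::ennreal)" and t: "0 < t"
  and z: "z \<longlonglongrightarrow> z0"
 shows "(\<lambda>n. \<integral>\<^sup>+w. F (w t) \<partial>P (z n)) \<longlonglongrightarrow> (\<E> z0 (\<lambda>w. F (w t)))"
proof -
 obtain N where "\<forall>n\<ge>N. norm (z n - z0) < 1"
  using LIMSEQ_D[OF z, of 1] by auto
 then have N: "\<And>n. N \<le> n \<Longrightarrow> norm (z n - z0) \<le> 1" by (meson less_imp_le)
 define c where "c = (1 / sqrt (2 * pi * t)) ^ DIM('a) * exp (1 / (2 * t))"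
 have c: "0 \<le> c" using t by (simp add: c_def)
 have "(\<lambda>n. \<integral>\<^sup>+v. F v * ennreal (gauss t (v - z (n + N))) \<partial>lborel) \<longlonglongrightarrow> (\<integral>\<^sup>+v. F v * ennreal (gauss t (v - z0)) \<partial>lborel)"
 proof (rule nn_integral_dominated_convergence[where w = "\<lambda>v. ennreal c * ennreal (exp (- (1 / (4 * t)) * (norm (v - z0))\<^sup>2))"])
  show "AE v in lborel. F v * ennreal (gauss t (v - z (n + N))) \<le> ennreal c * ennreal (exp (- (1 / (4 * t)) * (norm (v - z0))\<^sup>2))" for n
  proof (rule AE_I2)
   fix v
   have "F v * ennreal (gauss t (v - z (n + N))) \<le> 1 * ennreal (gauss t (v - z (n + N)))"
    by (intro mult_right_mono F1) simp
   also have "\<dots> \<le> ennreal (c * exp (- (1 / (4 * t)) * (norm (v - z0))\<^sup>2))"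
    using gauss_translate_dominated[OF t N[of "n + N"], of v] by (simp add: c_def ennreal_leI)
   finally show "F v * ennreal (gauss t (v - z (n + N))) \<le> ennreal c * ennreal (exp (- (1 / (4 * t)) * (norm (v - z0))\<^sup>2))"
    using c by (simp add: ennreal_mult)
  qed
  show "(\<integral>\<^sup>+v. ennreal c * ennreal (exp (- (1 / (4 * t)) * (norm (v - z0))\<^sup>2)) \<partial>lborel) < \<infinity>"
   using nn_integral_exp_norm[of "1 / (4 * t)" z0] t by (simp add: nn_integral_cmult ennreal_mult_less_top)
  show "AE v in lborel. (\<lambda>n. F v * ennreal (gauss t (v - z (n + N)))) \<longlonglongrightarrow> F v * ennreal (gauss t (v - z0))"
  proof (rule AE_I2)
   fix v
   have "(\<lambda>n. z (n + N)) \<longlonglongrightarrow> z0" using z by (rule LIMSEQ_ignore_initial_segment)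
   then have "(\<lambda>n. (1 / sqrt (2 * pi * t)) ^ DIM('a) * exp (- (norm (v - z (n + N)))\<^sup>2 / (2 * t))) \<longlonglongrightarrow>
     (1 / sqrt (2 * pi * t)) ^ DIM('a) * exp (- (norm (v - z0))\<^sup>2 / (2 * t))"
    using t by (intro tendsto_intros) auto
   then have "(\<lambda>n. gauss t (v - z (n + N))) \<longlonglongrightarrow> gauss t (v - z0)"
    unfolding gauss_eq[OF t] .
   moreover have "F v < \<top>" using F1[of v] by (simp add: le_less_trans)
   ultimately show "(\<lambda>n. F v * ennreal (gauss t (v - z (n + N)))) \<longlonglongrightarrow> F v * ennreal (gauss t (v - z0))"
    by (intro ennreal_tendsto_cmult tendsto_ennrealI)
  qed
 qed measurable
 then have "(\<lambda>n. \<integral>\<^sup>+v. F v * ennreal (gauss t (v - z n)) \<partial>lborel) \<longlonglongrightarrow> (\<integral>\<^sup>+v. F v * ennreal (gauss t (v - z0)) \<partial>lborel)"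
  by (rule LIMSEQ_offset)
 then show ?thesis by (simp only: nn_integral_P_eval[OF F t])
qed

text \<open>The largest displacement up to time \<open>t\<close>; rational times suffice by continuity.\<close>

definition excursion :: "real \<Rightarrow> (real \<Rightarrow> 'a) \<Rightarrow> ennreal" where
 "excursion t w = (SUP q\<in>{q\<in>\<rat>. 0 \<le> q \<and> q \<le> 1}. ennreal (norm (w (q * t) - w 0)))"

lemma measurable_excursion: "0 \<le> t \<Longrightarrow> excursion t \<in> borel_measurable path_space"
 unfolding excursion_def[abs_def]
proof (rule borel_measurable_SUP)
 assume t: "0 \<le> t"
 show "countable {q\<in>\<rat>. 0 \<le> q \<and> q \<le> (1::real)}"
  by (rule countable_subset[OF _ countable_rat]) auto
 fix q :: real assume "q \<in> {q\<in>\<rat>. 0 \<le> q \<and> q \<le> 1}"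
 then have [measurable]: "(\<lambda>w. w (q * t)) \<in> borel_measurable path_space" "(\<lambda>w. w 0) \<in> borel_measurable path_space"
  using t by (auto intro!: measurable_path_coord)
 show "(\<lambda>w. ennreal (norm (w (q * t) - w 0))) \<in> borel_measurable path_space" by measurable
qed

lemma hit_imp_excursion:
 assumes w: "w \<in> hit_event y" "hit y w \<le> t" and t: "0 \<le> t" and far: "1 + r \<le> dist y (w 0)" and r: "s < r" "0 \<le> s"
 shows "ennreal s \<le> excursion t w"
proof -
 have ws: "w \<in> space path_space" using w hit_event_space by blast
 obtain n :: nat where n: "inverse (real (Suc n)) < r - s" using reals_Archimedean[of "r - s"] r by auto
 obtain q where q: "q \<in> {q\<in>\<rat>. 0 \<le> q \<and> q \<le> 1}" "dist y (w (q * t)) < 1 + inverse (real (Suc n))"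
  using hit_le_iff_rational[OF ws t, of y] w by blast
 have "dist y (w 0) \<le> dist y (w (q * t)) + norm (w (q * t) - w 0)"
  using dist_triangle[of y "w 0" "w (q * t)"] by (simp add: dist_norm)
 then have "s \<le> norm (w (q * t) - w 0)" using far q(2) n by linarith
 then have "ennreal s \<le> ennreal (norm (w (q * t) - w 0))" by (rule ennreal_leI)
 also have "\<dots> \<le> excursion t w" unfolding excursion_def by (rule SUP_upper[OF q(1)])
 finally show ?thesis .
qed

text \<open>From the start 0 the probability tends to 0 with \<open>t\<close>, by continuity of
  paths at time 0. Displacements do not depend on the starting point, so the bound is
  uniform.\<close>

lemma excursion_small:
 assumes r: "0 < r" and e: "0 < \<epsilon>" and h: "0 < \<eta>"
 shows "\<exists>t>0. t < \<eta> \<and> (\<forall>z. emeasure (P z) {w\<in>space path_space. ennreal r \<le> excursion t w} \<le> ennreal \<epsilon>)"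
proof -
 interpret prob_space "P 0" by (rule prob_P)
 define t where "t n = inverse (real (Suc n))" for n
 have t0: "0 < t n" for n by (simp add: t_def)
 define A where "A n = {w\<in>space path_space. ennreal r \<le> excursion (t n) w}" for n
 have Am: "A n \<in> sets path_space" for n
 proof -
  note [measurable] = measurable_excursion[OF less_imp_le[OF t0[of n]]]
  show ?thesis unfolding A_def by measurable
 qed
 have "(\<lambda>n. \<integral>\<^sup>+w. indicator (A n) w \<partial>P 0) \<longlonglongrightarrow> (\<E> 0 (\<lambda>w. 0))"
 proof (rule nn_integral_dominated_convergence[where w = "\<lambda>_. 1"])
  show "AE w in P 0. (\<lambda>n. indicator (A n) w :: ennreal) \<longlonglongrightarrow> 0"
  proof (rule AE_I2)
   fix w assume "w \<in> space (P 0)"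
   then have w: "w \<in> space path_space" by simp
   obtain \<delta> where \<delta>: "0 < \<delta>" "\<And>s. 0 \<le> s \<Longrightarrow> dist s 0 < \<delta> \<Longrightarrow> dist (w s) (w 0) < r / 2"
    using path_continuous_on[OF w] r unfolding continuous_on_iff
    by (metis atLeast_iff half_gt_zero order_refl)
   obtain N where N: "t N < \<delta>" using reals_Archimedean[OF \<delta>(1)] by (auto simp: t_def)
   have "\<forall>\<^sub>F n in sequentially. (indicator (A n) w :: ennreal) = 0"
   proof (rule eventually_sequentiallyI)
    fix n assume "N \<le> n"
    then have "t n \<le> t N" by (simp add: t_def)
    then have tn: "t n < \<delta>" using N by simp
    have "excursion (t n) w \<le> ennreal (r / 2)"
     unfolding excursion_def
    proof (rule SUP_least)
     fix q :: real assume q: "q \<in> {q\<in>\<rat>. 0 \<le> q \<and> q \<le> 1}"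
     have qt: "q * t n \<le> t n" using q t0[of n] by (simp add: mult_left_le_one_le less_imp_le)
     then have "q * t n < \<delta>" using tn by (rule le_less_trans)
     then have "dist (w (q * t n)) (w 0) < r / 2"
      using q t0[of n] by (intro \<delta>(2)) (auto simp: abs_of_nonneg less_imp_le)
     then show "ennreal (norm (w (q * t n) - w 0)) \<le> ennreal (r / 2)"
      by (intro ennreal_leI) (simp add: dist_norm)
    qed
    also have "\<dots> < ennreal r" using r by (intro ennreal_lessI) auto
    finally show "(indicator (A n) w :: ennreal) = 0" by (simp add: A_def not_le)
   qed
   then show "(\<lambda>n. indicator (A n) w :: ennreal) \<longlonglongrightarrow> 0" by (rule tendsto_eventually)
  qed
 qed (use Am in \<open>auto simp: indicator_def\<close>)
 then have "(\<lambda>n. emeasure (P 0) (A n)) \<longlonglongrightarrow> 0" using Am by simp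
 then have "\<forall>\<^sub>F n in sequentially. emeasure (P 0) (A n) < ennreal \<epsilon>"
  using e by (intro order_tendstoD(2)) auto
 moreover have "\<forall>\<^sub>F n in sequentially. t n < \<eta>"
  unfolding t_def using LIMSEQ_inverse_real_of_nat h by (rule order_tendstoD(2))
 ultimately have "\<forall>\<^sub>F n in sequentially. emeasure (P 0) (A n) < ennreal \<epsilon> \<and> t n < \<eta>"
  by (rule eventually_conj)
 then obtain n where n: "emeasure (P 0) (A n) < ennreal \<epsilon>" "t n < \<eta>"
  by (auto simp: eventually_sequentially)
 have "emeasure (P z) {w\<in>space path_space. ennreal r \<le> excursion (t n) w} \<le> ennreal \<epsilon>" for z
 proof -
  have "emeasure (P z) (A n) = emeasure (P 0) (add_path z -` A n \<inter> space (P 0))"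
   using Am[of n] by (subst P_eq_distr, intro emeasure_distr) simp_all
  also have "add_path z -` A n \<inter> space (P 0) = A n"
  proof -
   have "excursion (t n) (add_path z w) = excursion (t n) w" for w
    unfolding excursion_def using t0[of n] by (intro SUP_cong) auto
   then show ?thesis using measurable_space[OF measurable_add_path] by (auto simp: A_def)
  qed
  finally show ?thesis using n by (simp add: A_def)
 qed
 then show ?thesis using t0 n by blast
qed

text \<open>\<open>cross f v y\<close> is compared with \<open>\<psi> v\<close>, its mean after the
  path has moved freely for a short time \<open>t\<close>. The errors are the probability of
  reaching the ball before \<open>t\<close> and that of being killed before \<open>t\<close>, both
  uniformly small for starts near \<open>z0\<close>, while \<open>\<psi>\<close> is continuous by
  \<open>heat_continuous\<close>.\<close>

lemma cross_continuous:
 assumes f: "pot_bound f c K" and z0: "z0 \<notin> cball y 1" and z: "z \<longlonglongrightarrow> z0"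
 shows "(\<lambda>n. enn2real (cross f (z n) y)) \<longlonglongrightarrow> enn2real (cross f z0 y)"
proof (rule LIMSEQ_I)
 fix e :: real assume e: "0 < e"
 define \<epsilon> where "\<epsilon> = e / 4"
 have eps: "0 < \<epsilon>" using e by (simp add: \<epsilon>_def)
 \<comment> \<open>A third of the distance from \<open>z0\<close> to the ball: a start within
   \<open>r\<close> of \<open>z0\<close> still has \<open>2 * r\<close> to go, so reaching the ball
   needs an excursion of size at least \<open>r\<close>.\<close>
 define r where "r = (dist y z0 - 1) / 3"
 have r: "0 < r" using z0 by (simp add: r_def)
 define R where "R = norm (z0 - c) + r"
 have K: "0 \<le> K" and fm: "f \<in> borel_measurable borel" using pot_boundD[OF f] by auto
 define \<phi> where "\<phi> v = enn2real (cross f v y)" for v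
 have \<phi>: "cross f v y = ennreal (\<phi> v)" "0 \<le> \<phi> v" for v
  using cross_le_1[of f v y] by (auto simp: \<phi>_def ennreal_enn2real_if top_unique)
 obtain t where t: "0 < t" "t < min 2 (\<epsilon> / (K * pot_const R + 1))"
  and exc: "\<And>z. emeasure (P z) {w\<in>space path_space. ennreal r \<le> excursion t w} \<le> ennreal \<epsilon>"
  using excursion_small[OF r eps, of "min 2 (\<epsilon> / (K * pot_const R + 1))"] eps K
  by (auto simp: divide_pos_pos add_nonneg_pos less_imp_le)
 have tK: "t * (K * pot_const R) \<le> \<epsilon>"
 proof -
  have "0 < K * pot_const R + 1" using K by (simp add: add_nonneg_pos less_imp_le)
  then have "t * (K * pot_const R + 1) < \<epsilon>" using t(2) by (simp add: pos_less_divide_eq)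
  then show ?thesis using t(1) by (simp add: distrib_left)
 qed
 have mcr: "(\<lambda>v. cross f v y) \<in> borel_measurable borel" by (rule measurable_cross[OF fm])
 define \<psi> where "\<psi> v = \<E> v (\<lambda>w. cross f (w t) y)" for v
 let ?F = "\<lambda>w. indicator (hit_event y) w * surv f (hit y w) w"
 note mF = measurable_cross_functional[OF fm, of y]
 have t0: "0 \<le> t" using t by simp
 have ms: "(\<lambda>w. surv f t w) \<in> borel_measurable path_space"
  using measurable_survival_path[OF fm, of "\<lambda>_. t" path_space "\<lambda>w. w"] by simp
 have mc: "(\<lambda>w. cross f (w t) y) \<in> borel_measurable path_space"
  by (rule measurable_eval_P[OF t0 mcr])
 have m1: "(\<lambda>w. ennreal (1 - survival f t w)) \<in> borel_measurable path_space"
 proof -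
  have [measurable]: "(\<lambda>w. survival f t w) \<in> borel_measurable path_space"
   using measurable_survival_path[OF fm, of "\<lambda>_. t" path_space "\<lambda>w. w"] by simp
  show ?thesis by measurable
 qed
 have mex: "{w\<in>space path_space. ennreal r \<le> excursion t w} \<in> sets path_space"
 proof -
  note [measurable] = measurable_excursion[OF t0]
  show ?thesis by measurable
 qed
 have up: "cross f v y \<le> ennreal \<epsilon> + \<psi> v" if v: "norm (v - z0) \<le> r" for v
 proof -
  have far: "1 + 2 * r \<le> dist y v"
   using dist_triangle[of y z0 v] v r by (simp add: r_def dist_norm field_simps)
  have "cross f v y \<le> \<E> v (\<lambda>w. indicator {w\<in>space path_space. ennreal r \<le> excursion t w} w + ?F (shift_path t w))"
   unfolding cross_def
  proof (rule nn_integral_P_mono)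
   fix w assume w: "w \<in> space path_space" "w 0 = v"
   show "?F w \<le> indicator {w\<in>space path_space. ennreal r \<le> excursion t w} w + ?F (shift_path t w)"
   proof (cases "w \<in> hit_event y")
    case True
    note he = True
    show ?thesis
    proof (cases "hit y w \<le> t")
     case True
     have "ennreal r \<le> excursion t w"
      using hit_imp_excursion[OF he True t0, of "2 * r" r] far w r by simp
     then show ?thesis using he w by (simp add: add_increasing2)
    next
     case False
     define S where "S = hit y w - t"
     have S: "0 \<le> S" using False by (simp add: S_def)
     have at: "shift_path t w S \<in> cball y 1" using hit_attained[OF he] S by (simp add: S_def)
     have ws: "shift_path t w \<in> space path_space" by (rule shift_path_space[OF w(1) t0])
     have "shift_path t w s \<notin> cball y 1" if "0 \<le> s" "s < S" for s
      using hit_before[of "t + s" y w] that t0 by (simp add: S_def)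
     then have hS: "hit y (shift_path t w) = S" "shift_path t w \<in> hit_event y"
      using hit_unique[OF S at _ ws] hit_eventI[OF ws S at] by auto
     have "survival f (hit y w) w = survival f t w * survival f S (shift_path t w)"
      using survival_add[OF fm w(1) t0 S] by (simp add: S_def)
     also have "\<dots> \<le> 1 * survival f S (shift_path t w)" by (intro mult_right_mono) auto
     finally have "?F w \<le> ?F (shift_path t w)" using he hS by (simp add: ennreal_leI)
     then show ?thesis by (simp add: add_increasing)
    qed
   qed simp
  qed
  also have "\<dots> = \<E> v (\<lambda>w. indicator {w\<in>space path_space. ennreal r \<le> excursion t w} w) + \<E> v (\<lambda>w. ?F (shift_path t w))"
   using mex measurable_compose[OF measurable_shift_path[OF t0] mF] by (intro nn_integral_add) auto
  also have "\<E> v (\<lambda>w. ?F (shift_path t w)) = \<psi> v"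
   using markov[OF fm mF t0, of "\<lambda>_. 1" v] by (simp add: \<psi>_def cross_def)
  also have "\<E> v (\<lambda>w. indicator {w\<in>space path_space. ennreal r \<le> excursion t w} w) \<le> ennreal \<epsilon>"
   using exc[of v] mex by simp
  finally show ?thesis by (simp add: add_right_mono)
 qed
 \<comment> \<open>Reinserting survival up to \<open>t\<close> costs at most
   \<open>1 - survival f t w\<close>, which is bounded by the action up to \<open>t\<close>.\<close>
 have lo: "\<psi> v \<le> cross f v y + ennreal \<epsilon>" if v: "norm (v - z0) \<le> r" for v
 proof -
  have "norm (v - c) \<le> R" using norm_triangle_ineq[of "v - z0" "z0 - c"] v by (simp add: R_def)
  note act = nn_integral_action_bound[OF f this t0]
  have "\<psi> v \<le> \<E> v (\<lambda>w. surv f t w * cross f (w t) y + ennreal (1 - survival f t w))"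
   unfolding \<psi>_def
  proof (rule nn_integral_mono)
   fix w
   have "\<phi> (w t) \<le> 1" using cross_le_1[of f "w t" y] unfolding \<phi>(1) by simp
   then have "0 \<le> (1 - survival f t w) * (1 - \<phi> (w t))" by (intro mult_nonneg_nonneg) auto
   then have "\<phi> (w t) \<le> survival f t w * \<phi> (w t) + (1 - survival f t w)"
    by (simp add: algebra_simps)
   then show "cross f (w t) y \<le> surv f t w * cross f (w t) y + ennreal (1 - survival f t w)"
    unfolding \<phi>(1) using \<phi>(2)[of "w t"]
    by (simp add: ennreal_mult[symmetric] ennreal_plus[symmetric] ennreal_leI del: ennreal_plus)
  qed
  also have "\<dots> = \<E> v (\<lambda>w. surv f t w * cross f (w t) y) + \<E> v (\<lambda>w. ennreal (1 - survival f t w))"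
   using ms mc m1 by (intro nn_integral_add) auto
  also have "\<E> v (\<lambda>w. surv f t w * cross f (w t) y) \<le> cross f v y"
  proof -
   have "\<E> v (\<lambda>w. surv f t w * cross f (w t) y) = \<E> v (\<lambda>w. surv f t w * ?F (shift_path t w))"
    unfolding cross_def by (rule markov[OF fm mF t0 ms, symmetric]) (simp add: survival_stop)
   also have "\<dots> \<le> cross f v y"
    unfolding cross_def
   proof (rule nn_integral_mono)
    fix w assume "w \<in> space (P v)"
    then have w: "w \<in> space path_space" by simp
    show "surv f t w * ?F (shift_path t w) \<le> ?F w"
    proof (cases "shift_path t w \<in> hit_event y")
     case True
     define S where "S = hit y (shift_path t w)"
     have at: "w (t + S) \<in> cball y 1" using hit_attained[OF True] by (simp add: S_def)
     have "0 \<le> t + S" using t0 by (simp add: S_def)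
     then have "w \<in> hit_event y" "hit y w \<le> t + S" using hit_eventI[OF w _ at] hit_le[of "t + S" w y] at by auto
     moreover have "survival f t w * survival f S (shift_path t w) = survival f (t + S) w"
      using survival_add[OF fm w t0, of S] by (simp add: S_def)
     ultimately show ?thesis
      using True survival_antimono[of "hit y w" "t + S" f w]
      by (simp add: S_def ennreal_mult[symmetric])
    qed simp
   qed
   finally show ?thesis .
  qed
  also have "\<E> v (\<lambda>w. ennreal (1 - survival f t w)) \<le> ennreal \<epsilon>"
  proof -
   have "\<E> v (\<lambda>w. ennreal (1 - survival f t w)) \<le> \<E> v (\<lambda>w. action f t w)"
   proof (rule nn_integral_mono)
    fix w
    show "ennreal (1 - survival f t w) \<le> action f t w"
    proof (cases "action f t w")
     case (real a)
     then show ?thesis using exp_neg_ge[of a] by (simp add: survival_action ennreal_leI)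
    qed simp
   qed
   also have "\<dots> \<le> ennreal (t * (K * pot_const R))" using act t by simp
   also have "\<dots> \<le> ennreal \<epsilon>" by (rule ennreal_leI[OF tK])
   finally show ?thesis .
  qed
  finally show ?thesis by (simp add: add_left_mono add_right_mono)
 qed
 have \<psi>fin: "\<psi> v = ennreal (enn2real (\<psi> v))" for v
 proof -
  have "\<psi> v \<le> \<E> v (\<lambda>w. 1)" unfolding \<psi>_def by (intro nn_integral_mono cross_le_1)
  then show ?thesis by (auto simp: ennreal_enn2real_if top_unique)
 qed
 have close: "\<bar>\<phi> v - enn2real (\<psi> v)\<bar> \<le> \<epsilon>" if v: "norm (v - z0) \<le> r" for v
 proof -
  have "ennreal (\<phi> v) \<le> ennreal (\<epsilon> + enn2real (\<psi> v))"
   using up[OF v] eps unfolding \<phi>(1) by (subst (asm) \<psi>fin) (simp add: ennreal_plus[symmetric] del: ennreal_plus)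
  moreover have "ennreal (enn2real (\<psi> v)) \<le> ennreal (\<phi> v + \<epsilon>)"
   using lo[OF v] eps \<phi>(2)[of v] unfolding \<phi>(1) by (subst (asm) \<psi>fin) (simp add: ennreal_plus[symmetric] del: ennreal_plus)
  ultimately have "\<phi> v \<le> \<epsilon> + enn2real (\<psi> v)" "enn2real (\<psi> v) \<le> \<phi> v + \<epsilon>"
   using eps \<phi>(2)[of v] by (simp_all add: ennreal_le_iff add_nonneg_nonneg del: ennreal_plus)
  then show ?thesis by (simp add: abs_le_iff)
 qed
 have "(\<lambda>n. \<psi> (z n)) \<longlonglongrightarrow> \<psi> z0"
  unfolding \<psi>_def by (rule heat_continuous[OF mcr cross_le_1 t(1) z])
 then have "(\<lambda>n. ennreal (enn2real (\<psi> (z n)))) \<longlonglongrightarrow> ennreal (enn2real (\<psi> z0))"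
  using \<psi>fin by simp
 then have "(\<lambda>n. enn2real (\<psi> (z n))) \<longlonglongrightarrow> enn2real (\<psi> z0)"
  by (subst (asm) tendsto_ennreal_iff) auto
 from LIMSEQ_D[OF this eps] obtain N1 where N1: "\<And>n. N1 \<le> n \<Longrightarrow> \<bar>enn2real (\<psi> (z n)) - enn2real (\<psi> z0)\<bar> < \<epsilon>" by auto
 from LIMSEQ_D[OF z r] obtain N2 where N2: "\<And>n. N2 \<le> n \<Longrightarrow> norm (z n - z0) < r" by auto
 show "\<exists>N. \<forall>n\<ge>N. norm (enn2real (cross f (z n) y) - enn2real (cross f z0 y)) < e"
 proof (intro exI[of _ "max N1 N2"] allI impI)
  fix n assume "max N1 N2 \<le> n"
  then have "\<bar>enn2real (\<psi> (z n)) - enn2real (\<psi> z0)\<bar> < \<epsilon>" "norm (z n - z0) \<le> r" using N1 N2 by (auto intro: less_imp_le)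
  moreover from this(2) have "\<bar>\<phi> (z n) - enn2real (\<psi> (z n))\<bar> \<le> \<epsilon>" by (rule close)
  moreover have "\<bar>\<phi> z0 - enn2real (\<psi> z0)\<bar> \<le> \<epsilon>" using close[of z0] r by simp
  moreover have "e = 4 * \<epsilon>" by (simp add: \<epsilon>_def)
  ultimately have "\<bar>\<phi> (z n) - \<phi> z0\<bar> < e" using e by linarith
  then show "norm (enn2real (cross f (z n) y) - enn2real (cross f z0 y)) < e" by (simp add: \<phi>_def)
 qed
qed

end

section \<open>Harnack inequality and approximate symmetry\<close>

text \<open>Continuity localises inequalities between integrals over shrinking balls. Two centres
  are allowed because the Harnack inequality compares different points.\<close>

lemma ball_average_le:
 fixes g h :: "'a::euclidean_space \<Rightarrow> ennreal"
 assumes g: "isCont g y" and h: "isCont h z" and r: "0 < r"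
  and le: "\<And>d. 0 < d \<Longrightarrow> d < r \<Longrightarrow> (\<integral>\<^sup>+v\<in>ball y d. g v \<partial>lborel) \<le> (\<integral>\<^sup>+v\<in>ball z d. h v \<partial>lborel)"
 shows "g y \<le> h z"
proof (rule ccontr)
 assume "\<not> g y \<le> h z"
 then obtain m where m: "h z < m" "m < g y" using dense by (auto simp: not_le)
 \<comment> \<open>Integration preserves the bounds by \<open>m\<close> and \<open>m'\<close> only
   weakly; the gap between the two levels gives the contradiction.\<close>
 obtain m' where m': "h z < m'" "m' < m" using dense[OF m(1)] by blast
 have "\<forall>\<^sub>F v in nhds y. m < g v" "\<forall>\<^sub>F v in nhds z. h v < m'"
  using order_tendstoD g h m m' unfolding isCont_def tendsto_at_iff_tendsto_nhds by blast+
 then obtain d1 d2 where d: "0 < d1" "\<And>v. dist v y < d1 \<Longrightarrow> m < g v" "0 < d2" "\<And>v. dist v z < d2 \<Longrightarrow> h v < m'"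
  unfolding eventually_nhds_metric by metis
 define d where "d = min (r / 2) (min d1 d2)"
 have d0: "0 < d" "d < r" "d \<le> d1" "d \<le> d2" using r d(1,3) by (auto simp: d_def)
 have b: "emeasure lborel (ball z d) = emeasure lborel (ball y d)" by (rule emeasure_ball_translate)
 have "m * emeasure lborel (ball y d) = (\<integral>\<^sup>+v\<in>ball y d. m \<partial>lborel)" by (simp add: nn_integral_cmult_indicator)
 also have "\<dots> \<le> (\<integral>\<^sup>+v\<in>ball y d. g v \<partial>lborel)"
  by (rule nn_integral_mono) (use d(2) d0 in \<open>auto simp: indicator_def less_imp_le dist_commute\<close>)
 also have "\<dots> \<le> (\<integral>\<^sup>+v\<in>ball z d. h v \<partial>lborel)" by (rule le[OF d0(1,2)])
 also have "\<dots> \<le> (\<integral>\<^sup>+v\<in>ball z d. m' \<partial>lborel)"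
  by (rule nn_integral_mono) (use d(4) d0 in \<open>auto simp: indicator_def less_imp_le dist_commute\<close>)
 also have "\<dots> = m' * emeasure lborel (ball y d)" by (simp add: nn_integral_cmult_indicator b)
 also have "\<dots> < m * emeasure lborel (ball y d)"
  using m'(2) emeasure_ball_pos[OF d0(1), of y] ball_sets_borel(2)[of y d]
  by (intro ennreal_mult_strict_right_mono) (auto simp: less_top)
 finally show False by simp
qed

context brownian
begin

definition tame :: "('a \<Rightarrow> real) \<Rightarrow> 'a \<Rightarrow> real \<Rightarrow> real \<Rightarrow> bool" where
 "tame f c K L \<longleftrightarrow> pot_bound f c K \<and> green_bound f c L"

definition cross_real :: "('a \<Rightarrow> real) \<Rightarrow> 'a \<Rightarrow> 'a \<Rightarrow> real" where
 "cross_real f x y = enn2real (cross f x y)"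

lemma cross_eq_real: "cross f x y = ennreal (cross_real f x y)"
 using cross_le_1[of f x y] by (auto simp: cross_real_def ennreal_enn2real_if top_unique)

lemma cross_real_bounds: "0 \<le> cross_real f x y" "cross_real f x y \<le> 1"
 using cross_le_1[of f x y] unfolding cross_eq_real by (simp_all add: cross_real_def)

lemma isCont_cross_real:
 assumes "pot_bound f c K" "z \<notin> cball y 1"
 shows "isCont (\<lambda>z. cross_real f z y) z"
 unfolding continuous_at_sequentially comp_def cross_real_def
 using cross_continuous[OF assms] by blast

text \<open>Bounds from the entrance points, transported to \<open>x\<close>. A path from outside
  enters on the unit sphere, at distance at least 1/4 from sets within 3/4 of \<open>c\<close>,
  which makes the upper bound proportional to the volume. For the unit ball itself the upper bound
  is the constant \<open>L\<close> of \<open>green_bound\<close>, valid from every start.\<close>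

lemma green_cross_bounds:
 obtains C where "1 \<le> C"
  "\<And>f c K L x A. tame f c K L \<Longrightarrow> A \<in> sets borel \<Longrightarrow> A \<subseteq> ball c (3 / 4) \<Longrightarrow> x \<notin> ball c 1 \<or> DIM('a) = 1 \<Longrightarrow>
    ennreal (exp (- C * (1 + K + ln L))) * emeasure lborel A * cross f x c \<le> green f x (indicator A)"
  "\<And>f c K L x A. tame f c K L \<Longrightarrow> A \<in> sets borel \<Longrightarrow> A \<subseteq> ball c (3 / 4) \<Longrightarrow> x \<notin> ball c 1 \<or> DIM('a) = 1 \<Longrightarrow>
    green f x (indicator A) \<le> ennreal (exp (C * (1 + K + ln L))) * emeasure lborel A * cross f x c"
  "\<And>f c K L x. tame f c K L \<Longrightarrow>
    ennreal (exp (- C * (1 + K + ln L))) * cross f x c \<le> green f x (indicator (ball c 1))"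
  "\<And>f c K L x. tame f c K L \<Longrightarrow>
    green f x (indicator (ball c 1)) \<le> ennreal (exp (C * (1 + K + ln L))) * cross f x c"
proof -
 obtain C1 where c1: "0 \<le> C1 \<and> (\<forall>f c K z A. pot_bound f c K \<longrightarrow> norm (z - c) \<le> 1 \<longrightarrow> A \<in> sets borel \<longrightarrow> A \<subseteq> cball c 1 \<longrightarrow>
   ennreal (exp (- C1 * (1 + K))) * emeasure lborel A \<le> green f z (indicator A))"
  by (rule exE[OF green_lower])
 note C1 = conjunct1[OF c1] and lower = conjunct2[OF c1, rule_format]
 obtain C2 where c2: "0 < C2 \<and> (\<forall>f c L z A. green_bound f c L \<longrightarrow> norm (z - c) \<le> 1 \<longrightarrow> A \<in> sets borel \<longrightarrow>
   DIM('a) = 1 \<or> (\<forall>a\<in>A. 1 / 4 \<le> dist z a) \<longrightarrow>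
   green f z (indicator A) \<le> ennreal (C2 * L) * emeasure lborel A)"
  by (rule exE[OF green_upper])
 note C2 = conjunct1[OF c2] and upper = conjunct2[OF c2, rule_format]
 define b where "b = measure lborel (ball (0::'a) 1)"
 have b: "0 < b" "emeasure lborel (ball v 1) = ennreal b" for v :: 'a
  by (auto simp: b_def content_ball_pos emeasure_ball content_ball)
 define C where "C = 1 + C1 + \<bar>ln C2\<bar> + \<bar>ln b\<bar>"
 have C: "1 \<le> C" "C1 \<le> C" "\<bar>ln C2\<bar> \<le> C" "C1 + \<bar>ln b\<bar> \<le> C" using C1 by (auto simp: C_def)
 have KL: "0 \<le> K" "1 \<le> L" "pot_bound f c K" "green_bound f c L" "f \<in> borel_measurable borel" "0 \<le> ln L"
  if "tame f c K L" for f c K L using that by (auto simp: tame_def pot_bound_def green_bound_def)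
 have expL: "C2 * L \<le> exp (C * (1 + K + ln L))" "L \<le> exp (C * (1 + K + ln L))"
  and expK: "exp (- C * (1 + K + ln L)) \<le> exp (- C1 * (1 + K))"
   "exp (- C * (1 + K + ln L)) \<le> exp (- C1 * (1 + K)) * b"
  if t: "tame f c K L" for f c K L
 proof -
  note kl = KL(1,2,6)[OF t]
  have "1 * ln L \<le> C * ln L" using C(1) kl by (intro mult_right_mono)
  then have CK: "0 \<le> C * K" "0 \<le> C * ln L" "ln L \<le> C * ln L" using C(1) kl by auto
  have "ln C2 + ln L \<le> C * (1 + K + ln L)" using C(3) CK by (simp add: algebra_simps)
  then have "exp (ln C2 + ln L) \<le> exp (C * (1 + K + ln L))" by simp
  then show "C2 * L \<le> exp (C * (1 + K + ln L))" using C2 kl by (simp add: exp_add)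
  have "ln L \<le> C * (1 + K + ln L)" using C(1) CK by (simp add: algebra_simps)
  then have "exp (ln L) \<le> exp (C * (1 + K + ln L))" by simp
  then show "L \<le> exp (C * (1 + K + ln L))" using kl by simp
  have CK1: "C1 * K \<le> C * K" using C(2) kl by (intro mult_right_mono)
  then have "C1 * (1 + K) + \<bar>ln b\<bar> \<le> C * (1 + K + ln L)" using C(4) CK by (simp add: algebra_simps)
  then have 1: "- C * (1 + K + ln L) \<le> - C1 * (1 + K) + ln b" by simp
  have "C1 * (1 + K) \<le> C * (1 + K + ln L)" using CK1 C(2) CK by (simp add: algebra_simps)
  then show "exp (- C * (1 + K + ln L)) \<le> exp (- C1 * (1 + K))" by simp
  from 1 have "exp (- C * (1 + K + ln L)) \<le> exp (- C1 * (1 + K) + ln b)" by (simp only: exp_le_cancel_iff)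
  also have "\<dots> = exp (- C1 * (1 + K)) * b" using b(1) by (simp only: exp_add exp_ln)
  finally show "exp (- C * (1 + K + ln L)) \<le> exp (- C1 * (1 + K)) * b" .
 qed
 show ?thesis
 proof (rule that[OF C(1)])
  fix f c K L x and A :: "'a set"
  assume t: "tame f c K L" and A: "A \<in> sets borel" "A \<subseteq> ball c (3 / 4)" and x: "x \<notin> ball c 1 \<or> DIM('a) = 1"
  have mA: "(indicator A :: 'a \<Rightarrow> ennreal) \<in> borel_measurable borel" using A by simp
  have A0: "indicator A v = (0::ennreal)" if "v \<notin> cball c 1" for v
  proof -
   have "v \<notin> A" using A(2) that by fastforce
   then show ?thesis by simp
  qed
  define S where "S = {v. v \<in> cball c 1 \<and> (x \<notin> ball c 1 \<longrightarrow> dist c v = 1)}"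
  have S: "norm (v - c) \<le> 1" "DIM('a) = 1 \<or> (\<forall>a\<in>A. 1 / 4 \<le> dist v a)" if v: "v \<in> S" for v
  proof -
   show "norm (v - c) \<le> 1" using v by (auto simp: S_def dist_norm norm_minus_commute)
   show "DIM('a) = 1 \<or> (\<forall>a\<in>A. 1 / 4 \<le> dist v a)"
   proof (cases "DIM('a) = 1")
    case False
    then have "dist c v = 1" using x v by (simp add: S_def)
    have "1 / 4 \<le> dist v a" if "a \<in> A" for a
    proof -
     have "dist c a < 3 / 4" using A(2) that by auto
     then show ?thesis using \<open>dist c v = 1\<close> dist_triangle[of c v a] by (simp add: dist_commute)
    qed
    then show ?thesis by blast
   qed simp
  qed
  have Ac: "A \<subseteq> cball c 1" using A(2) by fastforce
  have "cross f x c * (ennreal (exp (- C1 * (1 + K))) * emeasure lborel A) \<le> green f x (indicator A)"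
  proof (rule green_ge_cross[OF KL(5)[OF t] mA A0, where S = S])
   show "ennreal (exp (- C1 * (1 + K))) * emeasure lborel A \<le> green f v (indicator A)" if "v \<in> S" for v
    by (rule lower[OF KL(3)[OF t] S(1)[OF that] A(1) Ac])
  qed (auto simp: S_def)
  moreover have "ennreal (exp (- C * (1 + K + ln L))) * emeasure lborel A * cross f x c \<le>
    ennreal (exp (- C1 * (1 + K))) * emeasure lborel A * cross f x c"
   using expK(1)[OF t] by (intro mult_right_mono ennreal_leI) auto
  ultimately show "ennreal (exp (- C * (1 + K + ln L))) * emeasure lborel A * cross f x c \<le> green f x (indicator A)"
   by (simp add: mult.commute order_trans)
  have "green f x (indicator A) \<le> cross f x c * (ennreal (C2 * L) * emeasure lborel A)"
  proof (rule green_le_cross[OF KL(5)[OF t] mA A0, where S = S])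
   show "green f v (indicator A) \<le> ennreal (C2 * L) * emeasure lborel A" if "v \<in> S" for v
    by (rule upper[OF KL(4)[OF t] S(1)[OF that] A(1) S(2)[OF that]])
  qed (auto simp: S_def)
  also have "\<dots> \<le> cross f x c * (ennreal (exp (C * (1 + K + ln L))) * emeasure lborel A)"
   using expL(1)[OF t] by (intro mult_left_mono mult_right_mono ennreal_leI) auto
  finally show "green f x (indicator A) \<le> ennreal (exp (C * (1 + K + ln L))) * emeasure lborel A * cross f x c"
   by (simp add: mult.commute)
 next
  fix f c K L and x :: 'a assume t: "tame f c K L"
  have mB: "(indicator (ball c 1) :: 'a \<Rightarrow> ennreal) \<in> borel_measurable borel" by simp
  have B0: "indicator (ball c 1) v = (0::ennreal)" if "v \<notin> cball c 1" for v using that by simp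
  have "ennreal (exp (- C * (1 + K + ln L))) * cross f x c \<le> cross f x c * (ennreal (exp (- C1 * (1 + K))) * ennreal b)"
   using expK(2)[OF t] b(1) by (subst mult.commute) (intro mult_left_mono, auto simp: ennreal_mult[symmetric] ennreal_leI)
  also have "\<dots> \<le> green f x (indicator (ball c 1))"
  proof (rule green_ge_cross[OF KL(5)[OF t] mB B0, where S = "cball c 1"])
   fix v assume "v \<in> cball c 1"
   then have "norm (v - c) \<le> 1" by (simp add: dist_norm norm_minus_commute)
   from lower[OF KL(3)[OF t] this, of "ball c 1"] b(2)
   show "ennreal (exp (- C1 * (1 + K))) * ennreal b \<le> green f v (indicator (ball c 1))" by simp
  qed auto
  finally show "ennreal (exp (- C * (1 + K + ln L))) * cross f x c \<le> green f x (indicator (ball c 1))" .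
  have "green f x (indicator (ball c 1)) \<le> cross f x c * ennreal L"
  proof (rule green_le_cross[OF KL(5)[OF t] mB B0, where S = UNIV])
   fix v
   have "green f v (indicator (ball c 1)) \<le> ennreal (L * exp ((norm (c - c))\<^sup>2 / 16))"
    using KL(4)[OF t] unfolding green_bound_def by blast
   then show "green f v (indicator (ball c 1)) \<le> ennreal L" by simp
  qed auto
  also have "\<dots> \<le> cross f x c * ennreal (exp (C * (1 + K + ln L)))"
   using expL(2)[OF t] by (intro mult_left_mono ennreal_leI) auto
  finally show "green f x (indicator (ball c 1)) \<le> ennreal (exp (C * (1 + K + ln L))) * cross f x c"
   by (simp add: mult.commute)
 qed
qed

text \<open>
 By symmetry of the Green measure, the average of \<open>x \<mapsto> G(x, B(y))\<close> over a small ball near \<open>c\<close> is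
 the Green measure of this ball integrated over starting points in \<open>B(y)\<close>. The latter
 are compared through the first hitting of the unit ball around \<open>c\<close>.
\<close>

theorem harnack:
 obtains C where "1 \<le> C"
  "\<And>f c K L y K' L' z1 z2. tame f c K L \<Longrightarrow> tame f y K' L' \<Longrightarrow> 3 \<le> dist c y \<Longrightarrow>
    z1 \<in> cball c (1 / 2) \<Longrightarrow> z2 \<in> cball c (1 / 2) \<Longrightarrow>
    exp (- C * (2 + K + ln L + K' + ln L')) * cross_real f z1 y \<le> cross_real f z2 y"
  "\<And>f x y K L K' L'. (\<And>c. c \<in> cball x 1 \<Longrightarrow> tame f c K L) \<Longrightarrow> (\<And>c. c \<in> cball y 1 \<Longrightarrow> tame f c K' L') \<Longrightarrow>
    4 \<le> dist x y \<Longrightarrow> exp (- C * (2 + K + ln L + K' + ln L')) * cross_real f x y \<le> cross_real f y x"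
proof (rule green_cross_bounds, goal_cases)
 case (1 C0)
 note C0 = 1(2) and small_ge = 1(3) and small_le = 1(4) and ball_ge = 1(5) and ball_le = 1(6)
 have fm: "f \<in> borel_measurable borel" and pb: "pot_bound f c K" and KL: "0 \<le> K" "0 \<le> ln L"
  if "tame f c K L" for f c K L using that by (auto simp: tame_def pot_bound_def green_bound_def)
 have mB: "(indicator (ball c r) :: 'a \<Rightarrow> ennreal) \<in> borel_measurable borel" for c r by simp
 have exp_cancel: "X \<le> ennreal (exp a) * Y" if "ennreal (exp (- a)) * X \<le> Y" for X Y a
 proof -
  have "ennreal (exp a) * (ennreal (exp (- a)) * X) \<le> ennreal (exp a) * Y" using that by (intro mult_left_mono) auto
  then show ?thesis by (simp add: mult.assoc[symmetric] ennreal_mult[symmetric] exp_minus_inverse)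
 qed
 have H: "exp (- 2 * C0 * (2 + K + ln L + K' + ln L')) * cross_real f z1 y \<le> cross_real f z2 y"
  if t: "tame f c K L" and t': "tame f y K' L'" and far: "3 \<le> dist c y"
   and z: "z1 \<in> cball c (1 / 2)" "z2 \<in> cball c (1 / 2)" for f c K L y K' L' z1 z2
 proof -
  define E where "E = exp (- 2 * C0 * (2 + K + ln L + K' + ln L'))"
  have out: "v \<notin> cball y 1" if "v \<in> cball c (1 / 2)" for v
   using that far dist_triangle[of c y v] by (auto simp: dist_commute)
  have cont: "isCont (\<lambda>v. cross_real f v y) z1" "isCont (\<lambda>v. cross_real f v y) z2"
   using isCont_cross_real[OF pb[OF t]] out z by auto
  have "ennreal (E * cross_real f z1 y) \<le> ennreal (cross_real f z2 y)"
  proof (rule ball_average_le[where r = "1 / 4" and g = "\<lambda>v. ennreal (E * cross_real f v y)" and h = "\<lambda>v. ennreal (cross_real f v y)"])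
  show "isCont (\<lambda>v. ennreal (E * cross_real f v y)) z1" "isCont (\<lambda>v. ennreal (cross_real f v y)) z2"
   using cont unfolding isCont_def by (auto intro!: tendsto_ennrealI tendsto_mult_left)
  fix \<delta> :: real assume \<delta>: "0 < \<delta>" "\<delta> < 1 / 4"
  let ?a = "C0 * (1 + K + ln L)" and ?a' = "C0 * (1 + K' + ln L')"
  \<comment> \<open>\<open>I\<close> does not depend on \<open>z\<close>. Up to the constants of
    both ends, \<open>J z\<close> is comparable to \<open>V * I\<close>, for \<open>z1\<close> and
    \<open>z2\<close> alike.\<close>
  define I where "I = (\<integral>\<^sup>+v. indicator (ball y 1) v * cross f v c \<partial>lborel)"
  define J where "J z = (\<integral>\<^sup>+v. indicator (ball z \<delta>) v * cross f v y \<partial>lborel)" for z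
  define V where "V = emeasure lborel (ball (0::'a) \<delta>)"
  have V: "emeasure lborel (ball z \<delta>) = V" for z :: 'a unfolding V_def by (rule emeasure_ball_translate)
  note [measurable] = measurable_cross[OF fm[OF t]] measurable_green[OF fm[OF t] mB]
  have sub: "ball z \<delta> \<subseteq> ball c (3 / 4)" if "z \<in> cball c (1 / 2)" for z
  proof
   fix v assume "v \<in> ball z \<delta>"
   then show "v \<in> ball c (3 / 4)" using that \<delta> dist_triangle[of c v z] by simp
  qed
  have outB: "v \<notin> ball c 1" if "v \<in> ball y 1" for v
   using that far dist_triangle[of c y v] by (auto simp: dist_commute)
  have sym: "(\<integral>\<^sup>+v. indicator (ball z \<delta>) v * green f v (indicator (ball y 1)) \<partial>lborel) =
    (\<integral>\<^sup>+v. indicator (ball y 1) v * green f v (indicator (ball z \<delta>)) \<partial>lborel)" for z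
   by (rule green_symmetric[OF fm[OF t] mB mB])
  have lo: "ennreal (exp (- ?a)) * V * I \<le> ennreal (exp ?a') * J z" if "z \<in> cball c (1 / 2)" for z
  proof -
   have "ennreal (exp (- ?a)) * V * I = (\<integral>\<^sup>+v. ennreal (exp (- ?a)) * V * (indicator (ball y 1) v * cross f v c) \<partial>lborel)"
    unfolding I_def by (rule nn_integral_cmult[symmetric]) measurable
   also have "\<dots> \<le> (\<integral>\<^sup>+v. indicator (ball y 1) v * green f v (indicator (ball z \<delta>)) \<partial>lborel)"
    using small_ge[OF t _ sub[OF that]] outB
    by (intro nn_integral_mono) (auto simp: indicator_def V)
   also have "\<dots> \<le> (\<integral>\<^sup>+v. ennreal (exp ?a') * (indicator (ball z \<delta>) v * cross f v y) \<partial>lborel)"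
    unfolding sym[symmetric] using ball_le[OF t'] by (intro nn_integral_mono) (auto simp: indicator_def)
   also have "\<dots> = ennreal (exp ?a') * J z"
    unfolding J_def by (rule nn_integral_cmult) measurable
   finally show ?thesis .
  qed
  have hi: "ennreal (exp (- ?a')) * J z \<le> ennreal (exp ?a) * V * I" if "z \<in> cball c (1 / 2)" for z
  proof -
   have "ennreal (exp (- ?a')) * J z = (\<integral>\<^sup>+v. ennreal (exp (- ?a')) * (indicator (ball z \<delta>) v * cross f v y) \<partial>lborel)"
    unfolding J_def by (rule nn_integral_cmult[symmetric]) measurable
   also have "\<dots> \<le> (\<integral>\<^sup>+v. indicator (ball z \<delta>) v * green f v (indicator (ball y 1)) \<partial>lborel)"
    using ball_ge[OF t'] by (intro nn_integral_mono) (auto simp: indicator_def)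
   also have "\<dots> \<le> (\<integral>\<^sup>+v. ennreal (exp ?a) * V * (indicator (ball y 1) v * cross f v c) \<partial>lborel)"
    unfolding sym using small_le[OF t _ sub[OF that]] outB
    by (intro nn_integral_mono) (auto simp: indicator_def V)
   also have "\<dots> = ennreal (exp ?a) * V * I"
    unfolding I_def by (rule nn_integral_cmult) measurable
   finally show ?thesis .
  qed
  have "J z1 \<le> ennreal (exp ?a') * (ennreal (exp ?a) * V * I)" by (rule exp_cancel[OF hi[OF z(1)]])
  also have "V * I \<le> ennreal (exp ?a) * (ennreal (exp ?a') * J z2)"
   using lo[OF z(2)] by (rule_tac exp_cancel) (simp add: mult.assoc)
  then have "ennreal (exp ?a') * (ennreal (exp ?a) * V * I) \<le>
    ennreal (exp ?a') * (ennreal (exp ?a) * (ennreal (exp ?a) * (ennreal (exp ?a') * J z2)))"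
   unfolding mult.assoc by (intro mult_left_mono) auto
  also have "\<dots> = ennreal (exp (2 * C0 * (2 + K + ln L + K' + ln L'))) * J z2"
  proof -
   have ex: "2 * C0 * (2 + K + ln L + K' + ln L') = ?a' + (?a + (?a + ?a'))" by (simp add: algebra_simps)
   show ?thesis unfolding ex by (simp only: exp_add ennreal_mult exp_ge_zero mult_nonneg_nonneg mult.assoc)
  qed
  finally have "ennreal E * J z1 \<le> ennreal E * (ennreal (exp (2 * C0 * (2 + K + ln L + K' + ln L'))) * J z2)"
   by (rule mult_left_mono) simp
  also have "\<dots> = J z2"
   unfolding E_def by (simp only: mult.assoc[symmetric] ennreal_mult[symmetric] exp_ge_zero exp_add[symmetric]) simp
  also have "ennreal E * J z1 = (\<integral>\<^sup>+v\<in>ball z1 \<delta>. ennreal (E * cross_real f v y) \<partial>lborel)"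
  proof -
   have "ennreal E * J z1 = (\<integral>\<^sup>+v. ennreal E * (indicator (ball z1 \<delta>) v * cross f v y) \<partial>lborel)"
    unfolding J_def by (rule nn_integral_cmult[symmetric]) measurable
   also have "\<dots> = (\<integral>\<^sup>+v\<in>ball z1 \<delta>. ennreal (E * cross_real f v y) \<partial>lborel)"
    by (rule nn_integral_cong) (simp add: cross_eq_real ennreal_mult E_def cross_real_bounds indicator_def)
   finally show ?thesis .
  qed
  finally show "(\<integral>\<^sup>+v\<in>ball z1 \<delta>. ennreal (E * cross_real f v y) \<partial>lborel) \<le> (\<integral>\<^sup>+v\<in>ball z2 \<delta>. ennreal (cross_real f v y) \<partial>lborel)"
   by (simp add: J_def cross_eq_real mult.commute)
  qed simp
  then show ?thesis using cross_real_bounds by (simp add: E_def)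
 qed
 \<comment> \<open>Two points at distance at most 1 both lie within 1/2 of their midpoint, which
   serves as the centre in \<open>H\<close>.\<close>
 have sub_cball: "z1 \<in> cball ((1 / 2) *\<^sub>R (x + z)) (1 / 2)" if "z \<in> cball x 1" "z1 = x \<or> z1 = z" for x z z1 :: 'a
 proof -
  have "x - (1 / 2) *\<^sub>R (x + z) = (1 / 2) *\<^sub>R (x - z)" "z - (1 / 2) *\<^sub>R (x + z) = (1 / 2) *\<^sub>R (z - x)"
   by (simp_all add: algebra_simps flip: scaleR_left.add)
  moreover have "norm (x - z) \<le> 1" "norm (z - x) \<le> 1" using that by (simp_all add: dist_norm norm_minus_commute)
  ultimately have "norm (z1 - (1 / 2) *\<^sub>R (x + z)) \<le> 1 / 2"
   using that(2) by (elim disjE) simp_all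
  then show ?thesis by (simp add: dist_norm norm_minus_commute)
 qed
 have H2: "exp (- 2 * C0 * (2 + K + ln L + K' + ln L')) * cross_real f z1 y \<le> cross_real f z2 y"
  if near: "\<And>c. c \<in> cball x 1 \<Longrightarrow> tame f c K L" and t': "tame f y K' L'" and far: "4 \<le> dist x y"
   and z: "z \<in> cball x 1" "z1 = x \<or> z1 = z" "z2 = x \<or> z2 = z" for f x K L y K' L' z z1 z2
 proof (rule H[OF _ t'])
  let ?c = "(1 / 2) *\<^sub>R (x + z)"
  have c: "dist ?c x \<le> 1 / 2" using sub_cball[OF z(1), of x] by simp
  then show "tame f ?c K L" by (intro near) (simp add: dist_commute)
  show "3 \<le> dist ?c y" using far c dist_triangle[of x y ?c] by (simp add: dist_commute)
 qed (use sub_cball[OF z(1)] z in auto)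
 define b where "b = emeasure lborel (ball (0::'a) 1)"
 have b: "emeasure lborel (ball v 1) = b" for v :: 'a unfolding b_def by (rule emeasure_ball_translate)
 have b0: "0 < b" "b < \<infinity>" unfolding b_def by (rule emeasure_ball_pos, simp)+
 \<comment> \<open>The integral over \<open>ball x 1\<close> of the Green measure of
   \<open>ball y 1\<close> is bounded below through \<open>cross_real f x y\<close> and, by
   symmetry, above through \<open>cross_real f y x\<close>. Each side loses
   \<open>3 * C0 * D\<close> in the exponent, of which \<open>2 * C0 * D\<close> come from moving
   the start inside its ball; this is the origin of the 6.\<close>
 have S: "exp (- 6 * C0 * (2 + K + ln L + K' + ln L')) * cross_real f x y \<le> cross_real f y x"
  if near: "\<And>c. c \<in> cball x 1 \<Longrightarrow> tame f c K L" and near': "\<And>c. c \<in> cball y 1 \<Longrightarrow> tame f c K' L'"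
   and far: "4 \<le> dist x y" for f x y K L K' L'
 proof -
  have t: "tame f x K L" and t': "tame f y K' L'" using near near' by auto
  note [measurable] = measurable_cross[OF fm[OF t]] measurable_green[OF fm[OF t] mB]
  define D where "D = 2 + K + ln L + K' + ln L'"
  have kl: "0 \<le> K" "0 \<le> ln L" "0 \<le> K'" "0 \<le> ln L'" using KL[OF t] KL[OF t'] by auto
  have aD: "exp (C0 * (1 + K + ln L)) \<le> exp (C0 * D)" "exp (- C0 * D) \<le> exp (- C0 * (1 + K' + ln L'))"
   using C0 kl by (auto simp: D_def intro!: mult_left_mono)
  have dc: "4 \<le> dist y x" using far by (simp add: dist_commute)
  have D': "2 + K' + ln L' + K + ln L = D" by (simp add: D_def)
  let ?l = "exp (- C0 * D) * (exp (- 2 * C0 * D) * cross_real f x y)"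
  let ?u = "exp (C0 * D) * (exp (2 * C0 * D) * cross_real f y x)"
  have "ennreal ?l * b =
    (\<integral>\<^sup>+v. ennreal ?l * indicator (ball x 1) v \<partial>lborel)"
   by (subst nn_integral_cmult_indicator) (simp_all add: b)
  also have "\<dots> \<le> (\<integral>\<^sup>+v. indicator (ball x 1) v * green f v (indicator (ball y 1)) \<partial>lborel)"
  proof (rule nn_integral_mono)
   fix v
   show "ennreal ?l * indicator (ball x 1) v \<le>
     indicator (ball x 1) v * green f v (indicator (ball y 1))"
   proof (cases "v \<in> ball x 1")
    case True
    then have v: "v \<in> cball x 1" by simp
    have "exp (- 2 * C0 * D) * cross_real f x y \<le> cross_real f v y"
     unfolding D_def by (rule H2[OF near t' far v]) auto
    then have "?l \<le> exp (- C0 * (1 + K' + ln L')) * cross_real f v y"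
     using aD(2) cross_real_bounds by (intro mult_mono) auto
    then have "ennreal ?l \<le> ennreal (exp (- C0 * (1 + K' + ln L'))) * cross f v y"
     unfolding cross_eq_real using cross_real_bounds by (subst ennreal_mult[symmetric]) (auto intro!: ennreal_leI)
    also have "\<dots> \<le> green f v (indicator (ball y 1))" by (rule ball_ge[OF t'])
    finally show ?thesis using True by simp
   qed simp
  qed
  also have "\<dots> = (\<integral>\<^sup>+v. indicator (ball y 1) v * green f v (indicator (ball x 1)) \<partial>lborel)"
   by (rule green_symmetric[OF fm[OF t] mB mB])
  also have "\<dots> \<le> (\<integral>\<^sup>+v. ennreal ?u * indicator (ball y 1) v \<partial>lborel)"
  proof (rule nn_integral_mono)
   fix v
   show "indicator (ball y 1) v * green f v (indicator (ball x 1)) \<le>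
     ennreal ?u * indicator (ball y 1) v"
   proof (cases "v \<in> ball y 1")
    case True
    then have v: "v \<in> cball y 1" by simp
    have "exp (- 2 * C0 * D) * cross_real f v x \<le> cross_real f y x"
     unfolding D'[symmetric] by (rule H2[OF near' t dc v]) auto
    then have "exp (2 * C0 * D) * (exp (- 2 * C0 * D) * cross_real f v x) \<le> exp (2 * C0 * D) * cross_real f y x"
     by (intro mult_left_mono) auto
    then have vy: "cross_real f v x \<le> exp (2 * C0 * D) * cross_real f y x"
     by (simp add: mult.assoc[symmetric] exp_add[symmetric])
    have "green f v (indicator (ball x 1)) \<le> ennreal (exp (C0 * (1 + K + ln L))) * cross f v x" by (rule ball_le[OF t])
    also have "\<dots> = ennreal (exp (C0 * (1 + K + ln L)) * cross_real f v x)"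
     unfolding cross_eq_real using cross_real_bounds by (simp add: ennreal_mult)
    also have "\<dots> \<le> ennreal ?u"
     using aD(1) vy cross_real_bounds by (intro ennreal_leI mult_mono) auto
    finally show ?thesis using True by simp
   qed simp
  qed
  also have "\<dots> = ennreal ?u * b"
   by (subst nn_integral_cmult_indicator) (simp_all add: b)
  finally have "ennreal ?l \<le>
    ennreal ?u"
  proof -
   assume *: "ennreal ?l * b \<le>
    ennreal ?u * b"
   obtain r where r: "b = ennreal r" "0 < r" using b0 by (cases b) auto
   show ?thesis using * r cross_real_bounds[of f x y] cross_real_bounds[of f y x]
    by (simp add: r(1) ennreal_mult[symmetric])
  qed
  then have "?l \<le> ?u"
   using cross_real_bounds[of f y x] by (subst (asm) ennreal_le_iff) auto
  then have "exp (- 3 * C0 * D) * ?l \<le>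
    exp (- 3 * C0 * D) * ?u"
   by (intro mult_left_mono) auto
  then show ?thesis unfolding D_def[symmetric]
   by (simp add: mult.assoc[symmetric] exp_add[symmetric])
 qed
 show ?case
 proof (rule that[of "6 * C0"])
  show "1 \<le> 6 * C0" using C0 by simp
  fix f c K L y K' L' z1 z2
  assume a: "tame f c K L" "tame f y K' L'" "3 \<le> dist c y" "z1 \<in> cball c (1 / 2)" "z2 \<in> cball c (1 / 2)"
  have "0 \<le> C0 * (2 + K + ln L + K' + ln L')" using C0 KL[OF a(1)] KL[OF a(2)] by simp
  then have "exp (- (6 * C0) * (2 + K + ln L + K' + ln L')) \<le> exp (- 2 * C0 * (2 + K + ln L + K' + ln L'))" by simp
  then have "exp (- (6 * C0) * (2 + K + ln L + K' + ln L')) * cross_real f z1 y \<le> exp (- 2 * C0 * (2 + K + ln L + K' + ln L')) * cross_real f z1 y"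
   using cross_real_bounds by (intro mult_right_mono) auto
  then show "exp (- (6 * C0) * (2 + K + ln L + K' + ln L')) * cross_real f z1 y \<le> cross_real f z2 y"
   using H[OF a] by linarith
 next
  fix f x y K L K' L'
  assume "\<And>c. c \<in> cball x 1 \<Longrightarrow> tame f c K L" "\<And>c. c \<in> cball y 1 \<Longrightarrow> tame f c K' L'" "4 \<le> dist x y"
  from S[OF this] show "exp (- (6 * C0) * (2 + K + ln L + K' + ln L')) * cross_real f x y \<le> cross_real f y x" by simp
 qed
qed

end

section \<open>Bounds for the Green measure of a ball\<close>

context brownian
begin

lemma semigroup_indicator_le:
 assumes "0 < t" "A \<in> sets borel"
 shows "semigroup f t x (indicator A) \<le> (\<integral>\<^sup>+v. indicator A v * ennreal (gauss t (v - x)) \<partial>lborel)"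
proof -
 have "semigroup f t x (indicator A) \<le> \<E> x (\<lambda>w. indicator A (w t))"
  unfolding semigroup_def by (intro nn_integral_mono) (auto simp: indicator_def)
 then show ?thesis using nn_integral_P_eval[of "indicator A" t x] assms by simp
qed

lemma semigroup_le_1: "semigroup f t x (indicator A) \<le> 1"
proof -
 have "semigroup f t x (indicator A) \<le> \<E> x (\<lambda>w. 1)"
  unfolding semigroup_def by (intro nn_integral_mono) (auto simp: indicator_def)
 then show ?thesis by simp
qed

text \<open>Up to time 1 at most one unit of time is spent in the ball; afterwards, in dimension at
  least three, the heat kernel is at most \<open>t powr (- 3 / 2)\<close>, which is integrable at
  infinity.\<close>

lemma green_bound_transient:
 assumes D: "3 \<le> DIM('a)"
 shows "\<exists>L\<ge>1. \<forall>f x v. f \<in> borel_measurable borel \<longrightarrow> green f x (indicator (ball v 1)) \<le> ennreal L"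
proof -
 define b where "b = measure lborel (ball (0::'a) 1)"
 have b: "0 < b" "emeasure lborel (ball v 1) = ennreal b" for v :: 'a
  by (auto simp: b_def content_ball_pos emeasure_ball content_ball)
 have g: "gauss t (v::'a) \<le> t powr (- 3 / 2)" if t: "1 \<le> t" for t v
 proof -
  have "1 * t \<le> 2 * pi * t" using t pi_ge_two by (intro mult_right_mono) auto
  then have "1 / sqrt (2 * pi * t) \<le> 1 / sqrt t" using t by (intro frac_le) auto
  then have p: "(1 / sqrt (2 * pi * t)) ^ DIM('a) \<le> (1 / sqrt t) ^ DIM('a)"
   using t by (intro power_mono) auto
  also have "\<dots> \<le> (1 / sqrt t) ^ 3" using t D by (intro power_decreasing) auto
  also have "1 / sqrt t = t powr (- 1 / 2)" using t by (simp add: powr_minus_divide powr_half_sqrt)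
  also have "(t powr (- 1 / 2)) ^ 3 = t powr (- 3 / 2)" using t by (simp add: powr_power)
  finally have "(1 / sqrt (2 * pi * t)) ^ DIM('a) * exp (- (norm v)\<^sup>2 / (2 * t)) \<le> t powr (- 3 / 2) * 1"
   using t by (intro mult_mono) auto
  then show ?thesis using t by (subst gauss_eq) auto
 qed
 have hi: "((\<lambda>t. t powr (- 3 / 2)) has_integral 2) {1::real..}"
  using has_integral_powr_to_inf[of "- 3 / 2" 1] by simp
 have I: "(\<integral>\<^sup>+t. ennreal (t powr (- 3 / 2)) * indicator {1..} t \<partial>lborel) = ennreal 2"
  by (rule nn_integral_has_integral_lebesgue'[OF _ hi]) auto
 have "green f x (indicator (ball v 1)) \<le> ennreal (1 + b * 2)" if f: "f \<in> borel_measurable borel" for f x v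
 proof -
  have "green f x (indicator (ball v 1)) = (\<integral>\<^sup>+t. semigroup f t x (indicator (ball v 1)) * indicator {0..} t \<partial>lborel)"
   by (rule green_eq_semigroup[OF f]) simp
  also have "\<dots> \<le> (\<integral>\<^sup>+t. indicator {0..1} t + ennreal b * (ennreal (t powr (- 3 / 2)) * indicator {1..} t) \<partial>lborel)"
  proof (rule nn_integral_mono)
   fix t :: real
   consider "t < 0" | "0 \<le> t" "t < 1" | "1 \<le> t" by linarith
   then show "semigroup f t x (indicator (ball v 1)) * indicator {0..} t \<le>
     indicator {0..1} t + ennreal b * (ennreal (t powr (- 3 / 2)) * indicator {1..} t)"
   proof cases
    case 3
    have "semigroup f t x (indicator (ball v 1)) \<le> (\<integral>\<^sup>+a. indicator (ball v 1) a * ennreal (gauss t (a - x)) \<partial>lborel)"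
     using 3 by (intro semigroup_indicator_le) auto
    also have "\<dots> \<le> (\<integral>\<^sup>+a. ennreal (t powr (- 3 / 2)) * indicator (ball v 1) a \<partial>lborel)"
     using g[OF 3] by (intro nn_integral_mono) (auto simp: indicator_def intro!: ennreal_leI)
    also have "\<dots> = ennreal b * ennreal (t powr (- 3 / 2))"
     by (subst nn_integral_cmult_indicator) (simp_all add: b mult.commute)
    finally show ?thesis using 3 by (simp add: add_increasing)
   qed (use semigroup_le_1 in auto)
  qed
  also have "\<dots> = 1 + ennreal b * ennreal 2"
   unfolding I[symmetric] by (subst nn_integral_add) (auto simp: nn_integral_cmult)
  also have "\<dots> = ennreal (1 + b * 2)"
   using b(1) by (subst ennreal_plus) (auto simp: ennreal_mult)
  finally show ?thesis .
 qed
 then show ?thesis using b(1) by (intro exI[of _ "1 + b * 2"]) auto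
qed

section \<open>Dimensions one and two: killing by the obstacle\<close>

text \<open>Returns to the ball cost a fixed factor, because the path may visit the obstacle in between.
 The time horizon \<open>n\<close> makes all quantities finite.\<close>

lemma green_bound_of_killing:
 assumes f: "f \<in> borel_measurable borel" and T: "0 \<le> T" and q: "0 < q"
  and kill: "\<And>x. x \<in> cball v 1 \<Longrightarrow> \<E> x (\<lambda>w. surv f T w) + ennreal q \<le> 1"
 shows "green f x (indicator (ball v 1)) \<le> ennreal (T / q)"
proof -
 let ?F = "indicator (ball v 1) :: 'a \<Rightarrow> ennreal"
 have mB: "?F \<in> borel_measurable borel" by simp
 note mo = measurable_occupation[OF f mB]
 have ms: "(\<lambda>w. surv f T w) \<in> borel_measurable path_space"
  using measurable_survival_path[OF f, of "\<lambda>_. T" path_space "\<lambda>w. w"] by simp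
 have le_time: "occupation f ?F t w \<le> ennreal t" if "0 \<le> t" for t w
 proof -
  have "occupation f ?F t w \<le> (\<integral>\<^sup>+s. indicator {0..t} s \<partial>lborel)"
   unfolding occupation_def by (intro nn_integral_mono) (auto simp: indicator_def)
  then show ?thesis using that by simp
 qed
 have E_time: "\<E> x (occupation f ?F t) \<le> ennreal t" if "0 \<le> t" for x t
  using nn_integral_mono[of "P x" "occupation f ?F t" "\<lambda>_. ennreal t"] le_time[OF that] by simp
 have bound: "\<E> x (occupation f ?F (real n)) \<le> ennreal (T / q)" for x n
 proof -
  let ?o = "occupation f ?F (real n)"
  \<comment> \<open>The worst mean occupation time. Splitting at time \<open>T\<close> gives
    \<open>S \<le> T + S * (1 - q)\<close>, which can be solved because \<open>S\<close> is
    finite.\<close>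
  define S where "S = (SUP x. \<E> x ?o)"
  have "S \<le> ennreal (real n)" unfolding S_def by (intro SUP_least E_time) simp
  then obtain s where s: "S = ennreal s" "0 \<le> s" by (cases S) (auto simp: top_unique)
  have le: "\<E> x ?o \<le> S" for x unfolding S_def by (rule SUP_upper) simp
  have q1: "ennreal p \<le> ennreal (1 - q) \<and> 0 \<le> 1 - q" if "ennreal p + ennreal q \<le> 1" "0 \<le> p" for p
  proof -
   have "ennreal (p + q) \<le> ennreal 1" using that q by simp
   then have "p + q \<le> 1" by (subst (asm) ennreal_le_iff) auto
   then show ?thesis using that(2) by (simp add: ennreal_leI)
  qed
  have surv_le: "\<E> x (\<lambda>w. surv f T w) \<le> ennreal (1 - q)" "0 \<le> 1 - q" if x: "x \<in> cball v 1" for x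
   using kill[OF x] q1 by (cases "\<E> x (\<lambda>w. surv f T w)"; auto simp: top_unique)+
  have q0: "0 \<le> 1 - q" by (rule surv_le(2)[of v]) simp
  have cb: "\<E> x ?o \<le> ennreal (T + s * (1 - q))" if x: "x \<in> cball v 1" for x
  proof -
   have "\<E> x ?o \<le> \<E> x (\<lambda>w. occupation f ?F T w + surv f T w * ?o (shift_path T w))"
    by (intro nn_integral_mono occupation_split[OF f mB _ T]) simp
   also have "\<dots> = \<E> x (occupation f ?F T) + \<E> x (\<lambda>w. surv f T w * ?o (shift_path T w))"
    using mo ms measurable_compose[OF measurable_shift_path[OF T] mo(1)] by (intro nn_integral_add) auto
   also have "\<E> x (\<lambda>w. surv f T w * ?o (shift_path T w)) = \<E> x (\<lambda>w. surv f T w * \<E> (w T) ?o)"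
    by (rule markov[OF f mo(1) T ms]) (simp add: survival_stop)
   also have "\<dots> \<le> \<E> x (\<lambda>w. surv f T w * S)" by (intro nn_integral_mono mult_left_mono le) simp
   also have "\<dots> = \<E> x (\<lambda>w. surv f T w) * S" by (rule nn_integral_multc) (use ms in simp)
   also have "\<dots> \<le> ennreal (1 - q) * ennreal s" unfolding s(1) by (intro mult_right_mono surv_le[OF x]) simp
   also have "\<dots> = ennreal (s * (1 - q))" using s q0 by (simp add: ennreal_mult mult.commute)
   finally show ?thesis using E_time[OF T, of x] T s q0 by (simp add: add_mono order_trans[OF _ add_mono])
  qed
  \<comment> \<open>A general start reduces to one in the ball by waiting for the first
    visit.\<close>
  have "S \<le> ennreal (T + s * (1 - q))"
   unfolding S_def
  proof (rule SUP_least)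
   fix x
   have "\<E> x ?o \<le> \<E> x (\<lambda>w. indicator (hit_event v) w * (surv f (hit v w) w * ?o (shift_path (hit v w) w)))"
   proof (rule nn_integral_mono)
    fix w assume "w \<in> space (P x)"
    then have w: "w \<in> space path_space" by simp
    show "?o w \<le> indicator (hit_event v) w * (surv f (hit v w) w * ?o (shift_path (hit v w) w))"
    proof (cases "w \<in> hit_event v")
     case True
     have "occupation f ?F (hit v w) w = 0" by (rule occupation_hit) auto
     then show ?thesis using occupation_split[OF f mB w hit_nonneg[of v w], of "real n"] True by simp
    next
     case False
     then have "?F (w t) = 0" if "0 \<le> t" for t using hit_eventI[OF w that, of v] by (auto simp: indicator_def)
     then have "?o w = (\<integral>\<^sup>+t. 0 \<partial>(lborel :: real measure))"
      unfolding occupation_def by (intro nn_integral_cong) (auto simp: indicator_def)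
     then show ?thesis by simp
    qed
   qed
   also have "\<dots> = \<E> x (\<lambda>w. indicator (hit_event v) w * (surv f (hit v w) w * \<E> (w (hit v w)) ?o))"
    by (rule strong_markov_hit[OF f mo(1)])
   also have "\<dots> \<le> \<E> x (\<lambda>w. ennreal (T + s * (1 - q)))"
   proof (rule nn_integral_mono)
    fix w
    show "indicator (hit_event v) w * (surv f (hit v w) w * \<E> (w (hit v w)) ?o) \<le> ennreal (T + s * (1 - q))"
     using mult_mono[of "surv f (hit v w) w" 1, OF _ cb[of "w (hit v w)"]] hit_attained[of w v]
     by (cases "w \<in> hit_event v") auto
   qed
   finally show "\<E> x ?o \<le> ennreal (T + s * (1 - q))" by simp
  qed
  moreover have "0 \<le> T + s * (1 - q)" using T s q0 by simp
  ultimately have "s \<le> T + s * (1 - q)" unfolding s(1) by (simp add: ennreal_le_iff)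
  then have "s \<le> T / q" using q by (simp add: field_simps)
  then show ?thesis using le[of x] s by (simp add: order_trans ennreal_leI)
 qed
 have "total_occupation f ?F w = (SUP n. occupation f ?F (real n) w)" if w: "w \<in> space path_space" for w
 proof -
  have [measurable]: "(\<lambda>t. surv f t w * ?F (w (max 0 t))) \<in> borel_measurable borel"
   using measurable_compose[OF _ measurable_survival_eval[OF f mB], of "\<lambda>t. (w, t)" borel] w by simp
  have "indicator {0..} t = (SUP n. indicator {0..real n} t :: ennreal)" for t :: real
  proof (rule antisym)
   obtain n :: nat where "t \<le> real n" using real_arch_simple by blast
   then show "indicator {0..} t \<le> (SUP n. indicator {0..real n} t :: ennreal)"
    by (intro SUP_upper2[of n]) (auto simp: indicator_def)
  qed (auto intro!: SUP_least simp: indicator_def)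
  then have "total_occupation f ?F w = (\<integral>\<^sup>+t. (SUP n. (surv f t w * ?F (w (max 0 t))) * indicator {0..real n} t) \<partial>lborel)"
   unfolding occupation_max by (simp add: SUP_mult_left_ennreal)
  also have "\<dots> = (SUP n. occupation f ?F (real n) w)"
   unfolding occupation_max
   by (rule nn_integral_monotone_convergence_SUP, force simp: incseq_def le_fun_def indicator_def, measurable)
  finally show ?thesis .
 qed
 then have "green f x ?F = \<E> x (\<lambda>w. SUP n. occupation f ?F (real n) w)"
  unfolding green_def by (intro nn_integral_cong) simp
 also have "\<dots> = (SUP n. \<E> x (occupation f ?F (real n)))"
 proof (rule nn_integral_monotone_convergence_SUP)
  show "incseq (\<lambda>n. occupation f ?F (real n))"
   unfolding occupation_def by (auto simp: incseq_def le_fun_def indicator_def intro!: nn_integral_mono)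
 qed (use mo in simp)
 also have "\<dots> \<le> ennreal (T / q)" by (intro SUP_least bound)
 finally show ?thesis .
qed

text \<open>\<open>Lw\<close> is the time spent in the obstacle \<open>A\<close> during
  \<open>[T, T + 1]\<close>. Survival is at most \<open>exp (- \<epsilon> * Lw)\<close>, hence at
  most \<open>1 - \<epsilon> / 2 * Lw\<close> since \<open>\<epsilon> * Lw\<close> is at most 1; and
  the mean of \<open>Lw\<close> is at least \<open>\<epsilon> * g\<close> by Fubini.\<close>

lemma survival_killing:
 assumes f: "f \<in> borel_measurable borel" and T: "1 \<le> T" and e: "0 < \<epsilon>" "\<epsilon> \<le> 1"
  and A: "A \<in> sets borel" "\<And>a. a \<in> A \<Longrightarrow> \<epsilon> \<le> f a" "ennreal \<epsilon> \<le> emeasure lborel A"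
  and g: "\<And>a s. a \<in> A \<Longrightarrow> T \<le> s \<Longrightarrow> s \<le> T + 1 \<Longrightarrow> g \<le> gauss s (a - x)" and g0: "0 \<le> g"
 shows "\<E> x (\<lambda>w. surv f (T + 1) w) + ennreal (\<epsilon> / 2 * (\<epsilon> * g)) \<le> 1"
proof -
 interpret prob_space "P x" by (rule prob_P)
 interpret pair_sigma_finite "P x" "lborel :: real measure" ..
 have mA: "(indicator A :: 'a \<Rightarrow> ennreal) \<in> borel_measurable borel" using A by measurable
 define Lw where "Lw w = (\<integral>\<^sup>+s. indicator A (w (max 0 s)) * indicator {T..T + 1} s \<partial>lborel)" for w :: "real \<Rightarrow> 'a"
 have mAp: "(\<lambda>p. indicator A (fst p (max 0 (snd p))) :: ennreal) \<in> borel_measurable (path_space \<Otimes>\<^sub>M (borel :: real measure))"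
  by (rule measurable_compose[OF measurable_path_eval mA]) auto
 have [measurable]: "(\<lambda>p. indicator A (fst p (max 0 (snd p))) :: ennreal) \<in> borel_measurable (P x \<Otimes>\<^sub>M lborel)"
  using mAp by (simp cong: measurable_cong_sets)
 have mL: "Lw \<in> borel_measurable (P x)" unfolding Lw_def by measurable
 have L1: "Lw w \<le> 1" for w
 proof -
  have "Lw w \<le> (\<integral>\<^sup>+s. indicator {T..T + 1} s \<partial>lborel)" unfolding Lw_def
   by (intro nn_integral_mono) (auto simp: indicator_def)
  then show ?thesis by simp
 qed
 have pw: "surv f (T + 1) w + ennreal (\<epsilon> / 2) * Lw w \<le> 1" if w: "w \<in> space path_space" for w
 proof -
  obtain l where l: "Lw w = ennreal l" "0 \<le> l" using L1[of w] by (cases "Lw w") (auto simp: top_unique)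
  have l1: "l \<le> 1" using L1[of w] l by simp
  have ms [measurable]: "(\<lambda>s. indicator A (w (max 0 s)) * indicator {T..T + 1} s :: ennreal) \<in> borel_measurable lborel"
   using measurable_compose[OF measurable_path_max[OF w] mA] by measurable
  have "ennreal \<epsilon> * Lw w = (\<integral>\<^sup>+s. ennreal \<epsilon> * (indicator A (w (max 0 s)) * indicator {T..T + 1} s) \<partial>lborel)"
   unfolding Lw_def by (rule nn_integral_cmult[symmetric]) measurable
  also have "\<dots> \<le> action f (T + 1) w"
   unfolding action_max using A(2) T by (intro nn_integral_mono) (auto simp: indicator_def intro!: ennreal_leI)
  finally have "ennreal (\<epsilon> * l) \<le> action f (T + 1) w" using l e by (simp add: ennreal_mult)
  then have "survival f (T + 1) w \<le> exp (- (\<epsilon> * l))"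
   unfolding survival_action using exp_neg_antimono[of "ennreal (\<epsilon> * l)"] l e by (simp add: exp_neg_ennreal)
  also have "\<dots> \<le> 1 - \<epsilon> / 2 * l"
  proof -
   define y where "y = \<epsilon> * l"
   have y: "0 \<le> y" "y \<le> 1" using l l1 e by (auto simp: y_def mult_le_one)
   \<comment> \<open>This is \<open>y * y \<le> y\<close>. Together with
     \<open>1 + y \<le> exp y\<close> it gives \<open>exp (- y) \<le> 1 - y / 2\<close> on the unit
     interval.\<close>
   have "1 \<le> (1 - y / 2) * (1 + y)"
    using mult_left_mono[OF y(2) y(1)] by (simp add: algebra_simps)
   also have "\<dots> \<le> (1 - y / 2) * exp y" using y exp_ge_add_one_self[of y] by (intro mult_left_mono) auto
   finally have "exp (- y) * 1 \<le> exp (- y) * ((1 - y / 2) * exp y)" by (intro mult_left_mono) auto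
   also have "exp (- y) * ((1 - y / 2) * exp y) = (1 - y / 2) * (exp y * exp (- y))" by (simp only: mult_ac)
   finally show ?thesis by (simp add: exp_minus_inverse y_def)
  qed
  finally have "survival f (T + 1) w + \<epsilon> / 2 * l \<le> 1" by simp
  then have "ennreal (survival f (T + 1) w + \<epsilon> / 2 * l) \<le> 1" by simp
  moreover have "ennreal (\<epsilon> / 2) * Lw w = ennreal (\<epsilon> / 2 * l)"
   unfolding l(1) using l e by (intro ennreal_mult[symmetric]) auto
  ultimately show ?thesis using l e by simp
 qed
 have mS: "(\<lambda>w. surv f (T + 1) w) \<in> borel_measurable (P x)"
  using measurable_survival_path[OF f, of "\<lambda>_. T + 1" path_space "\<lambda>w. w"] by simp
 have "\<E> x (\<lambda>w. surv f (T + 1) w) + ennreal (\<epsilon> / 2) * \<E> x (\<lambda>w. Lw w) =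
   \<E> x (\<lambda>w. surv f (T + 1) w + ennreal (\<epsilon> / 2) * Lw w)"
  using mS mL by (simp add: nn_integral_add nn_integral_cmult)
 also have "\<dots> \<le> \<E> x (\<lambda>w. 1)" using pw by (intro nn_integral_mono) auto
 finally have 1: "\<E> x (\<lambda>w. surv f (T + 1) w) + ennreal (\<epsilon> / 2) * \<E> x (\<lambda>w. Lw w) \<le> 1" by simp
 have "ennreal (\<epsilon> * g) = (\<integral>\<^sup>+s. ennreal (\<epsilon> * g) * indicator {T..T + 1} s \<partial>lborel)"
  by (simp add: nn_integral_cmult_indicator)
 also have "\<dots> \<le> (\<integral>\<^sup>+s. \<integral>\<^sup>+w. indicator A (w (max 0 s)) * indicator {T..T + 1} s \<partial>P x \<partial>lborel)"
 proof (rule nn_integral_mono)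
  fix s
  show "ennreal (\<epsilon> * g) * indicator {T..T + 1} s \<le> \<E> x (\<lambda>w. indicator A (w (max 0 s)) * indicator {T..T + 1} s)"
  proof (cases "s \<in> {T..T + 1}")
   case True
   then have s: "0 < s" using T by simp
   have "ennreal (\<epsilon> * g) \<le> ennreal g * emeasure lborel A"
    using mult_left_mono[OF A(3), of "ennreal g"] e g0 by (simp add: ennreal_mult mult.commute)
   also have "\<dots> = (\<integral>\<^sup>+a. ennreal g * indicator A a \<partial>lborel)" using A by (simp add: nn_integral_cmult_indicator)
   also have "\<dots> \<le> (\<integral>\<^sup>+a. indicator A a * ennreal (gauss s (a - x)) \<partial>lborel)"
    using g True by (intro nn_integral_mono) (auto simp: indicator_def intro!: ennreal_leI)
   also have "\<dots> = \<E> x (\<lambda>w. indicator A (w s))" by (rule nn_integral_P_eval[OF mA s, symmetric])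
   finally show ?thesis using True s by (simp add: max_absorb2)
  qed simp
 qed
 also have "\<dots> = \<E> x (\<lambda>w. Lw w)"
  unfolding Lw_def by (rule Fubini') (simp add: case_prod_beta)
 finally have "ennreal (\<epsilon> / 2 * (\<epsilon> * g)) \<le> ennreal (\<epsilon> / 2) * \<E> x (\<lambda>w. Lw w)"
  using e g0 by (subst ennreal_mult) (auto intro!: mult_left_mono)
 then show ?thesis using 1 by (meson add_left_mono order_trans)
qed

text \<open>The time allowed for reaching the obstacle is of the order of its distance. In time
  \<open>T\<close> a Gaussian covers a distance of order \<open>T\<close> with probability at least
  exponentially small in \<open>T\<close> rather than in its square, so the logarithm of the bound
  is linear in \<open>norm (u - v)\<close>.\<close>

lemma green_bound_recurrent:
 assumes r: "0 < \<rho>" and e: "0 < \<epsilon>"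
 shows "\<exists>C\<ge>0. \<forall>f u x v. f \<in> borel_measurable borel \<longrightarrow> (\<forall>a. 0 \<le> f a) \<longrightarrow>
   ennreal \<epsilon> < emeasure lborel ({a. \<epsilon> < f a} \<inter> ball u \<rho>) \<longrightarrow>
   green f x (indicator (ball v 1)) \<le> ennreal (exp (C * (1 + norm (u - v))))"
proof -
 let ?D = "DIM('a)"
 define \<delta> where "\<delta> = min \<epsilon> 1"
 have d: "0 < \<delta>" "\<delta> \<le> 1" "\<delta> \<le> \<epsilon>" using e by (auto simp: \<delta>_def)
 \<comment> \<open>For \<open>T \<ge> 1\<close>, the summands times \<open>T\<close> dominate the
   exponents coming from \<open>T + 1\<close>, from the normalisation of the Gaussian, from its
   exponential factor, and from \<open>2 / \<delta>\<^sup>2\<close>.\<close>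
 define C where "C = 3 + 4 * pi * real ?D + \<rho> + \<rho>\<^sup>2 + \<bar>ln (2 / \<delta>\<^sup>2)\<bar>"
 have C: "0 \<le> C" using r by (simp add: C_def)
 have "green f x (indicator (ball v 1)) \<le> ennreal (exp (C * (1 + norm (u - v))))"
  if f: "f \<in> borel_measurable borel" "\<And>a. 0 \<le> f a"
   and A: "ennreal \<epsilon> < emeasure lborel ({a. \<epsilon> < f a} \<inter> ball u \<rho>)" for f u x v
 proof -
  note [measurable] = f(1)
  define T where "T = 1 + norm (u - v)"
  have T: "1 \<le> T" by (simp add: T_def)
  define g where "g = (1 / sqrt (2 * pi * (T + 1))) ^ ?D * exp (- (T + \<rho>)\<^sup>2 / (2 * T))"
  have g: "0 < g" using T by (simp add: g_def)
  define q where "q = \<delta> / 2 * (\<delta> * g)"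
  have q: "0 < q" using d g by (simp add: q_def)
  have "green f x (indicator (ball v 1)) \<le> ennreal ((T + 1) / q)"
  proof (rule green_bound_of_killing[OF f(1) _ q])
   show "0 \<le> T + 1" using T by simp
   fix x assume x: "x \<in> cball v 1"
   show "\<E> x (\<lambda>w. surv f (T + 1) w) + ennreal q \<le> 1"
    unfolding q_def
   proof (rule survival_killing[OF f(1) T d(1,2)])
    show "{a. \<epsilon> < f a} \<inter> ball u \<rho> \<in> sets borel" by measurable
    show "\<delta> \<le> f a" if "a \<in> {a. \<epsilon> < f a} \<inter> ball u \<rho>" for a using that d by simp
    show "ennreal \<delta> \<le> emeasure lborel ({a. \<epsilon> < f a} \<inter> ball u \<rho>)"
     using A d(3) by (meson ennreal_leI less_imp_le order_trans)
    show "0 \<le> g" using g by simp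
    fix a s assume a: "a \<in> {a. \<epsilon> < f a} \<inter> ball u \<rho>" and s: "T \<le> s" "s \<le> T + 1"
    have "norm (a - x) \<le> norm (a - u) + norm (u - v) + norm (v - x)"
     using norm_triangle_ineq[of "a - u" "u - v"] norm_triangle_ineq[of "a - v" "v - x"] by simp
    moreover have "norm (a - u) \<le> \<rho>" "norm (v - x) \<le> 1" using a x by (auto simp: dist_norm norm_minus_commute)
    ultimately have "norm (a - x) \<le> T + \<rho>" by (simp add: T_def)
    then show "g \<le> gauss s (a - x)" unfolding g_def using T by (intro gauss_ge s) auto
   qed
  qed
  also have "(T + 1) / q \<le> exp (C * T)"
  proof -
   define p where "p = sqrt (2 * pi * (T + 1)) ^ ?D"
   have pT: "1 \<le> 2 * pi * (T + 1)" using T pi_ge_two mult_mono[of 1 "2 * pi" 1 "T + 1"] by simp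
   have p0: "0 < p" using T by (simp add: p_def)
   have p: "p \<le> exp (2 * pi * (T + 1) * real ?D)"
   proof -
    have "sqrt (2 * pi * (T + 1)) \<le> 2 * pi * (T + 1)"
     using pT by (intro real_le_lsqrt) (auto simp: power2_eq_square intro!: mult_left_mono[of 1 "2 * pi * (T + 1)" "2 * pi * (T + 1)", simplified])
    also have "\<dots> \<le> exp (2 * pi * (T + 1))" using exp_ge_add_one_self[of "2 * pi * (T + 1)"] by linarith
    finally have "p \<le> exp (2 * pi * (T + 1)) ^ ?D" unfolding p_def using pT by (intro power_mono) auto
    also have "\<dots> = exp (2 * pi * (T + 1) * real ?D)" by (simp add: exp_of_nat2_mult)
    finally show ?thesis .
   qed
   have "(T + \<rho>)\<^sup>2 / (2 * T) = T / 2 + \<rho> + \<rho>\<^sup>2 / (2 * T)" using T by (simp add: field_simps power2_eq_square)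
   moreover have "\<rho>\<^sup>2 / (2 * T) \<le> \<rho>\<^sup>2 / 1" using T by (intro divide_left_mono) auto
   ultimately have sq: "(T + \<rho>)\<^sup>2 / (2 * T) \<le> T / 2 + \<rho> + \<rho>\<^sup>2" by simp
   have gi: "1 / g = p * exp ((T + \<rho>)\<^sup>2 / (2 * T))"
    by (simp add: g_def p_def exp_minus power_one_over field_simps)
   have "(T + 1) / q = (T + 1) * (2 / \<delta>\<^sup>2) * (1 / g)" using d g by (simp add: q_def power2_eq_square field_simps)
   also have "\<dots> \<le> exp (T + 1) * exp \<bar>ln (2 / \<delta>\<^sup>2)\<bar> * (exp (2 * pi * (T + 1) * real ?D) * exp (T / 2 + \<rho> + \<rho>\<^sup>2))"
    unfolding gi
   proof (intro mult_mono p)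
    show "T + 1 \<le> exp (T + 1)" using exp_ge_add_one_self[of "T + 1"] by linarith
    have "2 / \<delta>\<^sup>2 = exp (ln (2 / \<delta>\<^sup>2))" using d by simp
    also have "\<dots> \<le> exp \<bar>ln (2 / \<delta>\<^sup>2)\<bar>" by simp
    finally show "2 / \<delta>\<^sup>2 \<le> exp \<bar>ln (2 / \<delta>\<^sup>2)\<bar>" .
   qed (use T p0 sq in auto)
   also have "\<dots> = exp (T + 1 + \<bar>ln (2 / \<delta>\<^sup>2)\<bar> + 2 * pi * (T + 1) * real ?D + (T / 2 + \<rho> + \<rho>\<^sup>2))"
    by (simp only: exp_add mult.assoc)
   also have "\<dots> \<le> exp (C * T)"
   proof -
    have a: "\<bar>ln (2 / \<delta>\<^sup>2)\<bar> * 1 \<le> \<bar>ln (2 / \<delta>\<^sup>2)\<bar> * T" "\<rho> * 1 \<le> \<rho> * T" "\<rho>\<^sup>2 * 1 \<le> \<rho>\<^sup>2 * T"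
     using T r by (intro mult_left_mono; simp)+
    have b: "2 * pi * (T + 1) * real ?D \<le> 2 * pi * (2 * T) * real ?D"
     using T by (intro mult_right_mono mult_left_mono) auto
    have "C * T = 3 * T + 2 * pi * (2 * T) * real ?D + \<rho> * T + \<rho>\<^sup>2 * T + \<bar>ln (2 / \<delta>\<^sup>2)\<bar> * T"
     by (simp add: C_def algebra_simps)
    then show ?thesis using a b T unfolding exp_le_cancel_iff by linarith
   qed
   finally show ?thesis .
  qed
  then have "ennreal ((T + 1) / q) \<le> ennreal (exp (C * T))" by (rule ennreal_leI)
  finally show ?thesis by (simp add: T_def)
 qed
 then show ?thesis using C by blast
qed

end

section \<open>Ergodic theory\<close>

locale measure_preserving_map = prob_space M for M :: "'w measure" +
 fixes T :: "'w \<Rightarrow> 'w"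
 assumes T_measurable [measurable]: "T \<in> measurable M M" and T_preserving: "distr M M T = M"
begin

lemma funpow_measurable [measurable]: "(T ^^ k) \<in> measurable M M"
 by (induction k) (auto intro: measurable_comp)

lemma distr_funpow: "distr M M (T ^^ k) = M"
proof (induction k)
 case (Suc k)
 have "distr M M (T ^^ Suc k) = distr (distr M M (T ^^ k)) M T"
  by (subst distr_distr) auto
 then show ?case by (simp only: Suc T_preserving)
qed (simp add: distr_id2 id_def)

lemma AE_funpow:
 assumes "AE x in M. Q x" shows "AE x in M. Q ((T ^^ k) x)"
proof -
 have "AE x in distr M M (T ^^ k). Q x" by (subst distr_funpow) (rule assms)
 then show ?thesis by (rule AE_distrD[rotated]) measurable
qed

lemma integral_funpow: "X \<in> borel_measurable M \<Longrightarrow> (\<integral>x. X ((T ^^ k) x) \<partial>M) = (\<integral>x. (X x :: real) \<partial>M)"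
 using integral_distr[of "T ^^ k" M M X] by (simp add: distr_funpow)

lemma integrable_funpow: "integrable M X \<Longrightarrow> integrable M (\<lambda>x. X ((T ^^ k) x) :: real)"
 using integrable_distr[of "T ^^ k" M M X] by (simp add: distr_funpow)

lemma nn_integral_funpow: "X \<in> borel_measurable M \<Longrightarrow> (\<integral>\<^sup>+x. X ((T ^^ k) x) \<partial>M) = (\<integral>\<^sup>+x. X x \<partial>M)"
 using nn_integral_distr[of "T ^^ k" M M X] by (simp add: distr_funpow)

text \<open>Garsia's proof: on the set where the maximal partial sum \<open>R\<close> is positive one has
 \<open>R \<le> F + R \<circ> T\<close>, and \<open>R\<close> and \<open>R \<circ> T\<close> have the same integral.\<close>

lemma maximal_ergodic_finite:
 fixes h :: "'w \<Rightarrow> real"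
 assumes h: "integrable M h" and l: "0 < l" and nn: "\<And>x. x \<in> space M \<Longrightarrow> 0 \<le> h x"
 shows "l * prob {x\<in>space M. \<exists>n\<le>N. real n * l < (\<Sum>k<n. h ((T ^^ k) x))} \<le> (\<integral>x. h x \<partial>M)"
proof -
 have [measurable]: "h \<in> borel_measurable M" using h by simp
 define F where "F x = h x - l" for x
 have F: "integrable M F" unfolding F_def using h by simp
 define S where "S n x = (\<Sum>k<n. F ((T ^^ k) x))" for n x
 have S: "integrable M (S n)" for n unfolding S_def using F by (intro Bochner_Integration.integrable_sum integrable_funpow)
 define R where "R x = Max ((\<lambda>n. S n x) ` {..N})" for x
 have R_ge: "S n x \<le> R x" if "n \<le> N" for n x unfolding R_def using that by (intro Max_ge) auto
 have R0: "0 \<le> R x" for x using R_ge[of 0 x] by (simp add: S_def)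
 have "R x \<in> (\<lambda>n. S n x) ` {..N}" for x unfolding R_def by (rule Max_in) auto
 then have R_in: "\<exists>n\<le>N. R x = S n x" for x by blast
 have R_pos: "0 < R x \<longleftrightarrow> (\<exists>n\<le>N. real n * l < (\<Sum>k<n. h ((T ^^ k) x)))" for x
 proof -
  have "S n x = (\<Sum>k<n. h ((T ^^ k) x)) - real n * l" for n
   by (simp add: S_def F_def sum_subtractf)
  then show ?thesis using R_ge R_in by (metis diff_gt_0_iff_gt less_le_trans)
 qed
 have [measurable]: "S n \<in> borel_measurable M" for n using S by simp
 have Rm [measurable]: "R \<in> borel_measurable M" unfolding R_def by measurable
 have Ri: "integrable M R"
 proof (rule Bochner_Integration.integrable_bound)
  show "integrable M (\<lambda>x. \<Sum>n\<le>N. \<bar>S n x\<bar>)" using S by (intro Bochner_Integration.integrable_sum integrable_abs)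
  show "AE x in M. norm (R x) \<le> norm (\<Sum>n\<le>N. \<bar>S n x\<bar>)"
  proof (rule AE_I2)
   fix x
   obtain n where n: "n \<le> N" "R x = S n x" using R_in by blast
   have "\<bar>S n x\<bar> \<le> (\<Sum>n\<le>N. \<bar>S n x\<bar>)" using n by (intro member_le_sum) auto
   then show "norm (R x) \<le> norm (\<Sum>n\<le>N. \<bar>S n x\<bar>)" using n by simp
  qed
 qed simp
 define A where "A = {x\<in>space M. 0 < R x}"
 have [measurable]: "A \<in> sets M" unfolding A_def by measurable
 have iA: "integrable M (\<lambda>x. indicator A x * f x)" if "integrable M f" for f :: "'w \<Rightarrow> real"
  using integrable_real_mult_indicator[of A M f] that by (simp add: mult.commute)
 have RT: "integrable M (\<lambda>x. R (T x))" using integrable_funpow[OF Ri, of 1] by simp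
 have eqR: "(\<integral>x. R (T x) \<partial>M) = (\<integral>x. R x \<partial>M)" using integral_funpow[OF Rm, of 1] by simp
 have key: "R x - R (T x) \<le> indicator A x * F x" if x: "x \<in> space M" for x
 proof (cases "x \<in> A")
  case True
  obtain n where n: "n \<le> N" "R x = S n x" using R_in by blast
  have "n \<noteq> 0" using True n by (cases n) (auto simp: A_def S_def)
  then obtain m where m: "n = Suc m" using not0_implies_Suc by blast
  have "S (Suc m) x = F x + S m (T x)"
   unfolding S_def by (subst sum.lessThan_Suc_shift) (simp add: funpow_swap1)
  then show ?thesis using n m R_ge[of m "T x"] True by simp
 next
  case False
  then have "R x = 0" using R0[of x] x by (auto simp: A_def)
  then show ?thesis using False R0[of "T x"] by simp
 qed
 have "0 = (\<integral>x. R x - R (T x) \<partial>M)" using Ri RT eqR by simp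
 also have "\<dots> \<le> (\<integral>x. indicator A x * F x \<partial>M)"
  using Ri RT F key by (intro integral_mono) (auto intro: iA)
 also have "\<dots> = (\<integral>x. indicator A x * h x \<partial>M) - l * prob A"
 proof -
  have "(\<integral>x. indicator A x * F x \<partial>M) = (\<integral>x. indicator A x * h x - l * indicator A x \<partial>M)"
   by (intro Bochner_Integration.integral_cong) (auto simp: F_def algebra_simps)
  also have "\<dots> = (\<integral>x. indicator A x * h x \<partial>M) - (\<integral>x. l * indicator A x \<partial>M)"
   using h by (intro Bochner_Integration.integral_diff iA integrable_mult_right) (auto simp: integrable_indicator_iff emeasure_eq_measure)
  finally show ?thesis by simp
 qed
 finally have "l * prob A \<le> (\<integral>x. indicator A x * h x \<partial>M)" by simp
 also have "\<dots> \<le> (\<integral>x. h x \<partial>M)"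
  using h nn by (intro integral_mono iA) (auto simp: indicator_def)
 finally show ?thesis using R_pos by (simp add: A_def)
qed

lemma maximal_ergodic:
 fixes h :: "'w \<Rightarrow> real"
 assumes h: "integrable M h" and l: "0 < l" and nn: "\<And>x. x \<in> space M \<Longrightarrow> 0 \<le> h x"
 shows "prob {x\<in>space M. \<exists>n. real n * l < (\<Sum>k<n. h ((T ^^ k) x))} \<le> (\<integral>x. h x \<partial>M) / l"
proof -
 have [measurable]: "h \<in> borel_measurable M" using h by simp
 define A where "A N = {x\<in>space M. \<exists>n\<le>N. real n * l < (\<Sum>k<n. h ((T ^^ k) x))}" for N
 have [measurable]: "A N \<in> sets M" for N unfolding A_def by measurable
 have "incseq A" by (auto simp: incseq_def A_def intro: order_trans)
 then have lim: "(\<lambda>N. prob (A N)) \<longlonglongrightarrow> prob (\<Union>N. A N)" by (intro finite_Lim_measure_incseq) auto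
 have "(\<Union>N. A N) = {x\<in>space M. \<exists>n. real n * l < (\<Sum>k<n. h ((T ^^ k) x))}" by (auto simp: A_def)
 moreover have "prob (A N) \<le> (\<integral>x. h x \<partial>M) / l" for N
  using maximal_ergodic_finite[OF h l nn, of N] l by (simp add: A_def pos_le_divide_eq mult.commute)
 ultimately show ?thesis using LIMSEQ_le_const2[OF lim] by auto
qed

text \<open>Borel-Cantelli: the probabilities that \<open>X\<close> exceeds \<open>e * n\<close> sum
  to at most the mean of \<open>X / e + 1\<close>, and composition with powers of \<open>T\<close>
  preserves them.\<close>

lemma AE_funpow_over_n:
 fixes X :: "'w \<Rightarrow> real"
 assumes X: "integrable M X" and nn: "\<And>x. x \<in> space M \<Longrightarrow> 0 \<le> X x"
 shows "AE x in M. (\<lambda>n. X ((T ^^ n) x) / real n) \<longlonglongrightarrow> 0"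
proof -
 have [measurable]: "X \<in> borel_measurable M" using X by simp
 have ev: "AE x in M. \<forall>\<^sub>F n in sequentially. X ((T ^^ n) x) \<le> e * real n" if e: "0 < e" for e
 proof -
  define B where "B n = {x\<in>space M. e * real n < X x}" for n
  have [measurable]: "B n \<in> sets M" for n unfolding B_def by measurable
  have sum_le: "(\<Sum>n<m. prob (B n)) \<le> (\<integral>x. X x / e + 1 \<partial>M)" for m
  proof -
   have "(\<Sum>n<m. prob (B n)) = (\<integral>x. (\<Sum>n<m. indicator (B n) x) \<partial>M)"
    by (subst Bochner_Integration.integral_sum) (auto simp: integrable_indicator_iff emeasure_eq_measure)
   also have "\<dots> \<le> (\<integral>x. X x / e + 1 \<partial>M)"
   proof (rule integral_mono)
    fix x assume x: "x \<in> space M"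
    let ?J = "{n. n < m \<and> e * real n < X x}"
    have sub: "?J \<subseteq> {..<nat \<lceil>X x / e\<rceil>}"
    proof
     fix n assume "n \<in> ?J"
     then have "real n < X x / e" using e by (simp add: pos_less_divide_eq mult.commute)
     then have "int n < \<lceil>X x / e\<rceil>" by (simp add: less_ceiling_iff)
     then show "n \<in> {..<nat \<lceil>X x / e\<rceil>}" by simp
    qed
    have "(\<Sum>n<m. indicator (B n) x) = (\<Sum>n\<in>?J. 1 :: real)"
     using x by (intro sum.mono_neutral_cong_right) (auto simp: B_def)
    also have "\<dots> \<le> real (nat \<lceil>X x / e\<rceil>)" using card_mono[OF _ sub] by simp
    also have "\<dots> \<le> X x / e + 1"
     using nn[OF x] e of_int_ceiling_le_add_one[of "X x / e"] by (simp add: of_nat_nat)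
    finally show "(\<Sum>n<m. indicator (B n) x) \<le> X x / e + 1" .
   qed (use X in \<open>auto simp: integrable_indicator_iff emeasure_eq_measure\<close>)
   finally show ?thesis .
  qed
  have "prob ((T ^^ n) -` B n \<inter> space M) = prob (B n)" for n
   using measure_distr[of "T ^^ n" M M "B n"] by (simp add: distr_funpow)
  moreover have "summable (\<lambda>n. prob (B n))" by (rule summableI_nonneg_bounded[OF _ sum_le]) simp
  ultimately have "AE x in M. \<forall>\<^sub>F n in sequentially. x \<in> space M - ((T ^^ n) -` B n \<inter> space M)"
   by (intro borel_cantelli_AE1) (auto simp: emeasure_eq_measure)
  then show ?thesis
   by eventually_elim (auto simp: B_def not_less elim!: eventually_mono dest: measurable_space[OF funpow_measurable])
 qed
 have "AE x in M. \<forall>i::nat. \<forall>\<^sub>F n in sequentially. X ((T ^^ n) x) \<le> inverse (real (Suc i)) * real n"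
  unfolding AE_all_countable using ev by simp
 then show ?thesis using AE_space
 proof eventually_elim
  case (elim x)
  show ?case
  proof (rule LIMSEQ_I)
   fix r :: real assume "0 < r"
   then obtain i where i: "inverse (real (Suc i)) < r" using reals_Archimedean by blast
   from elim(1) obtain N where N: "\<And>n. N \<le> n \<Longrightarrow> X ((T ^^ n) x) \<le> inverse (real (Suc i)) * real n"
    unfolding eventually_sequentially by meson
   have "norm (X ((T ^^ n) x) / real n - 0) < r" if "max N 1 \<le> n" for n
   proof -
    have "X ((T ^^ n) x) / real n \<le> inverse (real (Suc i))" using N[of n] that by (simp add: pos_divide_le_eq)
    moreover have "0 \<le> X ((T ^^ n) x)" using nn measurable_space[OF funpow_measurable elim(2)] by blast
    ultimately show ?thesis using i by simp
   qed
   then show "\<exists>no. \<forall>n\<ge>no. norm (X ((T ^^ n) x) / real n - 0) < r" by blast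
  qed
 qed
qed

end

section \<open>The subadditive ergodic theorem\<close>

text \<open>The covering argument of Steele's proof of the subadditive ergodic theorem: from a good start
 \<open>j\<close> one jumps ahead by a block of length at most \<open>N\<close> with small cost, and from a bad start by one step.\<close>

lemma subadditive_covering:
 fixes a :: "nat \<Rightarrow> nat \<Rightarrow> real"
 assumes sub: "\<And>j m n. a j (m + n) \<le> a j m + a (j + m) n" and a0: "\<And>j. a j 0 \<le> 0" and nn: "\<And>j n. 0 \<le> a j n"
  and k: "0 \<le> \<kappa>" and h: "\<And>j. h j = (if \<forall>n\<in>{1..N}. real n * \<kappa> < a j n then a j 1 else 0)"
 shows "a j n \<le> real n * \<kappa> + (\<Sum>k<n. h (j + k)) + (\<Sum>k\<in>{n - N..<n}. a (j + k) 1)"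
proof (induction n arbitrary: j rule: less_induct)
 case (less n)
 have h0: "0 \<le> h j" for j using h nn by simp
 have le_sum: "a j n \<le> (\<Sum>k<n. a (j + k) 1)" for n
 proof (induction n)
  case (Suc n)
  then show ?case using sub[of j n 1] by simp
 qed (use a0 in simp)
 show ?case
 proof (cases "n = 0")
  case True then show ?thesis using a0 by simp
 next
  case False
  show ?thesis
  proof (cases "\<forall>n\<in>{1..N}. real n * \<kappa> < a j n")
   case True
   obtain m where m: "n = Suc m" using False not0_implies_Suc by blast
   have "a j n \<le> h j + a (j + 1) m" using sub[of j 1 m] True h[of j] m by simp
   also have "a (j + 1) m \<le> real m * \<kappa> + (\<Sum>k<m. h (j + 1 + k)) + (\<Sum>k\<in>{m - N..<m}. a (j + 1 + k) 1)"
    by (rule less.IH) (simp add: m)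
   also have "(\<Sum>k\<in>{m - N..<m}. a (j + 1 + k) 1) = (\<Sum>k\<in>{Suc (m - N)..<Suc m}. a (j + k) 1)"
    by (subst sum.shift_bounds_Suc_ivl) simp
   also have "\<dots> \<le> (\<Sum>k\<in>{n - N..<n}. a (j + k) 1)"
    using nn m by (intro sum_mono2) auto
   finally have "a j n \<le> h j + (real m * \<kappa> + (\<Sum>k<m. h (j + 1 + k)) + (\<Sum>k\<in>{n - N..<n}. a (j + k) 1))" by simp
   moreover have "(\<Sum>k<n. h (j + k)) = h j + (\<Sum>k<m. h (j + 1 + k))"
    unfolding m by (subst sum.lessThan_Suc_shift) simp
   moreover have "real m * \<kappa> \<le> real n * \<kappa>" using k m by (intro mult_right_mono) auto
   ultimately show ?thesis by linarith
  next
   case False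
   then obtain m where m: "1 \<le> m" "m \<le> N" "a j m \<le> real m * \<kappa>" by (auto simp: not_less)
   show ?thesis
   proof (cases "m \<le> n")
    case True
    define d where "d = n - m"
    have nd: "n = m + d" using True by (simp add: d_def)
    have "a j n \<le> real m * \<kappa> + a (j + m) d" using sub[of j m d] m nd by simp
    also have "a (j + m) d \<le> real d * \<kappa> + (\<Sum>k<d. h (j + m + k)) + (\<Sum>k\<in>{d - N..<d}. a (j + m + k) 1)"
     by (rule less.IH) (use m nd in simp)
    also have "(\<Sum>k<d. h (j + m + k)) = (\<Sum>k\<in>{0 + m..<d + m}. h (j + k))"
     by (subst sum.shift_bounds_nat_ivl) (simp add: lessThan_atLeast0 ac_simps)
    also have "\<dots> \<le> (\<Sum>k<n. h (j + k))" using h0 nd by (intro sum_mono2) auto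
    also have "(\<Sum>k\<in>{d - N..<d}. a (j + m + k) 1) = (\<Sum>k\<in>{d - N + m..<d + m}. a (j + k) 1)"
     by (subst sum.shift_bounds_nat_ivl) (simp add: ac_simps)
    also have "\<dots> \<le> (\<Sum>k\<in>{n - N..<n}. a (j + k) 1)" using nn nd by (intro sum_mono2) auto
    finally have "a j n \<le> real m * \<kappa> + (real d * \<kappa> + (\<Sum>k<n. h (j + k)) + (\<Sum>k\<in>{n - N..<n}. a (j + k) 1))" by simp
    moreover have "real m * \<kappa> + real d * \<kappa> = real n * \<kappa>" by (simp add: nd distrib_right)
    ultimately show ?thesis by linarith
   next
    case False
    \<comment> \<open>The block would overshoot. Then \<open>n\<close> is less than
      \<open>N\<close>, so all remaining steps are among the last \<open>N\<close> and are paid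
      singly.\<close>
    then have "{n - N..<n} = {..<n}" using m by auto
    then show ?thesis using le_sum[of n] k sum_nonneg[of "{..<n}" "\<lambda>k. h (j + k)"] h0
     by (simp add: add_increasing)
   qed
  qed
 qed
qed

context measure_preserving_map
begin

text \<open>Fatou's lemma bounds the means from below, and the covering bounds means and paths from
  above. Constancy of the liminf is a hypothesis because it will come from ergodicity of the whole
  flow, not of the single map \<open>T\<close>.\<close>

theorem subadditive_ergodic:
 fixes X :: "nat \<Rightarrow> 'w \<Rightarrow> real"
 assumes X: "\<And>n. integrable M (X n)" and nn: "\<And>n x. 0 \<le> X n x" and X0: "\<And>x. X 0 x = 0"
  and sub: "\<And>m n. AE x in M. X (m + n) x \<le> X m x + X n ((T ^^ m) x)"
  and const: "AE x in M. liminf (\<lambda>n. ennreal (X n x / real n)) = c"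
 obtains \<gamma> where "0 \<le> \<gamma>" "(\<lambda>n. (\<integral>x. X n x \<partial>M) / real n) \<longlonglongrightarrow> \<gamma>" "\<And>n. 0 < n \<Longrightarrow> \<gamma> \<le> (\<integral>x. X n x \<partial>M) / real n"
  "AE x in M. (\<lambda>n. X n x / real n) \<longlonglongrightarrow> \<gamma>" "(\<lambda>n. \<integral>x. \<bar>X n x / real n - \<gamma>\<bar> \<partial>M) \<longlonglongrightarrow> 0"
proof -
 have Xm [measurable]: "X n \<in> borel_measurable M" for n using X by simp
 define E where "E n = (\<integral>x. X n x \<partial>M)" for n
 have E_nn: "(\<integral>\<^sup>+x. ennreal (X n x / real m) \<partial>M) = ennreal (E n / real m)" for n m
 proof -
  have "(\<integral>\<^sup>+x. ennreal (X n x / real m) \<partial>M) = ennreal (\<integral>x. X n x / real m \<partial>M)"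
   using X nn by (intro nn_integral_eq_integral) auto
  then show ?thesis by (simp add: E_def)
 qed
 have E0: "0 \<le> E n" for n unfolding E_def using nn by simp
 have E_add: "E (m + n) \<le> E m + E n" for m n
 proof -
  have "E (m + n) \<le> (\<integral>x. X m x + X n ((T ^^ m) x) \<partial>M)"
   unfolding E_def using X sub by (intro integral_mono_AE) (auto intro!: Bochner_Integration.integrable_add integrable_funpow)
  also have "\<dots> = E m + E n"
   unfolding E_def using X by (simp add: integrable_funpow integral_funpow)
  finally show ?thesis .
 qed
 have E_mult: "E (k * n) \<le> real k * E n" for k n
 proof (induction k)
  case 0
  then show ?case using X0 by (simp add: E_def)
 next
  case (Suc k)
  then show ?case using E_add[of n "k * n"] by (simp add: algebra_simps)
 qed
 \<comment> \<open>Fatou's lemma along the multiples of \<open>n\<close>, whose normalised means are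
   at most \<open>E n / n\<close> by subadditivity.\<close>
 have c_le: "c \<le> ennreal (E n / real n)" if n: "0 < n" for n
 proof -
  have "c = (\<integral>\<^sup>+x. c \<partial>M)" by (simp add: emeasure_space_1)
  also have "\<dots> \<le> (\<integral>\<^sup>+x. liminf (\<lambda>k. ennreal (X (Suc k * n) x / real (Suc k * n))) \<partial>M)"
  proof (rule nn_integral_mono_AE)
   have sm: "strict_mono (\<lambda>k. Suc k * n)" using n by (simp add: strict_mono_Suc_iff)
   show "AE x in M. c \<le> liminf (\<lambda>k. ennreal (X (Suc k * n) x / real (Suc k * n)))"
    using const
   proof eventually_elim
    case (elim x)
    show ?case using liminf_subseq_mono[OF sm, of "\<lambda>n. ennreal (X n x / real n)"] elim by (simp add: comp_def)
   qed
  qed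
  also have "\<dots> \<le> liminf (\<lambda>k. \<integral>\<^sup>+x. ennreal (X (Suc k * n) x / real (Suc k * n)) \<partial>M)"
   by (rule nn_integral_liminf) measurable
  also have "\<dots> \<le> liminf (\<lambda>k. ennreal (E n / real n))"
  proof (rule Liminf_mono, rule always_eventually, rule allI)
   fix k
   have "E (Suc k * n) / real (Suc k * n) \<le> (real (Suc k) * E n) / real (Suc k * n)"
    by (rule divide_right_mono[OF E_mult]) simp
   also have "\<dots> = E n / real n" unfolding of_nat_mult by (rule mult_divide_mult_cancel_left) simp
   finally show "(\<integral>\<^sup>+x. ennreal (X (Suc k * n) x / real (Suc k * n)) \<partial>M) \<le> ennreal (E n / real n)"
    unfolding E_nn by (rule ennreal_leI)
  qed
  finally show ?thesis by (simp add: Liminf_const)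
 qed
 obtain \<gamma> where g: "c = ennreal \<gamma>" "0 \<le> \<gamma>" using c_le[of 1] by (cases c) (auto simp: top_unique)
 have g_le: "\<gamma> \<le> E n / real n" if "0 < n" for n
  using c_le[OF that] E0[of n] by (simp add: g ennreal_le_iff)
 have good: "AE x in M. \<forall>j m n. X (m + n) ((T ^^ j) x) \<le> X m ((T ^^ j) x) + X n ((T ^^ (j + m)) x)"
  unfolding AE_all_countable
 proof (intro allI)
  fix j m n
  from AE_funpow[OF sub[of m n], of j]
  show "AE x in M. X (m + n) ((T ^^ j) x) \<le> X m ((T ^^ j) x) + X n ((T ^^ (j + m)) x)"
   by (simp add: funpow_add[of m j, unfolded comp_def] add.commute[of j m])
 qed
 \<comment> \<open>The cost of one step at points where no block of length at most \<open>N\<close>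
   has average cost at most \<open>\<gamma> + \<epsilon>\<close>. Almost every point has such a
   block once \<open>N\<close> is large, so the mean of \<open>h\<close> vanishes as
   \<open>N\<close> grows.\<close>
 define h where "h \<epsilon> N x = (if \<forall>n\<in>{1..N}. real n * (\<gamma> + \<epsilon>) < X n x then X 1 x else 0)" for \<epsilon> N x
 have hm [measurable]: "h \<epsilon> N \<in> borel_measurable M" for \<epsilon> N unfolding h_def by measurable
 have h_bd: "0 \<le> h \<epsilon> N x" "h \<epsilon> N x \<le> X 1 x" for \<epsilon> N x using nn[of 1 x] by (auto simp: h_def)
 have hi: "integrable M (h \<epsilon> N)" for \<epsilon> N
  using h_bd nn by (intro Bochner_Integration.integrable_bound[OF X[of 1]]) auto
 have h_lim: "(\<lambda>N. \<integral>x. h \<epsilon> N x \<partial>M) \<longlonglongrightarrow> 0" if e: "0 < \<epsilon>" for \<epsilon>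
 proof -
  have "(\<lambda>N. \<integral>x. h \<epsilon> N x \<partial>M) \<longlonglongrightarrow> (\<integral>x. 0 \<partial>M)"
  proof (rule integral_dominated_convergence[where w = "X 1"])
   show "AE x in M. (\<lambda>N. h \<epsilon> N x) \<longlonglongrightarrow> 0"
    using const
   proof eventually_elim
    case (elim x)
    have "liminf (\<lambda>n. ennreal (X n x / real n)) < ennreal (\<gamma> + \<epsilon>)"
     unfolding elim g(1) using g(2) e by (intro ennreal_lessI) auto
    then have "\<exists>n\<ge>1. ennreal (X n x / real n) < ennreal (\<gamma> + \<epsilon>)"
    proof (rule contrapos_pp)
     assume "\<not> (\<exists>n\<ge>1. ennreal (X n x / real n) < ennreal (\<gamma> + \<epsilon>))"
     then have "\<forall>\<^sub>F n in sequentially. ennreal (\<gamma> + \<epsilon>) \<le> ennreal (X n x / real n)"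
      by (intro eventually_sequentiallyI[of 1]) (auto simp: not_less)
     then have "ennreal (\<gamma> + \<epsilon>) \<le> liminf (\<lambda>n. ennreal (X n x / real n))" by (rule Liminf_bounded)
     then show "\<not> liminf (\<lambda>n. ennreal (X n x / real n)) < ennreal (\<gamma> + \<epsilon>)" by simp
    qed
    then obtain n where n: "1 \<le> n" "X n x / real n < \<gamma> + \<epsilon>" using nn g e by (auto simp: ennreal_less_iff simp del: ennreal_plus)
    then have "X n x < real n * (\<gamma> + \<epsilon>)" by (simp add: pos_divide_less_eq mult.commute)
    then have "h \<epsilon> N x = 0" if "n \<le> N" for N
     using n that by (auto simp: h_def not_less dest!: bspec[of _ _ n])
    then have "\<forall>\<^sub>F N in sequentially. h \<epsilon> N x = 0" by (rule eventually_sequentiallyI)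
    then show ?case by (rule tendsto_eventually)
   qed
   show "AE x in M. norm (h \<epsilon> N x) \<le> X 1 x" for N using h_bd by simp
  qed (use X in auto)
  then show ?thesis by simp
 qed
 have cover: "AE x in M. \<forall>n N. X n x \<le> real n * (\<gamma> + \<epsilon>) + (\<Sum>k<n. h \<epsilon> N ((T ^^ k) x)) + (\<Sum>k\<in>{n - N..<n}. X 1 ((T ^^ k) x))"
  if e: "0 < \<epsilon>" for \<epsilon>
  using good
 proof eventually_elim
  case (elim x)
  show ?case
  proof (intro allI)
   fix n N
   have "X n ((T ^^ 0) x) \<le> real n * (\<gamma> + \<epsilon>) + (\<Sum>k<n. h \<epsilon> N ((T ^^ (0 + k)) x)) + (\<Sum>k\<in>{n - N..<n}. X 1 ((T ^^ (0 + k)) x))"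
    by (rule subadditive_covering[where a = "\<lambda>j n. X n ((T ^^ j) x)" and h = "\<lambda>j. h \<epsilon> N ((T ^^ j) x)"])
      (use elim X0 nn g e in \<open>auto simp: h_def\<close>)
   then show "X n x \<le> real n * (\<gamma> + \<epsilon>) + (\<Sum>k<n. h \<epsilon> N ((T ^^ k) x)) + (\<Sum>k\<in>{n - N..<n}. X 1 ((T ^^ k) x))" by simp
  qed
 qed
 have Elim: "(\<lambda>n. E n / real n) \<longlonglongrightarrow> \<gamma>"
 proof (rule LIMSEQ_I)
  fix r :: real assume r: "0 < r"
  define \<epsilon> where "\<epsilon> = r / 4"
  have e: "0 < \<epsilon>" using r by (simp add: \<epsilon>_def)
  obtain N where N: "(\<integral>x. h \<epsilon> N x \<partial>M) < \<epsilon>"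
   using order_tendstoD(2)[OF h_lim[OF e] e] by (auto simp: eventually_sequentially)
  have bound: "E n \<le> real n * (\<gamma> + \<epsilon>) + real n * \<epsilon> + real N * E 1" for n
  proof -
   have "E n \<le> (\<integral>x. real n * (\<gamma> + \<epsilon>) + (\<Sum>k<n. h \<epsilon> N ((T ^^ k) x)) + (\<Sum>k\<in>{n - N..<n}. X 1 ((T ^^ k) x)) \<partial>M)"
    unfolding E_def using cover[OF e] X hi
    by (intro integral_mono_AE) (auto intro!: Bochner_Integration.integrable_add Bochner_Integration.integrable_sum integrable_funpow)
   also have "\<dots> = real n * (\<gamma> + \<epsilon>) + (\<Sum>k<n. \<integral>x. h \<epsilon> N x \<partial>M) + (\<Sum>k\<in>{n - N..<n}. E 1)"
    unfolding E_def using X hi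
    by (simp add: Bochner_Integration.integral_sum integrable_funpow integral_funpow prob_space)
   also have "\<dots> \<le> real n * (\<gamma> + \<epsilon>) + real n * \<epsilon> + real N * E 1"
   proof -
    have "(\<Sum>k<n. \<integral>x. h \<epsilon> N x \<partial>M) \<le> real n * \<epsilon>" using N by (simp add: mult_left_mono)
    moreover have "(\<Sum>k\<in>{n - N..<n}. E 1) \<le> real N * E 1" using E0[of 1] by (auto intro!: mult_right_mono)
    ultimately show ?thesis by linarith
   qed
   finally show ?thesis .
  qed
  obtain n0 :: nat where n0: "real N * E 1 / \<epsilon> < real n0" using reals_Archimedean2 by blast
  show "\<exists>no. \<forall>n\<ge>no. norm (E n / real n - \<gamma>) < r"
  proof (intro exI allI impI)
   fix n assume n: "max 1 n0 \<le> n"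
   then have n1: "0 < real n" by simp
   have "real N * E 1 < \<epsilon> * real n0" using n0 e by (simp add: pos_divide_less_eq mult.commute)
   also have "\<dots> \<le> \<epsilon> * real n" using n e by (intro mult_left_mono) auto
   finally have "E n < real n * (\<gamma> + \<epsilon>) + real n * \<epsilon> + real n * \<epsilon>" using bound[of n] by (simp add: mult.commute)
   then have "E n < (\<gamma> + 3 * \<epsilon>) * real n" by (simp add: algebra_simps)
   then have "E n / real n < \<gamma> + 3 * \<epsilon>" using n1 by (simp add: pos_divide_less_eq)
   then show "norm (E n / real n - \<gamma>) < r" using g_le[of n] n1 r by (simp add: \<epsilon>_def)
  qed
 qed
 have tail: "AE x in M. \<forall>\<^sub>F n in sequentially. X n x \<le> real n * (\<gamma> + 3 * \<epsilon>)" if e: "0 < \<epsilon>" for \<epsilon>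
 proof -
  define D where "D = {x\<in>space M. \<not> (\<forall>\<^sub>F n in sequentially. X n x \<le> real n * (\<gamma> + 3 * \<epsilon>))}"
  have [measurable]: "D \<in> sets M" unfolding D_def eventually_sequentially by measurable
  \<comment> \<open>\<open>D\<close> does not depend on \<open>N\<close>, so a bound that vanishes
    as \<open>N\<close> grows makes it a null event. The bound is the maximal inequality for the
    steps from bad points.\<close>
  have "prob D \<le> (\<integral>x. h \<epsilon> N x \<partial>M) / \<epsilon>" for N
  proof -
   define A where "A = {x\<in>space M. \<exists>n. real n * \<epsilon> < (\<Sum>k<n. h \<epsilon> N ((T ^^ k) x))}"
   have [measurable]: "A \<in> sets M" unfolding A_def by measurable
   have "AE x in M. x \<in> D \<longrightarrow> x \<in> A"
    using cover[OF e] AE_funpow_over_n[OF X nn, of 1] AE_space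
   proof eventually_elim
    case (elim x)
    show ?case
    proof
     assume D: "x \<in> D"
     \<comment> \<open>Each of the last \<open>N\<close> steps eventually costs at most
       \<open>\<eta> * n\<close>, so together they cost at most
       \<open>\<epsilon> * n\<close>.\<close>
     define \<eta> where "\<eta> = \<epsilon> / real (Suc N)"
     have eta: "0 < \<eta>" "real N * \<eta> \<le> \<epsilon>" using e by (auto simp: \<eta>_def field_simps)
     obtain K0 where K0: "\<And>k. K0 \<le> k \<Longrightarrow> \<bar>X 1 ((T ^^ k) x) / real k\<bar> < \<eta>"
      using LIMSEQ_D[OF elim(2) eta(1)] by auto
     have last: "(\<Sum>k\<in>{n - N..<n}. X 1 ((T ^^ k) x)) \<le> real n * \<epsilon>" if n: "Suc K0 + N \<le> n" for n
     proof -
      have "X 1 ((T ^^ k) x) \<le> \<eta> * real n" if k: "k \<in> {n - N..<n}" for k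
      proof -
       have k1: "0 < real k" "K0 \<le> k" "k \<le> n" using k n by auto
       have "X 1 ((T ^^ k) x) / real k < \<eta>" using K0[OF k1(2)] by (simp only: abs_less_iff)
       then have "X 1 ((T ^^ k) x) \<le> \<eta> * real k" using k1(1) by (simp add: pos_divide_less_eq less_imp_le)
       also have "\<dots> \<le> \<eta> * real n" using eta k1 by (intro mult_left_mono) auto
       finally show ?thesis .
      qed
      then have "(\<Sum>k\<in>{n - N..<n}. X 1 ((T ^^ k) x)) \<le> (\<Sum>k\<in>{n - N..<n}. \<eta> * real n)" by (rule sum_mono)
      also have "\<dots> \<le> real N * (\<eta> * real n)" using eta by (auto intro!: mult_right_mono)
      also have "\<dots> = real n * (real N * \<eta>)" by simp
      also have "\<dots> \<le> real n * \<epsilon>" using eta by (intro mult_left_mono) auto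
      finally show ?thesis .
     qed
     have "\<not> (\<forall>n\<ge>Suc K0 + N. X n x \<le> real n * (\<gamma> + 3 * \<epsilon>))" using D unfolding D_def eventually_sequentially by blast
     then obtain n where n: "Suc K0 + N \<le> n" "real n * (\<gamma> + 3 * \<epsilon>) < X n x" by (auto simp: not_le)
     have "X n x \<le> real n * (\<gamma> + \<epsilon>) + (\<Sum>k<n. h \<epsilon> N ((T ^^ k) x)) + (\<Sum>k\<in>{n - N..<n}. X 1 ((T ^^ k) x))"
      using elim(1) by blast
     then have "real n * (\<gamma> + 3 * \<epsilon>) < real n * (\<gamma> + \<epsilon>) + (\<Sum>k<n. h \<epsilon> N ((T ^^ k) x)) + real n * \<epsilon>"
      using last[OF n(1)] n(2) by linarith
     then have "real n * \<epsilon> < (\<Sum>k<n. h \<epsilon> N ((T ^^ k) x))" by (simp add: algebra_simps)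
     then show "x \<in> A" using elim(3) by (auto simp: A_def)
    qed
   qed
   then have "prob D \<le> prob A" by (intro finite_measure_mono_AE) auto
   also have "\<dots> \<le> (\<integral>x. h \<epsilon> N x \<partial>M) / \<epsilon>"
    unfolding A_def by (rule maximal_ergodic[OF hi e h_bd(1)])
   finally show ?thesis .
  qed
  moreover have "(\<lambda>N. (\<integral>x. h \<epsilon> N x \<partial>M) / \<epsilon>) \<longlonglongrightarrow> 0 / \<epsilon>" by (intro tendsto_divide h_lim e tendsto_const) (use e in auto)
  ultimately have "prob D \<le> 0 / \<epsilon>" by (intro LIMSEQ_le_const) auto
  then have "prob D = 0" by (simp add: measure_le_0_iff)
  then have "AE x in M. x \<notin> D" by (intro AE_not_in) (auto simp: emeasure_eq_measure null_sets_def)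
  then show ?thesis using AE_space by eventually_elim (auto simp: D_def)
 qed
 have AElim: "AE x in M. (\<lambda>n. X n x / real n) \<longlonglongrightarrow> \<gamma>"
 proof -
  have "AE x in M. \<forall>i::nat. \<forall>\<^sub>F n in sequentially. X n x \<le> real n * (\<gamma> + 3 * inverse (real (Suc i)))"
   unfolding AE_all_countable using tail by simp
  then show ?thesis using const
  proof eventually_elim
   case (elim x)
   show ?case
   proof (rule LIMSEQ_I)
    fix r :: real assume r: "0 < r"
    obtain i where i: "inverse (real (Suc i)) < r / 3" using reals_Archimedean[of "r / 3"] r by auto
    obtain N1 where N1: "\<And>n. N1 \<le> n \<Longrightarrow> X n x \<le> real n * (\<gamma> + 3 * inverse (real (Suc i)))"
     using elim(1) unfolding eventually_sequentially by meson
    have "\<forall>\<^sub>F n in sequentially. \<gamma> - r < X n x / real n"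
    proof (cases "\<gamma> - r < 0")
     case True
     then have "\<gamma> - r < X n x / real n" for n
      by (rule less_le_trans) (use nn[of n x] in simp)
     then show ?thesis by simp
    next
     case False
     have "ennreal (\<gamma> - r) < liminf (\<lambda>n. ennreal (X n x / real n))"
      unfolding elim(2) g(1) using r False g(2) by (intro ennreal_lessI) auto
     then show ?thesis using False by (auto dest!: less_LiminfD elim!: eventually_mono simp: ennreal_less_iff)
    qed
    then obtain N2 where N2: "\<And>n. N2 \<le> n \<Longrightarrow> \<gamma> - r < X n x / real n" unfolding eventually_sequentially by blast
    show "\<exists>no. \<forall>n\<ge>no. norm (X n x / real n - \<gamma>) < r"
    proof (intro exI allI impI)
     fix n assume n: "max 1 (max N1 N2) \<le> n"
     have "X n x / real n \<le> \<gamma> + 3 * inverse (real (Suc i))"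
      using N1[of n] n by (simp add: pos_divide_le_eq mult.commute)
     then show "norm (X n x / real n - \<gamma>) < r" using N2[of n] n i by (simp add: abs_less_iff)
    qed
   qed
  qed
 qed
 \<comment> \<open>An absolute value is the number itself plus twice its negative part. The negative
   part is at most \<open>\<gamma>\<close> because \<open>X\<close> is nonnegative, so its mean
   vanishes by dominated convergence; the rest is the limit of the means.\<close>
 have L1: "(\<lambda>n. \<integral>x. \<bar>X n x / real n - \<gamma>\<bar> \<partial>M) \<longlonglongrightarrow> 0"
 proof -
  have "(\<lambda>n. \<integral>x. max 0 (\<gamma> - X n x / real n) \<partial>M) \<longlonglongrightarrow> (\<integral>x. 0 \<partial>M)"
  proof (rule integral_dominated_convergence[where w = "\<lambda>_. \<gamma>"])
   show "AE x in M. (\<lambda>n. max 0 (\<gamma> - X n x / real n)) \<longlonglongrightarrow> 0"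
    using AElim
   proof eventually_elim
    case (elim x)
    have "(\<lambda>n. max 0 (\<gamma> - X n x / real n)) \<longlonglongrightarrow> max 0 (\<gamma> - \<gamma>)"
     by (intro tendsto_max tendsto_diff tendsto_const elim)
    then show ?case by simp
   qed
   show "AE x in M. norm (max 0 (\<gamma> - X n x / real n)) \<le> \<gamma>" for n
   proof (rule AE_I2)
    fix x show "norm (max 0 (\<gamma> - X n x / real n)) \<le> \<gamma>"
     using nn[of n x] g(2) divide_nonneg_nonneg[of "X n x" "real n"] by simp
   qed
  qed auto
  then have "(\<lambda>n. (E n / real n - \<gamma>) + 2 * (\<integral>x. max 0 (\<gamma> - X n x / real n) \<partial>M)) \<longlonglongrightarrow> (\<gamma> - \<gamma>) + 2 * (\<integral>x. 0 \<partial>M)"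
   by (intro tendsto_add tendsto_diff tendsto_mult tendsto_const Elim)
  moreover have "(\<integral>x. \<bar>X n x / real n - \<gamma>\<bar> \<partial>M) = (E n / real n - \<gamma>) + 2 * (\<integral>x. max 0 (\<gamma> - X n x / real n) \<partial>M)" for n
  proof -
   have i1: "integrable M (\<lambda>x. X n x / real n - \<gamma>)" using X by simp
   have i2: "integrable M (\<lambda>x. max 0 (\<gamma> - X n x / real n))" using X by (intro integrable_max) auto
   have "(\<integral>x. \<bar>X n x / real n - \<gamma>\<bar> \<partial>M) = (\<integral>x. (X n x / real n - \<gamma>) + 2 * max 0 (\<gamma> - X n x / real n) \<partial>M)"
    by (intro Bochner_Integration.integral_cong) (auto simp: max_def)
   also have "\<dots> = (\<integral>x. X n x / real n - \<gamma> \<partial>M) + 2 * (\<integral>x. max 0 (\<gamma> - X n x / real n) \<partial>M)"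
    using i1 i2 by simp
   also have "(\<integral>x. X n x / real n - \<gamma> \<partial>M) = E n / real n - \<gamma>" using X by (simp add: E_def prob_space)
   finally show ?thesis .
  qed
  ultimately show ?thesis by simp
 qed
 show ?thesis
  by (rule that[OF g(2) Elim[unfolded E_def] g_le[unfolded E_def] AElim L1])
qed

end

section \<open>Costs in a controlled potential\<close>

context brownian
begin

text \<open>As \<open>ln 0 = 0\<close>, this is the crossing cost only where the crossing weight is
  positive, which \<open>regular_cross_pos\<close> provides.\<close>

definition cost :: "('a \<Rightarrow> real) \<Rightarrow> 'a \<Rightarrow> 'a \<Rightarrow> real" where
 "cost f x y = - ln (cross_real f x y)"

text \<open>One number \<open>s\<close> controls the potential as a factor and the Green measure in
  the exponent, so that an integrable \<open>s\<close> will do. The rate 1/64 leaves room for the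
  rate 1/16 of \<open>tame\<close> around a nearby centre.\<close>

definition regular :: "('a \<Rightarrow> real) \<Rightarrow> 'a \<Rightarrow> real \<Rightarrow> bool" where
 "regular f c s \<longleftrightarrow> f \<in> borel_measurable borel \<and> 0 \<le> s \<and> (\<forall>v. f v \<le> s * exp ((norm (v - c))\<^sup>2 / 64)) \<and>
   (\<forall>x v. green f x (indicator (ball v 1)) \<le> ennreal (exp (s + (norm (v - c))\<^sup>2 / 64)))"

lemma P_add: "P (y + x) = distr (P x) path_space (add_path y)"
 using wiener_unique[OF wiener wiener_add_path[OF wiener]] by simp

lemma hitting_time_add_path: "hitting_time (y + v) (add_path y w) = hitting_time v w"
 unfolding hitting_time_def by (rule arg_cong[where f = Inf], rule image_cong) (auto simp: dist_norm)

lemma survival_add_path: "survival f t (add_path y w) = survival (\<lambda>v. f (y + v)) t w"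
 unfolding survival_def by (intro arg_cong[where f = exp_neg] nn_integral_cong) (auto simp: indicator_def)

lemma cross_translate:
 assumes f: "f \<in> borel_measurable borel"
 shows "cross (\<lambda>v. f (y + v)) z w = cross f (y + z) (y + w)"
proof -
 have "cross f (y + z) (y + w) = \<E> z (\<lambda>p. indicator (hit_event (y + w)) (add_path y p) *
   surv f (hit (y + w) (add_path y p)) (add_path y p))"
  unfolding cross_def P_add by (rule nn_integral_distr) (use measurable_cross_functional[OF f] in auto)
 also have "\<dots> = cross (\<lambda>v. f (y + v)) z w"
  unfolding cross_def
 proof (rule nn_integral_cong)
  fix p assume "p \<in> space (P z)"
  then have "add_path y p \<in> space path_space" "p \<in> space path_space"
   using measurable_space[OF measurable_add_path, of p y] by auto
  then show "indicator (hit_event (y + w)) (add_path y p) * surv f (hit (y + w) (add_path y p)) (add_path y p) =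
    indicator (hit_event w) p * surv (\<lambda>v. f (y + v)) (hit w p) p"
   by (simp add: hit_def hit_event_def hitting_time_add_path survival_add_path indicator_def)
 qed
 finally show ?thesis by simp
qed

lemma green_translate:
 assumes f: "f \<in> borel_measurable borel" and F: "F \<in> borel_measurable borel"
 shows "green (\<lambda>v. f (y + v)) x (\<lambda>v. F (y + v)) = green f (y + x) F"
proof -
 have "green f (y + x) F = \<E> x (\<lambda>p. total_occupation f F (add_path y p))"
  unfolding green_def P_add by (rule nn_integral_distr) (use measurable_occupation(2)[OF f F] in auto)
 also have "\<dots> = green (\<lambda>v. f (y + v)) x (\<lambda>v. F (y + v))"
  unfolding green_def total_occupation_def
  by (rule nn_integral_cong, rule nn_integral_cong) (simp add: survival_add_path indicator_def)
 finally show ?thesis by simp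
qed

lemma regular_translate:
 assumes f: "f \<in> borel_measurable borel" and r: "regular (\<lambda>v. f (y + v)) c s"
 shows "regular f (y + c) s"
proof -
 have "f v \<le> s * exp ((norm (v - (y + c)))\<^sup>2 / 64)" for v
 proof -
  have "f (y + (v - y)) \<le> s * exp ((norm ((v - y) - c))\<^sup>2 / 64)" using r unfolding regular_def by blast
  then show ?thesis by (simp add: algebra_simps)
 qed
 moreover have "green f x (indicator (ball v 1)) \<le> ennreal (exp (s + (norm (v - (y + c)))\<^sup>2 / 64))" for x v
 proof -
  have "green (\<lambda>v. f (y + v)) (x - y) (indicator (ball (v - y) 1)) \<le> ennreal (exp (s + (norm ((v - y) - c))\<^sup>2 / 64))"
   using r unfolding regular_def by blast
  moreover have "(indicator (ball (v - y) 1) :: 'a \<Rightarrow> ennreal) = (\<lambda>u. indicator (ball v 1) (y + u))"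
   by (auto simp: indicator_def dist_norm algebra_simps fun_eq_iff)
  ultimately show ?thesis
   using green_translate[OF f, of "indicator (ball v 1)" y "x - y"] by (simp add: algebra_simps)
 qed
 ultimately show ?thesis using f r unfolding regular_def by blast
qed

text \<open>A change of centre by at most \<open>R\<close> doubles the rate at most and costs a
  constant. The new bound of the potential and the logarithm of the new Green constant both stay
  affine in \<open>s\<close>.\<close>

lemma regular_tame:
 assumes r: "regular f c s" and R: "norm (c' - c) \<le> R"
 shows "tame f c' (s * exp (R\<^sup>2 / 32)) (exp (s + R\<^sup>2 / 32))"
proof -
 have s: "0 \<le> s" and fm: "f \<in> borel_measurable borel" using r by (auto simp: regular_def)
 have sq: "(norm (v - c))\<^sup>2 / 64 \<le> R\<^sup>2 / 32 + (norm (v - c'))\<^sup>2 / 16" for v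
 proof -
  have "norm (v - c) \<le> norm (v - c') + R" using norm_triangle_ineq[of "v - c'" "c' - c"] R by simp
  then have "(norm (v - c))\<^sup>2 \<le> (norm (v - c') + R)\<^sup>2" by (intro power_mono) auto
  also have "\<dots> \<le> 2 * (norm (v - c'))\<^sup>2 + 2 * R\<^sup>2"
   using zero_le_power2[of "norm (v - c') - R"] by (simp add: power2_eq_square algebra_simps)
  finally show ?thesis using zero_le_power2[of "norm (v - c')"] by linarith
 qed
 have "f v \<le> s * exp (R\<^sup>2 / 32) * exp ((norm (v - c'))\<^sup>2 / 16)" for v
 proof -
  have "f v \<le> s * exp ((norm (v - c))\<^sup>2 / 64)" using r by (auto simp: regular_def)
  also have "\<dots> \<le> s * exp (R\<^sup>2 / 32 + (norm (v - c'))\<^sup>2 / 16)" using s sq by (intro mult_left_mono) auto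
  finally show ?thesis by (simp add: exp_add mult.assoc)
 qed
 moreover have "green f x (indicator (ball v 1)) \<le> ennreal (exp (s + R\<^sup>2 / 32) * exp ((norm (v - c'))\<^sup>2 / 16))" for x v
 proof -
  have "green f x (indicator (ball v 1)) \<le> ennreal (exp (s + (norm (v - c))\<^sup>2 / 64))" using r by (auto simp: regular_def)
  also have "\<dots> \<le> ennreal (exp ((s + R\<^sup>2 / 32) + (norm (v - c'))\<^sup>2 / 16))" using sq[of v] by (intro ennreal_leI) simp
  finally show ?thesis by (simp only: exp_add)
 qed
 ultimately show ?thesis using s fm by (auto simp: tame_def pot_bound_def green_bound_def)
qed

lemma cost_bounded:
 "\<exists>C\<ge>0. \<forall>f c s z w. regular f c s \<longrightarrow> z \<in> cball c R \<longrightarrow> w \<in> cball c R \<longrightarrow> 0 < cross_real f z w \<and> cost f z w \<le> C * (1 + s)"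
proof -
 obtain C where C: "0 \<le> C" "\<And>f c K z y. pot_bound f c K \<Longrightarrow> norm (z - c) \<le> R \<Longrightarrow> norm (y - c) \<le> R \<Longrightarrow>
   ennreal (exp (- C * (1 + K))) \<le> cross f z y" using cross_lower[of R] by blast
 show ?thesis
 proof (intro exI[of _ C] conjI allI impI)
  fix f c s and z w :: 'a assume a: "regular f c s" "z \<in> cball c R" "w \<in> cball c R"
  have "pot_bound f c s" using regular_tame[OF a(1), of c 0] by (simp add: tame_def)
  then have "ennreal (exp (- C * (1 + s))) \<le> cross f z w"
   using a by (intro C(2)) (auto simp: dist_norm norm_minus_commute)
  then have le: "exp (- C * (1 + s)) \<le> cross_real f z w" by (simp add: cross_eq_real cross_real_bounds)
  then show p: "0 < cross_real f z w" by (rule less_le_trans[rotated]) simp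
  have "ln (exp (- C * (1 + s))) \<le> ln (cross_real f z w)" using le p by (subst ln_le_cancel_iff) auto
  then show "cost f z w \<le> C * (1 + s)" by (simp add: cost_def)
 qed (rule C)
qed

lemma regular_cross_pos: "regular f c s \<Longrightarrow> 0 < cross_real f z w"
 using cost_bounded[of "dist c z + dist c w"] by (auto simp: add_increasing add_increasing2)

lemma cost_nonneg [simp]: "0 \<le> cost f z w"
 using cross_real_bounds[of f z w] by (cases "cross_real f z w = 0") (auto simp: cost_def)

lemma cost_eq_0: "z \<in> cball y 1 \<Longrightarrow> cost f z y = 0"
 by (simp add: cost_def cross_real_def cross_eq_1)

text \<open>Logarithmic form of \<open>cross_subadditive\<close>: \<open>q\<close> bounds the cost
  from every point at which the path may arrive.\<close>

lemma cost_triangle: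
 assumes r: "regular f c s" and q: "\<And>v. v \<in> cball y 1 \<Longrightarrow> cost f v z \<le> q"
 shows "cost f x z \<le> cost f x y + q"
proof -
 have "ennreal (exp (- q)) \<le> cross f v z" if v: "v \<in> cball y 1" for v
 proof -
  have "exp (- q) \<le> exp (ln (cross_real f v z))" using q[OF v] by (simp add: cost_def)
  then show ?thesis using regular_cross_pos[OF r] by (simp add: cross_eq_real ennreal_leI)
 qed
 moreover have "f \<in> borel_measurable borel" using r by (simp add: regular_def)
 ultimately have "cross f x y * ennreal (exp (- q)) \<le> cross f x z" by (intro cross_subadditive)
 then have "cross_real f x y * exp (- q) \<le> cross_real f x z"
  by (simp add: cross_eq_real ennreal_mult'[symmetric] cross_real_bounds)
 then have "ln (cross_real f x y * exp (- q)) \<le> ln (cross_real f x z)"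
  using regular_cross_pos[OF r] by (subst ln_le_cancel_iff) auto
 then show ?thesis using regular_cross_pos[OF r, of x y] by (simp add: cost_def ln_mult)
qed

lemma cost_compare:
 assumes "regular f c s" "exp (- D) * cross_real f x y \<le> cross_real f x' y'"
 shows "cost f x' y' \<le> cost f x y + D"
proof -
 have "ln (exp (- D) * cross_real f x y) \<le> ln (cross_real f x' y')"
  using assms(2) regular_cross_pos[OF assms(1)] by (subst ln_le_cancel_iff) auto
 then show ?thesis using regular_cross_pos[OF assms(1), of x y] by (simp add: cost_def ln_mult)
qed

text \<open>The Green function is known through integrals; its continuity turns bounds on small
  balls into bounds at their centre.\<close>

lemma density_bounds:
 fixes g :: "'a \<Rightarrow> ennreal"
 assumes g: "continuous_on UNIV g" and r: "0 < r"
  and lo: "\<And>\<delta>. 0 < \<delta> \<Longrightarrow> \<delta> < r \<Longrightarrow> ennreal e1 * emeasure lborel (ball y \<delta>) \<le> (\<integral>\<^sup>+v\<in>ball y \<delta>. g v \<partial>lborel)"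
  and up: "\<And>\<delta>. 0 < \<delta> \<Longrightarrow> \<delta> < r \<Longrightarrow> (\<integral>\<^sup>+v\<in>ball y \<delta>. g v \<partial>lborel) \<le> ennreal e2 * emeasure lborel (ball y \<delta>)"
 shows "ennreal e1 \<le> g y" "g y \<le> ennreal e2"
proof -
 have const: "(\<integral>\<^sup>+v\<in>ball y d. m \<partial>lborel) = m * emeasure lborel (ball y d)" for m d
  by (simp add: nn_integral_cmult_indicator)
 have "isCont g y" using g by (simp add: continuous_on_eq_continuous_at)
 then show "ennreal e1 \<le> g y" "g y \<le> ennreal e2"
  using ball_average_le[of y "\<lambda>_. ennreal e1" y g r] ball_average_le[of y g y "\<lambda>_. ennreal e2" r] r lo up by (simp_all add: const)
qed

text \<open>Collects the comparisons in the form used along a ray: an error affine in the control at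
  each end of the crossing, with one constant that depends on \<open>R\<close> but not on the
  potential.\<close>

theorem cost_comparison:
 assumes R: "0 \<le> R"
 obtains C where "0 \<le> C"
  "\<And>f c s z w. regular f c s \<Longrightarrow> z \<in> cball c R \<Longrightarrow> w \<in> cball c R \<Longrightarrow> cost f z w \<le> C * (1 + s)"
  "\<And>f c s y t z z' y' y''. regular f c s \<Longrightarrow> regular f y t \<Longrightarrow> z \<in> cball c 1 \<Longrightarrow> z' \<in> cball c 1 \<Longrightarrow>
    y' \<in> cball y R \<Longrightarrow> y'' \<in> cball y R \<Longrightarrow> cost f z y' \<le> cost f z' y'' + C * (1 + s) + C * (1 + t)"
  "\<And>f c s y t. regular f c s \<Longrightarrow> regular f y t \<Longrightarrow> cost f y c \<le> cost f c y + C * (1 + s) + C * (1 + t)"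
  "\<And>f x y t y' g. regular f y t \<Longrightarrow> y' \<in> cball y R \<Longrightarrow> 1 \<le> dist x y' \<or> DIM('a) = 1 \<Longrightarrow> continuous_on UNIV g \<Longrightarrow>
    (\<And>A. A \<in> sets borel \<Longrightarrow> green f x (indicator A) = (\<integral>\<^sup>+v\<in>A. g v \<partial>lborel)) \<Longrightarrow>
    \<exists>G. neg_log (g y') = ereal G \<and> \<bar>G - cost f x y'\<bar> \<le> C * (1 + t)"
proof (rule harnack, rule green_cross_bounds, goal_cases)
 case (1 H G)
 note H = 1(2-4) and G = 1(5-7)
 \<comment> \<open>The 5 leaves room for unit balls around points within \<open>R\<close> of the
   centre, and for treating end points closer than 5 by the crude bound \<open>C1\<close>.\<close>
 define R' where "R' = R + 5"
 define k where "k = exp (R'\<^sup>2 / 32)"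
 define B where "B = 2 + k + R'\<^sup>2 / 32"
 have k: "0 < k" by (simp add: k_def)
 have tame: "tame f c' (s * k) (exp (s + R'\<^sup>2 / 32))" if "regular f c s" "c' \<in> cball c R'" for f c s c'
  unfolding k_def by (rule regular_tame[OF that(1)]) (use that(2) in \<open>auto simp: dist_norm norm_minus_commute\<close>)
 have nn: "0 \<le> s" if "regular f c s" for f c s using that by (simp add: regular_def)
 have B: "1 + s * k + ln (exp (s + R'\<^sup>2 / 32)) \<le> B * (1 + s)" if "0 \<le> s" for s
 proof -
  have "0 \<le> s * (R'\<^sup>2 / 32)" using that by simp
  then show ?thesis using that k by (simp only: B_def ln_exp distrib_left distrib_right mult.commute mult_1_right)
 qed
 obtain C1 where C1: "0 \<le> C1" "\<And>f c s z w. regular f c s \<Longrightarrow> z \<in> cball c R' \<Longrightarrow> w \<in> cball c R' \<Longrightarrow> cost f z w \<le> C1 * (1 + s)"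
  using cost_bounded[of R'] by blast
 define C where "C = C1 + 2 * (H * B) + G * B"
 have B0: "0 < B" using k by (simp add: B_def add_pos_nonneg)
 have HB: "0 \<le> H * B" "0 \<le> G * B" using H(1) G(1) B0 by auto
 have C0: "0 \<le> C" using C1(1) HB by (simp add: C_def)
 have le: "C1 * (1 + s) + 2 * (H * B * (1 + s)) + G * B * (1 + s) = C * (1 + s)" for s by (simp add: C_def algebra_simps)
 \<comment> \<open>One use of the Harnack inequality, around the midpoint \<open>m\<close>. Since
   \<open>m\<close> is within 1 of \<open>c\<close>, the distance 5 between \<open>c\<close> and
   \<open>y\<close> leaves more than the required 3.\<close>
 have step: "cost f z2 y \<le> cost f z1 y + H * B * (1 + s) + H * B * (1 + t)"
  if r: "regular f c s" "regular f y0 t" "z1 \<in> cball c 1" "z2 \<in> cball c 1" "dist z1 z2 \<le> 1" "5 \<le> dist c y" "y \<in> cball y0 R'"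
  for f c s y0 t z1 z2 y
 proof -
  define m where "m = (1 / 2) *\<^sub>R (z1 + z2)"
  have "m - z1 = (1 / 2) *\<^sub>R (z2 - z1)" "m - z2 = (1 / 2) *\<^sub>R (z1 - z2)"
   unfolding m_def by (simp_all add: algebra_simps flip: scaleR_left.add)
  then have mz: "z1 \<in> cball m (1 / 2)" "z2 \<in> cball m (1 / 2)" using r(5) by (auto simp: dist_norm norm_minus_commute)
  have mc: "m \<in> cball c 1"
   using convexD_alt[OF convex_cball r(3,4), of "1 / 2"] by (simp add: m_def algebra_simps)
  then have m3: "3 \<le> dist m y" using dist_triangle[of c y m] r(6) by simp
  have "m \<in> cball c R'" using mc R by (simp add: R'_def)
  note h = cost_compare[OF r(1) H(2)[OF tame[OF r(1) this] tame[OF r(2,7)] m3 mz, simplified mult_minus_left]]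
  have "H * (2 + s * k + ln (exp (s + R'\<^sup>2 / 32)) + t * k + ln (exp (t + R'\<^sup>2 / 32))) \<le> H * (B * (1 + s) + B * (1 + t))"
   using B[OF nn[OF r(1)]] B[OF nn[OF r(2)]] H(1) by (intro mult_left_mono) auto
  then show ?thesis using h by (simp add: algebra_simps)
 qed
 show ?case
 proof (rule that[OF C0])
  fix f c s and z w :: 'a assume a: "regular f c s" "z \<in> cball c R" "w \<in> cball c R"
  have "cost f z w \<le> C1 * (1 + s)" using a by (intro C1(2)) (auto simp: R'_def)
  then show "cost f z w \<le> C * (1 + s)"
   using le[of s] HB nn[OF a(1)] mult_nonneg_nonneg[OF HB(1), of "1 + s"] mult_nonneg_nonneg[OF HB(2), of "1 + s"] by linarith
 next
  fix f c s y t and z z' y' y'' :: 'a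
  assume a: "regular f c s" "regular f y t" "z \<in> cball c 1" "z' \<in> cball c 1" "y' \<in> cball y R" "y'' \<in> cball y R"
  have s0: "0 \<le> H * B * (1 + s)" "0 \<le> G * B * (1 + s)" "0 \<le> C1 * (1 + s)" using HB C1 nn[OF a(1)] by auto
  have t0: "0 \<le> H * B * (1 + t)" "0 \<le> G * B * (1 + t)" "0 \<le> C1 * (1 + t)" using HB C1 nn[OF a(2)] by auto
  have "cost f z y' \<le> cost f z y'' + C1 * (1 + t)"
  proof (rule cost_triangle[OF a(1)])
   fix v assume "v \<in> cball y'' 1"
   then show "cost f v y' \<le> C1 * (1 + t)"
    using a(5,6) dist_triangle[of y v y''] by (intro C1(2)[OF a(2)]) (auto simp: R'_def)
  qed
  moreover have "cost f z y'' \<le> cost f z' y'' + C1 * (1 + s) + 2 * (H * B * (1 + s)) + 2 * (H * B * (1 + t))"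
  proof (cases "5 \<le> dist c y''")
   case True
   have y: "y'' \<in> cball y R'" and cc: "c \<in> cball c 1" using a(6) by (auto simp: R'_def)
   \<comment> \<open>\<open>z\<close> and \<open>z'\<close> may be 2 apart, so the comparison passes
     through \<open>c\<close>.\<close>
   have "cost f z y'' \<le> cost f c y'' + H * B * (1 + s) + H * B * (1 + t)"
    by (rule step[OF a(1,2) cc a(3) _ True y]) (use a(3) in \<open>auto simp: dist_commute\<close>)
   moreover have "cost f c y'' \<le> cost f z' y'' + H * B * (1 + s) + H * B * (1 + t)"
    by (rule step[OF a(1,2) a(4) cc _ True y]) (use a(4) in \<open>auto simp: dist_commute\<close>)
   ultimately show ?thesis using s0 by linarith
  next
   case False
   then have "cost f z y'' \<le> C1 * (1 + s)" using a(3) R by (intro C1(2)[OF a(1)]) (auto simp: R'_def)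
   then show ?thesis using s0 t0 cost_nonneg[of f z' y''] by linarith
  qed
  ultimately show "cost f z y' \<le> cost f z' y'' + C * (1 + s) + C * (1 + t)"
   using le[of s] le[of t] s0 t0 by linarith
 next
  fix f and c :: 'a and s y t assume a: "regular f c s" "regular f y t"
  have s0: "0 \<le> H * B * (1 + s)" "0 \<le> G * B * (1 + s)" "0 \<le> C1 * (1 + s)" using HB C1 nn[OF a(1)] by auto
  have t0: "0 \<le> H * B * (1 + t)" "0 \<le> G * B * (1 + t)" "0 \<le> C1 * (1 + t)" using HB C1 nn[OF a(2)] by auto
  have "cost f y c \<le> cost f c y + C1 * (1 + s) + H * B * (1 + s) + H * B * (1 + t)"
  proof (cases "4 \<le> dist c y")
   case True
   have "exp (- (H * (2 + s * k + ln (exp (s + R'\<^sup>2 / 32)) + t * k + ln (exp (t + R'\<^sup>2 / 32))))) * cross_real f c y \<le> cross_real f y c"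
    using R by (intro H(3)[simplified mult_minus_left] tame[OF a(1)] tame[OF a(2)] True) (auto simp: R'_def)
   from cost_compare[OF a(1) this]
   have h: "cost f y c \<le> cost f c y + H * (2 + s * k + ln (exp (s + R'\<^sup>2 / 32)) + t * k + ln (exp (t + R'\<^sup>2 / 32)))" .
   have "H * (2 + s * k + ln (exp (s + R'\<^sup>2 / 32)) + t * k + ln (exp (t + R'\<^sup>2 / 32))) \<le> H * (B * (1 + s) + B * (1 + t))"
    using B[OF nn[OF a(1)]] B[OF nn[OF a(2)]] H(1) by (intro mult_left_mono) auto
   also have "\<dots> = H * B * (1 + s) + H * B * (1 + t)" by (simp add: algebra_simps)
   finally show ?thesis using h s0 by linarith
  next
   case False
   then have "cost f y c \<le> C1 * (1 + s)" using R by (intro C1(2)[OF a(1)]) (auto simp: R'_def)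
   then show ?thesis using s0 t0 cost_nonneg[of f c y] by linarith
  qed
  then show "cost f y c \<le> cost f c y + C * (1 + s) + C * (1 + t)" using le[of s] le[of t] s0 t0 by linarith
 next
  fix f and x :: 'a and y t y' and g :: "'a \<Rightarrow> ennreal"
  assume a: "regular f y t" "y' \<in> cball y R" "1 \<le> dist x y' \<or> DIM('a) = 1" "continuous_on UNIV g"
   and g: "\<And>A. A \<in> sets borel \<Longrightarrow> green f x (indicator A) = (\<integral>\<^sup>+v\<in>A. g v \<partial>lborel)"
  have T: "tame f y' (t * k) (exp (t + R'\<^sup>2 / 32))" using a(2) by (intro tame[OF a(1)]) (simp add: R'_def)
  define D where "D = G * (1 + t * k + ln (exp (t + R'\<^sup>2 / 32)))"
  define q where "q = cross_real f x y'"
  have q: "0 < q" "cross f x y' = ennreal q" unfolding q_def using regular_cross_pos[OF a(1)] by (auto simp: cross_eq_real)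
  have x: "x \<notin> ball y' 1 \<or> DIM('a) = 1" using a(3) by (auto simp: dist_commute)
  have split: "ennreal (exp d * q) * e = ennreal (exp d) * e * ennreal q" for d e
   using q(1) by (simp add: ennreal_mult mult.assoc mult.commute mult.left_commute)
  have b: "ball y' d \<in> sets borel" "d < 3 / 4 \<Longrightarrow> ball y' d \<subseteq> ball y' (3 / 4)" for d by auto
  have lo: "ennreal (exp (- D) * q) * emeasure lborel (ball y' d) \<le> (\<integral>\<^sup>+v\<in>ball y' d. g v \<partial>lborel)"
   and up: "(\<integral>\<^sup>+v\<in>ball y' d. g v \<partial>lborel) \<le> ennreal (exp D * q) * emeasure lborel (ball y' d)" if "d < 3 / 4" for d
   using G(2)[OF T b(1) b(2)[OF that] x] G(3)[OF T b(1) b(2)[OF that] x] unfolding g[OF b(1)] split q(2) D_def by simp_all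
  note bounds = density_bounds[OF a(4) _ lo up, of "3 / 4", simplified]
  define h where "h = enn2real (g y')"
  have gh: "g y' = ennreal h" unfolding h_def using bounds(2) by (simp add: le_less_trans[OF _ ennreal_less_top] less_top)
  have h0: "0 \<le> h" by (simp add: h_def)
  have hb: "exp (- D) * q \<le> h" "h \<le> exp D * q" using bounds h0 q(1) unfolding gh by (auto simp: ennreal_le_iff2)
  have h1: "0 < h" by (rule less_le_trans[OF _ hb(1)]) (use q(1) in simp)
  have "ln (exp (- D) * q) \<le> ln h" "ln h \<le> ln (exp D * q)" using hb h1 q(1) by (simp_all add: ln_le_cancel_iff)
  then have "\<bar>- ln h - cost f x y'\<bar> \<le> D" using q(1) by (simp add: ln_mult cost_def q_def abs_le_iff)
  also have "D \<le> G * (B * (1 + t))" unfolding D_def using B[OF nn[OF a(1)]] G(1) by (intro mult_left_mono) auto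
  also have "\<dots> \<le> C * (1 + t)" using le[of t] HB C1(1) nn[OF a(1)] mult_nonneg_nonneg[OF HB(1), of "1 + t"]
    mult_nonneg_nonneg[OF C1(1), of "1 + t"] unfolding mult.assoc by linarith
  finally have "\<bar>- ln h - cost f x y'\<bar> \<le> C * (1 + t)" .
  moreover have "neg_log (g y') = ereal (- ln h)" using h1 unfolding gh neg_log_def by auto
  ultimately show "\<exists>G. neg_log (g y') = ereal G \<and> \<bar>G - cost f x y'\<bar> \<le> C * (1 + t)" by blast
 qed
qed

end

section \<open>Limits along a stationary environment\<close>

lemma ereal_expectation_real:
 assumes y: "integrable M y" and Y: "AE \<omega> in M. Y \<omega> = ereal (y \<omega>)"
 shows "ereal_expectation M Y = ereal (\<integral>\<omega>. y \<omega> \<partial>M)"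
proof -
 have "(\<integral>\<^sup>+\<omega>. e2ennreal (Y \<omega>) \<partial>M) = (\<integral>\<^sup>+\<omega>. ennreal (y \<omega>) \<partial>M)"
  "(\<integral>\<^sup>+\<omega>. e2ennreal (- Y \<omega>) \<partial>M) = (\<integral>\<^sup>+\<omega>. ennreal (- y \<omega>) \<partial>M)"
  using Y by (auto intro!: nn_integral_cong_AE simp: e2ennreal_ereal elim!: eventually_mono)
 moreover
 have "(\<integral>\<^sup>+\<omega>. ennreal (y \<omega>) \<partial>M) < \<infinity>" "(\<integral>\<^sup>+\<omega>. ennreal (- y \<omega>) \<partial>M) < \<infinity>"
  using y by (auto simp: real_integrable_def less_top)
 then obtain a b where "0 \<le> a" "(\<integral>\<^sup>+\<omega>. ennreal (y \<omega>) \<partial>M) = ennreal a" "0 \<le> b" "(\<integral>\<^sup>+\<omega>. ennreal (- y \<omega>) \<partial>M) = ennreal b"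
  by (auto simp: less_top_ennreal)
 ultimately show ?thesis by (simp add: ereal_expectation_def real_lebesgue_integral_def[OF y] enn2ereal_ennreal)
qed

abbreviation (input) linear_growth :: "'w measure \<Rightarrow> (real \<Rightarrow> 'w \<Rightarrow> ereal) \<Rightarrow> real \<Rightarrow> bool" where
 "linear_growth M Y l \<equiv> converges_AE M (\<lambda>r \<omega>. Y r \<omega> / ereal r) l \<and> converges_L1 M (\<lambda>r \<omega>. Y r \<omega> / ereal r) l \<and>
   ((\<lambda>r. ereal_expectation M (Y r) / ereal r) \<longlongrightarrow> ereal l) at_top"

context measure_preserving_map
begin

text \<open>Passes from integer to real times. Between integers the process differs from
  \<open>X\<close> by values of \<open>\<zeta>\<close> at the two ends of the orbit segment, which
  are negligible after division, almost surely and in mean.\<close>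

lemma interpolated_limit:
 fixes Y :: "real \<Rightarrow> 'w \<Rightarrow> ereal"
 assumes X: "\<And>n. integrable M (X n)" and X_AE: "AE x in M. (\<lambda>n. X n x / real n) \<longlonglongrightarrow> \<gamma>"
  and X_L1: "(\<lambda>n. \<integral>x. \<bar>X n x / real n - \<gamma>\<bar> \<partial>M) \<longlonglongrightarrow> 0"
  and Z: "integrable M \<zeta>" "\<And>x. 0 \<le> \<zeta> x" and Ym: "\<And>r. 0 < r \<Longrightarrow> Y r \<in> borel_measurable M"
  and Y: "AE x in M. \<forall>r\<ge>r0. \<exists>y. Y r x = ereal y \<and> \<bar>y - X (nat \<lfloor>r\<rfloor>) x\<bar> \<le> \<zeta> x + \<zeta> ((T ^^ nat \<lfloor>r\<rfloor>) x)"
 shows "converges_AE M (\<lambda>r x. Y r x / ereal r) \<gamma>" "converges_L1 M (\<lambda>r x. Y r x / ereal r) \<gamma>"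
  "((\<lambda>r. ereal_expectation M (Y r) / ereal r) \<longlongrightarrow> ereal \<gamma>) at_top"
proof -
 \<comment> \<open>One error function for all three conclusions: it tends to 0 almost surely and in
   mean. The summand \<open>\<bar>\<gamma>\<bar>\<close> pays for the difference between
   \<open>r\<close> and its integer part.\<close>
 define h where "h n x = \<bar>X n x / real n - \<gamma>\<bar> + (\<bar>\<gamma>\<bar> + \<zeta> x + \<zeta> ((T ^^ n) x)) / real n" for n x
 define y where "y r x = real_of_ereal (Y r x)" for r x
 define N where "N r = nat \<lfloor>r\<rfloor>" for r :: real
 define R where "R = max 1 r0"
 have N: "filterlim N sequentially at_top"
  unfolding N_def by (rule filterlim_compose[OF filterlim_nat_sequentially filterlim_floor_sequentially])
 have hi: "integrable M (h n)" for n
  unfolding h_def using X Z integrable_funpow[OF Z(1)] by auto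
 have "AE x in M. (\<lambda>n. h n x) \<longlonglongrightarrow> 0"
  using X_AE AE_funpow_over_n[OF Z]
 proof eventually_elim
  case (elim x)
  have "(\<lambda>n. \<bar>X n x / real n - \<gamma>\<bar> + ((\<bar>\<gamma>\<bar> + \<zeta> x) / real n + \<zeta> ((T ^^ n) x) / real n)) \<longlonglongrightarrow> \<bar>\<gamma> - \<gamma>\<bar> + (0 + 0)"
   by (intro tendsto_add tendsto_rabs tendsto_diff elim tendsto_const lim_const_over_n)
  then show ?case by (simp add: h_def add_divide_distrib add.assoc)
 qed
 then have h_AE: "AE x in M. ((\<lambda>r. h (N r) x) \<longlongrightarrow> 0) at_top"
  by (rule AE_mp) (auto intro!: AE_I2 filterlim_compose[OF _ N])
 have "(\<integral>x. h n x \<partial>M) = (\<integral>x. \<bar>X n x / real n - \<gamma>\<bar> \<partial>M) + (\<bar>\<gamma>\<bar> + 2 * (\<integral>x. \<zeta> x \<partial>M)) / real n" for n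
  using X Z integrable_funpow[OF Z(1), of n] integral_funpow[of \<zeta> n] by (simp add: h_def prob_space)
 moreover have "(\<lambda>n. (\<integral>x. \<bar>X n x / real n - \<gamma>\<bar> \<partial>M) + (\<bar>\<gamma>\<bar> + 2 * (\<integral>x. \<zeta> x \<partial>M)) / real n) \<longlonglongrightarrow> 0 + 0"
  by (intro tendsto_add X_L1 lim_const_over_n)
 ultimately have "(\<lambda>n. \<integral>x. h n x \<partial>M) \<longlonglongrightarrow> 0" by simp
 then have h_L1: "((\<lambda>r. \<integral>x. h (N r) x \<partial>M) \<longlongrightarrow> 0) at_top" by (rule filterlim_compose[OF _ N])
 have Yy: "AE x in M. \<forall>r\<ge>R. Y r x = ereal (y r x) \<and> \<bar>y r x / r - \<gamma>\<bar> \<le> h (N r) x"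
  using Y
 proof eventually_elim
  case (elim x)
  show ?case
  proof (intro allI impI)
   fix r assume r: "R \<le> r"
   then obtain z where z: "Y r x = ereal z" "\<bar>z - X (N r) x\<bar> \<le> \<zeta> x + \<zeta> ((T ^^ N r) x)"
    using elim by (auto simp: R_def N_def)
   have n: "1 \<le> real (N r)" "real (N r) \<le> r" "r \<le> real (N r) + 1" using r by (auto simp: N_def R_def le_nat_floor)
   have "z - r * \<gamma> = (z - X (N r) x) + (X (N r) x - real (N r) * \<gamma>) - (r - real (N r)) * \<gamma>" by (simp add: algebra_simps)
   moreover have "\<bar>(r - real (N r)) * \<gamma>\<bar> \<le> 1 * \<bar>\<gamma>\<bar>" unfolding abs_mult using n by (intro mult_right_mono) auto
   ultimately have "\<bar>z - r * \<gamma>\<bar> \<le> \<bar>X (N r) x - real (N r) * \<gamma>\<bar> + (\<bar>\<gamma>\<bar> + \<zeta> x + \<zeta> ((T ^^ N r) x))" using z(2) by linarith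
   then have "\<bar>z - r * \<gamma>\<bar> / r \<le> (\<bar>X (N r) x - real (N r) * \<gamma>\<bar> + (\<bar>\<gamma>\<bar> + \<zeta> x + \<zeta> ((T ^^ N r) x))) / real (N r)"
    using n Z(2) by (intro frac_le) auto
   also have "\<dots> = h (N r) x"
   proof -
    have "X (N r) x / real (N r) - \<gamma> = (X (N r) x - real (N r) * \<gamma>) / real (N r)" using n by (simp add: field_simps)
    then show ?thesis using n by (simp add: h_def add_divide_distrib abs_divide)
   qed
   also have "\<bar>z - r * \<gamma>\<bar> / r = \<bar>z / r - \<gamma>\<bar>"
   proof -
    have "z / r - \<gamma> = (z - r * \<gamma>) / r" using n by (simp add: field_simps)
    then show ?thesis using n by (simp add: abs_divide)
   qed
   finally show "Y r x = ereal (y r x) \<and> \<bar>y r x / r - \<gamma>\<bar> \<le> h (N r) x" using z by (simp add: y_def)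
  qed
 qed
 have R: "1 \<le> R" by (simp add: R_def)
 have evR: "\<forall>\<^sub>F r in at_top. R \<le> r" by (rule eventually_ge_at_top)
 show "converges_AE M (\<lambda>r x. Y r x / ereal r) \<gamma>"
  unfolding converges_AE_def using Yy h_AE
 proof eventually_elim
  case (elim x)
  have "((\<lambda>r. y r x / r - \<gamma>) \<longlongrightarrow> 0) at_top"
   by (rule Lim_null_comparison[OF _ elim(2)], use evR in eventually_elim) (use elim(1) in auto)
  then have "((\<lambda>r. ereal (y r x / r)) \<longlongrightarrow> ereal \<gamma>) at_top" by (simp add: LIM_zero_iff)
  moreover have "\<forall>\<^sub>F r in at_top. ereal (y r x / r) = Y r x / ereal r"
   using evR by eventually_elim (use elim(1) R in auto)
  ultimately show ?case by (rule Lim_transform_eventually)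
 qed
 have le: "AE x in M. \<bar>y r x / r - \<gamma>\<bar> \<le> h (N r) x \<and> Y r x = ereal (y r x)" if "R \<le> r" for r
  using Yy by eventually_elim (use that in auto)
 have [measurable]: "y r \<in> borel_measurable M" if "R \<le> r" for r
  unfolding y_def using Ym[of r] that R by auto
 show "converges_L1 M (\<lambda>r x. Y r x / ereal r) \<gamma>"
  unfolding converges_L1_def
 proof (intro conjI allI impI)
  fix r :: real assume "0 < r"
  then show "(\<lambda>x. Y r x / ereal r) \<in> borel_measurable M" using Ym by measurable
 next
  have "(\<integral>\<^sup>+x. e2ennreal \<bar>Y r x / ereal r - ereal \<gamma>\<bar> \<partial>M) \<le> ennreal (\<integral>x. h (N r) x \<partial>M)" if r: "R \<le> r" for r
  proof -
   have "(\<integral>\<^sup>+x. e2ennreal \<bar>Y r x / ereal r - ereal \<gamma>\<bar> \<partial>M) \<le> (\<integral>\<^sup>+x. ennreal (h (N r) x) \<partial>M)"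
    by (rule nn_integral_mono_AE, use le[OF r] in eventually_elim) (use r R in \<open>auto intro!: ennreal_leI simp: e2ennreal_ereal\<close>)
   also have "\<dots> = ennreal (\<integral>x. h (N r) x \<partial>M)"
    by (rule nn_integral_eq_integral[OF hi]) (auto simp: h_def Z(2))
   finally show ?thesis .
  qed
  then have "\<forall>\<^sub>F r in at_top. (\<integral>\<^sup>+x. e2ennreal \<bar>Y r x / ereal r - ereal \<gamma>\<bar> \<partial>M) \<le> ennreal (\<integral>x. h (N r) x \<partial>M)"
   using evR by (rule eventually_mono[rotated])
  moreover have "((\<lambda>r. ennreal (\<integral>x. h (N r) x \<partial>M)) \<longlongrightarrow> 0) at_top" using tendsto_ennrealI[OF h_L1] by simp
  ultimately show "((\<lambda>r. \<integral>\<^sup>+x. e2ennreal \<bar>Y r x / ereal r - ereal \<gamma>\<bar> \<partial>M) \<longlongrightarrow> 0) at_top"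
   by (rule tendsto_sandwich[OF always_eventually _ tendsto_const, rotated]) simp
 qed
 have yi: "integrable M (\<lambda>x. y r x / r)" if r: "R \<le> r" for r
 proof (rule Bochner_Integration.integrable_bound)
  show "integrable M (\<lambda>x. h (N r) x + \<bar>\<gamma>\<bar>)" using hi by simp
  show "AE x in M. norm (y r x / r) \<le> norm (h (N r) x + \<bar>\<gamma>\<bar>)" using le[OF r] by eventually_elim (unfold real_norm_def, arith)
 qed (use r in simp)
 have "((\<lambda>r. (\<integral>x. y r x / r \<partial>M) - \<gamma>) \<longlongrightarrow> 0) at_top"
 proof (rule Lim_null_comparison[OF _ h_L1])
  show "\<forall>\<^sub>F r in at_top. norm ((\<integral>x. y r x / r \<partial>M) - \<gamma>) \<le> (\<integral>x. h (N r) x \<partial>M)"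
   using evR
  proof eventually_elim
   case (elim r)
   have "norm (\<integral>x. y r x / r - \<gamma> \<partial>M) \<le> (\<integral>x. norm (y r x / r - \<gamma>) \<partial>M)" by (rule integral_norm_bound)
   also have "\<dots> \<le> (\<integral>x. h (N r) x \<partial>M)"
    by (rule integral_mono_AE) (use yi[OF elim] le[OF elim] hi in \<open>auto elim: eventually_mono\<close>)
   finally have "norm (\<integral>x. y r x / r - \<gamma> \<partial>M) \<le> (\<integral>x. h (N r) x \<partial>M)" .
   then show ?case using yi[OF elim] by (simp add: prob_space)
  qed
 qed
 then have "((\<lambda>r. ereal (\<integral>x. y r x / r \<partial>M)) \<longlongrightarrow> ereal \<gamma>) at_top" by (simp add: LIM_zero_iff)
 moreover have "\<forall>\<^sub>F r in at_top. ereal (\<integral>x. y r x / r \<partial>M) = ereal_expectation M (Y r) / ereal r"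
  using evR
 proof eventually_elim
  case (elim r)
  have "integrable M (\<lambda>x. r * (y r x / r))" by (intro integrable_mult_right yi elim)
  then have "integrable M (y r)" using elim R by simp
  then have "ereal_expectation M (Y r) = ereal (\<integral>x. y r x \<partial>M)"
   by (rule ereal_expectation_real) (use le[OF elim] in \<open>auto elim: eventually_mono\<close>)
  then show ?case using elim R by simp
 qed
 ultimately show "((\<lambda>r. ereal_expectation M (Y r) / ereal r) \<longlongrightarrow> ereal \<gamma>) at_top" by (rule Lim_transform_eventually)
qed

end

section \<open>Consequences of ergodicity of the flow\<close>

context ergodic_flow
begin

lemma flow_measurable' [measurable]: "tau x \<in> measurable M M"
 by (rule flow_measurable)

lemma flow_pair [measurable]: "(\<lambda>p. tau (snd p) (fst p)) \<in> measurable (M \<Otimes>\<^sub>M borel) M"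
proof -
 have "(\<lambda>p. case (snd p, fst p) of (x, \<omega>) \<Rightarrow> tau x \<omega>) \<in> measurable (M \<Otimes>\<^sub>M borel) M"
  by (rule measurable_compose[OF _ flow_joint_measurable]) measurable
 then show ?thesis by simp
qed

lemma flow_orbit: "\<omega> \<in> space M \<Longrightarrow> (\<lambda>z. tau z \<omega>) \<in> measurable borel M"
 using measurable_compose[OF measurable_Pair1' flow_pair] by simp

lemma AE_flow:
 assumes "AE \<omega> in M. Q \<omega>" shows "AE \<omega> in M. Q (tau y \<omega>)"
proof -
 have "AE \<omega> in distr M M (tau y). Q \<omega>" by (subst flow_invariant) (rule assms)
 then show ?thesis by (rule AE_distrD[rotated]) measurable
qed

lemma flow_map: "measure_preserving_map M (tau x)"
 by unfold_locales (auto simp: flow_measurable flow_invariant)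

lemma flow_funpow: "\<omega> \<in> space M \<Longrightarrow> (tau x ^^ n) \<omega> = tau (real n *\<^sub>R x) \<omega>"
 by (induction n) (simp_all add: flow_zero flow_add algebra_simps)

lemma flow_space: "\<omega> \<in> space M \<Longrightarrow> tau x \<omega> \<in> space M"
 using measurable_space[OF flow_measurable] .

text \<open>Ergodicity speaks about strictly invariant sets; replacing \<open>A\<close> by the set of points whose orbit
 spends almost all Lebesgue time in \<open>A\<close> turns an almost invariant set into a strictly invariant one.\<close>

lemma almost_invariant_prob:
 assumes A [measurable]: "A \<in> sets M" and inv: "\<And>z. AE \<omega> in M. tau z \<omega> \<in> A \<longleftrightarrow> \<omega> \<in> A"
 shows "prob A \<in> {0, 1}"
proof -
 define h where "h \<omega> = (\<integral>\<^sup>+z. indicator (space M - A) (tau z \<omega>) \<partial>(lborel :: 'a measure))" for \<omega>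
 define B where "B = {\<omega>\<in>space M. h \<omega> = 0}"
 have hm [measurable]: "h \<in> borel_measurable M"
  unfolding h_def by measurable
 have [measurable]: "B \<in> sets M" unfolding B_def by measurable
 have hz: "(\<lambda>z. indicator (space M - A) (tau z \<omega>) :: ennreal) \<in> borel_measurable borel" if "\<omega> \<in> space M" for \<omega>
  using flow_orbit[OF that] by measurable
 have h_flow: "h (tau y \<omega>) = h \<omega>" if "\<omega> \<in> space M" for y \<omega>
 proof -
  have "h (tau y \<omega>) = (\<integral>\<^sup>+z. indicator (space M - A) (tau (y + z) \<omega>) \<partial>lborel)"
   unfolding h_def by (simp add: flow_add that add.commute)
  also have "\<dots> = (\<integral>\<^sup>+z. indicator (space M - A) (tau z \<omega>) \<partial>distr lborel borel ((+) y))"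
   using hz[OF that] by (subst nn_integral_distr) auto
  finally show ?thesis by (simp add: h_def lborel_distr_plus)
 qed
 have "tau x ` B = B" for x
 proof
  show "tau x ` B \<subseteq> B" by (auto simp: B_def h_flow flow_space)
  show "B \<subseteq> tau x ` B"
  proof
   fix \<omega> assume w: "\<omega> \<in> B"
   then have "tau x (tau (- x) \<omega>) = \<omega>" by (simp add: B_def flow_add flow_zero)
   moreover have "tau (- x) \<omega> \<in> B" using w by (auto simp: B_def h_flow flow_space)
   ultimately show "\<omega> \<in> tau x ` B" by (metis imageI)
  qed
 qed
 then have "prob B \<in> {0, 1}" by (intro flow_ergodic) auto
 moreover have "AE \<omega> in M. \<omega> \<in> B \<longleftrightarrow> \<omega> \<in> A"
 proof -
  interpret pair_sigma_finite M "lborel :: 'a measure" ..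
  have "AE \<omega> in M. AE z in (lborel :: 'a measure). tau z \<omega> \<in> A \<longleftrightarrow> \<omega> \<in> A"
  proof (rule AE_commute[THEN iffD2])
   show "{p \<in> space (M \<Otimes>\<^sub>M lborel). tau (snd p) (fst p) \<in> A \<longleftrightarrow> fst p \<in> A} \<in> sets (M \<Otimes>\<^sub>M (lborel :: 'a measure))"
    by measurable
  qed (use inv in auto)
  then show ?thesis using AE_space
  proof eventually_elim
   case (elim \<omega>)
   have eq: "h \<omega> = 0 \<longleftrightarrow> (AE z in lborel. tau z \<omega> \<in> A)"
    unfolding h_def using hz[OF elim(2)] flow_space[OF elim(2)]
    by (subst nn_integral_0_iff_AE) (auto simp: indicator_def)
   show ?case
   proof (cases "\<omega> \<in> A")
    case True
    then show ?thesis using elim eq by (auto simp: B_def)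
   next
    case False
    have "\<not> (AE z in lborel. tau z \<omega> \<in> A)"
    proof
     assume "AE z in lborel. tau z \<omega> \<in> A"
     then have "AE z in (lborel :: 'a measure). False" using elim(1) by eventually_elim (use False in auto)
     then show False by (simp add: AE_iff_null null_sets_def)
    qed
    then show ?thesis using False eq by (auto simp: B_def)
   qed
  qed
 qed
 then have "prob B = prob A" by (intro finite_measure_eq_AE) auto
 ultimately show ?thesis by simp
qed

text \<open>The inequality for \<open>z\<close> and for \<open>- z\<close> gives equality, so every
  sublevel set is almost invariant and hence null or full. The constant is the essential supremum
  \<open>Inf S\<close>, reached from above and below along countably many levels.\<close>

lemma almost_invariant_const:
 fixes Z :: "'w \<Rightarrow> ennreal"
 assumes [measurable]: "Z \<in> borel_measurable M" and inv: "\<And>z. AE \<omega> in M. Z (tau z \<omega>) \<le> Z \<omega>"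
 shows "\<exists>c. AE \<omega> in M. Z \<omega> = c"
proof -
 have eq: "AE \<omega> in M. Z (tau z \<omega>) = Z \<omega>" for z
  using inv[of z] AE_flow[OF inv[of "- z"], of z] AE_space
  by eventually_elim (simp add: flow_add flow_zero)
 have dich: "(AE \<omega> in M. Z \<omega> \<le> q) \<or> (AE \<omega> in M. \<not> Z \<omega> \<le> q)" for q
 proof -
  have "prob {\<omega>\<in>space M. Z \<omega> \<le> q} \<in> {0, 1}"
  proof (rule almost_invariant_prob)
   show "AE \<omega> in M. tau z \<omega> \<in> {\<omega>\<in>space M. Z \<omega> \<le> q} \<longleftrightarrow> \<omega> \<in> {\<omega>\<in>space M. Z \<omega> \<le> q}" for z
    using eq[of z] AE_space by eventually_elim (simp add: flow_space)
  qed simp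
  then show ?thesis by (auto simp: prob_Collect_eq_1 prob_Collect_eq_0)
 qed
 define S where "S = {q. AE \<omega> in M. Z \<omega> \<le> q}"
 have "S \<noteq> {}" unfolding S_def by (rule ex_in_conv[THEN iffD1], rule exI[of _ \<top>]) auto
 then obtain q :: "nat \<Rightarrow> ennreal" where q: "range q \<subseteq> S" "Inf S = (INF i. q i)"
  using ennreal_Inf_countable_INF[of S] by blast
 have "AE \<omega> in M. \<forall>i. Z \<omega> \<le> q i" unfolding AE_all_countable using q(1) by (auto simp: S_def)
 then have up: "AE \<omega> in M. Z \<omega> \<le> Inf S" unfolding q(2) by eventually_elim (auto intro: INF_greatest)
 have lo: "AE \<omega> in M. Inf S \<le> Z \<omega>"
 proof (cases "Inf S = 0")
  case False
  then have "0 < Inf S" by (simp add: zero_less_iff_neq_zero)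
  then obtain u where u: "\<And>n::nat. u n < Inf S" "u \<longlonglongrightarrow> Inf S" using approx_from_below_dense_linorder by blast
  have "AE \<omega> in M. \<forall>n. \<not> Z \<omega> \<le> u n"
   unfolding AE_all_countable using dich u(1) by (metis (mono_tags) Inf_lower S_def mem_Collect_eq not_le)
  then show ?thesis by eventually_elim (rule LIMSEQ_le_const2[OF u(2)], auto simp: not_le less_imp_le)
 qed simp
 show ?thesis using up lo by (intro exI[of _ "Inf S"]) (auto elim!: eventually_elim2)
qed

end

section \<open>The Lyapunov exponent of a stationary environment\<close>

definition dense_ball :: "'a::euclidean_space set" where
 "dense_ball = (SOME Q. countable Q \<and> Q \<subseteq> cball 0 1 \<and> cball 0 1 \<subseteq> closure Q)"

lemma dense_ball:
 "countable (dense_ball :: 'a::euclidean_space set)" "(dense_ball :: 'a set) \<subseteq> cball 0 1" "cball (0::'a) 1 \<subseteq> closure dense_ball"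
proof -
 have "\<exists>Q :: 'a set. countable Q \<and> Q \<subseteq> cball 0 1 \<and> cball 0 1 \<subseteq> closure Q"
  using separable[of "cball (0::'a) 1"] by metis
 from someI_ex[OF this]
 show "countable (dense_ball :: 'a set)" "(dense_ball :: 'a set) \<subseteq> cball 0 1" "cball 0 1 \<subseteq> closure (dense_ball :: 'a set)"
  unfolding dense_ball_def by auto
qed

text \<open>Apart from measurability, the potential enters from here on only through stationarity
  and one integrable function \<open>\<xi>\<close> that makes almost every realisation regular
  around 0. By stationarity it is then regular around \<open>y\<close> with control
  \<open>\<xi> (tau y \<omega>)\<close>.\<close>

locale environment = ergodic_flow M tau + brownian P
 for M :: "'w measure" and tau :: "'a::euclidean_space \<Rightarrow> 'w \<Rightarrow> 'w" and P :: "'a \<Rightarrow> (real \<Rightarrow> 'a) measure" +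
 fixes f :: "'w \<Rightarrow> 'a \<Rightarrow> real" and \<xi> :: "'w \<Rightarrow> real"
 assumes f_joint: "(\<lambda>(\<omega>, v). f \<omega> v) \<in> borel_measurable (M \<Otimes>\<^sub>M borel)"
  and f_flow: "\<And>\<omega> y. \<omega> \<in> space M \<Longrightarrow> f (tau y \<omega>) = (\<lambda>v. f \<omega> (y + v))"
  and \<xi>_integrable: "integrable M \<xi>" and \<xi>_nonneg: "\<And>\<omega>. 0 \<le> \<xi> \<omega>"
  and \<xi>_regular: "AE \<omega> in M. regular (f \<omega>) 0 (\<xi> \<omega>)"
begin

lemma \<xi>_measurable [measurable]: "\<xi> \<in> borel_measurable M"
 using \<xi>_integrable by simp

lemma f_borel: "\<omega> \<in> space M \<Longrightarrow> f \<omega> \<in> borel_measurable borel"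
 using measurable_compose[OF measurable_Pair1' f_joint] by simp

lemma measurable_cross_environment: "(\<lambda>\<omega>. cross (f \<omega>) z y) \<in> borel_measurable M"
proof -
 interpret Pz: prob_space "P z" by (rule prob_P)
 note [measurable] = f_joint
 have "(\<lambda>x. survival (f (fst x)) (hit y (snd x)) (snd x)) \<in> borel_measurable (M \<Otimes>\<^sub>M path_space)"
 proof (rule measurable_survival)
  have "(\<lambda>x. case (fst (fst x), snd x) of (\<omega>, v) \<Rightarrow> f \<omega> v) \<in> borel_measurable ((M \<Otimes>\<^sub>M path_space) \<Otimes>\<^sub>M borel)"
   by (rule measurable_compose[OF _ f_joint]) measurable
  then show "(\<lambda>(x, v). f (fst x) v) \<in> borel_measurable ((M \<Otimes>\<^sub>M path_space) \<Otimes>\<^sub>M borel)"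
   by (simp add: case_prod_beta')
 qed (use measurable_compose[OF measurable_snd hit_measurable] in auto)
 then have "(\<lambda>(\<omega>, w). indicator (hit_event y) w * surv (f \<omega>) (hit y w) w) \<in> borel_measurable (M \<Otimes>\<^sub>M path_space)"
  unfolding case_prod_beta' by measurable
 then have "(\<lambda>(\<omega>, w). indicator (hit_event y) w * surv (f \<omega>) (hit y w) w) \<in> borel_measurable (M \<Otimes>\<^sub>M P z)"
  by (subst measurable_cong_sets[OF sets_pair_measure_cong[OF refl sets_P] refl])
 from Pz.borel_measurable_nn_integral[OF this] show ?thesis by (simp add: cross_def)
qed

lemma measurable_cost_environment [measurable]: "(\<lambda>\<omega>. cost (f \<omega>) z y) \<in> borel_measurable M"
 unfolding cost_def cross_real_def using measurable_cross_environment by measurable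

lemma regular_at: "AE \<omega> in M. regular (f \<omega>) y (\<xi> (tau y \<omega>))"
 using AE_flow[OF \<xi>_regular, of y] AE_space
proof eventually_elim
 case (elim \<omega>)
 show ?case using regular_translate[OF f_borel[OF elim(2)], of y 0] elim by (simp add: f_flow)
qed

lemma cost_flow: "\<omega> \<in> space M \<Longrightarrow> cost (f (tau y \<omega>)) z w = cost (f \<omega>) (y + z) (y + w)"
 by (simp add: f_flow cost_def cross_real_def cross_translate[OF f_borel])

text \<open>The supremum over all starting points is taken over a countable set to make it measurable;
 the two agree by continuity of the cost in its starting point.\<close>

definition worst :: "'a \<Rightarrow> 'w \<Rightarrow> real" where
 "worst y \<omega> = enn2real (SUP z\<in>dense_ball. ennreal (cost (f \<omega>) z y))"

lemma worst_measurable [measurable]: "worst y \<in> borel_measurable M"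
proof -
 have "(\<lambda>\<omega>. SUP z\<in>dense_ball. ennreal (cost (f \<omega>) z y)) \<in> borel_measurable M"
  by (rule borel_measurable_SUP[OF dense_ball(1)]) measurable
 then show ?thesis unfolding worst_def[abs_def] by measurable
qed

lemma worst_nonneg [simp]: "0 \<le> worst y \<omega>"
 by (simp add: worst_def)

lemma worst_le:
 assumes "\<And>z. z \<in> cball 0 1 \<Longrightarrow> cost (f \<omega>) z y \<le> q" shows "worst y \<omega> \<le> q"
proof -
 have "0 \<le> q" using assms[of 0] order_trans[OF cost_nonneg] by simp
 moreover have "(SUP z\<in>dense_ball. ennreal (cost (f \<omega>) z y)) \<le> ennreal q"
  using assms dense_ball(2) by (intro SUP_least ennreal_leI) auto
 ultimately show ?thesis unfolding worst_def using enn2real_mono[of _ "ennreal q"] by fastforce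
qed

text \<open>Outside the target ball, continuity in the starting point extends the bound from the
  dense set to the whole ball of starts; inside the target ball the cost is 0.\<close>

lemma worst_ge:
 assumes r: "regular (f \<omega>) c s" and z: "z \<in> cball 0 1"
 shows "cost (f \<omega>) z y \<le> worst y \<omega>"
proof -
 define R where "R = norm c + norm (y - c) + 1"
 obtain C where C: "\<And>f c s z w. regular f c s \<Longrightarrow> z \<in> cball c R \<Longrightarrow> w \<in> cball c R \<Longrightarrow> cost f z w \<le> C * (1 + s)"
  using cost_bounded[of R] by blast
 have b: "cost (f \<omega>) q y \<le> C * (1 + s)" if "q \<in> dense_ball" for q
 proof (rule C[OF r])
  have "norm q \<le> 1" using that dense_ball(2) by auto
  then show "q \<in> cball c R"
   using norm_triangle_ineq4[of c q] norm_ge_zero[of "y - c"] unfolding mem_cball dist_norm R_def by linarith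
 qed (simp add: dist_norm norm_minus_commute R_def)
 \<comment> \<open>Finiteness matters because \<open>enn2real\<close> would send an infinite
   supremum to 0.\<close>
 have fin: "(SUP z\<in>dense_ball. ennreal (cost (f \<omega>) z y)) < \<top>"
  by (rule le_less_trans[OF SUP_least ennreal_less_top[of "C * (1 + s)"]]) (use b in \<open>auto intro: ennreal_leI\<close>)
 have q: "cost (f \<omega>) q y \<le> worst y \<omega>" if "q \<in> dense_ball" for q
  using enn2real_mono[OF SUP_upper[OF that, of "\<lambda>z. ennreal (cost (f \<omega>) z y)"] fin] by (simp add: worst_def)
 show ?thesis
 proof (cases "z \<in> cball y 1")
  case False
  have "pot_bound (f \<omega>) c (s * exp (0\<^sup>2 / 32))" using regular_tame[OF r, of c 0] by (simp add: tame_def)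
  then have "isCont (\<lambda>z. cross_real (f \<omega>) z y) z" using False by (rule isCont_cross_real)
  moreover obtain u where u: "\<And>n. u n \<in> dense_ball" "u \<longlonglongrightarrow> z"
   using z dense_ball(3) closure_sequential[of z dense_ball] by auto
  ultimately have "(\<lambda>n. cost (f \<omega>) (u n) y) \<longlonglongrightarrow> cost (f \<omega>) z y"
   unfolding cost_def using regular_cross_pos[OF r, of z y]
   by (intro tendsto_minus tendsto_ln isCont_tendsto_compose[of z "\<lambda>z. cross_real (f \<omega>) z y"]) auto
  then show ?thesis by (rule LIMSEQ_le_const2) (use q u(1) in auto)
 qed (simp add: cost_eq_0)
qed

lemma worst_0: "norm y \<le> 1 \<Longrightarrow> y = 0 \<Longrightarrow> worst y \<omega> = 0"
 using worst_le[of \<omega> y 0] worst_nonneg[of y \<omega>] by (simp add: cost_eq_0 antisym)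

lemma worst_add: "AE \<omega> in M. worst (u + v) \<omega> \<le> worst u \<omega> + worst v (tau u \<omega>)"
 using \<xi>_regular AE_flow[OF \<xi>_regular, of u] AE_space
proof eventually_elim
 case (elim \<omega>)
 show ?case
 proof (rule worst_le)
  fix z :: 'a assume z: "z \<in> cball 0 1"
  have "cost (f \<omega>) z (u + v) \<le> cost (f \<omega>) z u + worst v (tau u \<omega>)"
  proof (rule cost_triangle[OF elim(1)])
   fix w assume w: "w \<in> cball u 1"
   have "cost (f (tau u \<omega>)) (w - u) v \<le> worst v (tau u \<omega>)"
    by (rule worst_ge[OF elim(2)]) (use w in \<open>auto simp: dist_norm norm_minus_commute\<close>)
   then show "cost (f \<omega>) w (u + v) \<le> worst v (tau u \<omega>)" by (simp add: cost_flow[OF elim(3)])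
  qed
  then show "cost (f \<omega>) z (u + v) \<le> worst u \<omega> + worst v (tau u \<omega>)" using worst_ge[OF elim(1) z, of u] by linarith
 qed
qed

lemma integrable_\<xi>_flow: "integrable M (\<lambda>\<omega>. \<xi> (tau y \<omega>))"
 using integrable_distr[of "tau y" M M \<xi>] \<xi>_integrable by (simp add: flow_invariant)

lemma integral_flow: "X \<in> borel_measurable M \<Longrightarrow> (\<integral>\<omega>. X (tau y \<omega>) \<partial>M) = (\<integral>\<omega>. (X \<omega> :: real) \<partial>M)"
 using integral_distr[of "tau y" M M X] by (simp add: flow_invariant)

lemma
 shows integrable_worst: "integrable M (worst y)" and integrable_cost: "integrable M (\<lambda>\<omega>. cost (f \<omega>) 0 y)"
proof -
 obtain C where C: "\<forall>f c s z w. regular f c s \<longrightarrow> z \<in> cball c (norm y + 1) \<longrightarrow> w \<in> cball c (norm y + 1) \<longrightarrow>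
   0 < cross_real f z w \<and> cost f z w \<le> C * (1 + s)" using cost_bounded[of "norm y + 1"] by blast
 have "integrable M (\<lambda>\<omega>. C * (1 + \<xi> \<omega>))" using \<xi>_integrable by simp
 note b = Bochner_Integration.integrable_bound[OF this]
 have z: "AE \<omega> in M. \<forall>z\<in>cball 0 1. cost (f \<omega>) z y \<le> C * (1 + \<xi> \<omega>)"
  using \<xi>_regular
 proof eventually_elim
  case (elim \<omega>)
  have "z \<in> cball 0 1 \<Longrightarrow> z \<in> cball 0 (norm y + 1)" "y \<in> cball 0 (norm y + 1)" for z :: 'a
   by (auto simp: dist_norm add_increasing)
  then show ?case using C elim by meson
 qed
 show "integrable M (worst y)"
  by (rule b) (use z in \<open>auto elim!: eventually_mono intro: worst_le order_trans[OF _ abs_ge_self]\<close>)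
 show "integrable M (\<lambda>\<omega>. cost (f \<omega>) 0 y)"
  by (rule b) (use z in \<open>auto elim!: eventually_mono intro: order_trans[OF _ abs_ge_self]\<close>)
qed

lemma worst_compare:
 assumes "0 \<le> R"
 shows "\<exists>C\<ge>0. \<forall>\<omega> y s t y'. regular (f \<omega>) 0 s \<longrightarrow> regular (f \<omega>) y t \<longrightarrow> y' \<in> cball y R \<longrightarrow>
  \<bar>cost (f \<omega>) 0 y' - worst y \<omega>\<bar> \<le> C * (1 + s) + C * (1 + t)"
proof (rule cost_comparison[OF assms], goal_cases)
 case (1 C)
 note C = 1(1,3)
 show ?case
 proof (intro exI[of _ C] conjI allI impI)
  fix \<omega> y s t y' assume a: "regular (f \<omega>) 0 s" "regular (f \<omega>) y t" "y' \<in> cball y R"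
  have y: "y \<in> cball y R" and z0: "(0::'a) \<in> cball 0 1" using assms by auto
  have "cost (f \<omega>) 0 y' \<le> worst y \<omega> + C * (1 + s) + C * (1 + t)"
   using C(2)[OF a(1,2) z0 z0 a(3) y] worst_ge[OF a(1) z0, of y] by linarith
  moreover have "worst y \<omega> \<le> cost (f \<omega>) 0 y' + C * (1 + s) + C * (1 + t)"
   by (rule worst_le) (rule C(2)[OF a(1,2) _ z0 y a(3)])
  ultimately show "\<bar>cost (f \<omega>) 0 y' - worst y \<omega>\<bar> \<le> C * (1 + s) + C * (1 + t)" by linarith
 qed (rule C(1))
qed

text \<open>A crossing from near \<open>z\<close> to \<open>z + n x\<close> is bounded by one from
  near 0 to \<open>n x\<close> and two detours, from \<open>z\<close> to 0 and from
  \<open>n x\<close> to \<open>z + n x\<close>. The first detour has a cost independent of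
  \<open>n\<close>, the second is controlled by \<open>\<xi>\<close> at \<open>n x\<close>, which is
  o(n).\<close>

lemma liminf_worst_invariant:
 "AE \<omega> in M. liminf (\<lambda>n. ennreal (worst (real n *\<^sub>R x) (tau z \<omega>) / real n)) \<le> liminf (\<lambda>n. ennreal (worst (real n *\<^sub>R x) \<omega> / real n))"
proof -
 obtain C where C: "\<And>f c s u w. regular f c s \<Longrightarrow> u \<in> cball c (norm z + 1) \<Longrightarrow> w \<in> cball c (norm z + 1) \<Longrightarrow> cost f u w \<le> C * (1 + s)"
  using cost_bounded[of "norm z + 1"] by blast
 interpret T: measure_preserving_map M "tau x" by (rule flow_map)
 have "AE \<omega> in M. \<forall>n. regular (f \<omega>) (real n *\<^sub>R x) (\<xi> (tau (real n *\<^sub>R x) \<omega>))"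
  unfolding AE_all_countable using regular_at by blast
 then show ?thesis using \<xi>_regular T.AE_funpow_over_n[OF \<xi>_integrable \<xi>_nonneg] AE_space
 proof eventually_elim
  case (elim \<omega>)
  let ?e = "\<lambda>n. (C * (1 + \<xi> \<omega>) + C) / real n + C * (\<xi> ((tau x ^^ n) \<omega>) / real n)"
  have z: "z \<in> cball 0 (norm z + 1)" "0 \<in> cball (0::'a) (norm z + 1)" by auto
  have "worst (real n *\<^sub>R x) (tau z \<omega>) \<le> worst (real n *\<^sub>R x) \<omega> + C * (1 + \<xi> \<omega>) + C * (1 + \<xi> (tau (real n *\<^sub>R x) \<omega>))" for n
  proof (rule worst_le)
   fix w :: 'a assume w: "w \<in> cball 0 1"
   let ?y = "real n *\<^sub>R x"
   have "cost (f \<omega>) v (z + ?y) \<le> worst ?y \<omega> + C * (1 + \<xi> (tau ?y \<omega>))" if v: "v \<in> cball 0 1" for v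
   proof -
    have "cost (f \<omega>) v (z + ?y) \<le> cost (f \<omega>) v ?y + C * (1 + \<xi> (tau ?y \<omega>))"
    proof (rule cost_triangle[OF elim(2)])
     fix u assume "u \<in> cball ?y 1"
     then have "u \<in> cball ?y (norm z + 1)" by (auto simp: add_increasing)
     moreover have "z + ?y \<in> cball ?y (norm z + 1)" by (simp add: dist_norm)
     ultimately show "cost (f \<omega>) u (z + ?y) \<le> C * (1 + \<xi> (tau ?y \<omega>))" using elim(1) C by blast
    qed
    then show ?thesis using worst_ge[OF elim(2) v, of ?y] by linarith
   qed
   from cost_triangle[OF elim(2) this]
   have "cost (f \<omega>) (z + w) (z + ?y) \<le> cost (f \<omega>) (z + w) 0 + (worst ?y \<omega> + C * (1 + \<xi> (tau ?y \<omega>)))" .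
   moreover have "z + w \<in> cball 0 (norm z + 1)" using w norm_triangle_ineq[of z w] by simp
   then have "cost (f \<omega>) (z + w) 0 \<le> C * (1 + \<xi> \<omega>)" using elim(2) C z by blast
   ultimately show "cost (f (tau z \<omega>)) w ?y \<le> worst ?y \<omega> + C * (1 + \<xi> \<omega>) + C * (1 + \<xi> (tau ?y \<omega>))"
    by (simp add: cost_flow[OF elim(4)])
  qed
  then have le: "worst (real n *\<^sub>R x) (tau z \<omega>) / real n \<le> worst (real n *\<^sub>R x) \<omega> / real n + ?e n" for n
   using flow_funpow[OF elim(4), of n x]
   by (simp add: divide_right_mono algebra_simps flip: add_divide_distrib)
  have "?e \<longlonglongrightarrow> 0 + C * 0" by (intro tendsto_add tendsto_mult tendsto_const lim_const_over_n elim)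
  then have e: "?e \<longlonglongrightarrow> 0" by simp
  show ?case
  proof (rule ennreal_le_epsilon)
   fix r :: real assume r: "0 < r"
   have "liminf (\<lambda>n. ennreal (worst (real n *\<^sub>R x) (tau z \<omega>) / real n)) \<le>
     liminf (\<lambda>n. ennreal r + ennreal (worst (real n *\<^sub>R x) \<omega> / real n))"
   proof (rule Liminf_mono, use order_tendstoD(2)[OF e r] in eventually_elim)
    case (elim n)
    then have "worst (real n *\<^sub>R x) (tau z \<omega>) / real n \<le> r + worst (real n *\<^sub>R x) \<omega> / real n" using le[of n] by linarith
    then have "ennreal (worst (real n *\<^sub>R x) (tau z \<omega>) / real n) \<le> ennreal (r + worst (real n *\<^sub>R x) \<omega> / real n)" by (rule ennreal_leI)
    then show ?case using r by (subst (asm) ennreal_plus) simp_all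
   qed
   then show "liminf (\<lambda>n. ennreal (worst (real n *\<^sub>R x) (tau z \<omega>) / real n)) \<le>
     liminf (\<lambda>n. ennreal (worst (real n *\<^sub>R x) \<omega> / real n)) + ennreal r"
    by (simp add: Liminf_const_add add.commute)
  qed
 qed
qed

section \<open>The exponent, its limits and its seminorm property\<close>

definition exponent :: "'a \<Rightarrow> real" where
 "exponent x = lim (\<lambda>n. (\<integral>\<omega>. worst (real n *\<^sub>R x) \<omega> \<partial>M) / real n)"

text \<open>\<open>exponent_limit\<close> serves all variants of the cost: whatever differs from
  \<open>worst\<close> at the integer part of \<open>r\<close> by an affine function of
  \<open>\<xi>\<close> at both ends has the same growth.\<close>

theorem
 shows exponent_nonneg: "0 \<le> exponent x"
  and exponent_tendsto: "(\<lambda>n. (\<integral>\<omega>. worst (real n *\<^sub>R x) \<omega> \<partial>M) / real n) \<longlonglongrightarrow> exponent x"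
  and exponent_le: "0 < n \<Longrightarrow> exponent x \<le> (\<integral>\<omega>. worst (real n *\<^sub>R x) \<omega> \<partial>M) / real n"
  and exponent_limit: "\<And>Y r0 C. (\<And>r. 0 < r \<Longrightarrow> Y r \<in> borel_measurable M) \<Longrightarrow> 0 \<le> C \<Longrightarrow>
   AE \<omega> in M. \<forall>r\<ge>r0. \<exists>y. Y r \<omega> = ereal y \<and> \<bar>y - worst (real (nat \<lfloor>r\<rfloor>) *\<^sub>R x) \<omega>\<bar> \<le>
    C * (1 + \<xi> \<omega>) + C * (1 + \<xi> (tau (real (nat \<lfloor>r\<rfloor>) *\<^sub>R x) \<omega>)) \<Longrightarrow>
   linear_growth M Y (exponent x)"
proof -
 interpret T: measure_preserving_map M "tau x" by (rule flow_map)
 define X where "X n = worst (real n *\<^sub>R x)" for n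
 have "\<exists>c. AE \<omega> in M. liminf (\<lambda>n. ennreal (X n \<omega> / real n)) = c"
  unfolding X_def by (rule almost_invariant_const[OF _ liminf_worst_invariant]) measurable
 then obtain c where c: "AE \<omega> in M. liminf (\<lambda>n. ennreal (X n \<omega> / real n)) = c" by blast
 have sub: "AE \<omega> in M. X (m + n) \<omega> \<le> X m \<omega> + X n ((tau x ^^ m) \<omega>)" for m n
  using worst_add[of "real m *\<^sub>R x" "real n *\<^sub>R x"] AE_space
  by eventually_elim (simp add: X_def flow_funpow scaleR_add_left)
 have X: "integrable M (X n)" "0 \<le> X n \<omega>" "X 0 \<omega> = 0" for n \<omega> by (auto simp: X_def integrable_worst worst_0)
 obtain \<gamma> where g: "0 \<le> \<gamma>" "(\<lambda>n. (\<integral>x. X n x \<partial>M) / real n) \<longlonglongrightarrow> \<gamma>" "\<And>n. 0 < n \<Longrightarrow> \<gamma> \<le> (\<integral>x. X n x \<partial>M) / real n"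
  "AE x in M. (\<lambda>n. X n x / real n) \<longlonglongrightarrow> \<gamma>" "(\<lambda>n. \<integral>x. \<bar>X n x / real n - \<gamma>\<bar> \<partial>M) \<longlonglongrightarrow> 0"
  by (rule T.subadditive_ergodic[OF X sub c]) (rule that)
 have e: "exponent x = \<gamma>" unfolding exponent_def using limI[OF g(2)] by (simp add: X_def)
 show "0 \<le> exponent x" "(\<lambda>n. (\<integral>\<omega>. worst (real n *\<^sub>R x) \<omega> \<partial>M) / real n) \<longlonglongrightarrow> exponent x"
  "0 < n \<Longrightarrow> exponent x \<le> (\<integral>\<omega>. worst (real n *\<^sub>R x) \<omega> \<partial>M) / real n"
  using g(1-3) by (auto simp: e X_def)
 fix Y :: "real \<Rightarrow> 'w \<Rightarrow> ereal" and r0 C :: real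
 assume Y: "\<And>r. 0 < r \<Longrightarrow> Y r \<in> borel_measurable M" "0 \<le> C"
  and b: "AE \<omega> in M. \<forall>r\<ge>r0. \<exists>y. Y r \<omega> = ereal y \<and> \<bar>y - worst (real (nat \<lfloor>r\<rfloor>) *\<^sub>R x) \<omega>\<bar> \<le>
    C * (1 + \<xi> \<omega>) + C * (1 + \<xi> (tau (real (nat \<lfloor>r\<rfloor>) *\<^sub>R x) \<omega>))"
 have z: "integrable M (\<lambda>\<omega>. C * (1 + \<xi> \<omega>))" "\<And>\<omega>. 0 \<le> C * (1 + \<xi> \<omega>)" using \<xi>_integrable \<xi>_nonneg Y(2) by auto
 have b': "AE \<omega> in M. \<forall>r\<ge>r0. \<exists>y. Y r \<omega> = ereal y \<and> \<bar>y - X (nat \<lfloor>r\<rfloor>) \<omega>\<bar> \<le>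
   C * (1 + \<xi> \<omega>) + C * (1 + \<xi> ((tau x ^^ nat \<lfloor>r\<rfloor>) \<omega>))"
  using b AE_space by eventually_elim (simp add: X_def flow_funpow)
 show "linear_growth M Y (exponent x)"
  unfolding e by (intro conjI T.interpolated_limit[OF X(1) g(4,5) z Y(1) b'])
qed

lemma AE_regular_along: "AE \<omega> in M. regular (f \<omega>) 0 (\<xi> \<omega>) \<and> (\<forall>n. regular (f \<omega>) (real n *\<^sub>R x) (\<xi> (tau (real n *\<^sub>R x) \<omega>)))"
 using \<xi>_regular regular_at by (auto simp: AE_all_countable)

lemma ray_near: "0 \<le> r \<Longrightarrow> r *\<^sub>R x \<in> cball (real (nat \<lfloor>r\<rfloor>) *\<^sub>R x) (norm x)"
proof -
 assume "0 \<le> r"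
 then have "\<bar>real (nat \<lfloor>r\<rfloor>) - r\<bar> \<le> 1" by linarith
 then have "\<bar>real (nat \<lfloor>r\<rfloor>) - r\<bar> * norm x \<le> 1 * norm x" by (intro mult_right_mono) auto
 then show ?thesis by (simp add: dist_norm flip: scaleR_left.diff)
qed

lemma cost_limit:
 assumes Y: "\<And>r. 0 < r \<Longrightarrow> Y r \<in> borel_measurable M"
  and Yc: "AE \<omega> in M. \<forall>r. Y r \<omega> = ereal (cost (f \<omega>) 0 (r *\<^sub>R x))"
 shows "linear_growth M Y (exponent x)"
proof -
 obtain C where C: "0 \<le> C" "\<forall>\<omega> y s t y'. regular (f \<omega>) 0 s \<longrightarrow> regular (f \<omega>) y t \<longrightarrow> y' \<in> cball y (norm x) \<longrightarrow>
  \<bar>cost (f \<omega>) 0 y' - worst y \<omega>\<bar> \<le> C * (1 + s) + C * (1 + t)" using worst_compare[of "norm x"] by auto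
 show ?thesis
 proof (rule exponent_limit[OF Y C(1)])
  show "AE \<omega> in M. \<forall>r\<ge>0. \<exists>y. Y r \<omega> = ereal y \<and> \<bar>y - worst (real (nat \<lfloor>r\<rfloor>) *\<^sub>R x) \<omega>\<bar> \<le>
    C * (1 + \<xi> \<omega>) + C * (1 + \<xi> (tau (real (nat \<lfloor>r\<rfloor>) *\<^sub>R x) \<omega>))"
   using AE_regular_along[of x] Yc
  proof eventually_elim
   case (elim \<omega>)
   then show ?case using C(2) ray_near[of _ x] by blast
  qed
 qed
qed

lemma green_limit:
 assumes x: "x \<noteq> 0 \<or> DIM('a) = 1" and Y: "\<And>y. g y \<in> borel_measurable M"
  and g: "AE \<omega> in M. continuous_on UNIV (\<lambda>y. g y \<omega>) \<and>
   (\<forall>A\<in>sets borel. green (f \<omega>) 0 (indicator A) = (\<integral>\<^sup>+y\<in>A. g y \<omega> \<partial>lborel))"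
 shows "linear_growth M (\<lambda>r \<omega>. neg_log (g (r *\<^sub>R x) \<omega>)) (exponent x)"
proof -
 obtain C where C: "0 \<le> C" "\<forall>\<omega> y s t y'. regular (f \<omega>) 0 s \<longrightarrow> regular (f \<omega>) y t \<longrightarrow> y' \<in> cball y (norm x) \<longrightarrow>
  \<bar>cost (f \<omega>) 0 y' - worst y \<omega>\<bar> \<le> C * (1 + s) + C * (1 + t)" using worst_compare[of "norm x"] by auto
 show ?thesis
 proof (rule cost_comparison[OF norm_ge_zero[of x]], goal_cases)
 case (1 C')
 note C' = 1(1,5)
 show ?case
 proof (rule exponent_limit)
  show "0 \<le> C + C'" using C C' by simp
  have "neg_log \<in> borel_measurable borel" unfolding neg_log_def[abs_def] by measurable
  then show "(\<lambda>\<omega>. neg_log (g (r *\<^sub>R x) \<omega>)) \<in> borel_measurable M" for r by (rule measurable_compose[OF Y])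
  show "AE \<omega> in M. \<forall>r\<ge>inverse (norm x). \<exists>y. neg_log (g (r *\<^sub>R x) \<omega>) = ereal y \<and> \<bar>y - worst (real (nat \<lfloor>r\<rfloor>) *\<^sub>R x) \<omega>\<bar> \<le>
    (C + C') * (1 + \<xi> \<omega>) + (C + C') * (1 + \<xi> (tau (real (nat \<lfloor>r\<rfloor>) *\<^sub>R x) \<omega>))"
   using AE_regular_along[of x] g
  proof eventually_elim
   case (elim \<omega>)
   show ?case
   proof (intro allI impI)
    fix r assume r: "inverse (norm x) \<le> r"
    then have r0: "0 \<le> r" using order_trans[of 0 "inverse (norm x)" r] by simp
    have d: "1 \<le> dist 0 (r *\<^sub>R x) \<or> DIM('a) = 1"
     using x r r0 by (auto simp: field_simps inverse_eq_divide)
    let ?n = "real (nat \<lfloor>r\<rfloor>)"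
    have rn: "regular (f \<omega>) 0 (\<xi> \<omega>)" "regular (f \<omega>) (?n *\<^sub>R x) (\<xi> (tau (?n *\<^sub>R x) \<omega>))" using elim by auto
    have "\<exists>G. neg_log (g (r *\<^sub>R x) \<omega>) = ereal G \<and> \<bar>G - cost (f \<omega>) 0 (r *\<^sub>R x)\<bar> \<le> C' * (1 + \<xi> (tau (?n *\<^sub>R x) \<omega>))"
     using elim(2) by (intro C'(2)[OF rn(2) ray_near[OF r0] d, of "\<lambda>y. g y \<omega>"]) auto
    then obtain G where G: "neg_log (g (r *\<^sub>R x) \<omega>) = ereal G"
     "\<bar>G - cost (f \<omega>) 0 (r *\<^sub>R x)\<bar> \<le> C' * (1 + \<xi> (tau (?n *\<^sub>R x) \<omega>))" by blast
    have "\<bar>cost (f \<omega>) 0 (r *\<^sub>R x) - worst (?n *\<^sub>R x) \<omega>\<bar> \<le> C * (1 + \<xi> \<omega>) + C * (1 + \<xi> (tau (?n *\<^sub>R x) \<omega>))"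
     using C(2) rn ray_near[OF r0] by blast
    moreover have "0 \<le> C' * (1 + \<xi> \<omega>)" using C'(1) \<xi>_nonneg by simp
    ultimately have "\<bar>G - worst (?n *\<^sub>R x) \<omega>\<bar> \<le> (C + C') * (1 + \<xi> \<omega>) + (C + C') * (1 + \<xi> (tau (?n *\<^sub>R x) \<omega>))"
     using G(2) unfolding distrib_right[of C C'] by linarith
    then show "\<exists>y. neg_log (g (r *\<^sub>R x) \<omega>) = ereal y \<and> \<bar>y - worst (?n *\<^sub>R x) \<omega>\<bar> \<le>
      (C + C') * (1 + \<xi> \<omega>) + (C + C') * (1 + \<xi> (tau (?n *\<^sub>R x) \<omega>))" using G(1) by blast
   qed
  qed
 qed
 qed
qed

lemma mean_cost_limit: "((\<lambda>r. (\<integral>\<omega>. cost (f \<omega>) 0 (r *\<^sub>R x) \<partial>M) / r) \<longlongrightarrow> exponent x) at_top"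
proof -
 have "((\<lambda>r. ereal_expectation M (\<lambda>\<omega>. ereal (cost (f \<omega>) 0 (r *\<^sub>R x))) / ereal r) \<longlongrightarrow> ereal (exponent x)) at_top"
  using cost_limit[of "\<lambda>r \<omega>. ereal (cost (f \<omega>) 0 (r *\<^sub>R x))" x] by simp
 then have lim: "((\<lambda>r. ereal (\<integral>\<omega>. cost (f \<omega>) 0 (r *\<^sub>R x) \<partial>M) / ereal r) \<longlongrightarrow> ereal (exponent x)) at_top"
  by (simp only: ereal_expectation_real[OF integrable_cost AE_I2[OF refl]])
 have "\<forall>\<^sub>F r in at_top. ereal (\<integral>\<omega>. cost (f \<omega>) 0 (r *\<^sub>R x) \<partial>M) / ereal r = ereal ((\<integral>\<omega>. cost (f \<omega>) 0 (r *\<^sub>R x) \<partial>M) / r)"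
  using eventually_gt_at_top[of 0] by eventually_elim simp
 from Lim_transform_eventually[OF lim this] show ?thesis by simp
qed

text \<open>Positive homogeneity is read off the limit over real \<open>r\<close>, along
  \<open>c * n\<close>. For evenness, stationarity turns the mean cost from 0 to \<open>- y\<close>
  into that from \<open>y\<close> to 0, and approximate symmetry reverses it. The triangle
  inequality is the mean of \<open>worst_add\<close>.\<close>

theorem seminorm_exponent: "seminorm exponent"
proof -
 define e where "e y = (\<integral>\<omega>. cost (f \<omega>) 0 y \<partial>M)" for y
 have lim: "(\<lambda>n. e (real n *\<^sub>R x) / real n) \<longlonglongrightarrow> exponent x" for x
  unfolding e_def by (rule filterlim_compose[OF mean_cost_limit filterlim_real_sequentially])
 have pos: "exponent (c *\<^sub>R x) = c * exponent x" if c: "0 \<le> c" for c x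
 proof (cases "c = 0")
  case True
  have "e 0 = 0" by (simp add: e_def cost_eq_0)
  then have "exponent 0 = 0" using LIMSEQ_unique[OF lim[of 0]] by simp
  then show ?thesis using True by simp
 next
  case False
  then have c: "0 < c" using c by simp
  have "filterlim (\<lambda>n. c * real n) at_top sequentially"
   by (rule filterlim_tendsto_pos_mult_at_top[OF tendsto_const c filterlim_real_sequentially])
  from filterlim_compose[OF mean_cost_limit this, of x]
  have "(\<lambda>n. e ((c * real n) *\<^sub>R x) / (c * real n)) \<longlonglongrightarrow> exponent x" by (simp add: e_def)
  then have "(\<lambda>n. c * (e ((c * real n) *\<^sub>R x) / (c * real n))) \<longlonglongrightarrow> c * exponent x" by (intro tendsto_intros)
  moreover have "(\<lambda>n. c * (e ((c * real n) *\<^sub>R x) / (c * real n))) = (\<lambda>n. e (real n *\<^sub>R (c *\<^sub>R x)) / real n)"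
   using c by (simp add: mult.commute)
  ultimately show ?thesis using LIMSEQ_unique[OF lim[of "c *\<^sub>R x"]] by simp
 qed
 have minus_le: "exponent (- x) \<le> exponent x" for x
 proof (rule cost_comparison[OF order_refl[of 0]], goal_cases)
  case (1 C)
  note C = 1(1,4)
  \<comment> \<open>The mean of the errors at both ends, a constant that disappears after division
    by \<open>n\<close>.\<close>
  define B where "B = 2 * (C * (1 + (\<integral>\<omega>. \<xi> \<omega> \<partial>M)))"
  have "e (- y) \<le> e y + B" for y
  proof -
   have "e (- y) = (\<integral>\<omega>. cost (f (tau y \<omega>)) 0 (- y) \<partial>M)" unfolding e_def by (rule integral_flow[symmetric]) measurable
   also have "\<dots> \<le> (\<integral>\<omega>. cost (f \<omega>) 0 y + C * (1 + \<xi> \<omega>) + C * (1 + \<xi> (tau y \<omega>)) \<partial>M)"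
   proof (rule integral_mono_AE)
    show "integrable M (\<lambda>\<omega>. cost (f (tau y \<omega>)) 0 (- y))"
     using integrable_distr[of "tau y" M M "\<lambda>\<omega>. cost (f \<omega>) 0 (- y)"] integrable_cost by (simp add: flow_invariant)
    show "integrable M (\<lambda>\<omega>. cost (f \<omega>) 0 y + C * (1 + \<xi> \<omega>) + C * (1 + \<xi> (tau y \<omega>)))"
     using integrable_cost \<xi>_integrable integrable_\<xi>_flow by simp
    show "AE \<omega> in M. cost (f (tau y \<omega>)) 0 (- y) \<le> cost (f \<omega>) 0 y + C * (1 + \<xi> \<omega>) + C * (1 + \<xi> (tau y \<omega>))"
     using \<xi>_regular regular_at[of y] AE_space
     by eventually_elim (use C(2) in \<open>auto simp: cost_flow\<close>)
   qed
   also have "\<dots> = e y + B"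
    using integrable_cost[of y] \<xi>_integrable integrable_\<xi>_flow[of y] integral_flow[of \<xi> y]
    by (simp add: e_def B_def prob_space algebra_simps)
   finally show ?thesis .
  qed
  then have "e (- y) / real n \<le> e y / real n + B / real n" for y n
   by (simp add: divide_right_mono flip: add_divide_distrib)
  then have "e (real n *\<^sub>R (- x)) / real n \<le> e (real n *\<^sub>R x) / real n + B / real n" for n by simp
  moreover have "(\<lambda>n. e (real n *\<^sub>R x) / real n + B / real n) \<longlonglongrightarrow> exponent x + 0"
   by (intro tendsto_add lim lim_const_over_n)
  ultimately show ?case using LIMSEQ_le[OF lim[of "- x"]] by force
 qed
 then have minus: "exponent (- x) = exponent x" for x using minus_le[of "- x"] by (simp add: antisym)
 have "exponent (c *\<^sub>R x) = \<bar>c\<bar> * exponent x" for c x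
  using pos[of c x] pos[of "- c" "- x"] minus[of x] by (cases "0 \<le> c") auto
 moreover have "exponent (x + y) \<le> exponent x + exponent y" for x y
 proof (rule LIMSEQ_le[OF exponent_tendsto tendsto_add[OF exponent_tendsto exponent_tendsto]])
  have "(\<integral>\<omega>. worst (u + v) \<omega> \<partial>M) \<le> (\<integral>\<omega>. worst u \<omega> \<partial>M) + (\<integral>\<omega>. worst v \<omega> \<partial>M)" for u v
  proof -
   have i: "integrable M (\<lambda>\<omega>. worst v (tau u \<omega>))"
    using integrable_distr[of "tau u" M M "worst v"] integrable_worst by (simp add: flow_invariant)
   have "(\<integral>\<omega>. worst (u + v) \<omega> \<partial>M) \<le> (\<integral>\<omega>. worst u \<omega> + worst v (tau u \<omega>) \<partial>M)"
    using worst_add i integrable_worst by (intro integral_mono_AE) auto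
   then show ?thesis using i integrable_worst by (simp add: integral_flow)
  qed
  then show "\<exists>N. \<forall>n\<ge>N. (\<integral>\<omega>. worst (real n *\<^sub>R (x + y)) \<omega> \<partial>M) / real n \<le>
    (\<integral>\<omega>. worst (real n *\<^sub>R x) \<omega> \<partial>M) / real n + (\<integral>\<omega>. worst (real n *\<^sub>R y) \<omega> \<partial>M) / real n"
   by (simp add: divide_right_mono scaleR_add_right flip: add_divide_distrib)
 qed
 ultimately show ?thesis unfolding seminorm_def using exponent_nonneg by blast
qed

text \<open>\<open>exponent_le\<close> concerns integers. Used with \<open>n = 1\<close> for the
  vector \<open>r *\<^sub>R x\<close>, homogeneity of the exponent turns it into a bound for every
  real \<open>r\<close>.\<close>

lemma worst_infimum:
 assumes Y: "\<And>r. AE \<omega> in M. Y r \<omega> = ereal (worst (r *\<^sub>R x) \<omega>)"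
 shows "(INF r\<in>{0<..}. ereal_expectation M (Y r) / ereal r) = ereal (exponent x)"
proof (rule antisym)
 define m where "m r = (\<integral>\<omega>. worst (r *\<^sub>R x) \<omega> \<partial>M)" for r
 have eq: "ereal_expectation M (Y r) / ereal r = ereal (m r / r)" if "0 < r" for r
  using that ereal_expectation_real[OF integrable_worst Y] by (simp add: m_def)
 show "ereal (exponent x) \<le> (INF r\<in>{0<..}. ereal_expectation M (Y r) / ereal r)"
 proof (rule INF_greatest)
  fix r :: real assume "r \<in> {0<..}"
  then have r: "0 < r" by simp
  have "r * exponent x \<le> m r"
   using exponent_le[of 1 "r *\<^sub>R x"] seminorm_exponent r by (simp add: seminorm_def m_def)
  then show "ereal (exponent x) \<le> ereal_expectation M (Y r) / ereal r"
   unfolding eq[OF r] using r by (simp add: pos_le_divide_eq mult.commute)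
 qed
 have "(\<lambda>n. ereal (m (real n) / real n)) \<longlonglongrightarrow> ereal (exponent x)" using exponent_tendsto by (simp add: m_def)
 then show "(INF r\<in>{0<..}. ereal_expectation M (Y r) / ereal r) \<le> ereal (exponent x)"
 proof (rule LIMSEQ_le_const)
  show "\<exists>N. \<forall>n\<ge>N. (INF r\<in>{0<..}. ereal_expectation M (Y r) / ereal r) \<le> ereal (m (real n) / real n)"
  proof (intro exI[of _ 1] allI impI)
   fix n :: nat assume n: "1 \<le> n"
   have "(INF r\<in>{0<..}. ereal_expectation M (Y r) / ereal r) \<le> ereal_expectation M (Y (real n)) / ereal (real n)"
    by (rule INF_lower) (use n in simp)
   then show "(INF r\<in>{0<..}. ereal_expectation M (Y r) / ereal r) \<le> ereal (m (real n) / real n)"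
    using eq[of "real n"] n by simp
  qed
 qed
qed

end

section \<open>Stationary potentials are controlled environments\<close>

text \<open>The value of V at \<open>v\<close> is bounded by the supremum over the unit ball around
  any \<open>u\<close> within 1 of \<open>v\<close>. Averaging over these \<open>u\<close> with
  Gaussian weights bounds V at all \<open>v\<close> by a single integral \<open>I\<close>, whose
  mean is finite by stationarity.\<close>

lemma (in ergodic_flow) potential_growth:
 assumes V0 [measurable]: "V0 \<in> borel_measurable M"
  and N: "(\<lambda>\<omega>. SUP x\<in>ball 0 1. ennreal (V0 (tau x \<omega>))) \<in> borel_measurable (completion M)"
  and fin: "(\<integral>\<^sup>+\<omega>. (SUP x\<in>ball 0 1. ennreal (V0 (tau x \<omega>))) \<partial>M) < \<infinity>"
 shows "\<exists>\<eta>. integrable M \<eta> \<and> (\<forall>\<omega>. 0 \<le> \<eta> \<omega>) \<and> (AE \<omega> in M. \<forall>v. V0 (tau v \<omega>) \<le> \<eta> \<omega> * exp ((norm v)\<^sup>2 / 64))"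
proof -
 let ?N = "\<lambda>\<omega>. SUP x\<in>ball 0 1. ennreal (V0 (tau x \<omega>))"
 \<comment> \<open>For \<open>u\<close> within 1 of \<open>v\<close> the squared norm of
   \<open>u\<close> is at most twice that of \<open>v\<close> plus 2, so the rate 1/128 becomes the
   rate 1/64 of the conclusion.\<close>
 let ?e = "\<lambda>u :: 'a. ennreal (exp (- (1 / 128) * (norm (u - 0))\<^sup>2))"
 obtain N' where N' [measurable]: "N' \<in> borel_measurable M" and eq: "AE \<omega> in M. ?N \<omega> = N' \<omega>"
  using completion_ex_borel_measurable[OF N] by blast
 have N'fin: "(\<integral>\<^sup>+\<omega>. N' \<omega> \<partial>M) < \<infinity>" using fin nn_integral_cong_AE[OF eq] by simp
 interpret pair_sigma_finite M "lborel :: 'a measure" ..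
 define I where "I \<omega> = (\<integral>\<^sup>+u. ?e u * N' (tau u \<omega>) \<partial>lborel)" for \<omega>
 have Im [measurable]: "I \<in> borel_measurable M" unfolding I_def by measurable
 have "(\<integral>\<^sup>+\<omega>. I \<omega> \<partial>M) = (\<integral>\<^sup>+u. (\<integral>\<^sup>+\<omega>. ?e u * N' (tau u \<omega>) \<partial>M) \<partial>lborel)"
  unfolding I_def by (rule Fubini'[symmetric]) measurable
 also have "\<dots> = (\<integral>\<^sup>+u. ?e u * (\<integral>\<^sup>+\<omega>. N' \<omega> \<partial>M) \<partial>lborel)"
 proof (rule nn_integral_cong)
  fix u
  have "(\<integral>\<^sup>+\<omega>. N' (tau u \<omega>) \<partial>M) = (\<integral>\<^sup>+\<omega>. N' \<omega> \<partial>M)"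
   using nn_integral_distr[of "tau u" M M N'] by (simp add: flow_invariant)
  then show "(\<integral>\<^sup>+\<omega>. ?e u * N' (tau u \<omega>) \<partial>M) = ?e u * (\<integral>\<^sup>+\<omega>. N' \<omega> \<partial>M)" by (subst nn_integral_cmult) auto
 qed
 also have "\<dots> = (\<integral>\<^sup>+u. ?e u \<partial>lborel) * (\<integral>\<^sup>+\<omega>. N' \<omega> \<partial>M)" by (rule nn_integral_multc) measurable
 also have "\<dots> < \<infinity>" using nn_integral_exp_norm[of "1 / 128" "0 :: 'a"] N'fin by (simp add: ennreal_mult_less_top)
 finally have Ifin: "(\<integral>\<^sup>+\<omega>. I \<omega> \<partial>M) < \<infinity>" .
 then have IAE: "AE \<omega> in M. I \<omega> \<noteq> \<infinity>" by (intro nn_integral_noteq_infinite) auto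
 define b where "b = measure lborel (ball (0::'a) 1)"
 have b: "emeasure lborel (ball v 1) = ennreal b" for v :: 'a
  using emeasure_ball_translate[of v 1 0] ennreal_enn2real[OF emeasure_lborel_ball_finite[of "0::'a" 1, unfolded infinity_ennreal_def]]
  by (simp add: b_def measure_def)
 have b0: "0 < b" using emeasure_ball_pos[of 1 "0::'a"] by (simp add: b)
 define \<eta> where "\<eta> \<omega> = enn2real (I \<omega>) * (exp (1 / 64) / b)" for \<omega>
 have "(\<integral>\<^sup>+\<omega>. ennreal (enn2real (I \<omega>)) \<partial>M) \<le> (\<integral>\<^sup>+\<omega>. I \<omega> \<partial>M)"
  by (rule nn_integral_mono) (simp add: ennreal_enn2real_if)
 then have "integrable M (\<lambda>\<omega>. enn2real (I \<omega>))" using Ifin by (intro integrableI_nonneg) auto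
 then have "integrable M \<eta>" unfolding \<eta>_def by (rule integrable_mult_left)
 moreover have "0 \<le> \<eta> \<omega>" for \<omega> using b0 by (simp add: \<eta>_def)
 moreover have "AE \<omega> in M. \<forall>v. V0 (tau v \<omega>) \<le> \<eta> \<omega> * exp ((norm v)\<^sup>2 / 64)"
 proof -
  \<comment> \<open>The supremum agrees with its measurable version \<open>N'\<close> off the null
    set \<open>B\<close>. Almost every orbit meets \<open>B\<close> only for a Lebesgue null set of
    \<open>u\<close>, which the integral over \<open>u\<close> does not see.\<close>
  obtain B where B: "{\<omega>\<in>space M. ?N \<omega> \<noteq> N' \<omega>} \<subseteq> B" "B \<in> null_sets M"
   using eq unfolding eventually_ae_filter by auto
  have [measurable]: "B \<in> sets M" using B(2) by auto
  have "AE \<omega> in M. AE u in lborel. tau u \<omega> \<notin> B"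
  proof (rule AE_commute[THEN iffD2])
   show "{p \<in> space (M \<Otimes>\<^sub>M lborel). tau (snd p) (fst p) \<notin> B} \<in> sets (M \<Otimes>\<^sub>M (lborel :: 'a measure))" by measurable
  qed (use AE_flow[OF AE_not_in[OF B(2)]] in auto)
  then show ?thesis using IAE AE_space
  proof eventually_elim
   case (elim \<omega>)
   show ?case
   proof
    fix v :: 'a
    define E where "E = exp (- (((norm v)\<^sup>2 + 1) / 64))"
    have "ennreal (V0 (tau v \<omega>)) * ennreal E * ennreal b = (\<integral>\<^sup>+u\<in>ball v 1. ennreal (V0 (tau v \<omega>)) * ennreal E \<partial>lborel)"
     by (simp add: nn_integral_cmult_indicator b)
    also have "\<dots> \<le> I \<omega>"
     unfolding I_def
    proof (rule nn_integral_mono_AE, use elim(1) in eventually_elim)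
     case (elim u)
     show ?case
     proof (cases "u \<in> ball v 1")
      case True
      have "norm u \<le> norm v + 1" using True norm_triangle_ineq2[of u v] by (simp add: dist_norm norm_minus_commute)
      then have "(norm u)\<^sup>2 \<le> (norm v + 1)\<^sup>2" by (intro power_mono) auto
      also have "\<dots> \<le> 2 * ((norm v)\<^sup>2 + 1)"
       using zero_le_power2[of "norm v - 1"] by (simp add: power2_eq_square algebra_simps)
      finally have E: "ennreal E \<le> ?e u" unfolding E_def by (intro ennreal_leI) simp
      have "ennreal (V0 (tau (v - u) (tau u \<omega>))) \<le> ?N (tau u \<omega>)"
       by (rule SUP_upper) (use True in \<open>auto simp: dist_norm norm_minus_commute\<close>)
      moreover have "?N (tau u \<omega>) = N' (tau u \<omega>)" using elim B(1) flow_space[OF \<open>\<omega> \<in> space M\<close>, of u] by blast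
      ultimately have "ennreal (V0 (tau v \<omega>)) \<le> N' (tau u \<omega>)" using \<open>\<omega> \<in> space M\<close> by (simp add: flow_add)
      then have "ennreal E * ennreal (V0 (tau v \<omega>)) \<le> ?e u * N' (tau u \<omega>)" by (intro mult_mono E) auto
      then show ?thesis using True by (simp add: mult.commute)
     qed simp
    qed
    also have "I \<omega> = ennreal (enn2real (I \<omega>))" using elim(2) by (simp add: less_top)
    finally have "ennreal (V0 (tau v \<omega>) * (E * b)) \<le> ennreal (enn2real (I \<omega>))"
     using b0 by (simp add: ennreal_mult'' E_def mult.assoc)
    then have "V0 (tau v \<omega>) * (E * b) \<le> enn2real (I \<omega>)" by (simp add: ennreal_le_iff)
    then have "V0 (tau v \<omega>) \<le> enn2real (I \<omega>) / (E * b)" using b0 by (simp add: pos_le_divide_eq E_def)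
    also have "\<dots> = \<eta> \<omega> * exp ((norm v)\<^sup>2 / 64)"
     unfolding \<eta>_def E_def exp_minus add_divide_distrib exp_add using b0 by (simp add: divide_simps)
    finally show "V0 (tau v \<omega>) \<le> \<eta> \<omega> * exp ((norm v)\<^sup>2 / 64)" .
   qed
  qed
 qed
 ultimately show ?thesis by blast
qed

text \<open>In dimension three and more a constant works. Otherwise the exponent
  \<open>C * (1 + norm (u \<omega> - v))\<close> is split into an integrable part and at most
  \<open>(norm v)\<^sup>2 / 64\<close>.\<close>

lemma (in brownian) green_growth:
 assumes "prob_space M" and f: "\<And>\<omega>. \<omega> \<in> space M \<Longrightarrow> f \<omega> \<in> borel_measurable borel" "\<And>\<omega> v. \<omega> \<in> space M \<Longrightarrow> 0 \<le> f \<omega> v"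
  and low: "DIM('a) \<le> 2 \<Longrightarrow> \<exists>\<rho>>0. \<exists>\<epsilon>>0. \<exists>u \<in> borel_measurable M.
    (AE \<omega> in M. emeasure lborel ({x. f \<omega> x > \<epsilon>} \<inter> ball (u \<omega>) \<rho>) > ennreal \<epsilon>) \<and> integrable M (\<lambda>\<omega>. norm (u \<omega>) ^ DIM('a))"
 shows "\<exists>\<eta>. integrable M \<eta> \<and> (\<forall>\<omega>. 0 \<le> \<eta> \<omega>) \<and>
  (AE \<omega> in M. \<forall>x v. green (f \<omega>) x (indicator (ball v 1)) \<le> ennreal (exp (\<eta> \<omega> + (norm v)\<^sup>2 / 64)))"
proof (cases "DIM('a) \<le> 2")
 case False
 interpret prob_space M by fact
 obtain L where L: "1 \<le> L" "\<forall>f x v. f \<in> borel_measurable borel \<longrightarrow> green f x (indicator (ball v 1)) \<le> ennreal L"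
  using green_bound_transient False by auto
 have "AE \<omega> in M. \<forall>x v. green (f \<omega>) x (indicator (ball v 1)) \<le> ennreal (exp (ln L + (norm v)\<^sup>2 / 64))"
  using AE_space
 proof eventually_elim
  case (elim \<omega>)
  show ?case
  proof (intro allI)
   fix x v
   have "green (f \<omega>) x (indicator (ball v 1)) \<le> ennreal L" using L(2) f(1)[OF elim] by blast
   also have "L * 1 \<le> L * exp ((norm v)\<^sup>2 / 64)" using L(1) by (intro mult_left_mono) auto
   then have "ennreal L \<le> ennreal (exp (ln L + (norm v)\<^sup>2 / 64))" using L(1) by (intro ennreal_leI) (simp add: exp_add)
   finally show "green (f \<omega>) x (indicator (ball v 1)) \<le> ennreal (exp (ln L + (norm v)\<^sup>2 / 64))" .
  qed
 qed
 then show ?thesis using L(1) by (intro exI[of _ "\<lambda>_. ln L"]) auto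
next
 case True
 interpret prob_space M by fact
 obtain \<rho> \<epsilon> u where u: "0 < \<rho>" "0 < \<epsilon>" "u \<in> borel_measurable M"
  "AE \<omega> in M. emeasure lborel ({x. f \<omega> x > \<epsilon>} \<inter> ball (u \<omega>) \<rho>) > ennreal \<epsilon>" "integrable M (\<lambda>\<omega>. norm (u \<omega>) ^ DIM('a))"
  using low[OF True] by blast
 obtain C where C: "0 \<le> C" "\<forall>f u x v. f \<in> borel_measurable borel \<longrightarrow> (\<forall>a. 0 \<le> f a) \<longrightarrow>
   ennreal \<epsilon> < emeasure lborel ({a. \<epsilon> < f a} \<inter> ball u \<rho>) \<longrightarrow> green f x (indicator (ball v 1)) \<le> ennreal (exp (C * (1 + norm (u - v))))"
  using green_bound_recurrent[OF u(1,2)] by blast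
 \<comment> \<open>\<open>16 * C\<^sup>2\<close> completes the square in \<open>C * norm v\<close>;
   the last summand bounds \<open>C * norm (u \<omega>)\<close>, since a nonnegative number is at
   most 1 plus its power.\<close>
 define \<eta> where "\<eta> \<omega> = C + 16 * C\<^sup>2 + C * (1 + norm (u \<omega>) ^ DIM('a))" for \<omega>
 have "AE \<omega> in M. \<forall>x v. green (f \<omega>) x (indicator (ball v 1)) \<le> ennreal (exp (\<eta> \<omega> + (norm v)\<^sup>2 / 64))"
  using u(4) AE_space
 proof eventually_elim
  case (elim \<omega>)
  show ?case
  proof (intro allI)
   fix x v
   have "green (f \<omega>) x (indicator (ball v 1)) \<le> ennreal (exp (C * (1 + norm (u \<omega> - v))))"
    using C(2) f[OF elim(2)] elim(1) by blast
   also have "C * (1 + norm (u \<omega> - v)) \<le> \<eta> \<omega> + (norm v)\<^sup>2 / 64"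
   proof -
    have "norm (u \<omega>) \<le> 1 + norm (u \<omega>) ^ DIM('a)"
     using self_le_power[of "norm (u \<omega>)" "DIM('a)"] by (cases "1 \<le> norm (u \<omega>)") (auto intro: add_increasing2)
    then have "C * norm (u \<omega>) \<le> C * (1 + norm (u \<omega>) ^ DIM('a))" using C(1) by (rule mult_left_mono)
    moreover have "C * norm (u \<omega> - v) \<le> C * norm (u \<omega>) + C * norm v"
     using mult_left_mono[OF norm_triangle_ineq4[of "u \<omega>" v] C(1)] by (simp add: distrib_left)
    moreover have "C * norm v \<le> 16 * C\<^sup>2 + (norm v)\<^sup>2 / 64"
     using zero_le_power2[of "4 * C - norm v / 8"] by (simp add: power2_eq_square field_simps)
    ultimately show ?thesis by (simp add: \<eta>_def distrib_left)
   qed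
   then have "ennreal (exp (C * (1 + norm (u \<omega> - v)))) \<le> ennreal (exp (\<eta> \<omega> + (norm v)\<^sup>2 / 64))"
    by (intro ennreal_leI) simp
   finally show "green (f \<omega>) x (indicator (ball v 1)) \<le> ennreal (exp (\<eta> \<omega> + (norm v)\<^sup>2 / 64))" .
  qed
 qed
 moreover have "integrable M \<eta>" unfolding \<eta>_def using u(5) by simp
 moreover have "0 \<le> \<eta> \<omega>" for \<omega> using C(1) by (simp add: \<eta>_def)
 ultimately show ?thesis by blast
qed

lemma (in brownian) crossing_weight_eq:
 assumes f: "(\<lambda>z. V z \<omega>) \<in> borel_measurable borel"
 shows "crossing_weight P V x y \<omega> = cross_real (\<lambda>z. V z \<omega>) x y"
proof -
 let ?h = "\<lambda>w. indicator (hit_event y) w * surv (\<lambda>z. V z \<omega>) (hit y w) w"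
 have m: "?h \<in> borel_measurable (P x)" using measurable_cross_functional[OF f] by simp
 have "crossing_weight P V x y \<omega> = (\<integral>w. enn2real (?h w) \<partial>P x)"
  unfolding crossing_weight_def
  by (rule Bochner_Integration.integral_cong) (auto simp: hit_event_def hit_def indicator_def)
 also have "\<dots> = enn2real (\<E> x (\<lambda>w. ennreal (enn2real (?h w))))"
  by (rule integral_eq_nn_integral) (use m in auto)
 also have "\<E> x (\<lambda>w. ennreal (enn2real (?h w))) = cross (\<lambda>z. V z \<omega>) x y"
  unfolding cross_def by (rule nn_integral_cong) (simp add: indicator_def)
 finally show ?thesis by (simp add: cross_real_def)
qed

lemma (in brownian) green_measure_eq: "green_measure P V x A \<omega> = green (\<lambda>z. V z \<omega>) x (indicator A)"
 unfolding green_measure_def green_def total_occupation_def by (simp add: mult.commute)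

theorem theorem2p1:
 fixes M :: "'w measure"
  and tau :: "real ^ 'd \<Rightarrow> 'w \<Rightarrow> 'w"
  and V0 :: "'w \<Rightarrow> real"
  and V :: "real ^ 'd \<Rightarrow> 'w \<Rightarrow> real"
  and P :: "real ^ 'd \<Rightarrow> (real \<Rightarrow> real ^ 'd) measure"
 assumes potential: "ergodic_potential M tau V0"
  and V_eq: "\<And>x \<omega>. V x \<omega> = V0 (tau x \<omega>)"
  and wiener: "\<And>x. wiener_measure x (P x)"
  and sup_measurable:
   "(\<lambda>\<omega>. SUP x\<in>ball 0 1. ennreal (V x \<omega>)) \<in> borel_measurable (completion M)"
  and sup_integrable: "(\<integral>\<^sup>+\<omega>. (SUP x\<in>ball 0 1. ennreal (V x \<omega>)) \<partial>M) < \<infinity>"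
  and low_dim: "CARD('d) \<le> 2 \<Longrightarrow>
   \<exists>\<rho>>0. \<exists>\<epsilon>>0. \<exists>u \<in> borel_measurable M.
    (AE \<omega> in M. emeasure lborel ({x. V x \<omega> > \<epsilon>} \<inter> ball (u \<omega>) \<rho>) > ennreal \<epsilon>) \<and>
    integrable M (\<lambda>\<omega>. norm (u \<omega>) ^ CARD('d))"
 shows "\<exists>\<alpha> :: real ^ 'd \<Rightarrow> real. seminorm \<alpha> \<and>
  (\<forall>x.
    converges_AE M (\<lambda>r \<omega>. crossing_cost P V 0 (r *\<^sub>R x) \<omega> / ereal r) (\<alpha> x) \<and>
    converges_L1 M (\<lambda>r \<omega>. crossing_cost P V 0 (r *\<^sub>R x) \<omega> / ereal r) (\<alpha> x) \<and>
    ((\<lambda>r. ereal_expectation M (crossing_cost P V 0 (r *\<^sub>R x)) / ereal r)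
     \<longlongrightarrow> ereal (\<alpha> x)) at_top \<and>
    (INF r\<in>{0<..}. ereal_expectation M (ball_crossing_cost P V 0 (r *\<^sub>R x)) / ereal r)
     = ereal (\<alpha> x)) \<and>
  (\<forall>g. green_function M P V g \<longrightarrow>
    (\<forall>x. x \<noteq> 0 \<or> CARD('d) = 1 \<longrightarrow>
     converges_AE M (\<lambda>r \<omega>. neg_log (g 0 (r *\<^sub>R x) \<omega>) / ereal r) (\<alpha> x) \<and>
     converges_L1 M (\<lambda>r \<omega>. neg_log (g 0 (r *\<^sub>R x) \<omega>) / ereal r) (\<alpha> x) \<and>
     ((\<lambda>r. ereal_expectation M (\<lambda>\<omega>. neg_log (g 0 (r *\<^sub>R x) \<omega>)) / ereal r)
       \<longlongrightarrow> ereal (\<alpha> x)) at_top))"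
proof -
 interpret ergodic_potential M tau V0 by (rule potential)
 interpret brownian P by unfold_locales (rule wiener)
 note [measurable] = V0_measurable
 define f where "f \<omega> = (\<lambda>v. V v \<omega>)" for \<omega>
 have joint: "(\<lambda>(\<omega>, v). f \<omega> v) \<in> borel_measurable (M \<Otimes>\<^sub>M borel)"
  unfolding f_def V_eq case_prod_beta' by measurable
 have fm: "f \<omega> \<in> borel_measurable borel" if "\<omega> \<in> space M" for \<omega>
  using measurable_compose[OF measurable_Pair1'[OF that] joint] by simp
 have f0: "0 \<le> f \<omega> v" if "\<omega> \<in> space M" for \<omega> v
  using V0_nonneg[OF flow_space[OF that]] by (simp add: f_def V_eq)
 obtain \<eta>1 where h1: "integrable M \<eta>1" "\<forall>\<omega>. 0 \<le> \<eta>1 \<omega>"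
  "AE \<omega> in M. \<forall>v. V0 (tau v \<omega>) \<le> \<eta>1 \<omega> * exp ((norm v)\<^sup>2 / 64)"
  using potential_growth[OF V0_measurable] sup_measurable sup_integrable unfolding V_eq by blast
 have "\<exists>\<eta>. integrable M \<eta> \<and> (\<forall>\<omega>. 0 \<le> \<eta> \<omega>) \<and>
  (AE \<omega> in M. \<forall>x v. green (f \<omega>) x (indicator (ball v 1)) \<le> ennreal (exp (\<eta> \<omega> + (norm v)\<^sup>2 / 64)))"
  using low_dim by (intro green_growth prob_space_axioms fm f0) (simp_all add: f_def)
 then obtain \<eta>2 where h2: "integrable M \<eta>2" "\<forall>\<omega>. 0 \<le> \<eta>2 \<omega>"
  "AE \<omega> in M. \<forall>x v. green (f \<omega>) x (indicator (ball v 1)) \<le> ennreal (exp (\<eta>2 \<omega> + (norm v)\<^sup>2 / 64))" by blast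
 \<comment> \<open>\<open>regular\<close> asks for a single number, and the sum dominates both
   controls.\<close>
 interpret environment M tau P f "\<lambda>\<omega>. \<eta>1 \<omega> + \<eta>2 \<omega>"
 proof unfold_locales
  show "f (tau y \<omega>) = (\<lambda>v. f \<omega> (y + v))" if "\<omega> \<in> space M" for \<omega> y
   using that by (simp add: f_def V_eq flow_add add.commute)
  show "integrable M (\<lambda>\<omega>. \<eta>1 \<omega> + \<eta>2 \<omega>)" "0 \<le> \<eta>1 \<omega> + \<eta>2 \<omega>" for \<omega> using h1 h2 by auto
  show "AE \<omega> in M. regular (f \<omega>) 0 (\<eta>1 \<omega> + \<eta>2 \<omega>)"
   using h1(3) h2(3) AE_space
  proof eventually_elim
   case (elim \<omega>)
   have nn: "0 \<le> \<eta>1 \<omega>" "0 \<le> \<eta>2 \<omega>" using h1(2) h2(2) by auto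
   have "f \<omega> v \<le> (\<eta>1 \<omega> + \<eta>2 \<omega>) * exp ((norm v)\<^sup>2 / 64)" for v
   proof -
    have "f \<omega> v \<le> \<eta>1 \<omega> * exp ((norm v)\<^sup>2 / 64)" using elim(1) by (simp add: f_def V_eq)
    also have "\<dots> \<le> (\<eta>1 \<omega> + \<eta>2 \<omega>) * exp ((norm v)\<^sup>2 / 64)" using nn by (intro mult_right_mono) auto
    finally show ?thesis .
   qed
   moreover have "green (f \<omega>) x (indicator (ball v 1)) \<le> ennreal (exp (\<eta>1 \<omega> + \<eta>2 \<omega> + (norm v)\<^sup>2 / 64))" for x v
    by (rule order_trans[OF elim(2)[rule_format]]) (use nn in \<open>auto intro!: ennreal_leI\<close>)
   ultimately show ?case using fm[OF elim(3)] nn by (simp add: regular_def)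
  qed
 qed (rule joint)
 have weight: "crossing_weight P V z y \<omega> = cross_real (f \<omega>) z y" if "\<omega> \<in> space M" for z y \<omega>
  using crossing_weight_eq[of V \<omega> z y] fm[OF that] by (simp add: f_def)
 \<comment> \<open>Almost surely all crossing weights are positive, so the infinite values of
   \<open>neg_log\<close> do not occur.\<close>
 have cost: "AE \<omega> in M. \<forall>z y. crossing_cost P V z y \<omega> = ereal (cost (f \<omega>) z y)"
  using \<xi>_regular AE_space
 proof eventually_elim
  case (elim \<omega>)
  show ?case
   using regular_cross_pos[OF elim(1)]
   by (auto simp: crossing_cost_def weight[OF elim(2)] neg_log_def cost_def less_le)
 qed
 have cm: "crossing_cost P V z y \<in> borel_measurable M" for z y
 proof -
  have [measurable]: "neg_log \<in> borel_measurable borel" unfolding neg_log_def[abs_def] by measurable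
  have [measurable]: "(\<lambda>\<omega>. cross_real (f \<omega>) z y) \<in> borel_measurable M"
   unfolding cross_real_def using measurable_cross_environment by measurable
  have "(\<lambda>\<omega>. neg_log (ennreal (cross_real (f \<omega>) z y))) \<in> borel_measurable M" by measurable
  then show ?thesis
   by (subst measurable_cong[where g = "\<lambda>\<omega>. neg_log (ennreal (cross_real (f \<omega>) z y))"]) (simp_all add: crossing_cost_def weight)
 qed
 \<comment> \<open>The supremum over the uncountable ball equals the measurable \<open>worst\<close>
   almost surely, and \<open>ereal_expectation\<close> sees values only up to null sets.\<close>
 have ball: "AE \<omega> in M. ball_crossing_cost P V 0 y \<omega> = ereal (worst y \<omega>)" for y
  using cost \<xi>_regular
 proof eventually_elim
  case (elim \<omega>)
  let ?S = "SUP z\<in>cball 0 1. ereal (cost (f \<omega>) z y)"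
  have "?S \<le> ereal (worst y \<omega>)" using worst_ge[OF elim(2)] by (intro SUP_least) auto
  moreover have up: "ereal (cost (f \<omega>) z y) \<le> ?S" if "z \<in> cball 0 1" for z using that by (rule SUP_upper)
  then have "ereal (worst y \<omega>) \<le> ?S"
  proof (cases ?S)
   case (real q)
   then show ?thesis using up by (auto intro!: worst_le)
  next
   case MInf
   then show ?thesis using up[of 0] by simp
  qed simp
  ultimately show ?case using elim(1) by (simp add: ball_crossing_cost_def antisym)
 qed
 have "seminorm exponent" by (rule seminorm_exponent)
 moreover have "linear_growth M (\<lambda>r. crossing_cost P V 0 (r *\<^sub>R x)) (exponent x)" for x
  by (rule cost_limit[OF cm]) (use cost in \<open>auto elim: eventually_mono\<close>)
 moreover have "(INF r\<in>{0<..}. ereal_expectation M (ball_crossing_cost P V 0 (r *\<^sub>R x)) / ereal r) = ereal (exponent x)" for x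
  by (rule worst_infimum[OF ball])
 moreover have "linear_growth M (\<lambda>r \<omega>. neg_log (g 0 (r *\<^sub>R x) \<omega>)) (exponent x)"
  if g: "green_function M P V g" and x: "x \<noteq> 0 \<or> CARD('d) = 1" for g x
 proof (rule green_limit)
  show "x \<noteq> 0 \<or> DIM(real ^ 'd) = 1" using x by simp
  show "g 0 y \<in> borel_measurable M" for y using g by (simp add: green_function_def)
  show "AE \<omega> in M. continuous_on UNIV (\<lambda>y. g 0 y \<omega>) \<and>
    (\<forall>A\<in>sets borel. green (f \<omega>) 0 (indicator A) = (\<integral>\<^sup>+y\<in>A. g 0 y \<omega> \<partial>lborel))"
  proof -
   have "AE \<omega> in M. \<forall>x. continuous_on UNIV (\<lambda>y. g x y \<omega>) \<and>
     (\<forall>A\<in>sets borel. green_measure P V x A \<omega> = (\<integral>\<^sup>+y\<in>A. g x y \<omega> \<partial>lborel))"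
    using g by (simp add: green_function_def)
   then show ?thesis unfolding green_measure_eq f_def by eventually_elim blast
  qed
 qed
 ultimately show ?thesis by blast
qed

end
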